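(* Let $p$ be a prime and let $R$ be a commutative ring with $1$ containing $\mathbb{Z}$ as a unitary subring. Let $G$ and $H$ be finite groups, and let $b\in Z(\overline{\mathbb{F}}_pG)$ and $c\in Z(\overline{\mathbb{F}}_pH)$ be idempotents. Assume that $\mathbb{F}_p[b]=\mathbb{F}_p[c]$ and denote this common field by $k$. Assume further that the $k$-pairs $(G,b)$ and $(H,c)$ are functorially equivalent over $R$. Then there exists a bijection $I:\mathrm{IBr}(G,b)\to\mathrm{IBr}(H,c)$ such that ${}^\sigma I(\varphi)=I({}^\sigma\varphi)$ for all $\varphi\in\mathrm{IBr}(G,b)$ and all $\sigma\in\Gamma_b=\mathrm{Gal}(\overline{\mathbb{F}}_p/k)$.
   Context: $\overline{\mathbb{F}}_p$ is an algebraic closure of $\mathbb{F}_p$ and $\Gamma=\mathrm{Gal}(\overline{\mathbb{F}}_p/\mathbb{F}_p)$ acts on group algebras over $\overline{\mathbb{F}}_p$ through coefficients; $\Gamma_b$ is the stabiliser of $b$. For an idempotent $b=\sum_g\alpha_gg\in Z(\overline{\mathbb{F}}_pG)$, the minimal field $\mathbb{F}_p[b]$ is the smallest subfield of $\overline{\mathbb{F}}_p$ containing all coefficients $\alpha_g$. $\mathrm{IBr}(G,b)$ is the set of characters (trace functions $G\to\overline{\mathbb{F}}_p$) of simple $\overline{\mathbb{F}}_pGb$-modules (empty if $b=0$); $\Gamma_b$ acts on it by ${}^\sigma\varphi(g)=\sigma(\varphi(g))$. Let $k$ be a field of characteristic $p$. A $k$-pair is a pair $(G,b)$ with $G$ a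 finite group and $b$ an idempotent of $Z(kG)$. For $k$-pairs $(G,b)$, $(H,c)$, a $(kGb,kHc)$-bimodule is regarded as a $k[G\times H]$-module via $(g,h)m=gmh^{-1}$; it is a $p$-permutation bimodule if as such it is a direct summand of a finite-dimensional permutation module, and a $p$-permutation bimodule is called diagonal if all its indecomposable direct summands have twisted diagonal vertices, i.e. vertices of the form $\{(\phi(q),q)\mid q\in Q\}$ with $\phi:Q\to P$ an isomorphism between $p$-subgroups $Q\le H$, $P\le G$. $T^\Delta(kGb,kHc)$ is the Grothendieck group of diagonal $p$-permutation $(kGb,kHc)$-bimodules with respect to split short exact sequences, and $RT^\Delta(kGb,kHc)=R\otimes_{\mathbb{Z}}T^\Delta(kGb,kHc)$. $Rpp_k^\Delta$ is the category whose objects are finite groups, with morphisms from $G$ to $H$ given by $RT^\Delta(kH,kG)$ and composition induced by the tensor product of bimodules. A diagonal $p$-permutation functor over $R$ is an $R$-linear functor from $Rpp_k^\Delta$ to $R$-modules. Put $RT^\Delta_{(G,b)}=RT^\Delta(-,kGb)$. The $k$-pairs $(G,b)$ and $(H,c)$ are functorially equivalent over $R$ if the functors $RT^\Delta_{(G,b)}$ and $RT^\Delta_{(H,c)}$ are isomorphic. Equivalently (Yoneda), there are $\eta\in RT^\Delta(kGb,kHc)$ and $\omega\in RT^\Delta(kHc,kGb)$ such that $\eta\cdot_H\omega=[kGb]$ in $RT^\Delta(kGb,kGb)$ and $\omega\cdot_G\eta=[kHc]$ in $RT^\Delta(kHc,kHc)$, where $\cdot_H,\cdot_G$ are induced by $\otimes_{kH},\otimes_{kG}$.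 *)

theory Defs
  imports "HOL-Algebra.Algebra" "HOL-Algebra.Algebraic_Closure"
    "HOL-Algebra.Free_Abelian_Groups" "HOL-Algebra.IntRing"
begin

section \<open>Modules and bimodules over rings that need not be commutative\<close>

text \<open>As usual for \<^type>\<open>module\<close> records, the fields \<open>mult\<close> and \<open>one\<close> inherited from
  \<^type>\<open>ring\<close> carry no meaning.\<close>

locale left_module = A?: ring A + M?: abelian_group M
  for A :: "('a, 'y) ring_scheme" and M :: "('a, 'm, 'u) module_scheme" +
  assumes lsmult_closed:
      "\<lbrakk>a \<in> carrier A; x \<in> carrier M\<rbrakk> \<Longrightarrow> a \<odot>\<^bsub>M\<^esub> x \<in> carrier M"
    and lsmult_l_distr:
      "\<lbrakk>a \<in> carrier A; a' \<in> carrier A; x \<in> carrier M\<rbrakk>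
        \<Longrightarrow> (a \<oplus>\<^bsub>A\<^esub> a') \<odot>\<^bsub>M\<^esub> x = a \<odot>\<^bsub>M\<^esub> x \<oplus>\<^bsub>M\<^esub> a' \<odot>\<^bsub>M\<^esub> x"
    and lsmult_r_distr:
      "\<lbrakk>a \<in> carrier A; x \<in> carrier M; y \<in> carrier M\<rbrakk>
        \<Longrightarrow> a \<odot>\<^bsub>M\<^esub> (x \<oplus>\<^bsub>M\<^esub> y) = a \<odot>\<^bsub>M\<^esub> x \<oplus>\<^bsub>M\<^esub> a \<odot>\<^bsub>M\<^esub> y"
    and lsmult_assoc:
      "\<lbrakk>a \<in> carrier A; a' \<in> carrier A; x \<in> carrier M\<rbrakk>
        \<Longrightarrow> (a \<otimes>\<^bsub>A\<^esub> a') \<odot>\<^bsub>M\<^esub> x = a \<odot>\<^bsub>M\<^esub> (a' \<odot>\<^bsub>M\<^esub> x)"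
    and lsmult_one: "x \<in> carrier M \<Longrightarrow> \<one>\<^bsub>A\<^esub> \<odot>\<^bsub>M\<^esub> x = x"

record ('a, 'b, 'm) bimodule = "('a, 'm) module" +
  rsmult :: "['m, 'b] \<Rightarrow> 'm" (infixl \<open>\<star>\<index>\<close> 70)

locale bimodule = left_module A M + B?: ring B
  for A :: "('a, 'y) ring_scheme" and B :: "('b, 'z) ring_scheme"
    and M :: "('a, 'b, 'm, 'u) bimodule_scheme" +
  assumes rsmult_closed:
      "\<lbrakk>x \<in> carrier M; b \<in> carrier B\<rbrakk> \<Longrightarrow> x \<star>\<^bsub>M\<^esub> b \<in> carrier M"
    and rsmult_l_distr:
      "\<lbrakk>x \<in> carrier M; y \<in> carrier M; b \<in> carrier B\<rbrakk>
        \<Longrightarrow> (x \<oplus>\<^bsub>M\<^esub> y) \<star>\<^bsub>M\<^esub> b = x \<star>\<^bsub>M\<^esub> b \<oplus>\<^bsub>M\<^esub> y \<star>\<^bsub>M\<^esub> b"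
    and rsmult_r_distr:
      "\<lbrakk>x \<in> carrier M; b \<in> carrier B; b' \<in> carrier B\<rbrakk>
        \<Longrightarrow> x \<star>\<^bsub>M\<^esub> (b \<oplus>\<^bsub>B\<^esub> b') = x \<star>\<^bsub>M\<^esub> b \<oplus>\<^bsub>M\<^esub> x \<star>\<^bsub>M\<^esub> b'"
    and rsmult_assoc:
      "\<lbrakk>x \<in> carrier M; b \<in> carrier B; b' \<in> carrier B\<rbrakk>
        \<Longrightarrow> x \<star>\<^bsub>M\<^esub> (b \<otimes>\<^bsub>B\<^esub> b') = (x \<star>\<^bsub>M\<^esub> b) \<star>\<^bsub>M\<^esub> b'"
    and rsmult_one: "x \<in> carrier M \<Longrightarrow> x \<star>\<^bsub>M\<^esub> \<one>\<^bsub>B\<^esub> = x"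
    and lr_assoc:
      "\<lbrakk>a \<in> carrier A; x \<in> carrier M; b \<in> carrier B\<rbrakk>
        \<Longrightarrow> (a \<odot>\<^bsub>M\<^esub> x) \<star>\<^bsub>M\<^esub> b = a \<odot>\<^bsub>M\<^esub> (x \<star>\<^bsub>M\<^esub> b)"

definition lmod_hom ::
  "('a, 'y) ring_scheme \<Rightarrow> ('a, 'm, 'u) module_scheme \<Rightarrow> ('a, 'n, 'v) module_scheme
    \<Rightarrow> ('m \<Rightarrow> 'n) set" where
  "lmod_hom A M N = {f \<in> carrier M \<rightarrow> carrier N.
     (\<forall>x\<in>carrier M. \<forall>y\<in>carrier M. f (x \<oplus>\<^bsub>M\<^esub> y) = f x \<oplus>\<^bsub>N\<^esub> f y) \<and>
     (\<forall>a\<in>carrier A. \<forall>x\<in>carrier M. f (a \<odot>\<^bsub>M\<^esub> x) = a \<odot>\<^bsub>N\<^esub> f x)}"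

definition lmod_iso ::
  "('a, 'y) ring_scheme \<Rightarrow> ('a, 'm, 'u) module_scheme \<Rightarrow> ('a, 'n, 'v) module_scheme
    \<Rightarrow> ('m \<Rightarrow> 'n) set" where
  "lmod_iso A M N = {f \<in> lmod_hom A M N. bij_betw f (carrier M) (carrier N)}"

definition bimod_hom ::
  "('a, 'y) ring_scheme \<Rightarrow> ('b, 'z) ring_scheme \<Rightarrow> ('a, 'b, 'm, 'u) bimodule_scheme
    \<Rightarrow> ('a, 'b, 'n, 'v) bimodule_scheme \<Rightarrow> ('m \<Rightarrow> 'n) set" where
  "bimod_hom A B M N = {f \<in> lmod_hom A M N.
     \<forall>x\<in>carrier M. \<forall>b\<in>carrier B. f (x \<star>\<^bsub>M\<^esub> b) = f x \<star>\<^bsub>N\<^esub> b}"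

definition bimod_iso ::
  "('a, 'y) ring_scheme \<Rightarrow> ('b, 'z) ring_scheme \<Rightarrow> ('a, 'b, 'm, 'u) bimodule_scheme
    \<Rightarrow> ('a, 'b, 'n, 'v) bimodule_scheme \<Rightarrow> ('m \<Rightarrow> 'n) set" where
  "bimod_iso A B M N = {f \<in> bimod_hom A B M N. bij_betw f (carrier M) (carrier N)}"

definition split_exact ::
  "('a, 'y) ring_scheme \<Rightarrow> ('b, 'z) ring_scheme \<Rightarrow> ('a, 'b, 'l, 'u) bimodule_scheme
    \<Rightarrow> ('a, 'b, 'm, 'v) bimodule_scheme \<Rightarrow> ('a, 'b, 'n, 'w) bimodule_scheme \<Rightarrow> bool" where
  "split_exact A B L M N \<longleftrightarrow>
     (\<exists>i\<in>bimod_hom A B L M. \<exists>j\<in>bimod_hom A B M N. \<exists>s\<in>bimod_hom A B N M.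
        inj_on i (carrier L) \<and> j ` carrier M = carrier N \<and>
        i ` carrier L = {x \<in> carrier M. j x = \<zero>\<^bsub>N\<^esub>} \<and>
        (\<forall>x\<in>carrier N. j (s x) = x))"

text \<open>The library locale \<^locale>\<open>submodule\<close> does not assume the ring to be commutative.\<close>

definition simple_module ::
  "('a, 'y) ring_scheme \<Rightarrow> ('a, 'm, 'u) module_scheme \<Rightarrow> bool" where
  "simple_module A M \<longleftrightarrow> left_module A M \<and> carrier M \<noteq> {\<zero>\<^bsub>M\<^esub>} \<and>
     (\<forall>U. submodule U A M \<longrightarrow> U = {\<zero>\<^bsub>M\<^esub>} \<or> U = carrier M)"

definition internal_direct_sum ::
  "('a, 'y) ring_scheme \<Rightarrow> ('a, 'm, 'u) module_scheme \<Rightarrow> 'm set \<Rightarrow> 'm set \<Rightarrow> bool" where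
  "internal_direct_sum A M U W \<longleftrightarrow> submodule U A M \<and> submodule W A M \<and>
     U \<inter> W = {\<zero>\<^bsub>M\<^esub>} \<and> U <+>\<^bsub>M\<^esub> W = carrier M"

definition direct_summand ::
  "('a, 'y) ring_scheme \<Rightarrow> ('a, 'm, 'u) module_scheme \<Rightarrow> 'm set \<Rightarrow> bool" where
  "direct_summand A M U \<longleftrightarrow> (\<exists>W. internal_direct_sum A M U W)"

definition indecomposable ::
  "('a, 'y) ring_scheme \<Rightarrow> ('a, 'm, 'u) module_scheme \<Rightarrow> bool" where
  "indecomposable A M \<longleftrightarrow> carrier M \<noteq> {\<zero>\<^bsub>M\<^esub>} \<and>
     (\<forall>U W. internal_direct_sum A M U W \<longrightarrow> U = {\<zero>\<^bsub>M\<^esub>} \<or> W = {\<zero>\<^bsub>M\<^esub>})"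

definition iso_to_summand ::
  "('a, 'y) ring_scheme \<Rightarrow> ('a, 'm, 'u) module_scheme \<Rightarrow> ('a, 'n, 'v) module_scheme \<Rightarrow> bool" where
  "iso_to_summand A M V \<longleftrightarrow>
     (\<exists>U. direct_summand A V U \<and> lmod_iso A M (V\<lparr>carrier := U\<rparr>) \<noteq> {})"


section \<open>Abelian groups by generators and relations, and tensor products\<close>

definition presented_group :: "'a set \<Rightarrow> ('a \<Rightarrow>\<^sub>0 int) set \<Rightarrow> ('a \<Rightarrow>\<^sub>0 int) set monoid" where
  "presented_group S Rel =
     free_Abelian_group S Mod generate (free_Abelian_group S) Rel"

definition presented_class ::
  "'a set \<Rightarrow> ('a \<Rightarrow>\<^sub>0 int) set \<Rightarrow> ('a \<Rightarrow>\<^sub>0 int) \<Rightarrow> ('a \<Rightarrow>\<^sub>0 int) set" where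
  "presented_class S Rel c =
     generate (free_Abelian_group S) Rel #>\<^bsub>free_Abelian_group S\<^esub> c"

definition bilinear_extend ::
  "('a \<Rightarrow> 'b \<Rightarrow> 'c) \<Rightarrow> ('a \<Rightarrow>\<^sub>0 int) \<Rightarrow> ('b \<Rightarrow>\<^sub>0 int) \<Rightarrow> ('c \<Rightarrow>\<^sub>0 int)" where
  "bilinear_extend f c d = frag_extend (\<lambda>x. frag_extend (\<lambda>y. frag_of (f x y)) d) c"

definition tensor_rels ::
  "('b, 'y) ring_scheme \<Rightarrow> ('a, 'b, 'm, 'u) bimodule_scheme \<Rightarrow> ('b, 'n, 'v) module_scheme
    \<Rightarrow> ('m \<times> 'n \<Rightarrow>\<^sub>0 int) set" where
  "tensor_rels B M N =
     {frag_of (x \<oplus>\<^bsub>M\<^esub> x', y) - frag_of (x, y) - frag_of (x', y) | x x' y.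
        x \<in> carrier M \<and> x' \<in> carrier M \<and> y \<in> carrier N} \<union>
     {frag_of (x, y \<oplus>\<^bsub>N\<^esub> y') - frag_of (x, y) - frag_of (x, y') | x y y'.
        x \<in> carrier M \<and> y \<in> carrier N \<and> y' \<in> carrier N} \<union>
     {frag_of (x \<star>\<^bsub>M\<^esub> b, y) - frag_of (x, b \<odot>\<^bsub>N\<^esub> y) | x b y.
        x \<in> carrier M \<and> b \<in> carrier B \<and> y \<in> carrier N}"

text \<open>Maps between presented groups that are induced by maps on representatives are written as
  unions over all representatives; if the map is well defined, all members of such a union
  coincide (the library treats the product of cosets, \<^const>\<open>set_mult\<close>, in the same way).\<close>

definition tensor_left ::
  "('b, 'y) ring_scheme \<Rightarrow> ('a, 'b, 'm, 'u) bimodule_scheme \<Rightarrow> ('b, 'n, 'v) module_scheme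
    \<Rightarrow> ('a, ('m \<times> 'n \<Rightarrow>\<^sub>0 int) set) module" where
  "tensor_left B M N =
     (let S = carrier M \<times> carrier N; Rel = tensor_rels B M N; T = presented_group S Rel in
      \<lparr>carrier = carrier T, monoid.mult = undefined, monoid.one = undefined,
       ring.zero = \<one>\<^bsub>T\<^esub>, ring.add = monoid.mult T,
       smult = (\<lambda>a Y. \<Union>c\<in>Y. presented_class S Rel
                  (frag_extend (\<lambda>(x, y). frag_of (a \<odot>\<^bsub>M\<^esub> x, y)) c))\<rparr>)"

definition tensor ::
  "('b, 'y) ring_scheme \<Rightarrow> ('a, 'b, 'm, 'u) bimodule_scheme \<Rightarrow> ('b, 'c, 'n, 'v) bimodule_scheme
    \<Rightarrow> ('a, 'c, ('m \<times> 'n \<Rightarrow>\<^sub>0 int) set) bimodule" where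
  "tensor B M N =
     (let S = carrier M \<times> carrier N; Rel = tensor_rels B M N; T = tensor_left B M N in
      \<lparr>carrier = carrier T, monoid.mult = monoid.mult T, monoid.one = monoid.one T,
       ring.zero = ring.zero T, ring.add = ring.add T,
       smult = smult T,
       rsmult = (\<lambda>Y d. \<Union>c\<in>Y. presented_class S Rel
                   (frag_extend (\<lambda>(x, y). frag_of (x, y \<star>\<^bsub>N\<^esub> d)) c))\<rparr>)"


section \<open>Group algebras\<close>

definition group_ring :: "('f, 'y) ring_scheme \<Rightarrow> ('g, 'z) monoid_scheme \<Rightarrow> ('g \<Rightarrow> 'f) ring" where
  "group_ring K G =
     \<lparr>carrier = carrier G \<rightarrow>\<^sub>E carrier K,
      monoid.mult = (\<lambda>a b. \<lambda>g\<in>carrier G. \<Oplus>\<^bsub>K\<^esub>h\<in>carrier G. a h \<otimes>\<^bsub>K\<^esub> b (inv\<^bsub>G\<^esub> h \<otimes>\<^bsub>G\<^esub> g)),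
      monoid.one = (\<lambda>g\<in>carrier G. if g = \<one>\<^bsub>G\<^esub> then \<one>\<^bsub>K\<^esub> else \<zero>\<^bsub>K\<^esub>),
      ring.zero = (\<lambda>g\<in>carrier G. \<zero>\<^bsub>K\<^esub>),
      ring.add = (\<lambda>a b. \<lambda>g\<in>carrier G. a g \<oplus>\<^bsub>K\<^esub> b g)\<rparr>"

text \<open>The element \<open>l\<cdot>g\<close> of the group algebra.\<close>

definition gmonom ::
  "('f, 'y) ring_scheme \<Rightarrow> ('g, 'z) monoid_scheme \<Rightarrow> 'f \<Rightarrow> 'g \<Rightarrow> 'g \<Rightarrow> 'f" where
  "gmonom K G l g = (\<lambda>x\<in>carrier G. if x = g then l else \<zero>\<^bsub>K\<^esub>)"

definition ring_center :: "('a, 'y) ring_scheme \<Rightarrow> 'a set" where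
  "ring_center A = {z \<in> carrier A. \<forall>a\<in>carrier A. z \<otimes>\<^bsub>A\<^esub> a = a \<otimes>\<^bsub>A\<^esub> z}"

definition central_idempotent :: "('a, 'y) ring_scheme \<Rightarrow> 'a \<Rightarrow> bool" where
  "central_idempotent A e \<longleftrightarrow> e \<in> ring_center A \<and> e \<otimes>\<^bsub>A\<^esub> e = e"

definition minimal_field ::
  "('f, 'y) ring_scheme \<Rightarrow> ('g, 'z) monoid_scheme \<Rightarrow> ('g \<Rightarrow> 'f) \<Rightarrow> 'f set" where
  "minimal_field F G b = generate_field F (b ` carrier G)"

text \<open>The \<open>K\<close>-vector space underlying a \<open>KG\<close>-module.\<close>

definition scalar_restriction ::
  "('f, 'y) ring_scheme \<Rightarrow> ('g, 'z) monoid_scheme \<Rightarrow> ('g \<Rightarrow> 'f, 'm, 'u) module_scheme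
    \<Rightarrow> ('f, 'm) module" where
  "scalar_restriction K G M =
     \<lparr>carrier = carrier M, monoid.mult = monoid.mult M, monoid.one = monoid.one M,
      ring.zero = ring.zero M, ring.add = ring.add M,
      smult = (\<lambda>l x. gmonom K G l \<one>\<^bsub>G\<^esub> \<odot>\<^bsub>M\<^esub> x)\<rparr>"

definition fin_basis ::
  "('f, 'y) ring_scheme \<Rightarrow> ('f, 'm, 'u) module_scheme \<Rightarrow> 'm set \<Rightarrow> bool" where
  "fin_basis K V B \<longleftrightarrow> finite B \<and> B \<subseteq> carrier V \<and>
     (\<forall>x\<in>carrier V. \<exists>!a. a \<in> B \<rightarrow>\<^sub>E carrier K \<and> x = (\<Oplus>\<^bsub>V\<^esub>v\<in>B. a v \<odot>\<^bsub>V\<^esub> v))"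

definition coordinates ::
  "('f, 'y) ring_scheme \<Rightarrow> ('f, 'm, 'u) module_scheme \<Rightarrow> 'm set \<Rightarrow> 'm \<Rightarrow> 'm \<Rightarrow> 'f" where
  "coordinates K V B x =
     (THE a. a \<in> B \<rightarrow>\<^sub>E carrier K \<and> x = (\<Oplus>\<^bsub>V\<^esub>v\<in>B. a v \<odot>\<^bsub>V\<^esub> v))"

definition trace_of ::
  "('f, 'y) ring_scheme \<Rightarrow> ('f, 'm, 'u) module_scheme \<Rightarrow> ('m \<Rightarrow> 'm) \<Rightarrow> 'f" where
  "trace_of K V f =
     (let B = (SOME B. fin_basis K V B) in \<Oplus>\<^bsub>K\<^esub>v\<in>B. coordinates K V B (f v) v)"


section \<open>Characters of simple modules and the Galois action\<close>

definition character ::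
  "('f, 'y) ring_scheme \<Rightarrow> ('g, 'z) monoid_scheme \<Rightarrow> ('g \<Rightarrow> 'f, 'm, 'u) module_scheme
    \<Rightarrow> 'g \<Rightarrow> 'f" where
  "character F G V = (\<lambda>g\<in>carrier G.
     trace_of F (scalar_restriction F G V) (\<lambda>x. gmonom F G \<one>\<^bsub>F\<^esub> g \<odot>\<^bsub>V\<^esub> x))"

text \<open>Here and below, \<open>KGb\<close>-modules are identified with the \<open>KG\<close>-modules on which \<open>b\<close> acts as the
  identity.  Every finite-dimensional \<open>K\<close>-vector space has an isomorphic copy whose carrier is a
  set of functions \<open>nat \<Rightarrow> 'f\<close>, so it is no restriction to let \<open>V\<close> range over modules with
  elements of this type; the same type serves as universe for all other finite-dimensional
  modules below.\<close>

definition IBr ::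
  "('f, 'y) ring_scheme \<Rightarrow> ('g, 'z) monoid_scheme \<Rightarrow> ('g \<Rightarrow> 'f) \<Rightarrow> ('g \<Rightarrow> 'f) set" where
  "IBr F G b = {character F G V | V :: ('g \<Rightarrow> 'f, nat \<Rightarrow> 'f) module.
     simple_module (group_ring F G) V \<and> (\<forall>x\<in>carrier V. b \<odot>\<^bsub>V\<^esub> x = x)}"

text \<open>The stabiliser of \<open>b\<close> in the absolute Galois group is \<open>galois_group F (minimal_field F G b)\<close>.\<close>

definition galois_group :: "('f, 'y) ring_scheme \<Rightarrow> 'f set \<Rightarrow> ('f \<Rightarrow> 'f) set" where
  "galois_group F k = {\<sigma> \<in> ring_iso F F. \<forall>x\<in>k. \<sigma> x = x}"

definition galois_action ::
  "('g, 'z) monoid_scheme \<Rightarrow> ('f \<Rightarrow> 'f) \<Rightarrow> ('g \<Rightarrow> 'f) \<Rightarrow> 'g \<Rightarrow> 'f" where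
  "galois_action G \<sigma> \<phi> = (\<lambda>g\<in>carrier G. \<sigma> (\<phi> g))"


section \<open>Permutation modules and vertices\<close>

definition permutation_module ::
  "('f, 'y) ring_scheme \<Rightarrow> ('x, 'z) monoid_scheme \<Rightarrow> ('x \<Rightarrow> 'f, 'm, 'u) module_scheme \<Rightarrow> bool"
  where
  "permutation_module K Y V \<longleftrightarrow> left_module (group_ring K Y) V \<and>
     (\<exists>B. fin_basis K (scalar_restriction K Y V) B \<and>
        (\<forall>x\<in>carrier Y. \<forall>v\<in>B. gmonom K Y \<one>\<^bsub>K\<^esub> x \<odot>\<^bsub>V\<^esub> v \<in> B))"

text \<open>\<open>KY\<close> as a \<open>(KY, KQ)\<close>-bimodule for a subgroup \<open>Q\<close> of \<open>Y\<close>; elements of \<open>KQ\<close> are extended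
  by zero to elements of \<open>KY\<close>.\<close>

definition group_ring_over_subgroup ::
  "('f, 'y) ring_scheme \<Rightarrow> ('x, 'z) monoid_scheme \<Rightarrow> 'x set
    \<Rightarrow> ('x \<Rightarrow> 'f, 'x \<Rightarrow> 'f, 'x \<Rightarrow> 'f) bimodule" where
  "group_ring_over_subgroup K Y Q =
     (let A = group_ring K Y in
      \<lparr>carrier = carrier A, monoid.mult = monoid.mult A, monoid.one = monoid.one A,
       ring.zero = ring.zero A, ring.add = ring.add A,
       smult = monoid.mult A,
       rsmult = (\<lambda>a q. a \<otimes>\<^bsub>A\<^esub> (\<lambda>x\<in>carrier Y. if x \<in> Q then q x else \<zero>\<^bsub>K\<^esub>))\<rparr>)"

definition induced_module ::
  "('f, 'y) ring_scheme \<Rightarrow> ('x, 'z) monoid_scheme \<Rightarrow> 'x set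
    \<Rightarrow> ('x \<Rightarrow> 'f, 'm, 'u) module_scheme
    \<Rightarrow> ('x \<Rightarrow> 'f, (('x \<Rightarrow> 'f) \<times> 'm \<Rightarrow>\<^sub>0 int) set) module" where
  "induced_module K Y Q L =
     tensor_left (group_ring K (Y\<lparr>carrier := Q\<rparr>)) (group_ring_over_subgroup K Y Q) L"

definition relatively_projective ::
  "('f, 'y) ring_scheme \<Rightarrow> ('x, 'z) monoid_scheme \<Rightarrow> 'x set
    \<Rightarrow> ('x \<Rightarrow> 'f, 'm, 'u) module_scheme \<Rightarrow> bool" where
  "relatively_projective K Y Q N \<longleftrightarrow>
     (\<exists>L :: ('x \<Rightarrow> 'f, nat \<Rightarrow> 'f) module.
        left_module (group_ring K (Y\<lparr>carrier := Q\<rparr>)) L \<and>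
        (\<exists>B. fin_basis K (scalar_restriction K (Y\<lparr>carrier := Q\<rparr>) L) B) \<and>
        iso_to_summand (group_ring K Y) N (induced_module K Y Q L))"

text \<open>A vertex is a minimal subgroup \<open>Q\<close> for which the (indecomposable) module is a direct summand
  of a module induced from \<open>Q\<close>.\<close>

definition is_vertex ::
  "('f, 'y) ring_scheme \<Rightarrow> ('x, 'z) monoid_scheme \<Rightarrow> ('x \<Rightarrow> 'f, 'm, 'u) module_scheme
    \<Rightarrow> 'x set \<Rightarrow> bool" where
  "is_vertex K Y N Q \<longleftrightarrow> subgroup Q Y \<and> relatively_projective K Y Q N \<and>
     (\<forall>Q'. subgroup Q' Y \<and> Q' \<subset> Q \<longrightarrow> \<not> relatively_projective K Y Q' N)"

definition p_subgroup :: "nat \<Rightarrow> ('g, 'z) monoid_scheme \<Rightarrow> 'g set \<Rightarrow> bool" where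
  "p_subgroup p G P \<longleftrightarrow> subgroup P G \<and> (\<exists>n. card P = p ^ n)"

definition twisted_diagonal ::
  "nat \<Rightarrow> ('g, 'y) monoid_scheme \<Rightarrow> ('h, 'z) monoid_scheme \<Rightarrow> ('g \<times> 'h) set \<Rightarrow> bool" where
  "twisted_diagonal p G H D \<longleftrightarrow>
     (\<exists>P Q \<phi>. p_subgroup p G P \<and> p_subgroup p H Q \<and>
        \<phi> \<in> iso (H\<lparr>carrier := Q\<rparr>) (G\<lparr>carrier := P\<rparr>) \<and> D = (\<lambda>q. (\<phi> q, q)) ` Q)"


section \<open>Diagonal \<open>p\<close>-permutation bimodules\<close>

text \<open>The field of scalars is required to act in the same way from the left and from the right.\<close>

definition block_bimodule ::
  "('f, 'u) ring_scheme \<Rightarrow> ('g, 'v) monoid_scheme \<Rightarrow> ('g \<Rightarrow> 'f) \<Rightarrow> ('h, 'w) monoid_scheme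
    \<Rightarrow> ('h \<Rightarrow> 'f) \<Rightarrow> ('g \<Rightarrow> 'f, 'h \<Rightarrow> 'f, 'm, 'z) bimodule_scheme \<Rightarrow> bool" where
  "block_bimodule K G b H c M \<longleftrightarrow>
     bimodule (group_ring K G) (group_ring K H) M \<and>
     (\<forall>l\<in>carrier K. \<forall>x\<in>carrier M.
        gmonom K G l \<one>\<^bsub>G\<^esub> \<odot>\<^bsub>M\<^esub> x = x \<star>\<^bsub>M\<^esub> gmonom K H l \<one>\<^bsub>H\<^esub>) \<and>
     (\<forall>x\<in>carrier M. b \<odot>\<^bsub>M\<^esub> x = x \<and> x \<star>\<^bsub>M\<^esub> c = x)"

text \<open>A bimodule as a \<open>K[G \<times> H]\<close>-module via \<open>(g, h) m = g m h\<^sup>-\<^sup>1\<close>.\<close>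

definition as_product_module ::
  "('f, 'u) ring_scheme \<Rightarrow> ('g, 'v) monoid_scheme \<Rightarrow> ('h, 'w) monoid_scheme
    \<Rightarrow> ('g \<Rightarrow> 'f, 'h \<Rightarrow> 'f, 'm, 'z) bimodule_scheme \<Rightarrow> ('g \<times> 'h \<Rightarrow> 'f, 'm) module" where
  "as_product_module K G H M =
     \<lparr>carrier = carrier M, monoid.mult = monoid.mult M, monoid.one = monoid.one M,
      ring.zero = ring.zero M, ring.add = ring.add M,
      smult = (\<lambda>a x. finsum M
        (\<lambda>(g, h). gmonom K G (a (g, h)) g \<odot>\<^bsub>M\<^esub> x \<star>\<^bsub>M\<^esub> gmonom K H \<one>\<^bsub>K\<^esub> (inv\<^bsub>H\<^esub> h))
        (carrier G \<times> carrier H))\<rparr>"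

definition p_permutation_bimodule ::
  "('f, 'u) ring_scheme \<Rightarrow> ('g, 'v) monoid_scheme \<Rightarrow> ('g \<Rightarrow> 'f) \<Rightarrow> ('h, 'w) monoid_scheme
    \<Rightarrow> ('h \<Rightarrow> 'f) \<Rightarrow> ('g \<Rightarrow> 'f, 'h \<Rightarrow> 'f, 'm, 'z) bimodule_scheme \<Rightarrow> bool" where
  "p_permutation_bimodule K G b H c M \<longleftrightarrow> block_bimodule K G b H c M \<and>
     (\<exists>V :: ('g \<times> 'h \<Rightarrow> 'f, nat \<Rightarrow> 'f) module.
        permutation_module K (G \<times>\<times> H) V \<and>
        iso_to_summand (group_ring K (G \<times>\<times> H)) (as_product_module K G H M) V)"

definition diagonal_bimodule ::
  "nat \<Rightarrow> ('f, 'u) ring_scheme \<Rightarrow> ('g, 'v) monoid_scheme \<Rightarrow> ('g \<Rightarrow> 'f) \<Rightarrow> ('h, 'w) monoid_scheme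
    \<Rightarrow> ('h \<Rightarrow> 'f) \<Rightarrow> ('g \<Rightarrow> 'f, 'h \<Rightarrow> 'f, 'm, 'z) bimodule_scheme \<Rightarrow> bool" where
  "diagonal_bimodule p K G b H c M \<longleftrightarrow> p_permutation_bimodule K G b H c M \<and>
     (let A = group_ring K (G \<times>\<times> H); N = as_product_module K G H M in
      \<forall>U. direct_summand A N U \<and> indecomposable A (N\<lparr>carrier := U\<rparr>) \<longrightarrow>
        (\<forall>D. is_vertex K (G \<times>\<times> H) (N\<lparr>carrier := U\<rparr>) D \<longrightarrow> twisted_diagonal p G H D))"


section \<open>Grothendieck groups and functorial equivalence\<close>

type_synonym ('f, 'g, 'h) univ_bimodule = "('g \<Rightarrow> 'f, 'h \<Rightarrow> 'f, nat \<Rightarrow> 'f) bimodule"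

type_synonym ('f, 'g, 'h) T_element = "(('f, 'g, 'h) univ_bimodule \<Rightarrow>\<^sub>0 int) set"

type_synonym ('r, 'f, 'g, 'h) RT_element = "('r \<times> ('f, 'g, 'h) T_element \<Rightarrow>\<^sub>0 int) set"

definition T_gens ::
  "nat \<Rightarrow> ('f, 'u) ring_scheme \<Rightarrow> ('g, 'v) monoid_scheme \<Rightarrow> ('g \<Rightarrow> 'f) \<Rightarrow> ('h, 'w) monoid_scheme
    \<Rightarrow> ('h \<Rightarrow> 'f) \<Rightarrow> ('f, 'g, 'h) univ_bimodule set" where
  "T_gens p K G b H c = {M. diagonal_bimodule p K G b H c M}"

definition T_rels ::
  "nat \<Rightarrow> ('f, 'u) ring_scheme \<Rightarrow> ('g, 'v) monoid_scheme \<Rightarrow> ('g \<Rightarrow> 'f) \<Rightarrow> ('h, 'w) monoid_scheme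
    \<Rightarrow> ('h \<Rightarrow> 'f) \<Rightarrow> (('f, 'g, 'h) univ_bimodule \<Rightarrow>\<^sub>0 int) set" where
  "T_rels p K G b H c = {frag_of M - frag_of L - frag_of N | L M N.
     L \<in> T_gens p K G b H c \<and> M \<in> T_gens p K G b H c \<and> N \<in> T_gens p K G b H c \<and>
     split_exact (group_ring K G) (group_ring K H) L M N}"

text \<open>The group \<open>T\<^sup>\<Delta>(KGb, KHc)\<close>, as a module over the integers.\<close>

definition T_Delta ::
  "nat \<Rightarrow> ('f, 'u) ring_scheme \<Rightarrow> ('g, 'v) monoid_scheme \<Rightarrow> ('g \<Rightarrow> 'f) \<Rightarrow> ('h, 'w) monoid_scheme
    \<Rightarrow> ('h \<Rightarrow> 'f) \<Rightarrow> (int, ('f, 'g, 'h) T_element) module" where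
  "T_Delta p K G b H c =
     (let T = presented_group (T_gens p K G b H c) (T_rels p K G b H c) in
      \<lparr>carrier = carrier T, monoid.mult = undefined, monoid.one = undefined,
       ring.zero = \<one>\<^bsub>T\<^esub>, ring.add = monoid.mult T, smult = (\<lambda>n x. x [^]\<^bsub>T\<^esub> n)\<rparr>)"

definition ring_as_int_bimodule :: "('r, 'z) ring_scheme \<Rightarrow> ('r, int, 'r) bimodule" where
  "ring_as_int_bimodule R =
     \<lparr>carrier = carrier R, monoid.mult = monoid.mult R, monoid.one = monoid.one R,
      ring.zero = ring.zero R, ring.add = ring.add R,
      smult = monoid.mult R, rsmult = (\<lambda>r n. add_pow R n r)\<rparr>"

text \<open>The \<open>R\<close>-module \<open>R \<otimes>\<^sub>\<int> T\<^sup>\<Delta>(KGb, KHc)\<close>.\<close>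

definition RT_Delta ::
  "('r, 'y) ring_scheme \<Rightarrow> nat \<Rightarrow> ('f, 'u) ring_scheme \<Rightarrow> ('g, 'v) monoid_scheme \<Rightarrow> ('g \<Rightarrow> 'f)
    \<Rightarrow> ('h, 'w) monoid_scheme \<Rightarrow> ('h \<Rightarrow> 'f) \<Rightarrow> ('r, ('r, 'f, 'g, 'h) RT_element) module" where
  "RT_Delta R p K G b H c = tensor_left \<Z> (ring_as_int_bimodule R) (T_Delta p K G b H c)"

definition univ_copy ::
  "('f, 'u) ring_scheme \<Rightarrow> ('g, 'v) monoid_scheme \<Rightarrow> ('h, 'w) monoid_scheme
    \<Rightarrow> ('g \<Rightarrow> 'f, 'h \<Rightarrow> 'f, 'm, 'z) bimodule_scheme \<Rightarrow> ('f, 'g, 'h) univ_bimodule" where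
  "univ_copy K G H M =
     (SOME U. bimodule (group_ring K G) (group_ring K H) U \<and>
        bimod_iso (group_ring K G) (group_ring K H) M U \<noteq> {})"

text \<open>Generators of \<open>T\<^sup>\<Delta>\<close> are modules rather than isomorphism classes: \<^const>\<open>split_exact\<close>
  sequences with a zero end term identify isomorphic modules in the quotient, so the choice made
  in \<^const>\<open>univ_copy\<close> does not matter.

  The product \<open>T\<^sup>\<Delta>(KGb, KL) \<times> T\<^sup>\<Delta>(KL, KHc) \<rightarrow> T\<^sup>\<Delta>(KGb, KHc)\<close> induced by \<open>\<otimes>\<close> over \<open>KL\<close>, and its
  \<open>R\<close>-bilinear extension.\<close>

definition T_comp ::
  "nat \<Rightarrow> ('f, 'u) ring_scheme \<Rightarrow> ('g, 'v) monoid_scheme \<Rightarrow> ('g \<Rightarrow> 'f) \<Rightarrow> ('l, 'x) monoid_scheme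
    \<Rightarrow> ('h, 'w) monoid_scheme \<Rightarrow> ('h \<Rightarrow> 'f)
    \<Rightarrow> ('f, 'g, 'l) T_element \<Rightarrow> ('f, 'l, 'h) T_element \<Rightarrow> ('f, 'g, 'h) T_element" where
  "T_comp p K G b L H c U V = (\<Union>x\<in>U. \<Union>y\<in>V.
     presented_class (T_gens p K G b H c) (T_rels p K G b H c)
       (bilinear_extend (\<lambda>M N. univ_copy K G H (tensor (group_ring K L) M N)) x y))"

definition RT_comp ::
  "('r, 'y) ring_scheme \<Rightarrow> nat \<Rightarrow> ('f, 'u) ring_scheme \<Rightarrow> ('g, 'v) monoid_scheme \<Rightarrow> ('g \<Rightarrow> 'f)
    \<Rightarrow> ('l, 'x) monoid_scheme \<Rightarrow> ('h, 'w) monoid_scheme \<Rightarrow> ('h \<Rightarrow> 'f)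
    \<Rightarrow> ('r, 'f, 'g, 'l) RT_element \<Rightarrow> ('r, 'f, 'l, 'h) RT_element
    \<Rightarrow> ('r, 'f, 'g, 'h) RT_element" where
  "RT_comp R p K G b L H c U V = (\<Union>x\<in>U. \<Union>y\<in>V.
     presented_class (carrier R \<times> carrier (T_Delta p K G b H c))
       (tensor_rels \<Z> (ring_as_int_bimodule R) (T_Delta p K G b H c))
       (bilinear_extend (\<lambda>(r, s) (r', t). (r \<otimes>\<^bsub>R\<^esub> r', T_comp p K G b L H c s t)) x y))"

text \<open>The objects of the category of diagonal \<open>p\<close>-permutation functors are finite groups; up to
  isomorphism these are the finite groups whose elements are natural numbers.\<close>

definition fin_group_obj :: "nat monoid \<Rightarrow> bool" where
  "fin_group_obj L \<longleftrightarrow> group L \<and> finite (carrier L)"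

text \<open>The functor \<open>RT\<^sup>\<Delta>(-, KGb)\<close> on objects, and on a morphism \<open>f\<close> from \<open>L\<close> to \<open>L'\<close>, i.e. on an
  element of \<open>RT\<^sup>\<Delta>(KL', KL)\<close>.\<close>

definition RT_fun_obj ::
  "('r, 'y) ring_scheme \<Rightarrow> nat \<Rightarrow> ('f, 'u) ring_scheme \<Rightarrow> ('g, 'v) monoid_scheme \<Rightarrow> ('g \<Rightarrow> 'f)
    \<Rightarrow> nat monoid \<Rightarrow> ('r, ('r, 'f, nat, 'g) RT_element) module" where
  "RT_fun_obj R p K G b L = RT_Delta R p K L \<one>\<^bsub>group_ring K L\<^esub> G b"

definition Rpp_mor ::
  "('r, 'y) ring_scheme \<Rightarrow> nat \<Rightarrow> ('f, 'u) ring_scheme \<Rightarrow> nat monoid \<Rightarrow> nat monoid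
    \<Rightarrow> ('r, 'f, nat, nat) RT_element set" where
  "Rpp_mor R p K L L' =
     carrier (RT_Delta R p K L' \<one>\<^bsub>group_ring K L'\<^esub> L \<one>\<^bsub>group_ring K L\<^esub>)"

definition RT_fun_mor ::
  "('r, 'y) ring_scheme \<Rightarrow> nat \<Rightarrow> ('f, 'u) ring_scheme \<Rightarrow> ('g, 'v) monoid_scheme \<Rightarrow> ('g \<Rightarrow> 'f)
    \<Rightarrow> nat monoid \<Rightarrow> nat monoid \<Rightarrow> ('r, 'f, nat, nat) RT_element
    \<Rightarrow> ('r, 'f, nat, 'g) RT_element \<Rightarrow> ('r, 'f, nat, 'g) RT_element" where
  "RT_fun_mor R p K G b L L' f x = RT_comp R p K L' \<one>\<^bsub>group_ring K L'\<^esub> L G b f x"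

definition functorially_equivalent ::
  "('r, 'y) ring_scheme \<Rightarrow> nat \<Rightarrow> ('f, 'u) ring_scheme \<Rightarrow> ('g, 'v) monoid_scheme \<Rightarrow> ('g \<Rightarrow> 'f)
    \<Rightarrow> ('h, 'w) monoid_scheme \<Rightarrow> ('h \<Rightarrow> 'f) \<Rightarrow> bool" where
  "functorially_equivalent R p K G b H c \<longleftrightarrow>
     (\<exists>\<tau> :: nat monoid \<Rightarrow> ('r, 'f, nat, 'g) RT_element \<Rightarrow> ('r, 'f, nat, 'h) RT_element.
        (\<forall>L. fin_group_obj L \<longrightarrow>
           \<tau> L \<in> lmod_iso R (RT_fun_obj R p K G b L) (RT_fun_obj R p K H c L)) \<and>
        (\<forall>L L'. fin_group_obj L \<and> fin_group_obj L' \<longrightarrow>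
           (\<forall>f\<in>Rpp_mor R p K L L'. \<forall>x\<in>carrier (RT_fun_obj R p K G b L).
              \<tau> L' (RT_fun_mor R p K G b L L' f x) = RT_fun_mor R p K H c L L' f (\<tau> L x))))"

end

(* A functorial equivalence of (G,b) and (H,c) also identifies the values of the two functors on
blocks of cyclic groups of order q^n - 1, where q = |k|. The class groups of projective bimodules
occurring there have ranks that count the orbits of the Frobenius map on pairs consisting of a
nonzero element of the field with q^n elements and an irreducible Brauer character. These numbers,
for all n, determine how many characters have each Frobenius period, so the two Frobenius
permutations have the same cycle type, and a bijection matching cycles of equal length is equivariant. *)
theory Submission
  imports Defs
begin

\<comment> \<open>The order q^n - 1 is chosen for two reasons. It is prime to p, so the cyclic group
  C has no nontrivial p-subgroup; hence all twisted diagonal vertices are trivial, every diagonal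
  bimodule is projective, and it splits into left ideals generated by primitive idempotents of the
  finite algebra k[C x G]. Moreover F contains q^n - 1 roots of unity of this order, the nonzero
  elements of the field with q^n elements, so over F the algebra becomes a product of copies of FG
  (with reversed multiplication) indexed by them. Descent from F to k turns the labels of simple
  modules into Frobenius orbits. The obstacle is that the equivalence is linear only over R, an
  arbitrary commutative ring containing the integers: the rank is read off as the trace of the
  identity. An orbit count is a sum of reciprocals of lcms of periods, and triangular inversion over
  the divisors of one common period isolates the number of characters of each period. Finally, an
  arbitrary Galois automorphism agrees with a power of Frobenius on the finitely many character
  values.\<close>
syntax "_index" :: "logic => index" ("._" [1000] 1000)
notation scalar_restriction ("res")
notation galois_action ("gal")
notation carrier ("<_>")
notation funcset (infixr "->" 60)
abbreviation (input) biimp :: "bool => bool => bool" (infixr "<->" 25) where "A <-> B == A = B"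

section \<open>Finite sums in abelian monoids\<close>

lemma finsum_hom:
 assumes "abelian_monoid G" and "abelian_monoid H"
  and f: "f:<G> -> <H>" "f \<zero>.G = \<zero>.H"
  and add: "!!x y. x:<G> ==> y:<G> ==> f (x \<oplus>.G y) = f x \<oplus>.H f y"
  and g: "g:A -> <G>"
 shows "f (finsum G g A) = finsum H (%i. f (g i)) A"
proof -
interpret G: abelian_monoid G by fact
interpret H: abelian_monoid H by fact
show ?thesis using g
proof (induction A rule: infinite_finite_induct)
 case (insert i A)
 have "finsum G g A:<G>" and "g i:<G>" using insert.prems by auto
 moreover have "(%i. f (g i)):A -> <H>" "f (g i):<H>" using insert.prems f by auto
 ultimately show ?case using insert add by auto
qed (use f in auto)
qed

context abelian_monoid
begin

lemma finsum_swap: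
 assumes "!!i j. i:A ==> j:B ==> f i j:<G>"
 shows "(\<Oplus>i\<in>A. \<Oplus>j\<in>B. f i j) = (\<Oplus>j\<in>B. \<Oplus>i\<in>A. f i j)" using assms
proof (induction A rule: infinite_finite_induct)
case (insert a A)
have "(\<Oplus>j\<in>B. \<Oplus>i\<in>insert a A. f i j) = (\<Oplus>j\<in>B. f a j \<oplus> (\<Oplus>i\<in>A. f i j))"
 using insert by (intro finsum_cong') auto
also have "... = (\<Oplus>j\<in>B. f a j) \<oplus> (\<Oplus>j\<in>B. \<Oplus>i\<in>A. f i j)"
 using insert by (intro finsum_addf) auto
finally show ?case using insert by (subst finsum_insert) auto
qed auto

lemma finsum_delta:
 assumes "finite A" "a:A" "f a:<G>"
 shows "(\<Oplus>x\<in>A. if x = a then f x else \<zero>) = f a"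
proof -
have "(\<Oplus>x\<in>A. if x = a then f x else \<zero>) = (\<Oplus>x\<in>A. if x = a then f a else \<zero>)"
 using assms by (intro finsum_cong') auto
also have "... = f a" using add.finprod_singleton_swap[OF assms(2,1), of "%_. f a"] assms(3) by auto
finally show ?thesis .
qed

lemma finsum_zero_eq: "(!!x. x:A ==> f x = \<zero>) ==> finsum G f A = \<zero>" by (rule add.finprod_one_eqI)

lemma finsum_reindex_bij:
 assumes "bij_betw h A B" "f:B -> <G>"
 shows "(\<Oplus>x\<in>A. f (h x)) = (\<Oplus>y\<in>B. f y)"
 using assms finsum_reindex[of f h A] by (auto simp: bij_betw_def)
end

lemma card_set_mset_le_size: "card (set_mset M) <= size M" by (induction M) (auto simp: card_insert_if)

section \<open>Polynomials given by coefficient functions, and their roots\<close>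

context field
begin

text \<open>\<open>eval\<close> reads coefficient lists from the leading term downwards, whence the
  \<open>rev\<close>.\<close>

lemma eval_coeffs:
 assumes "c:{..d::nat} -> <R>" "x:<R>"
 shows "eval (rev (map c [0..<Suc d])) x = (\<Oplus>j\<in>{..d}. c j\<otimes> x [^] j)" using assms
proof (induction d)
case (Suc d)
have "eval (rev (map c [0..<Suc (Suc d)])) x
  = c (Suc d)\<otimes> x [^] Suc d \<oplus> eval (rev (map c [0..<Suc d])) x" by simp
thus ?case using Suc by (auto simp: Pi_iff)
qed auto

lemma coeffs_poly:
 assumes "c:{..d::nat} -> <R>" "c d ~= \<zero>"
 defines "P \<equiv> rev (map c [0..<Suc d])"
 shows "P:carrier (poly_ring R)" "degree P = d" "P ~= []"
 using assms by (auto simp: univ_poly_carrier[symmetric] polynomial_def)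

text \<open>Asking for some nonzero coefficient instead of a nonzero leading one lets the induction
  drop vanishing top coefficients until the list is a genuine polynomial, whose degree bounds its
  roots.\<close>

lemma few_roots:
 assumes "c:{..d::nat} -> <R>" "i <= d" "c i ~= \<zero>" "Z <= <R>"
  and "!!x. x:Z ==> (\<Oplus>j\<in>{..d}. c j\<otimes> x [^] j) = \<zero>"
 shows "finite Z & card Z <= d" using assms
proof (induction d)
case (Suc d)
show ?case
proof (cases "c (Suc d) = \<zero>")
 case True
 have "(\<Oplus>j\<in>{..d}. c j\<otimes> x [^] j) = \<zero>" if "x:Z" for x using that Suc.prems True
  by (auto simp: Pi_iff subset_iff)
 moreover have "i <= d" using Suc.prems True by (metis le_SucE)
 moreover have "c:{..d} -> <R>" using Suc.prems(1) by auto
 ultimately have "finite Z & card Z <= d" using Suc.IH Suc.prems(3,4) by blast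
 thus ?thesis by simp
next
 case False
 note P = coeffs_poly[OF Suc.prems(1) False]
 define P where "P = rev (map c [0..<Suc (Suc d)])"
 have "Z <= set_mset (roots P)"
 proof
  fix x assume x: "x:Z"
  have "is_root P x" using x Suc.prems(4,5) eval_coeffs[OF Suc.prems(1), of x] unfolding is_root_def P_def by auto
  thus "x:set_mset (roots P)" using roots_mem_iff_is_root P(1) unfolding P_def by blast
 qed
 moreover have "card (set_mset (roots P)) <= Suc d" using size_roots_le_degree[OF P(1)] P(2) unfolding P_def
  by (metis le_trans card_set_mset_le_size)
 ultimately show ?thesis by (meson card_mono finite_set_mset le_trans rev_finite_subset)
qed
next
case 0
hence "Z = {}" by auto
thus ?case by simp
qed

lemma card_pow_eq_one:
 assumes "m > 0" "Z <= <R>" "!!x. x:Z ==> x [^] (m::nat) = \<one>"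
 shows "finite Z & card Z <= m"
proof (rule few_roots)
let ?c = "%j::nat. if j = m then \<one> else if j = 0 then \<ominus> \<one> else \<zero>"
show "?c:{..m} -> <R>" by auto
show "?c m ~= \<zero>" by auto
fix x assume x: "x:Z"
hence xc: "x:<R>" using assms by auto
have "(\<Oplus>j\<in>{..m}. ?c j\<otimes> x [^] j)
  = (\<Oplus>j\<in>{..m}. (if j = m then x [^] j else \<zero>) \<oplus> (if j = 0 then \<ominus> \<one> else \<zero>))"
 using xc \<open>m > 0\<close> by (intro finsum_cong') auto
also have "... = x [^] m \<oplus> \<ominus> \<one>" using xc by (subst finsum_addf) (auto simp: finsum_delta)
also have "... = \<zero>" using assms(3)[OF x] by (simp add: r_neg)
finally show "(\<Oplus>j\<in>{..m}. ?c j\<otimes> x [^] j) = \<zero>" .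
qed (use assms in auto)
end

lemma (in algebraically_closed) root_exists:
 assumes "c:{..d::nat} -> <L>" "c d ~= \<zero>" "d > 0"
 shows "EX x:<L>. (\<Oplus>j\<in>{..d}. c j\<otimes> x [^] j) = \<zero>"
proof -
note P = coeffs_poly[OF assms(1,2)]
have "size (roots (rev (map c [0..<Suc d]))) = d" using roots_over_carrier[OF P(1)] unfolding splitted_def by simp
then obtain x where "x:# roots (rev (map c [0..<Suc d]))"
 using assms(3) by (metis size_eq_0_iff_empty multiset_nonemptyE less_numeral_extra(3))
hence "is_root (rev (map c [0..<Suc d])) x" using roots_mem_iff_is_root[OF P(1)] by simp
thus ?thesis using eval_coeffs[OF assms(1)] unfolding is_root_def by auto
qed

context ring
begin

text \<open>Every extension step adjoins a vector v outside E, so (k, u) -> k v + u is injective on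
  K x E: two preimages with different k would put v into E.\<close>

lemma dimension_card:
 assumes "subfield K R" "finite K" "dimension n K E"
 shows "finite E & card E = card K ^ n" using assms(3,1,2)
proof (induction n K E rule: dimension.induct)
case zero_dim
thus ?case by simp
next
case (Suc_dim v E n K)
note sub = subfieldE[OF Suc_dim.prems(1)]
note sg = space_subgroup_props[OF Suc_dim.prems(1) Suc_dim.hyps(3)]
let ?f = "%(k, u). k\<otimes> v \<oplus> u"
have "line_extension K v E = ?f ` (K \<times> E)" using line_extension_mem_iff[of _ K v E] by force
moreover have "inj_on ?f (K \<times> E)"
proof (rule inj_onI, clarify)
 fix a u b w assume h: "a:K" "u:E" "b:K" "w:E" "a\<otimes> v \<oplus> u = b\<otimes> v \<oplus> w"
 have c: "a:<R>" "b:<R>" "u:<R>" "w:<R>" "v:<R>" using h sub(3) sg(1) Suc_dim.hyps by auto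
 have "a\<otimes> v = (b\<otimes> v \<oplus> w) \<oplus> \<ominus> u"
  using h(5) c add.inv_solve_right[of "a\<otimes> v" "b\<otimes> v \<oplus> w" u] by auto
 hence e: "(a \<ominus> b)\<otimes> v = w \<ominus> u" using c by (simp add: a_minus_def l_distr l_minus a_ac r_neg)
 have "a = b"
 proof (rule ccontr)
  assume "a ~= b"
  hence "a \<ominus> b ~= \<zero>" using c by simp
  moreover have "a \<ominus> b:K" using h sub(1) by (simp add: a_minus_def subringE)
  ultimately have nz: "a \<ominus> b:K - {\<zero>}" by blast
  have "(a \<ominus> b)\<otimes> v:E" using e h sg by (simp add: a_minus_def)
  thus False using space_subgroup_props(6)[OF Suc_dim.prems(1) Suc_dim.hyps(3) nz _ ] Suc_dim.hyps by blast
 qed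
 moreover hence "u = w" using h(5) c by (metis add.l_cancel m_closed)
 ultimately show "a = b & u = w" by blast
qed
ultimately show ?case using Suc_dim by (simp add: card_image)
qed
end

lemma (in cring) binomial_theorem:
 assumes [simp]: "x:<R>" "y:<R>"
 shows "(x \<oplus> y) [^] (n::nat) = (\<Oplus>i\<in>{..n}. [(n choose i)] \<cdot> (x [^] i\<otimes> y [^] (n - i)))"
proof (induction n)
case (Suc n)
define T where "T = (%n i. [(n choose i)] \<cdot> (x [^] i\<otimes> y [^] (n - i)))"
define U where "U = (%i. [(n choose i)] \<cdot> (x [^] i\<otimes> y [^] (Suc n - i)))"
have T[simp]: "T n i:<R>" "U i:<R>" for n i by (auto simp: T_def U_def)
have "y\<otimes> (\<Oplus>i\<in>{..n}. T n i) = (\<Oplus>i\<in>{..n}. y\<otimes> T n i)"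
 by (rule finsum_rdistr) auto
also have "... = (\<Oplus>i\<in>{..n}. U i)"
proof (rule finsum_cong')
 fix i assume "i:{..n}"
 hence "Suc n - i = Suc (n - i)" by auto
 thus "y\<otimes> T n i = U i" by (simp add: T_def U_def add_pow_rdistr m_ac)
qed auto
also have "... = (\<Oplus>i\<in>{..Suc n}. U i)" by (subst finsum_Suc) (auto simp: U_def binomial_eq_0)
also have "... = (\<Oplus>i\<in>{..n}. U (Suc i)) \<oplus> U 0" by (subst finsum_Suc2) auto
finally have y: "y\<otimes> (\<Oplus>i\<in>{..n}. T n i) = (\<Oplus>i\<in>{..n}. U (Suc i)) \<oplus> U 0" .
have x: "x\<otimes> (\<Oplus>i\<in>{..n}. T n i) = (\<Oplus>i\<in>{..n}. x\<otimes> T n i)"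
 by (rule finsum_rdistr) auto
have "(\<Oplus>i\<in>{..Suc n}. T (Suc n) i) = (\<Oplus>i\<in>{..n}. T (Suc n) (Suc i)) \<oplus> T (Suc n) 0"
 by (subst finsum_Suc2) auto
also have "(\<Oplus>i\<in>{..n}. T (Suc n) (Suc i)) = (\<Oplus>i\<in>{..n}. x\<otimes> T n i \<oplus> U (Suc i))"
 by (intro finsum_cong') (auto simp: T_def U_def add_pow_rdistr m_ac add.nat_pow_mult[symmetric])
also have "... = (\<Oplus>i\<in>{..n}. x\<otimes> T n i) \<oplus> (\<Oplus>i\<in>{..n}. U (Suc i))"
 by (rule finsum_addf) auto
also have "T (Suc n) 0 = U 0" by (simp add: T_def U_def)
finally have "(\<Oplus>i\<in>{..Suc n}. T (Suc n) i) = x\<otimes> (\<Oplus>i\<in>{..n}. T n i) \<oplus> y\<otimes> (\<Oplus>i\<in>{..n}. T n i)"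
 unfolding x y by (simp add: a_assoc)
thus ?case using Suc by (simp add: T_def m_comm l_distr)
qed auto

text \<open>For the exponent p the inner binomial coefficients are multiples of p and vanish in
  characteristic p; powers of p follow by iteration.\<close>

lemma (in cring) frobenius_add:
 assumes [simp]: "x:<R>" "y:<R>"
  and p: "Factorial_Ring.prime (p::nat)" "[p] \<cdot> \<one> = \<zero>"
 shows "(x \<oplus> y) [^] (p ^ r) = x [^] (p ^ r) \<oplus> y [^] (p ^ r)"
proof (induction r)
case (Suc r)
have z: "[m] \<cdot> u = \<zero>" if pm: "p dvd m" and "u:<R>" for m u
proof -
 obtain l where "m = p * l" using pm by (rule dvdE)
 hence "[m] \<cdot> u = ([m] \<cdot> \<one>)\<otimes> u" "[m] \<cdot> \<one> = \<zero>"
  using that add.nat_pow_pow[of \<one> l p] p(2) by (auto simp: add_pow_ldistr mult.commute)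
 thus ?thesis using that by simp
qed
have fr: "(u \<oplus> v) [^] p = u [^] p \<oplus> v [^] p" if [simp]: "u:<R>" "v:<R>" for u v
proof -
 have p0: "p > 0" "p ~= 0" using p by (auto simp: prime_gt_0_nat)
 have "(u \<oplus> v) [^] p = (\<Oplus>i\<in>{..p}. [(p choose i)] \<cdot> (u [^] i\<otimes> v [^] (p - i)))"
  by (rule binomial_theorem) auto
 also have "... = (\<Oplus>i\<in>{..p}. (if i = p then u [^] p else \<zero>) \<oplus> (if i = 0 then v [^] p else \<zero>))"
 proof (rule finsum_cong')
  fix i assume i: "i:{..p}"
  show "[(p choose i)] \<cdot> (u [^] i\<otimes> v [^] (p - i)) = (if i = p then u [^] p else \<zero>) \<oplus> (if i = 0 then v [^] p else \<zero>)"
  proof (cases "i = 0 \<or> i = p")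
   case False
   hence "p dvd (p choose i)" using p(1) i by (intro dvd_choose_prime) auto
   thus ?thesis using False z by auto
  qed (use p0 in auto)
 qed auto
 also have "... = u [^] p \<oplus> v [^] p" by (subst finsum_addf) (auto simp: finsum_delta)
 finally show ?thesis .
qed
have "(x \<oplus> y) [^] (p ^ Suc r) = ((x \<oplus> y) [^] (p ^ r)) [^] p" by (simp add: nat_pow_pow mult.commute)
thus ?case using Suc by (simp add: fr nat_pow_pow mult.commute)
qed simp

section \<open>Finite subfields of the closure and the Frobenius map\<close>

locale closure_over_finite = algebraic_closure F Fp
 for F :: "'f ring" (structure) and Fp :: "'f set" +
 fixes p :: nat and k :: "'f set"
 assumes prime_p: "Factorial_Ring.prime p" and card_Fp: "card Fp = p"
  and subfield_k: "subfield k F" and finite_k: "finite k"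
begin

definition q where "q = card k"
text \<open>The Frobenius map over k. On a finite set its iterates realize every automorphism fixing
  k, see \<open>galois_eq_phi\<close>.\<close>

definition phi where "phi x = x [^] q"

lemma finite_Fp: "finite Fp" using card_Fp prime_p by (metis card.infinite not_prime_0)

lemma char_p: "[p] \<cdot> \<one> = \<zero>"
proof -
have "subgroup Fp (add_monoid F)" using subring.axioms(1)[OF subfieldE(1)[OF subfield_axioms]] .
then interpret P: group "(add_monoid F)(|carrier := Fp|)" by blast
have "\<one>:Fp" using subringE(3)[OF subfieldE(1)[OF subfield_axioms]] .
hence "\<one> [^].((add_monoid F)(|carrier := Fp|)) p = \<zero>"
 using P.pow_order_eq_1[of \<one>] card_Fp by (simp add: order_def)
thus ?thesis by (simp add: nat_pow_def add_pow_def)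
qed

text \<open>The first p multiples of one are distinct by Bezout, so they exhaust the p elements of
  \<open>Fp\<close>; every subfield contains them.\<close>

lemma Fp_subset:
 assumes "subfield K F" shows "Fp <= K"
proof -
have sub: "subring K F" "subring Fp F" using assms subfield_axioms subfieldE(1) by auto
have mem: "[i] \<cdot> \<one>:K \<inter> Fp" for i :: nat
 using subringE(2,3,7)[OF sub(1)] subringE(2,3,7)[OF sub(2)] by (induction i) auto
have "inj_on (%i::nat. [i] \<cdot> \<one>) {..<p}"
proof (rule linorder_inj_onI')
 fix i j assume ij: "i:{..<p}" "j:{..<p}" "i < j"
 show "[i] \<cdot> \<one> ~= [j] \<cdot> \<one>"
 proof
  assume eq: "[i] \<cdot> \<one> = [j] \<cdot> \<one>"
  have "[j] \<cdot> \<one> = [i] \<cdot> \<one> \<oplus> [(j - i)] \<cdot> \<one>"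
   using ij add.nat_pow_mult[of \<one> i "j - i"] by auto
  hence z: "[(j - i)] \<cdot> \<one> = \<zero>" using eq by simp
  have "~ p dvd j - i" using ij by (intro nat_dvd_not_less) auto
  hence "coprime (j - i) p" using prime_p prime_imp_coprime coprime_commute by blast
  then obtain u v where uv: "(j - i) * u = p * v + 1"
   using bezout_nat[of "j - i" p] ij(3) by (metis coprime_imp_gcd_eq_1 diff_is_0_eq linorder_not_less)
  have "[((j - i) * u)] \<cdot> \<one> = \<zero>" using z add.nat_pow_pow[of \<one> u "j - i"] by simp
  moreover have "[(p * v + 1)] \<cdot> \<one> = \<one>" using char_p add.nat_pow_pow[of \<one> v p] by simp
  ultimately show False using uv by simp
 qed
qed
hence "card ((%i::nat. [i] \<cdot> \<one>) ` {..<p}) = p" by (simp add: card_image)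
hence "(%i::nat. [i] \<cdot> \<one>) ` {..<p} = Fp" using mem finite_Fp card_Fp by (intro card_subset_eq) auto
thus ?thesis using mem by blast
qed

text \<open>A finite K' is generated over K by the list of all its elements, which are algebraic, so
  it has finite dimension over K.\<close>

lemma finite_extension_degree:
 assumes "subfield K F" "finite K" "subfield K' F" "finite K'" "K <= K'"
 shows "EX n. card K' = card K ^ n"
proof -
obtain xs where xs: "set xs = K'" using assms(4) finite_list by blast
have sub: "set xs <= <F>" "subring K' F" using xs assms(3) subfieldE by auto
have alg: "(algebraic over K) x" if "x:<F>" for x
 using algebraic_extension that algebraic_mono[OF Fp_subset[OF assms(1)]] by blast
have "finite_extension K xs = K'"
 using finite_extension_subring_incl[OF sub(2) assms(5)] finite_extension_mem[OF subfieldE(1)[OF assms(1)] sub(1)] xs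
 by blast
hence "finite_dimension K K'" using finite_extension_finite_dimension(1)[OF assms(1) sub(1)] alg sub(1) by blast
thus ?thesis using dimension_card[OF assms(1,2)] unfolding finite_dimension_def by blast
qed

text \<open>Adjoining finitely many algebraic elements to \<open>Fp\<close> gives a finite field; k
  is put among the generators so that the result is an extension of k.\<close>

lemma finite_subfield:
 assumes "finite S" "S <= <F>"
 obtains K where "subfield K F" "finite K" "S <= K" "k <= K"
proof -
obtain xs where xs: "set xs = S \<union> k" using assms(1) finite_k finite_list by (meson finite_UnI)
have c: "set xs <= <F>" using xs assms subfieldE(3)[OF subfield_k] by auto
let ?K = "finite_extension Fp xs"
have "subfield ?K F" using finite_extension_is_subfield[OF subfield_axioms c] algebraic_extension c by blast
moreover have "finite ?K"
 using finite_extension_finite_dimension(1)[OF subfield_axioms c] algebraic_extension c dimension_card[OF subfield_axioms finite_Fp] unfolding finite_dimension_def by blast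
moreover have "set xs <= ?K" using finite_extension_mem[OF subfieldE(1)[OF subfield_axioms] c] .
ultimately show ?thesis using that xs by blast
qed

lemma q_power: "EX r. q = p ^ r"
 using finite_extension_degree[OF subfield_axioms finite_Fp subfield_k finite_k Fp_subset[OF subfield_k]]
 unfolding q_def card_Fp .

lemma q_gt_1: "q > 1"
proof -
have "{\<zero>, \<one>} <= k" using subringE[OF subfieldE(1)[OF subfield_k]] by auto
hence "card {\<zero>, \<one>} <= q" unfolding q_def using finite_k card_mono by blast
thus ?thesis by simp
qed

lemma q_pow_gt: "n > 0 ==> q ^ n > 1" using q_gt_1 by (metis one_less_power)

lemma p_dvd_q: "p dvd q" using q_power q_gt_1 by (metis gr0I less_irrefl power_0 dvd_power)

lemma phi_closed [simp]: "x:<F> ==> phi x:<F>" by (simp add: phi_def)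

lemma phi_pow: "x:<F> ==> (phi ^^ n) x = x [^] (q ^ n)"
 by (induction n) (auto simp: phi_def nat_pow_pow mult.commute)

lemma phi_pow_closed [simp]: "x:<F> ==> (phi ^^ n) x:<F>" by (simp add: phi_pow)

lemma phi_pow_hom: "phi ^^ n:ring_hom F F"
proof -
obtain r where r: "q = p ^ r" using q_power by blast
have "q ^ n > 0" using q_gt_1 by simp
thus ?thesis by (intro ring_hom_memI)
  (auto simp: phi_pow nat_pow_distrib r power_mult[symmetric] frobenius_add[OF _ _ prime_p char_p])
qed

text \<open>The q^n - 1 units of K satisfy x^(q^n - 1) = 1, and this equation has no further
  solutions because it has at most q^n - 1 of them.\<close>

lemma subfield_fixed:
 assumes "subfield K F" "finite K" "card K = q ^ n" "x:<F>" "n > 0"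
 shows "(phi ^^ n) x = x <-> x:K"
proof -
interpret K: field "F(|carrier := K|)" using subfield_iff(2)[OF assms(1)] .
let ?m = "q ^ n - 1"
have m: "?m > 0" using q_pow_gt[OF assms(5)] by simp
have K: "K <= <F>" "\<zero>:K" using subfieldE(3)[OF assms(1)] subringE(2)[OF subfieldE(1)[OF assms(1)]] by auto
have pow: "x [^] ?m = \<one>" if x: "x:K - {\<zero>}" for x
proof -
 interpret G: group "Multiplicative_Group.mult_of (F(|carrier := K|))" by (rule K.field_mult_group)
 have "x [^].(Multiplicative_Group.mult_of (F(|carrier := K|))) order (Multiplicative_Group.mult_of (F(|carrier := K|))) = \<one>"
  using G.pow_order_eq_1[of x] x by simp
 moreover have "order (Multiplicative_Group.mult_of (F(|carrier := K|))) = ?m"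
  using assms(2,3) K by (simp add: order_def)
 ultimately show ?thesis by (simp add: nat_pow_def)
qed
have e: "(phi ^^ n) x = x [^] ?m\<otimes> x" if "x:<F>" for x
proof -
 have "q ^ n = Suc ?m" using m by simp
 thus ?thesis using that phi_pow[of x n] nat_pow_Suc[of x ?m] by metis
qed
show ?thesis
proof
 assume "x:K"
 thus "(phi ^^ n) x = x" using e[OF assms(4)] pow[of x] assms(4) by (cases "x = \<zero>") auto
next
 assume fx: "(phi ^^ n) x = x"
 let ?Z = "{y:<F> - {\<zero>}. y [^] ?m = \<one>}"
 have "finite ?Z & card ?Z <= ?m" using m by (intro card_pow_eq_one) auto
 moreover have "K - {\<zero>} <= ?Z" using pow K by auto
 moreover have "card (K - {\<zero>}) = ?m" using assms by simp
 ultimately have "?Z = K - {\<zero>}" by (metis card_seteq)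
 moreover have "x = \<zero> \<or> x:?Z"
 proof (cases "x = \<zero>")
  case False
  have "x [^] ?m\<otimes> x = \<one>\<otimes> x" using e[OF assms(4)] fx assms(4) by simp
  hence "x [^] ?m = \<one>" using False assms(4) m_rcancel[of x "x [^] ?m" \<one>] by simp
  thus ?thesis using assms(4) by simp
 qed simp
 ultimately show "x:K" using K by blast
qed
qed

lemma phi_fixed: "x:<F> ==> phi x = x <-> x:k"
 using subfield_fixed[OF subfield_k finite_k, of 1 x] by (simp add: q_def)

text \<open>For surjectivity, each x lies in a finite subfield; Frobenius maps it into itself
  injectively, hence onto itself.\<close>

lemma phi_pow_iso: "phi ^^ n:ring_iso F F"
proof -
interpret h: ring_hom_ring F F "phi ^^ n" using phi_pow_hom by (intro ring_hom_ringI2 ring_axioms)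
have "inj_on (phi ^^ n) <F>" using non_trivial_field_hom_is_inj[OF phi_pow_hom field_axioms field_axioms] by auto
moreover have "x:(phi ^^ n) ` <F>" if x: "x:<F>" for x
proof -
 obtain K where K: "subfield K F" "finite K" "{x} <= K" using finite_subfield[of "{x}"] x by auto
 have "(phi ^^ n) ` K <= K"
 proof
  fix y assume "y:(phi ^^ n) ` K"
  then obtain z where z: "z:K" "y = (phi ^^ n) z" by blast
  hence "y = z [^] (q ^ n)" using phi_pow subfieldE(3)[OF K(1)] by blast
  moreover have "z [^] (i::nat):K" for i by (induction i) (use z subringE[OF subfieldE(1)[OF K(1)]] in auto)
  ultimately show "y:K" by blast
 qed
 moreover have "inj_on (phi ^^ n) K"
  using \<open>inj_on (phi ^^ n) <F>\<close> subfieldE(3)[OF K(1)] inj_on_subset by blast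
 ultimately have "(phi ^^ n) ` K = K" using K(2) endo_inj_surj by blast
 thus ?thesis using K(3) subfieldE(3)[OF K(1)] by blast
qed
ultimately show ?thesis using phi_pow_hom unfolding ring_iso_def bij_betw_def by auto
qed
end

lemma pred_dvd_power_pred: "(x::nat) > 0 ==> x - 1 dvd x ^ l - 1"
proof -
assume "x > 0"
hence "int (x ^ l - 1) = int (x - 1) * (\<Sum>i<l. int x ^ i)" using power_diff_1_eq[of "int x" l] by simp
thus ?thesis by (metis dvd_triv_left of_nat_dvd_iff)
qed

context closure_over_finite
begin

lemma galois_phi: "phi ^^ j:galois_group F k"
proof -
have "(phi ^^ j) x = x" if "x:k" for x by (induction j) (use that phi_fixed subfieldE(3)[OF subfield_k] in auto)
thus ?thesis using phi_pow_iso by (simp add: galois_group_def)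
qed

lemma card_subfield:
 assumes "subfield K F" "finite K" "k <= K"
 obtains n where "n > 0" "card K = q ^ n"
proof -
obtain n where n: "card K = q ^ n" using finite_extension_degree[OF subfield_k finite_k assms] q_def by auto
have "card K >= q" using card_mono[OF assms(2,3)] unfolding q_def .
hence "n > 0" using n q_gt_1 by (cases n) auto
thus ?thesis using n that by blast
qed

text \<open>The group of units is cyclic. A generator z has order exactly q^n - 1 because its powers
  exhaust the units.\<close>

lemma subfield_generator:
 assumes "subfield K F" "finite K" "card K = q ^ n" "n > 0"
 obtains z where "z:K" "z ~= \<zero>" "!!j::nat. z [^] j = \<one> <-> (q ^ n - 1) dvd j"
  "!!x. x:K ==> x ~= \<zero> ==> EX i::nat. x = z [^] i" "!!x. x:K ==> x ~= \<zero> ==> x [^] (q ^ n - 1) = \<one>"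
proof -
interpret K: field "F(|carrier := K|)" using subfield_iff(2)[OF assms(1)] .
let ?M = "Multiplicative_Group.mult_of (F(|carrier := K|))"
interpret G: group ?M by (rule K.field_mult_group)
have pow: "x [^].(?M) (i::nat) = x [^] i" "x [^].(F(|carrier := K|)) (i::nat) = x [^] i" for x i
 by (simp_all add: nat_pow_def)
obtain z where z: "z:<?M>" "<?M> = {z [^].(F(|carrier := K|)) i | i::nat. i:UNIV}"
 using K.finite_field_mult_group_has_gen assms(2) by auto
have ord: "order ?M = q ^ n - 1" using assms(2,3) subringE(2)[OF subfieldE(1)[OF assms(1)]] by (simp add: order_def)
have fin: "finite <?M>" using assms(2) by simp
have "G.ord z = order ?M"
proof -
 have "<?M> = {z [^].(?M) i | i::nat. i:UNIV}" using z(2) pow by simp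
 also have "... = (%i::nat. z [^].(?M) i) ` {0 .. G.ord z - 1}" using G.ord_elems[OF fin z(1)] by auto
 finally have "card <?M> <= G.ord z"
  using G.ord_ge_1[OF fin z(1)] card_image_le[of "{0 .. G.ord z - 1}" "%i::nat. z [^].(?M) i"] by simp
 moreover have "G.ord z dvd order ?M" using z(1) G.ord_dvd_group_order by blast
 moreover have "order ?M > 0" using ord q_pow_gt[OF assms(4)] by simp
 ultimately show ?thesis by (simp add: order_def dvd_imp_le le_antisym)
qed
hence "z [^] j = \<one> <-> (q ^ n - 1) dvd j" for j :: nat using G.pow_eq_id[OF z(1), of j] ord pow by simp
moreover have "EX i::nat. x = z [^] i" if "x:K" "x ~= \<zero>" for x using that z(2) pow by auto
moreover have "x [^] (q ^ n - 1) = \<one>" if "x:K" "x ~= \<zero>" for x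
 using G.pow_order_eq_1[of x] that ord pow by simp
ultimately show ?thesis using that z by auto
qed

text \<open>The Frobenius orbit of z has length exactly n: for 0 < i < n the number q^i - 1 is
  positive and smaller than the order q^n - 1 of z, so the i-th iterate moves z.\<close>

lemma generator_period:
 assumes "z:<F>" "z ~= \<zero>" "!!j::nat. z [^] j = \<one> <-> (q ^ n - 1) dvd j" "n > 0"
 shows "(phi ^^ i) z = (phi ^^ j) z <-> i mod n = j mod n"
  "(phi ^^ i) z = z <-> n dvd i"
proof -
have fix0: "(phi ^^ i) z = z <-> (q ^ n - 1) dvd (q ^ i - 1)" for i
proof -
 have "q ^ i > 0" using q_gt_1 by simp
 hence "(phi ^^ i) z = z [^] (q ^ i - 1)\<otimes> z"
  using assms(1) phi_pow[of z i] nat_pow_Suc[of z "q ^ i - 1"] by simp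
 moreover have "z [^] (q ^ i - 1)\<otimes> z = z <-> z [^] (q ^ i - 1) = \<one>"
  using assms(1,2) m_rcancel[of z "z [^] (q ^ i - 1)" \<one>] by auto
 ultimately show ?thesis using assms(3) by simp
qed
have n: "(phi ^^ n) z = z" using fix0 by simp
have mult: "(phi ^^ (n * m)) z = z" for m by (induction m) (auto simp: funpow_add n)
have small: "i = 0" if "(phi ^^ i) z = z" "i < n" for i
proof (rule ccontr)
 assume "i ~= 0"
 have "q ^ i - 1 < q ^ n - 1" using that q_gt_1 power_strict_increasing[of i n q] one_le_power[of q i] by linarith
 moreover have "q ^ i - 1 > 0" using \<open>i ~= 0\<close> q_pow_gt[of i] by simp
 ultimately show False using fix0 that nat_dvd_not_less by blast
qed
have red: "(phi ^^ i) z = (phi ^^ (i mod n)) z" for i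
proof -
 have "phi ^^ i = phi ^^ (i mod n) \<circ> phi ^^ (n * (i div n))" by (metis add.commute funpow_add mult_div_mod_eq)
 thus ?thesis using mult by simp
qed
show 1: "(phi ^^ i) z = z <-> n dvd i" for i
 by (metis red[of i] small[of "i mod n"] assms(4) dvd_eq_mod_eq_0 mod_less_divisor funpow_0)
have inj: "inj_on (phi ^^ i) <F>" for i using phi_pow_iso by (auto simp: ring_iso_def bij_betw_def)
have le: "(phi ^^ i) z = (phi ^^ j) z <-> i mod n = j mod n" if "i <= j" for i j
proof -
 have "(phi ^^ j) z = (phi ^^ i) ((phi ^^ (j - i)) z)"
  using that by (metis comp_apply funpow_add le_add_diff_inverse)
 hence "(phi ^^ i) z = (phi ^^ j) z <-> z = (phi ^^ (j - i)) z" using inj_on_eq_iff[OF inj] assms(1) by auto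
 also have "... <-> n dvd (j - i)" using 1 by metis
 also have "... <-> i mod n = j mod n" using mod_eq_dvd_iff_nat[OF that, of n] by auto
 finally show ?thesis .
qed
show "(phi ^^ i) z = (phi ^^ j) z <-> i mod n = j mod n" using le[of i j] le[of j i] by (metis linear)
qed

text \<open>E is the fixed field of the e-th iterate inside K, of order q^m say. A power of a
  generator of K with order q^e - 1 lies in E and has period e, so e divides m; a generator of E has
  period m and is fixed by the e-th iterate, so m divides e.\<close>

lemma subfield_of_divisor:
 assumes "subfield K F" "finite K" "k <= K" "card K = q ^ n" "n > 0" "e dvd n"
 obtains E where "subfield E F" "finite E" "k <= E" "card E = q ^ e"
proof -
obtain z where z: "z:K" "z ~= \<zero>" "!!j::nat. z [^] j = \<one> <-> (q ^ n - 1) dvd j"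
 using subfield_generator[OF assms(1,2,4,5)] by metis
have zc: "z:<F>" using z(1) subfieldE(3)[OF assms(1)] by blast
have e0: "e > 0" using assms(5,6) by (metis dvd_pos_nat)
define E where "E = {x:K. (phi ^^ e) x = x}"
interpret h: ring_hom_ring F F "phi ^^ e" using phi_pow_hom by (intro ring_hom_ringI2 ring_axioms)
have sub: "subring K F" "K <= <F>" using subfieldE[OF assms(1)] by auto
have cK: "x:<F>" if "x:K" for x using that sub by blast
have "subfield E F"
proof (rule subfieldI')
 show "subring E F" by (rule subringI) (use subringE(2,3,5,6,7)[OF sub(1)] in \<open>auto simp: E_def cK\<close>)
 fix x assume x: "x:E - {\<zero>}"
 hence xK: "x:K - {\<zero>}" and xc: "x:<F>" "(phi ^^ e) x = x" using sub by (auto simp: E_def)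
 have i: "inv x:K" using subfield_m_inv(1)[OF assms(1) xK] by blast
 have "(phi ^^ e) (inv x)\<otimes> x = (phi ^^ e) (inv x\<otimes> x)" using xc i sub by auto
 also have "... = inv x\<otimes> x" using subfield_m_inv(3)[OF assms(1) xK] by simp
 finally have "(phi ^^ e) (inv x) = inv x" using m_rcancel[of x "(phi ^^ e) (inv x)" "inv x"] x xc i sub by auto
 thus "inv x:E" using i by (simp add: E_def)
qed
moreover have finE: "finite E" using assms(2) by (simp add: E_def)
moreover have kE: "k <= E" using galois_phi[of e] assms(3) by (auto simp: E_def galois_group_def)
moreover have "card E = q ^ e"
proof -
 obtain m where m: "m > 0" "card E = q ^ m" using card_subfield[OF \<open>subfield E F\<close> finE kE] by blast
 obtain d where d: "q ^ n - 1 = (q ^ e - 1) * d"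
  using assms(6) pred_dvd_power_pred[of "q ^ e"] q_gt_1 by (metis dvdE power_mult zero_less_power less_trans zero_less_one)
 have d0: "d > 0" using d q_pow_gt[OF assms(5)] by (cases d) auto
 have "z [^] (i::nat) ~= \<zero>" for i by (induction i) (use zc z(2) in \<open>auto simp: integral_iff\<close>)
 hence wc: "z [^] d:<F>" "z [^] d ~= \<zero>" using zc by auto
 have w: "(z [^] d) [^] j = \<one> <-> (q ^ e - 1) dvd j" for j :: nat
  using z(3)[of "d * j"] zc d d0 by (simp add: nat_pow_pow)
 have "z [^] d:K" by (induction d) (use z subringE[OF sub(1)] in auto)
 hence "z [^] d:E" using generator_period(2)[OF wc w e0, of e] by (simp add: E_def)
 hence "(phi ^^ m) (z [^] d) = z [^] d"
  using subfield_fixed[OF \<open>subfield E F\<close> finE m(2) wc(1) m(1)] by blast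
 hence "e dvd m" using generator_period(2)[OF wc w e0] by blast
 hence "e <= m" using m(1) dvd_imp_le by blast
 moreover have "m <= e"
 proof -
  obtain y where y: "y:E" "y ~= \<zero>" "!!j::nat. y [^] j = \<one> <-> (q ^ m - 1) dvd j"
   using subfield_generator[OF \<open>subfield E F\<close> finE m(2,1)] by metis
  hence "m dvd e" using generator_period(2)[OF _ y(2,3) m(1), of e] sub by (auto simp: E_def)
  thus ?thesis using e0 dvd_imp_le by blast
 qed
 ultimately show ?thesis using m by simp
qed
ultimately show ?thesis using that by blast
qed

text \<open>The trace is a nonzero polynomial map of degree q^(n-1), less than the size of K, so it
  cannot vanish on K; a nonzero value lies in k and can be scaled to one.\<close>

lemma trace_one:
 assumes "subfield K F" "finite K" "k <= K" "card K = q ^ n" "n > 0"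
 obtains t where "t:K" "(\<Oplus>i\<in>{..<n}. (phi ^^ i) t) = \<one>"
proof -
have sub: "subring K F" "K <= <F>" using subfieldE[OF assms(1)] by auto
define tr where "tr x = (\<Oplus>i\<in>{..<n}. (phi ^^ i) x)" for x
have "EX x:K. tr x ~= \<zero>"
proof (rule ccontr)
 assume none: "~ ?thesis"
 let ?D = "q ^ (n - 1)"
 \<comment> \<open>The trace polynomial: coefficient one at the exponents 1, q, ...,
   q^(n-1).\<close>
 let ?c = "%j. if j:(%i. q ^ i) ` {..<n} then \<one> else \<zero>"
 have inj: "inj_on (%i. q ^ i) {..<n}" using q_gt_1 by (auto intro!: inj_onI)
 have le: "(%i. q ^ i) ` {..<n} <= {..?D}" using q_gt_1 by auto
 have "(\<Oplus>j\<in>{..?D}. ?c j\<otimes> x [^] j) = \<zero>" if x: "x:K" for x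
 proof -
  have xc: "x:<F>" using x sub by blast
  have "(\<Oplus>j\<in>{..?D}. ?c j\<otimes> x [^] j) = (\<Oplus>j\<in>(%i. q ^ i) ` {..<n}. x [^] j)"
   using xc le by (intro add.finprod_mono_neutral_cong_right) auto
  also have "... = (\<Oplus>i\<in>{..<n}. x [^] (q ^ i))" using xc inj by (subst finsum_reindex) auto
  also have "... = tr x" unfolding tr_def using xc by (intro finsum_cong') (auto simp: phi_pow)
  finally show ?thesis using none x by simp
 qed
 hence "card K <= ?D"
 proof -
  have "1:(%i. q ^ i) ` {..<n}" using assms(5) by (intro image_eqI[of _ _ 0]) auto
  hence "?c 1 ~= \<zero>" by simp
  moreover have "1 <= ?D" "?c:{..?D} -> <F>" using q_gt_1 by auto
  ultimately show ?thesis
   using few_roots[of ?c ?D 1 K] sub(2) \<open>!!x. x:K ==> (\<Oplus>j\<in>{..?D}. ?c j\<otimes> x [^] j) = \<zero>\<close> by blast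
 qed
 moreover have "?D < q ^ n" using assms(5) q_gt_1 by (intro power_strict_increasing) auto
 ultimately show False using assms(4) by simp
qed
then obtain x where x: "x:K" "tr x ~= \<zero>" by blast
have xc: "x:<F>" using x sub by blast
have trc: "tr x:<F>" using xc by (auto simp: tr_def)
interpret h: ring_hom_ring F F phi using phi_pow_hom[of 1] by (intro ring_hom_ringI2 ring_axioms) simp
have "phi (tr x) = (\<Oplus>i\<in>{..<n}. phi ((phi ^^ i) x))"
 unfolding tr_def using xc by (intro finsum_hom abelian_monoid_axioms) auto
also have "... = (\<Oplus>i\<in>{..<n}. (phi ^^ Suc i) x)" by simp
also have "... = (\<Oplus>i\<in>{..<n}. (phi ^^ i) x)"
proof -
 have n: "(phi ^^ n) x = x" using subfield_fixed[OF assms(1,2,4) xc assms(5)] x by blast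
 obtain m where m: "n = Suc m" using assms(5) gr0_implies_Suc by blast
 have "(\<Oplus>i\<in>{..m}. (phi ^^ Suc i) x) = (phi ^^ Suc m) x \<oplus> (\<Oplus>i\<in>{..<m}. (phi ^^ Suc i) x)"
  using xc by (intro add.finprod_Suc3) auto
 moreover have "(\<Oplus>i\<in>{..m}. (phi ^^ i) x) = (\<Oplus>i\<in>{..<m}. (phi ^^ Suc i) x) \<oplus> (phi ^^ 0) x"
 proof (cases m)
  case (Suc l)
  thus ?thesis using xc finsum_Suc2[of "%i. (phi ^^ i) x" l] by (simp add: lessThan_Suc_atMost)
 qed (use xc in simp)
 ultimately show ?thesis using n m xc by (simp add: lessThan_Suc_atMost a_comm del: funpow.simps)
qed
finally have "phi (tr x) = tr x" unfolding tr_def .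
hence trk: "tr x:k" using phi_fixed trc by blast
\<comment> \<open>The trace of x is fixed by \<open>phi\<close> and so lies in k; multiplication by
  its inverse commutes with all iterates of \<open>phi\<close>.\<close>
let ?u = "inv (tr x)"
have u: "?u:k" "?u\<otimes> tr x = \<one>" using subfield_m_inv[OF subfield_k] trk x(2) by auto
have uc: "?u:<F>" using u(1) subfieldE(3)[OF subfield_k] by blast
have "(phi ^^ i) (?u\<otimes> x) = ?u\<otimes> (phi ^^ i) x" for i
 using phi_pow_hom[of i] galois_phi[of i] u(1) uc xc by (auto simp: ring_hom_mult galois_group_def)
hence "(\<Oplus>i\<in>{..<n}. (phi ^^ i) (?u\<otimes> x)) = (\<Oplus>i\<in>{..<n}. ?u\<otimes> (phi ^^ i) x)" by simp
also have "... = ?u\<otimes> tr x"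
 using finsum_rdistr[of "{..<n}" ?u "%i. (phi ^^ i) x"] uc xc by (simp add: tr_def[of x, symmetric])
finally show ?thesis using that[of "?u\<otimes> x"] u x(1) assms(3) subringE(6)[OF sub(1), of ?u x] by auto
qed

text \<open>Enclose S in a finite field K with generator z. A nonzero polynomial over k of degree at
  most n has z as a root, hence also s z and the n distinct Frobenius conjugates of z. So s z is one
  of the conjugates, and agreement at z gives agreement on K.\<close>

lemma galois_eq_phi:
 assumes "s:galois_group F k" "finite S" "S <= <F>"
 obtains j where "!!x. x:S ==> s x = (phi ^^ j) x"
proof -
obtain K where K: "subfield K F" "finite K" "S <= K" "k <= K" using finite_subfield[OF assms(2,3)] by blast
obtain n where n: "n > 0" "card K = q ^ n" using card_subfield[OF K(1,2,4)] by blast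
obtain z where z: "z:K" "z ~= \<zero>" "!!j::nat. z [^] j = \<one> <-> (q ^ n - 1) dvd j"
 "!!x. x:K ==> x ~= \<zero> ==> EX i::nat. x = z [^] i" using subfield_generator[OF K(1,2) n(2,1)] by metis
have sub: "subring K F" "K <= <F>" "subring k F" "k <= <F>"
 using subfieldE[OF K(1)] subfieldE[OF subfield_k] by auto
have zc: "z:<F>" using z sub by blast
have zK: "z [^] (i::nat):K" for i by (induction i) (use z subringE[OF sub(1)] in auto)
\<comment> \<open>There are q^(n+1) coefficient vectors of length n + 1 but only q^n values in K, so
  two vectors agree at z; their difference is the polynomial sought.\<close>
let ?C = "{..n} \<rightarrow>\<^sub>E k"
define ev where "ev c y = (\<Oplus>j\<in>{..n}. c j\<otimes> y [^] j)" for c :: "nat => 'f" and y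
have fsK: "finsum F g {..m}:K" if "!!j. j <= m ==> g j:K" for g and m :: nat using that
proof (induction m)
 case (Suc m)
 have "finsum F g {..Suc m} = g (Suc m) \<oplus> finsum F g {..m}" using Suc.prems sub by (intro finsum_Suc) auto
 thus ?case using Suc subringE(7)[OF sub(1)] by simp
qed (use sub in auto)
have "ev c z:K" if "c:?C" for c unfolding ev_def using that K(4) zK subringE(6)[OF sub(1)] by (intro fsK) auto
hence "card (( %c. ev c z) ` ?C) <= q ^ n" using K(2) n(2) card_mono[of K "(%c. ev c z) ` ?C"] by auto
moreover have "card ?C = q ^ Suc n" by (simp add: card_PiE q_def)
moreover have "q ^ n < q ^ Suc n" using q_gt_1 by simp
ultimately have "~ inj_on (%c. ev c z) ?C" by (metis card_image linorder_not_less)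
then obtain c d where cd: "c:?C" "d:?C" "c ~= d" "ev c z = ev d z" unfolding inj_on_def by blast
then obtain i where i: "i <= n" "c i ~= d i" by (metis PiE_ext atMost_iff)
define e where "e j = c j \<ominus> d j" for j
have ek: "e j:k" if "j <= n" for j using cd that subringE(5,7)[OF sub(3)] by (auto simp: e_def a_minus_def PiE_iff)
have ec: "e:{..n} -> <F>" using ek sub(4) by auto
have ei: "e i ~= \<zero>" using i cd sub(4) by (auto simp: e_def PiE_iff subset_iff)
have "ev e z = ev c z \<ominus> ev d z"
proof -
 have cc: "c j:<F>" "d j:<F>" if "j <= n" for j using cd sub(4) that by auto
 have "ev e z \<oplus> ev d z = (\<Oplus>j\<in>{..n}. e j\<otimes> z [^] j \<oplus> d j\<otimes> z [^] j)"
  unfolding ev_def using cc zc ec by (intro finsum_addf[symmetric]) auto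
 also have "... = ev c z"
  unfolding ev_def using cc zc by (intro finsum_cong') (auto simp: e_def a_minus_def l_distr[symmetric] a_assoc l_neg)
 finally have "ev e z \<oplus> ev d z = ev c z" .
 moreover have "ev e z:<F>" "ev d z:<F>" unfolding ev_def using cc ec zc by (auto intro!: finsum_closed)
 ultimately show ?thesis by (metis add.inv_solve_right a_minus_def a_closed)
qed
moreover have "ev c z:<F>" using \<open>!!c. c:?C ==> ev c z:K\<close>[OF cd(1)] sub by blast
ultimately have ez: "ev e z = \<zero>" using cd(4) by simp
have conj: "ev e (\<tau> z) = \<zero>" if t: "\<tau>:galois_group F k" for \<tau>
proof -
 have th: "\<tau>:ring_hom F F" and tk: "!!x. x:k ==> \<tau> x = x"
  using t by (auto simp: galois_group_def ring_iso_def)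
 interpret h: ring_hom_ring F F \<tau> using th by (intro ring_hom_ringI2 ring_axioms)
 have "\<tau> (ev e z) = (\<Oplus>j\<in>{..n}. \<tau> (e j\<otimes> z [^] j))"
  unfolding ev_def using ec zc by (intro finsum_hom abelian_monoid_axioms) auto
 also have "... = ev e (\<tau> z)"
  unfolding ev_def using ec zc ek tk by (intro finsum_cong') (auto simp: Pi_iff h.hom_nat_pow)
 finally show ?thesis using ez by simp
qed
let ?Z = "(%i. (phi ^^ i) z) ` {..<n}"
have "inj_on (%i. (phi ^^ i) z) {..<n}" using generator_period(1)[OF zc z(2,3) n(1)] by (auto intro!: inj_onI)
hence cZ: "card ?Z = n" by (simp add: card_image)
have sz: "s z:<F>" using assms(1) zc by (auto simp: galois_group_def ring_iso_def ring_hom_closed)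
have "insert (s z) ?Z <= <F>" using sz zc by auto
hence "card (insert (s z) ?Z) <= n"
 using few_roots[OF ec i(1) ei, of "insert (s z) ?Z"] conj[OF assms(1)] conj[OF galois_phi] unfolding ev_def by auto
hence "s z:?Z" using cZ by (metis card_insert_disjoint finite_imageI finite_lessThan not_less_eq_eq order_refl)
then obtain j where j: "s z = (phi ^^ j) z" by blast
have "s x = (phi ^^ j) x" if xK: "x:K" for x
proof (cases "x = \<zero>")
 case True
 interpret h: ring_hom_ring F F "phi ^^ j" using phi_pow_hom by (intro ring_hom_ringI2 ring_axioms)
 interpret hs: ring_hom_ring F F s
  using assms(1) by (intro ring_hom_ringI2 ring_axioms) (auto simp: galois_group_def ring_iso_def)
 show ?thesis using True by simp
next
 case False
 then obtain i :: nat where i: "x = z [^] i" using z(4)[OF xK] by blast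
 interpret h: ring_hom_ring F F "phi ^^ j" using phi_pow_hom by (intro ring_hom_ringI2 ring_axioms)
 interpret hs: ring_hom_ring F F s
  using assms(1) by (intro ring_hom_ringI2 ring_axioms) (auto simp: galois_group_def ring_iso_def)
 show ?thesis using i j zc by (simp add: h.hom_nat_pow hs.hom_nat_pow)
qed
thus ?thesis using that K(3) by blast
qed
end

section \<open>Idempotents, Peirce components and nilpotent elements\<close>

context ring
begin

definition idem where "idem e <-> e:<R> & e\<otimes> e = e"

definition nilp where "nilp x <-> (EX n::nat. x [^] n = \<zero>)"

text \<open>For idempotents this is the Peirce component a R b.\<close>

definition corner where "corner a b = {x:<R>. a\<otimes> x = x & x\<otimes> b = x}"

definition prim where
 "prim a <-> idem a & a ~= \<zero> & (ALL e. idem e & e:corner a a --> e = \<zero> \<or> e = a)"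

text \<open>For idempotents this is isomorphism of the left ideals R a and R b: right
  multiplications by x and by y are mutually inverse.\<close>

definition idem_equiv where
 "idem_equiv a b <-> (EX x:corner a b. EX y:corner b a. x\<otimes> y = a & y\<otimes> x = b)"

definition orth_idems where
 "orth_idems I <-> finite I & (ALL e:I. idem e & e ~= \<zero>) & (ALL e:I. ALL f:I. e ~= f --> e\<otimes> f = \<zero>)"

lemma prim_idem: "prim a ==> idem a" "prim a ==> a ~= \<zero>" "prim a ==> a:<R>" "prim a ==> a\<otimes> a = a"
 by (auto simp: prim_def idem_def)

lemma cornerD: "x:corner a b ==> x:<R>" "x:corner a b ==> a\<otimes> x = x" "x:corner a b ==> x\<otimes> b = x"
 by (auto simp: corner_def)

lemma corner_mult:
 "[|a:<R>; c:<R>; x:corner a b; y:corner b' c|] ==> x\<otimes> y:corner a c"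
 by (auto simp: corner_def m_assoc[symmetric]) (auto simp: m_assoc)

lemma corner_sandwich:
 "[|idem a; idem b; x:<R>|] ==> a\<otimes> x\<otimes> b:corner a b"
 by (auto simp: corner_def idem_def m_assoc) (auto simp: m_assoc[symmetric])

lemma corner_add:
 "[|a:<R>; b:<R>; x:corner a b; y:corner a b|] ==> x \<oplus> y:corner a b"
 by (auto simp: corner_def r_distr l_distr)

lemma corner_neg:
 "[|a:<R>; b:<R>; x:corner a b|] ==> \<ominus> x:corner a b" by (auto simp: corner_def r_minus l_minus)

lemma corner_pow:
 "[|a:<R>; x:corner a a|] ==> n > 0 ==> x [^] (n::nat):corner a a"
proof (induction n)
case (Suc n)
show ?case
proof (cases "n = 0")
 case True
 thus ?thesis using Suc cornerD by simp
next
 case False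
 thus ?thesis using Suc corner_mult[of a a "x [^] n" a x a] by simp
qed
qed simp

lemma pow_unit:
 assumes "w:<R>" "x:<R>" "a:<R>" "w\<otimes> x = a" "a\<otimes> x = x" "a\<otimes> a = a"
 shows "w [^] Suc n\<otimes> x [^] Suc n = a"
proof (induction n)
case (Suc n)
have c: "w [^] Suc n:<R>" "x [^] Suc n:<R>" using assms by auto
have "w [^] Suc (Suc n)\<otimes> x [^] Suc (Suc n) = w [^] Suc n\<otimes> ((w\<otimes> x)\<otimes> x [^] Suc n)"
proof -
 have "x [^] Suc (Suc n) = x\<otimes> x [^] Suc n" using nat_pow_Suc2[OF assms(2), of "Suc n"] .
 moreover have "w [^] Suc (Suc n) = w [^] Suc n\<otimes> w" by simp
 ultimately show ?thesis using assms(1,2) by (simp add: m_assoc del: nat_pow_Suc)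
qed
also have "a\<otimes> x [^] Suc n = x [^] Suc n" using assms nat_pow_Suc2[of x n] by (simp add: m_assoc[symmetric])
hence "(w\<otimes> x)\<otimes> x [^] Suc n = x [^] Suc n" using assms(4) by simp
finally show ?case using Suc by simp
qed (use assms in simp)

lemma nilp_not_unit:
 assumes "idem a" "a ~= \<zero>" "x:corner a a" "w:<R>" "w\<otimes> x = a"
 shows "~ nilp x"
proof
assume "nilp x"
then obtain n :: nat where n: "x [^] n = \<zero>" by (auto simp: nilp_def)
have "x [^] Suc n = \<zero>" using n cornerD(1)[OF assms(3)] by simp
thus False using pow_unit[of w x a n] assms cornerD by (auto simp: idem_def)
qed
end

text \<open>Both properties hold for finite rings and for group algebras over the infinite field F;
  local corners and primitive decompositions are treated for both cases at once.\<close>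

locale pi_ring = ring R for R (structure) +
 assumes power_idem: "x:<R> ==> EX n::nat. n > 0 & idem (x [^] n)"
  and orth_bounded: "EX N. ALL I. orth_idems I --> card I <= N"
begin

text \<open>Some power of x is an idempotent of the corner, so by primitivity it is zero or a. In
  the second case the preceding power inverts x.\<close>

lemma prim_local:
 assumes "prim a" "x:corner a a"
 shows "nilp x \<or> (EX y:corner a a. x\<otimes> y = a & y\<otimes> x = a)"
proof -
note a = prim_idem[OF assms(1)] and x = cornerD[OF assms(2)]
obtain n :: nat where n: "n > 0" "idem (x [^] n)" using power_idem[OF x(1)] by blast
hence "x [^] n = \<zero> \<or> x [^] n = a" using corner_pow[OF a(3) assms(2)] assms(1) by (auto simp: prim_def)
moreover have "EX y:corner a a. x\<otimes> y = a & y\<otimes> x = a" if xa: "x [^] n = a"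
proof -
 obtain m where m: "n = Suc m" using n gr0_implies_Suc by blast
 have "x\<otimes> x [^] m = a" "x [^] m\<otimes> x = a" using xa x(1) m nat_pow_Suc2[of x m] by auto
 \<comment> \<open>Cutting down by a matters for m = 0, when the power is the one of the whole ring
   and not of the corner.\<close>
 moreover have "a\<otimes> x [^] m\<otimes> a:corner a a" using corner_sandwich a(1) x(1) by simp
 moreover have "x\<otimes> (a\<otimes> x [^] m\<otimes> a) = x\<otimes> x [^] m\<otimes> a" "(a\<otimes> x [^] m\<otimes> a)\<otimes> x = a\<otimes> (x [^] m\<otimes> x)"
  using a x by (simp_all add: m_assoc[symmetric]) (simp_all add: m_assoc)
 ultimately show ?thesis using a(4) by auto
qed
ultimately show ?thesis by (auto simp: nilp_def)
qed

lemma nilp_mult: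
 assumes "prim a" "x:corner a a" "u:corner a a" "nilp x"
 shows "nilp (u\<otimes> x)"
proof (rule ccontr)
note a = prim_idem[OF assms(1)]
assume "~ nilp (u\<otimes> x)"
then obtain y where "y:corner a a" "y\<otimes> (u\<otimes> x) = a"
 using prim_local[OF assms(1)] corner_mult[OF a(3) a(3) assms(3,2)] by blast
hence "y\<otimes> u:<R>" "(y\<otimes> u)\<otimes> x = a" using cornerD assms by (auto simp: m_assoc)
thus False using nilp_not_unit a assms by blast
qed

text \<open>Otherwise some u makes u x and u y nilpotent elements with sum a. A vector killed by u y
  is then fixed by u x, which is impossible for a nilpotent element.\<close>

lemma nilp_add:
 assumes "prim a" "x:corner a a" "y:corner a a" "nilp x" "nilp y"
 shows "nilp (x \<oplus> y)"
proof (rule ccontr)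
note a = prim_idem[OF assms(1)]
assume "~ nilp (x \<oplus> y)"
then obtain u where u: "u:corner a a" "u\<otimes> (x \<oplus> y) = a"
 using prim_local[OF assms(1)] corner_add[OF a(3) a(3) assms(2,3)] by blast
let ?m = "u\<otimes> x" and ?n = "u\<otimes> y"
have c: "?m:corner a a" "?n:corner a a" using corner_mult a u assms by auto
have s: "?m \<oplus> ?n = a" using u cornerD assms by (auto simp: r_distr)
have nil: "nilp ?m" "nilp ?n" using nilp_mult assms u by auto
\<comment> \<open>The last nonzero \<open>z l\<close> in this sequence is killed by
  \<open>?n\<close>, hence fixed by \<open>?m\<close>, as the two sum to a.\<close>
define z where "z k = ?n [^] k\<otimes> a" for k :: nat
have zc: "z k:<R>" for k using cornerD(1)[OF c(2)] a by (simp add: z_def)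
have "EX k. z k = \<zero>" using nil(2) a by (metis z_def nilp_def l_null)
then obtain k where k: "z k = \<zero>" "!!l. l < k ==> z l ~= \<zero>"
 using exists_least_iff[of "%k. z k = \<zero>"] by blast
have "z 0 ~= \<zero>" using a by (simp add: z_def)
then obtain l where l: "k = Suc l" using k by (cases k) auto
have "?n\<otimes> z l = \<zero>"
 using k(1) l cornerD(1)[OF c(2)] a nat_pow_Suc2[of ?n l] by (simp add: z_def m_assoc[symmetric])
moreover have "a\<otimes> z l = z l"
proof (cases l)
 case (Suc l')
 hence "?n [^] l:corner a a" using corner_pow[OF a(3) c(2), of l] by blast
 thus ?thesis using cornerD by (auto simp: z_def)
qed (use a in \<open>auto simp: z_def\<close>)
moreover have "a\<otimes> z l = ?m\<otimes> z l \<oplus> ?n\<otimes> z l"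
 using s zc cornerD(1)[OF c(1)] cornerD(1)[OF c(2)] by (metis l_distr)
ultimately have mz: "?m\<otimes> z l = z l" using zc cornerD(1)[OF c(1)] by simp
have "?m [^] i\<otimes> z l = z l" for i :: nat
 by (induction i) (use mz zc cornerD(1)[OF c(1)] in \<open>auto simp: m_assoc\<close>)
moreover obtain i :: nat where "?m [^] i = \<zero>" using nil(1) by (auto simp: nilp_def)
ultimately have "z l = \<zero>" using zc by (metis l_null)
thus False using k(2) l by simp
qed

text \<open>If u inverts x y in the local corner of a, then y (u x) is a nonzero idempotent in the
  corner of b, so it equals b, and u x and y realize the equivalence.\<close>

lemma idem_equivI:
 assumes "prim a" "prim b" "x:corner a b" "y:corner b a" "~ nilp (x\<otimes> y)"
 shows "idem_equiv a b"
proof -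
note a = prim_idem[OF assms(1)] and b = prim_idem[OF assms(2)]
have xy: "x\<otimes> y:corner a a" using corner_mult a assms by blast
then obtain u where u: "u:corner a a" "u\<otimes> (x\<otimes> y) = a"
 using prim_local[OF assms(1)] assms(5) by blast
note c = cornerD[OF u(1)] cornerD[OF assms(3)] cornerD[OF assms(4)]
have ux: "u\<otimes> x:corner a b" using corner_mult a b u assms by blast
have uxy: "(u\<otimes> x)\<otimes> y = a" using u c by (simp add: m_assoc)
let ?e = "y\<otimes> (u\<otimes> x)"
have ec: "?e:corner b b" using corner_mult b assms ux by blast
have "?e\<otimes> ?e = y\<otimes> (((u\<otimes> x)\<otimes> y)\<otimes> (u\<otimes> x))"
 using c by (simp add: m_assoc)
also have "... = ?e" using uxy cornerD(2)[OF ux] by simp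
finally have "idem ?e" using ec cornerD(1) by (simp add: idem_def)
hence "?e = \<zero> \<or> ?e = b" using assms(2) ec by (auto simp: prim_def)
moreover have "?e ~= \<zero>"
proof
 assume e0: "?e = \<zero>"
 have "a = a\<otimes> a" using a by simp
 also have "... = (u\<otimes> x)\<otimes> (?e\<otimes> y)" using c uxy by (metis m_assoc m_closed)
 also have "... = \<zero>" using e0 c by simp
 finally show False using a by simp
qed
ultimately show ?thesis using ux assms(4) uxy unfolding idem_equiv_def by blast
qed

text \<open>Finite by \<open>orth_bounded\<close>, this is the measure by which splitting off
  idempotents terminates.\<close>

definition idem_size where
 "idem_size e = Max {card I | I. orth_idems I & I <= corner e e}"

lemma idem_size_bound:
 "finite {card I | I. orth_idems I & I <= corner e e}" "{card I | I. orth_idems I & I <= corner e e} ~= {}"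
proof -
obtain N where "!!I. orth_idems I ==> card I <= N" using orth_bounded by blast
hence "{card I | I. orth_idems I & I <= corner e e} <= {..N}" by auto
thus "finite {card I | I. orth_idems I & I <= corner e e}" using finite_subset by blast
have "orth_idems {}" by (simp add: orth_idems_def)
thus "{card I | I. orth_idems I & I <= corner e e} ~= {}" by blast
qed

text \<open>A largest orthogonal family below f stays orthogonal when e - f is added, so the measure
  of e exceeds that of f.\<close>

lemma idem_size_split:
 assumes "idem e" "idem f" "f:corner e e" "f ~= \<zero>" "f ~= e"
 shows "idem_size f < idem_size e" "idem (e \<ominus> f)" "e \<ominus> f:corner e e" "f\<otimes> (e \<ominus> f) = \<zero>" "(e \<ominus> f)\<otimes> f = \<zero>"
proof -
have c: "e:<R>" "f:<R>" "e\<otimes> e = e" "f\<otimes> f = f" "e\<otimes> f = f" "f\<otimes> e = f"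
 using assms cornerD by (auto simp: idem_def)
let ?g = "e \<ominus> f"
have gc: "?g:<R>" using c by simp
show fg: "f\<otimes> ?g = \<zero>" "?g\<otimes> f = \<zero>"
 using c by (simp_all add: a_minus_def r_distr l_distr r_minus l_minus r_neg)
have eg: "e\<otimes> ?g = ?g" "?g\<otimes> e = ?g"
 using c by (simp_all add: a_minus_def r_distr l_distr r_minus l_minus)
have "?g\<otimes> ?g = ?g\<otimes> e \<ominus> ?g\<otimes> f" using c by (simp add: a_minus_def r_distr r_minus)
thus g: "idem ?g" using eg fg gc by (simp add: idem_def a_minus_def)
show gcorn: "?g:corner e e" using eg gc by (simp add: corner_def)
have g0: "?g ~= \<zero>" using assms(5) c by simp
have "idem_size f:{card I | I. orth_idems I & I <= corner f f}"
 unfolding idem_size_def using Max_in[OF idem_size_bound] .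
then obtain I where I: "idem_size f = card I" "orth_idems I" "I <= corner f f" by blast
have ig: "i\<otimes> ?g = \<zero>" "?g\<otimes> i = \<zero>" "e\<otimes> i = i" "i\<otimes> e = i" "i:<R>" if "i:I" for i
proof -
 have i: "i:<R>" "f\<otimes> i = i" "i\<otimes> f = i" using that I(3) cornerD by blast+
 show "i:<R>" using i by simp
 show "i\<otimes> ?g = \<zero>" using i fg c gc by (metis m_assoc r_null)
 show "?g\<otimes> i = \<zero>" using i fg c gc by (metis m_assoc l_null)
 show "e\<otimes> i = i" using i c by (metis m_assoc)
 show "i\<otimes> e = i" using i c by (metis m_assoc)
qed
have "?g \<notin> I" using ig(1) g g0 by (auto simp: idem_def)
moreover have "orth_idems (insert ?g I)" using I(2) g g0 ig by (auto simp: orth_idems_def)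
moreover have "insert ?g I <= corner e e" using gcorn ig by (auto simp: corner_def)
moreover have "finite I" using I(2) by (simp add: orth_idems_def)
ultimately have "Suc (card I):{card I | I. orth_idems I & I <= corner e e}"
 by (metis (mono_tags, lifting) card_insert_disjoint mem_Collect_eq)
hence "Suc (card I) <= idem_size e" unfolding idem_size_def using Max_ge[OF idem_size_bound(1)] by blast
thus "idem_size f < idem_size e" using I by simp
qed

lemma prim_decomposition:
 assumes "idem e"
 shows "EX I. finite I & (ALL i:I. prim i & i:corner e e) & (ALL i:I. ALL j:I. i ~= j --> i\<otimes> j = \<zero>)
  & e = (\<Oplus>i\<in>I. i)" using assms
proof (induction "idem_size e" arbitrary: e rule: less_induct)
case less
have ec: "e:<R>" "e\<otimes> e = e" using less.prems by (auto simp: idem_def)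
consider "e = \<zero>" | "prim e" | f where "idem f" "f:corner e e" "f ~= \<zero>" "f ~= e"
 using less.prems by (auto simp: prim_def)
thus ?case
proof cases
 case 1
 thus ?thesis by (intro exI[of _ "{}"]) auto
next
 case 2
 thus ?thesis using ec by (intro exI[of _ "{e}"]) (auto simp: corner_def)
next
 case (3 f)
 let ?g = "e \<ominus> f"
 note sf = idem_size_split[OF less.prems 3]
 have fc: "f:<R>" "e\<otimes> f = f" "f\<otimes> e = f" using cornerD[OF 3(2)] by auto
 have gc: "?g:<R>" using ec fc by simp
 have "?g ~= \<zero>" "?g ~= e"
 proof -
  show "?g ~= \<zero>" using 3 ec fc by simp
  show "?g ~= e"
  proof
   assume "?g = e"
   hence "f\<otimes> e = \<zero>" using sf(4) by simp
   thus False using fc 3(3) by simp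
  qed
 qed
 hence sg: "idem_size ?g < idem_size e" using idem_size_split(1)[OF less.prems sf(2,3)] by simp
 obtain I where I: "finite I" "ALL i:I. prim i & i:corner f f" "ALL i:I. ALL j:I. i ~= j --> i\<otimes> j = \<zero>"
  "f = (\<Oplus>i\<in>I. i)" using less.hyps[OF sf(1) 3(1)] by blast
 obtain J where J: "finite J" "ALL i:J. prim i & i:corner ?g ?g" "ALL i:J. ALL j:J. i ~= j --> i\<otimes> j = \<zero>"
  "?g = (\<Oplus>i\<in>J. i)" using less.hyps[OF sg sf(2)] by blast
 have c: "i:<R>" "f\<otimes> i = i" "i\<otimes> f = i" if "i:I" for i using I(2) that cornerD by blast+
 have d: "j:<R>" "?g\<otimes> j = j" "j\<otimes> ?g = j" if "j:J" for j using J(2) that cornerD by blast+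
 have ij: "i\<otimes> j = \<zero>" "j\<otimes> i = \<zero>" if "i:I" "j:J" for i j
 proof -
  have "i\<otimes> j = i\<otimes> ((f\<otimes> ?g)\<otimes> j)"
   using c[OF that(1)] d[OF that(2)] fc gc by (metis m_assoc)
  thus "i\<otimes> j = \<zero>" using sf(4) c[OF that(1)] d[OF that(2)] by simp
  have "j\<otimes> i = j\<otimes> ((?g\<otimes> f)\<otimes> i)"
   using c[OF that(1)] d[OF that(2)] fc gc by (metis m_assoc)
  thus "j\<otimes> i = \<zero>" using sf(5) c[OF that(1)] d[OF that(2)] by simp
 qed
 have disj: "I \<inter> J = {}" using ij(1) I(2) by (auto simp: prim_def idem_def)
 have "e = f \<oplus> ?g" using ec fc by (metis a_comm a_minus_def add.inv_closed add.m_assoc l_neg r_zero)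
 also have "... = (\<Oplus>i\<in>I \<union> J. i)"
  using I(4) J(4) c d disj I(1) J(1) by (metis (no_types, lifting) Pi_I finsum_Un_disjoint)
 finally have "e = (\<Oplus>i\<in>I \<union> J. i)" .
 moreover have "i:corner e e" if "i:I" for i using c[OF that] fc ec by (auto simp: corner_def) (metis m_assoc)+
 moreover have "j:corner e e" if "j:J" for j
  using d[OF that] cornerD[OF sf(3)] ec by (auto simp: corner_def) (metis m_assoc)+
 ultimately show ?thesis using I J ij by (intro exI[of _ "I \<union> J"]) auto
qed
qed

lemma prim_below:
 assumes "idem e" "e ~= \<zero>"
 obtains a where "prim a" "a:corner e e"
proof -
obtain I where I: "ALL i:I. prim i & i:corner e e" "e = (\<Oplus>i\<in>I. i)"
 using prim_decomposition[OF assms(1)] by blast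
hence "I ~= {}" using assms(2) by auto
thus ?thesis using that I(1) by blast
qed
end

context ring
begin

lemma finite_power_idem:
 assumes x: "x:<R>" and fin: "finite (range (%n::nat. x [^] n))"
 shows "EX n::nat. n > 0 & idem (x [^] n)"
proof -
have "~ inj (%n::nat. x [^] n)" using fin finite_imageD by blast
then obtain i j :: nat where ij: "i < j" "x [^] i = x [^] j" unfolding inj_def by (metis linorder_neqE_nat)
let ?d = "j - i"
have step: "x [^] (l + m * ?d) = x [^] l" if "l >= i" for l m
proof (induction m)
 case (Suc m)
 have "l + Suc m * ?d = (l - i + m * ?d) + j" "l + m * ?d = (l - i + m * ?d) + i" using ij that by auto
 hence "x [^] (l + Suc m * ?d) = x [^] (l - i + m * ?d)\<otimes> x [^] j"
  "x [^] (l + m * ?d) = x [^] (l - i + m * ?d)\<otimes> x [^] i" using nat_pow_mult[OF x] by metis+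
 hence "x [^] (l + Suc m * ?d) = x [^] (l + m * ?d)" using ij(2) by simp
 thus ?case using Suc by simp
qed simp
\<comment> \<open>A positive multiple of the period \<open>?d\<close> that is at least i, so the
  exponent n + n reduces to n.\<close>
define n where "n = Suc i * ?d"
have "?d >= 1" using ij by simp
hence "n >= Suc i" unfolding n_def by (metis mult.right_neutral mult_le_mono2)
hence n: "n >= i" "n > 0" by auto
have "x [^] n\<otimes> x [^] n = x [^] (n + Suc i * ?d)" using nat_pow_mult[OF x] n_def by simp
hence "x [^] n\<otimes> x [^] n = x [^] n" using step[of n "Suc i"] n by simp
thus ?thesis using n x by (auto simp: idem_def)
qed
end

locale finite_ring = ring R for R (structure) +
 assumes finite_carrier: "finite <R>"
begin

sublocale pi_ring
proof
show "EX n::nat. n > 0 & idem (x [^] n)" if "x:<R>" for x using finite_power_idem[OF that] finite_carrier that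
 by (meson finite_subset image_subsetI nat_pow_closed)
show "EX N. ALL I. orth_idems I --> card I <= N" using finite_carrier card_mono[of "<R>"]
 by (intro exI[of _ "card <R>"]) (auto simp: orth_idems_def idem_def subset_iff)
qed

text \<open>In a finite ring two members of the sequence coincide, which gives v = v s with s in S.
  Then v = v s^n for all n, and s is nilpotent. This replaces nilpotency of the radical.\<close>

lemma nil_chain_zero:
 assumes S: "!!s. s:S ==> s:<R> & nilp s" "!!s t. s:S ==> t:S ==> s\<otimes> t:S"
  and v: "!!n. v n:<R>" "!!n. EX s:S. v (Suc n) = v n\<otimes> s"
 shows "EX n::nat. v n = \<zero>"
proof -
have "~ inj v" using finite_carrier v(1) by (metis finite_imageD finite_subset image_subsetI infinite_UNIV_nat)
then obtain i j :: nat where ij: "i < j" "v i = v j" unfolding inj_def by (metis linorder_neqE_nat)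
have steps: "EX s:S. v (i + Suc m) = v i\<otimes> s" for m
proof (induction m)
 case (Suc m)
 then obtain s where s: "s:S" "v (i + Suc m) = v i\<otimes> s" by blast
 obtain t where t: "t:S" "v (i + Suc (Suc m)) = v (i + Suc m)\<otimes> t" using v(2)[of "i + Suc m"] by auto
 have "v (i + Suc (Suc m)) = v i\<otimes> (s\<otimes> t)" using s t S(1) v(1) by (simp add: m_assoc)
 thus ?case using S(2) s t by blast
qed (use v(2)[of i] in simp)
then obtain s where s: "s:S" "v i = v i\<otimes> s" using ij steps[of "j - i - 1"] by auto
have "v i = v i\<otimes> s [^] n" for n :: nat
 by (induction n) (use s S(1) v(1) in \<open>auto simp: m_assoc[symmetric]\<close>)
thus ?thesis using S(1)[OF s(1)] v(1) by (metis nilp_def r_null)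
qed

text \<open>If a and b are not equivalent, every product of an element of a R b with one of b R a is
  nilpotent. Primeness of P keeps a sequence of right multiples of a by such products outside P for
  ever, against \<open>nil_chain_zero\<close>.\<close>

lemma prime_ideal_prim_equiv:
 assumes P: "\<zero>:P" "!!x y. x:<R> ==> y:<R> ==> (!!r. r:<R> ==> x\<otimes> r\<otimes> y:P) ==> x:P \<or> y:P"
  and ab: "prim a" "prim b" "a \<notin> P" "b \<notin> P"
 shows "idem_equiv a b"
proof (rule ccontr)
note a = prim_idem[OF ab(1)] and b = prim_idem[OF ab(2)]
assume no: "~ idem_equiv a b"
define S where "S = {x\<otimes> y | x y. x:corner a b & y:corner b a}"
have nil: "nilp s" if "s:S" for s using that no idem_equivI[OF ab(1,2)] by (auto simp: S_def)
have Sc: "s:<R>" if "s:S" for s using that cornerD(1) by (auto simp: S_def)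
have Sm: "s\<otimes> t:S" if "s:S" "t:S" for s t
proof -
 obtain x y x' y' where xy: "x:corner a b" "y:corner b a" "s = x\<otimes> y"
  "x':corner a b" "y':corner b a" "t = x'\<otimes> y'" using \<open>s:S\<close> \<open>t:S\<close> by (auto simp: S_def)
 hence "s\<otimes> t = (x\<otimes> y\<otimes> x')\<otimes> y'" using cornerD(1) by (simp add: m_assoc)
 moreover have "x\<otimes> y\<otimes> x':corner a b" using xy corner_mult a b by meson
 ultimately show ?thesis using xy by (auto simp: S_def)
qed
\<comment> \<open>Primeness is applied twice, to reach b and to return to a; each round multiplies v
  by an element of S.\<close>
have step: "EX w. (w:<R> & w\<otimes> a = w & w \<notin> P) & (EX s:S. w = v\<otimes> s)"
 if v: "v:<R> & v\<otimes> a = v & v \<notin> P" for v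
proof -
 obtain r where r: "r:<R>" "v\<otimes> r\<otimes> b \<notin> P" using P(2)[of v b] v b ab(4) by blast
 then obtain t where t: "t:<R>" "(v\<otimes> r\<otimes> b)\<otimes> t\<otimes> a \<notin> P"
  using P(2)[of "v\<otimes> r\<otimes> b" a] v a b ab(3) by blast
 let ?s = "(a\<otimes> r\<otimes> b)\<otimes> (b\<otimes> t\<otimes> a)"
 have "?s:S" unfolding S_def using corner_sandwich[OF a(1) b(1) r(1)] corner_sandwich[OF b(1) a(1) t(1)] by blast
 moreover have "v\<otimes> ?s = (v\<otimes> a)\<otimes> r\<otimes> (b\<otimes> b)\<otimes> t\<otimes> a"
 proof -
  have "v:<R>" using v by simp
  thus ?thesis using a(3) b(3) r(1) t(1) by (simp add: m_assoc)
 qed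
 hence "v\<otimes> ?s = (v\<otimes> r\<otimes> b)\<otimes> t\<otimes> a" using v b(4) by simp
 moreover have "((v\<otimes> r\<otimes> b)\<otimes> t\<otimes> a)\<otimes> a = (v\<otimes> r\<otimes> b)\<otimes> t\<otimes> a"
  using v a b r t by (simp add: m_assoc)
 ultimately show ?thesis using t v a b r by (intro exI[of _ "v\<otimes> ?s"] conjI bexI[of _ ?s]) auto
qed
obtain v where v: "!!n. v n:<R> & v n\<otimes> a = v n & v n \<notin> P" "!!n. EX s:S. v (Suc n) = v n\<otimes> s"
 using dependent_nat_choice[of "%_ w. w:<R> & w\<otimes> a = w & w \<notin> P" "%_ v w. EX s:S. w = v\<otimes> s"] a ab(3) step by blast
hence "EX n. v n = \<zero>" using nil_chain_zero[of S v] nil Sc Sm by blast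
thus False using v(1) P(1) by metis
qed
end

section \<open>Submodules and simple modules\<close>

context left_module
begin

lemma lsmult_l_null [simp]: "x:<M> ==> \<zero>.A\<odot>.M x = \<zero>.M"
 using lsmult_l_distr[of "\<zero>.A" "\<zero>.A" x] lsmult_closed[of "\<zero>.A" x] by auto

lemma lsmult_r_null [simp]: "a:<A> ==> a\<odot>.M \<zero>.M = \<zero>.M"
 using lsmult_r_distr[of a "\<zero>.M" "\<zero>.M"] lsmult_closed[of a "\<zero>.M"] by auto

lemma lsmult_l_minus:
 "[|a:<A>; x:<M>|] ==> (\<ominus>.A a)\<odot>.M x = \<ominus>.M (a\<odot>.M x)"
 using lsmult_l_distr[of "\<ominus>.A a" a x] lsmult_closed M.add.inv_equality[of "(\<ominus>.A a)\<odot>.M x" "a\<odot>.M x"]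
 by (auto simp: A.l_neg)

lemma lsmult_r_minus:
 "[|a:<A>; x:<M>|] ==> a\<odot>.M (\<ominus>.M x) = \<ominus>.M (a\<odot>.M x)"
 using lsmult_r_distr[of a "\<ominus>.M x" x] lsmult_closed M.add.inv_equality[of "a\<odot>.M (\<ominus>.M x)" "a\<odot>.M x"]
 by (auto simp: M.l_neg)

lemma lsmult_finsum_l:
 assumes "f:I -> <A>" "x:<M>"
 shows "finsum A f I\<odot>.M x = (\<Oplus>.M i\<in>I. f i\<odot>.M x)" using assms lsmult_closed lsmult_l_distr
 by (intro finsum_hom A.abelian_monoid_axioms M.abelian_monoid_axioms) auto

lemma lsmult_finsum_r:
 assumes "f:I -> <M>" "a:<A>"
 shows "a\<odot>.M finsum M f I = (\<Oplus>.M i\<in>I. a\<odot>.M f i)" using assms lsmult_closed lsmult_r_distr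
 by (intro finsum_hom[where f = "%x. a\<odot>.M x"] M.abelian_monoid_axioms) auto

lemma submodule_intro:
 assumes "U <= <M>" "\<zero>.M:U" "!!x y. x:U ==> y:U ==> x \<oplus>.M y:U"
  "!!a x. a:<A> ==> x:U ==> a\<odot>.M x:U"
 shows "submodule U A M"
proof -
have "\<ominus>.M x:U" if "x:U" for x
 using assms(4)[of "\<ominus>.A \<one>.A" x] that assms(1) lsmult_l_minus[of "\<one>.A" x] lsmult_one by auto
thus ?thesis using assms by (intro submodule.intro submodule_axioms.intro M.add.subgroupI) auto
qed

lemma submoduleD:
 assumes "submodule U A M"
 shows "U <= <M>" "\<zero>.M:U" "!!x y. x:U ==> y:U ==> x \<oplus>.M y:U"
  "!!a x. a:<A> ==> x:U ==> a\<odot>.M x:U" "!!x. x:U ==> \<ominus>.M x:U"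
 using submodule.axioms(1)[OF assms, THEN subgroup.subset] submodule.axioms(1)[OF assms, THEN subgroup.one_closed] submodule.axioms(1)[OF assms, THEN subgroup.m_closed] submodule.smult_closed[OF assms] submodule.axioms(1)[OF assms, THEN subgroup.m_inv_closed]
 by (auto simp: a_inv_def)

lemma lm_submod:
 assumes "submodule U A M"
 shows "left_module A (M(|carrier := U|))"
proof -
note U = submoduleD[OF assms]
have "abelian_group (M(|carrier := U|))"
proof (rule abelian_groupI)
 fix x assume "x:carrier (M(|carrier := U|))"
 thus "EX y:carrier (M(|carrier := U|)). y \<oplus>.(M(|carrier := U|)) x = \<zero>.(M(|carrier := U|))"
  using U by (intro bexI[of _ "\<ominus>.M x"]) (auto simp: M.l_neg)
qed (use U in \<open>auto simp: M.a_assoc subset_iff intro: M.a_comm\<close>)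
thus ?thesis using U A.ring_axioms
 by (auto simp: left_module_def left_module_axioms_def subset_iff lsmult_l_distr lsmult_r_distr lsmult_assoc lsmult_one)
qed

lemma cyclic_submodule:
 assumes "v:<M>"
 shows "submodule ((%a. a\<odot>.M v) ` <A>) A M"
proof (rule submodule_intro)
show "\<zero>.M:(%a. a\<odot>.M v) ` <A>" using assms by (intro image_eqI[of _ _ "\<zero>.A"]) auto
fix x y assume "x:(%a. a\<odot>.M v) ` <A>" "y:(%a. a\<odot>.M v) ` <A>"
then obtain a b where "a:<A>" "b:<A>" "x = a\<odot>.M v" "y = b\<odot>.M v" by blast
thus "x \<oplus>.M y:(%a. a\<odot>.M v) ` <A>"
 using assms by (intro image_eqI[of _ _ "a \<oplus>.A b"]) (auto simp: lsmult_l_distr)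
next
fix c x assume "c:<A>" "x:(%a. a\<odot>.M v) ` <A>"
then obtain a where "a:<A>" "x = a\<odot>.M v" by blast
thus "c\<odot>.M x:(%a. a\<odot>.M v) ` <A>"
 using assms \<open>c:<A>\<close> by (intro image_eqI[of _ _ "c\<otimes>.A a"]) (auto simp: lsmult_assoc)
qed (use assms lsmult_closed in auto)

lemma simple_cyclic:
 assumes "simple_module A M" "v:<M>" "v ~= \<zero>.M" "w:<M>"
 obtains a where "a:<A>" "a\<odot>.M v = w"
proof -
define Y where "Y = (%a. a\<odot>.M v) ` <A>"
have "v:Y" unfolding Y_def using lsmult_one[OF assms(2)] by (intro image_eqI[of _ _ "\<one>.A"]) auto
moreover have "submodule Y A M" unfolding Y_def using cyclic_submodule[OF assms(2)] .
hence "Y = {\<zero>.M} \<or> Y = <M>" using assms(1) unfolding simple_module_def by simp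
ultimately have "w:Y" using assms(3,4) by auto
thus ?thesis using that unfolding Y_def by blast
qed
end

section \<open>Bases, coordinates and traces\<close>

locale vector_space = K?: field K + left_module K V for K (structure) and V
begin

abbreviation lin_comb where "lin_comb B a \<equiv> (\<Oplus>.V v\<in>B. a v\<odot>.V v)"

lemma lin_comb_closed: "B <= <V> ==> a:B -> <K> ==> lin_comb B a:<V>"
 using lsmult_closed by (intro M.finsum_closed) auto

lemma lin_comb_add:
 assumes "B <= <V>" "a:B -> <K>" "b:B -> <K>"
 shows "lin_comb B (%v. a v \<oplus> b v) = lin_comb B a \<oplus>.V lin_comb B b"
proof -
have "lin_comb B (%v. a v \<oplus> b v) = (\<Oplus>.V v\<in>B. a v\<odot>.V v \<oplus>.V b v\<odot>.V v)"
 using assms lsmult_closed by (intro M.finsum_cong') (auto simp: Pi_iff lsmult_l_distr)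
also have "... = lin_comb B a \<oplus>.V lin_comb B b"
 using assms lsmult_closed by (intro M.finsum_addf) (auto simp: Pi_iff)
finally show ?thesis .
qed

lemma lin_comb_smult:
 assumes "B <= <V>" "a:B -> <K>" "c:<K>"
 shows "lin_comb B (%v. c\<otimes> a v) = c\<odot>.V lin_comb B a"
proof -
have "c\<odot>.V lin_comb B a = (\<Oplus>.V v\<in>B. c\<odot>.V (a v\<odot>.V v))"
 using assms lsmult_closed by (intro lsmult_finsum_r) auto
also have "... = lin_comb B (%v. c\<otimes> a v)"
 using assms lsmult_closed by (intro M.finsum_cong') (auto simp: Pi_iff lsmult_assoc)
finally show ?thesis by simp
qed

lemma lin_comb_restrict: "B <= <V> ==> a:B -> <K> ==> lin_comb B (restrict a B) = lin_comb B a"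
 using lsmult_closed by (intro M.finsum_cong') auto

text \<open>If some vector has two expressions in S, their difference is a relation with a nonzero
  coefficient at some w, which expresses w through the rest; so S can be shrunk.\<close>

lemma exists_fin_basis:
 assumes "finite S" "S <= <V>" "!!x. x:<V> ==> EX a:S -> <K>. x = lin_comb S a"
 shows "EX B<=S. fin_basis K V B" using assms
proof (induction "card S" arbitrary: S rule: less_induct)
case less
show ?case
proof (cases "fin_basis K V S")
 case False
 have ex: "EX a. a:S \<rightarrow>\<^sub>E <K> & x = lin_comb S a" if x: "x:<V>" for x
 proof -
  obtain a where "a:S -> <K>" "x = lin_comb S a" using less.prems(3)[OF x] by blast
  thus ?thesis using lin_comb_restrict[OF less.prems(2)] by (intro exI[of _ "restrict a S"]) auto
 qed
 have "EX x:<V>. ~ (EX! a. a:S \<rightarrow>\<^sub>E <K> & x = lin_comb S a)"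
  using False less.prems(1,2) unfolding fin_basis_def by simp
 then obtain x where x: "x:<V>" "~ (EX! a. a:S \<rightarrow>\<^sub>E <K> & x = lin_comb S a)" by blast
 obtain a where a: "a:S \<rightarrow>\<^sub>E <K>" "x = lin_comb S a" using ex[OF x(1)] by blast
 have "EX a'. a':S \<rightarrow>\<^sub>E <K> & x = lin_comb S a' & a ~= a'"
 proof (rule ccontr)
  assume "~ ?thesis"
  hence "EX! a. a:S \<rightarrow>\<^sub>E <K> & x = lin_comb S a" using a by (intro ex1I[of _ a]) (blast, metis)
  thus False using x(2) by simp
 qed
 then obtain a' where aa: "x:<V>" "a:S \<rightarrow>\<^sub>E <K>" "a':S \<rightarrow>\<^sub>E <K>"
  "x = lin_comb S a" "x = lin_comb S a'" "a ~= a'" using x(1) a by auto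
 then obtain w where w: "w:S" "a w ~= a' w" by (meson PiE_ext)
 have S: "v:<V>" "a v:<K>" "a' v:<K>" if "v:S" for v using that less.prems(2) aa(2,3) by auto
 define d where "d v = a v \<ominus> a' v" for v
 have dc: "d v:<K>" if "v:S" for v using S[OF that] by (simp add: d_def)
 have d0: "d w ~= \<zero>" "d w:<K>" using w S[OF w(1)] by (auto simp: d_def)
 have i: "inv (d w):<K>" "inv (d w)\<otimes> d w = \<one>" using d0 by (auto simp: field_Units)
 have S': "finite (S - {w})" "S - {w} <= <V>" "insert w (S - {w}) = S" using w less.prems by auto
 have split: "lin_comb S c = c w\<odot>.V w \<oplus>.V lin_comb (S - {w}) c" if "c:S -> <K>" for c
  using M.finsum_insert[of "S - {w}" w "%v. c v\<odot>.V v"] that S' S w lsmult_closed by (auto simp: Pi_iff)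
 have "lin_comb S d \<oplus>.V lin_comb S a' = lin_comb S (%v. d v \<oplus> a' v)"
  using dc S by (intro lin_comb_add[symmetric]) auto
 also have "... = lin_comb S a"
  using S lsmult_closed by (intro M.finsum_cong') (auto simp: d_def a_minus_def K.a_assoc K.l_neg)
 finally have "lin_comb S d = \<zero>.V"
 proof -
  assume e: "lin_comb S d \<oplus>.V lin_comb S a' = lin_comb S a"
  have "lin_comb S d:<V>" using lin_comb_closed[OF less.prems(2), of d] dc by auto
  thus ?thesis using e M.add.r_cancel_one[of x "lin_comb S d"] unfolding aa(4)[symmetric] aa(5)[symmetric] using aa(1) by simp
 qed
 hence rel: "d w\<odot>.V w \<oplus>.V lin_comb (S - {w}) d = \<zero>.V" using split[of d] dc by auto
 have lc: "lin_comb (S - {w}) d:<V>" using dc S' by (intro lin_comb_closed) auto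
 have dw: "d w\<odot>.V w = \<ominus>.V lin_comb (S - {w}) d"
  using rel lc S[OF w(1)] d0 lsmult_closed by (metis M.minus_equality M.a_comm M.minus_minus)
 have "w = inv (d w)\<odot>.V (d w\<odot>.V w)"
  using i d0 S[OF w(1)] by (simp add: lsmult_assoc[symmetric] lsmult_one)
 also have "... = (\<ominus> (inv (d w)))\<odot>.V lin_comb (S - {w}) d"
  using dw i lc by (simp add: lsmult_l_minus lsmult_r_minus)
 also have "... = lin_comb (S - {w}) (%v. (\<ominus> (inv (d w)))\<otimes> d v)"
  using i dc S' by (intro lin_comb_smult[symmetric]) auto
 finally have weq: "w = lin_comb (S - {w}) (%v. (\<ominus> (inv (d w)))\<otimes> d v)" .
 have "EX c:S - {w} -> <K>. y = lin_comb (S - {w}) c" if y: "y:<V>" for y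
 proof -
  obtain c where c: "c:S -> <K>" "y = lin_comb S c" using less.prems(3)[OF y] by blast
  define e where "e v = c w\<otimes> ((\<ominus> (inv (d w)))\<otimes> d v)" for v
  have cc: "c v:<K>" "e v:<K>" if "v:S" for v using c(1) i(1) dc[OF that] that w(1) by (auto simp: e_def)
  have "lin_comb (S - {w}) e = c w\<odot>.V lin_comb (S - {w}) (%v. (\<ominus> (inv (d w)))\<otimes> d v)"
   unfolding e_def using i dc S' cc by (intro lin_comb_smult) auto
  hence "c w\<odot>.V w = lin_comb (S - {w}) e" using weq by simp
  hence "y = lin_comb (S - {w}) e \<oplus>.V lin_comb (S - {w}) c" using split[OF c(1)] c(2) by simp
  also have "... = lin_comb (S - {w}) (%v. e v \<oplus> c v)" using cc S' by (intro lin_comb_add[symmetric]) auto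
  finally show ?thesis using cc by (intro bexI[of _ "%v. e v \<oplus> c v"]) auto
 qed
 moreover have "card (S - {w}) < card S" using less.prems(1) w(1) by (meson card_Diff1_less)
 ultimately obtain B where "B <= S - {w}" "fin_basis K V B" using less.hyps[OF _ S'(1,2)] by blast
 thus ?thesis by blast
qed auto
qed

lemma fin_basisD:
 assumes "fin_basis K V B"
 shows "finite B" "B <= <V>" using assms by (auto simp: fin_basis_def)

lemma coordinates:
 assumes "fin_basis K V B" "x:<V>"
 shows "coordinates K V B x:B \<rightarrow>\<^sub>E <K>" "lin_comb B (coordinates K V B x) = x"
proof -
have "EX! a. a:B \<rightarrow>\<^sub>E <K> & x = lin_comb B a" using assms unfolding fin_basis_def by blast
from theI'[OF this] show "coordinates K V B x:B \<rightarrow>\<^sub>E <K>" "lin_comb B (coordinates K V B x) = x"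
 unfolding coordinates_def by auto
qed

lemma coordinates_closed: "fin_basis K V B ==> x:<V> ==> v:B ==> coordinates K V B x v:<K>"
 using coordinates(1) by blast

lemma coordinates_unique:
 assumes "fin_basis K V B" "a:B -> <K>" "v:B"
 shows "coordinates K V B (lin_comb B a) v = a v"
proof -
note B = fin_basisD[OF assms(1)]
have c: "lin_comb B a:<V>" using lin_comb_closed B assms by blast
have "restrict a B:B \<rightarrow>\<^sub>E <K>" "lin_comb B a = lin_comb B (restrict a B)"
 using assms(2) lin_comb_restrict[OF B(2)] by auto
moreover have "EX! a'. a':B \<rightarrow>\<^sub>E <K> & lin_comb B a = lin_comb B a'"
 using assms(1) c unfolding fin_basis_def by blast
ultimately have "coordinates K V B (lin_comb B a) = restrict a B"
 unfolding coordinates_def by (intro the1_equality) simp_all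
thus ?thesis using assms(3) by simp
qed

lemma coordinates_add:
 assumes "fin_basis K V B" "x:<V>" "y:<V>" "v:B"
 shows "coordinates K V B (x \<oplus>.V y) v = coordinates K V B x v \<oplus> coordinates K V B y v"
proof -
have "x \<oplus>.V y = lin_comb B (%v. coordinates K V B x v \<oplus> coordinates K V B y v)"
 using lin_comb_add fin_basisD[OF assms(1)] coordinates[OF assms(1)] coordinates_closed[OF assms(1)] assms(2,3) by auto
thus ?thesis using coordinates_unique[OF assms(1) _ assms(4)] coordinates_closed[OF assms(1)] assms(2,3) by auto
qed

lemma coordinates_smult:
 assumes "fin_basis K V B" "x:<V>" "c:<K>" "v:B"
 shows "coordinates K V B (c\<odot>.V x) v = c\<otimes> coordinates K V B x v"
proof -
have "c\<odot>.V x = lin_comb B (%v. c\<otimes> coordinates K V B x v)"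
 using lin_comb_smult fin_basisD[OF assms(1)] coordinates[OF assms(1)] coordinates_closed[OF assms(1)] assms(2,3) by auto
thus ?thesis using coordinates_unique[OF assms(1) _ assms(4)] coordinates_closed[OF assms(1)] assms(2,3) by auto
qed

definition trace_wrt where
 "trace_wrt B f = (\<Oplus>v\<in>B. coordinates K V B (f v) v)"

lemma linear_lin_comb:
 assumes "left_module K W" "f:lmod_hom K V W" "B <= <V>" "a:B -> <K>"
 shows "f (lin_comb B a) = (\<Oplus>.W v\<in>B. a v\<odot>.W f v)"
proof -
interpret W: left_module K W by fact
have f: "f:<V> -> <W>" "!!x y. x:<V> ==> y:<V> ==> f (x \<oplus>.V y) = f x \<oplus>.W f y"
 "!!c x. c:<K> ==> x:<V> ==> f (c\<odot>.V x) = c\<odot>.W f x" using assms(2) by (auto simp: lmod_hom_def)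
have z: "f \<zero>.V = \<zero>.W" using f(3)[of \<zero> "\<zero>.V"] f(1) by (auto simp: Pi_iff)
have "f (lin_comb B a) = (\<Oplus>.W v\<in>B. f (a v\<odot>.V v))" using f z assms(3,4) lsmult_closed
 by (intro finsum_hom M.abelian_monoid_axioms W.abelian_monoid_axioms) (auto simp: Pi_iff)
also have "... = (\<Oplus>.W v\<in>B. a v\<odot>.W f v)"
 using f assms(3,4) W.lsmult_closed by (intro W.M.finsum_cong') (auto simp: Pi_iff)
finally show ?thesis .
qed

lemma coordinates_lin_comb:
 assumes "fin_basis K V B" "finite C" "!!i. i:C ==> g i:<V>" "!!i. i:C ==> a i:<K>" "v:B"
 shows "coordinates K V B (\<Oplus>.V i\<in>C. a i\<odot>.V g i) v = (\<Oplus>i\<in>C. a i\<otimes> coordinates K V B (g i) v)"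
proof -
note cc = coordinates_closed[OF assms(1)]
have "coordinates K V B (\<Oplus>.V i\<in>C. a i\<odot>.V g i) v = (\<Oplus>i\<in>C. coordinates K V B (a i\<odot>.V g i) v)"
proof (rule finsum_hom[where f = "%x. coordinates K V B x v", OF M.abelian_monoid_axioms K.abelian_monoid_axioms])
 show "coordinates K V B \<zero>.V v = \<zero>"
  using coordinates_smult[OF assms(1) _ _ assms(5), of "\<zero>.V" \<zero>] cc[of "\<zero>.V" v] assms(5) by auto
qed (use cc coordinates_add[OF assms(1)] assms lsmult_closed in auto)
also have "... = (\<Oplus>i\<in>C. a i\<otimes> coordinates K V B (g i) v)"
 using coordinates_smult[OF assms(1)] cc assms by (intro K.finsum_cong') auto
finally show ?thesis .
qed

text \<open>The argument for tr(XY) = tr(YX). It yields independence of the basis (h the identity)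
  and invariance under isomorphism together.\<close>

lemma trace_transport:
 assumes W: "left_module K W" and f: "f:lmod_hom K V V" and B: "fin_basis K V B"
  and C: "fin_basis K W C" and h: "h:lmod_iso K V W" and f': "f':lmod_hom K W W"
  and comm: "!!x. x:<V> ==> f' (h x) = h (f x)"
 shows "(\<Oplus>v\<in>B. coordinates K V B (f v) v) = (\<Oplus>w\<in>C. coordinates K W C (f' w) w)"
proof -
interpret W: vector_space K W using W K.field_axioms by (simp add: vector_space_def)
note Bf = fin_basisD[OF B] and Cf = W.fin_basisD[OF C]
note cB = coordinates_closed[OF B] and cC = W.coordinates_closed[OF C]
have hh: "h:lmod_hom K V W" and hb: "bij_betw h <V> <W>" using h by (auto simp: lmod_iso_def)
have hc: "h x:<W>" if "x:<V>" for x using hh that by (auto simp: lmod_hom_def)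
have fc: "f x:<V>" if "x:<V>" for x using f that by (auto simp: lmod_hom_def)
have f'c: "f' x:<W>" if "x:<W>" for x using f' that by (auto simp: lmod_hom_def)
define h' where "h' = inv_into <V> h"
have h'c: "h' y:<V>" "h (h' y) = y" if "y:<W>" for y
 using hb that by (auto simp: h'_def bij_betw_def inv_into_into f_inv_into_f)
have h'h: "h' (h x) = x" if "x:<V>" for x using hb that by (simp add: h'_def bij_betw_def)
have h'hom: "h':lmod_hom K W V"
proof -
 have "h' (x \<oplus>.W y) = h' x \<oplus>.V h' y" if "x:<W>" "y:<W>" for x y
 proof -
  have "x \<oplus>.W y = h (h' x \<oplus>.V h' y)" using hh h'c that by (simp add: lmod_hom_def)
  thus ?thesis using h'h h'c that by simp
 qed
 moreover have "h' (a\<odot>.W y) = a\<odot>.V h' y" if "a:<K>" "y:<W>" for a y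
 proof -
  have "a\<odot>.W y = h (a\<odot>.V h' y)" using hh h'c that by (simp add: lmod_hom_def)
  thus ?thesis using h'h h'c that lsmult_closed by simp
 qed
 ultimately show ?thesis using h'c by (simp add: lmod_hom_def)
qed
\<comment> \<open>\<open>?x\<close> is the matrix of h and \<open>?y\<close> that of h' f'; the two
  traces are the diagonal sums of their products in the two orders.\<close>
let ?x = "%v w. coordinates K W C (h v) w" and ?y = "%w v. coordinates K V B (h' (f' w)) v"
have xc: "?x v w:<K>" if "v:B" "w:C" for v w using cC hc Bf that by blast
have yc: "?y w v:<K>" if "v:B" "w:C" for v w using cB h'c f'c Cf that by blast
have "coordinates K V B (f v) v = (\<Oplus>w\<in>C. ?x v w\<otimes> ?y w v)" if v: "v:B" for v
proof -
 have vc: "v:<V>" using v Bf by blast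
 have "f v = h' (f' (h v))" using comm h'h fc vc by simp
 also have "h v = W.lin_comb C (?x v)" using W.coordinates(2)[OF C hc[OF vc]] by simp
 also have "f' (W.lin_comb C (?x v)) = (\<Oplus>.W w\<in>C. ?x v w\<odot>.W f' w)"
  using W.linear_lin_comb[OF W f' Cf(2)] xc v by auto
 also have "h' ... = (\<Oplus>.V w\<in>C. ?x v w\<odot>.V h' (f' w))"
 proof -
  have "h' (\<Oplus>.W w\<in>C. ?x v w\<odot>.W f' w) = (\<Oplus>.V w\<in>C. h' (?x v w\<odot>.W f' w))"
  proof (rule finsum_hom[OF W.M.abelian_monoid_axioms M.abelian_monoid_axioms])
   show "h' \<zero>.W = \<zero>.V"
   proof -
    have "h' (a\<odot>.W y) = a\<odot>.V h' y" if "a:<K>" "y:<W>" for a y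
     using h'hom that by (simp add: lmod_hom_def)
    from this[of \<zero> "\<zero>.W"] show ?thesis using h'c by simp
   qed
  qed (use h'hom W.lsmult_closed xc v f'c Cf in \<open>auto simp: lmod_hom_def\<close>)
  also have "... = (\<Oplus>.V w\<in>C. ?x v w\<odot>.V h' (f' w))"
   using h'hom xc v f'c h'c Cf lsmult_closed by (intro M.finsum_cong') (auto simp: lmod_hom_def)
  finally show ?thesis .
 qed
 finally have "f v = (\<Oplus>.V w\<in>C. ?x v w\<odot>.V h' (f' w))" .
 moreover have "h' (f' w):<V>" if "w:C" for w using that h'c f'c Cf(2) by blast
 ultimately show ?thesis using coordinates_lin_comb[OF B Cf(1), of "%w. h' (f' w)" "?x v" v] v xc by auto
qed
hence "(\<Oplus>v\<in>B. coordinates K V B (f v) v) = (\<Oplus>v\<in>B. \<Oplus>w\<in>C. ?x v w\<otimes> ?y w v)"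
 using xc yc by (intro K.finsum_cong') auto
also have "... = (\<Oplus>w\<in>C. \<Oplus>v\<in>B. ?x v w\<otimes> ?y w v)"
 using xc yc by (intro K.finsum_swap) auto
also have "... = (\<Oplus>w\<in>C. coordinates K W C (f' w) w)"
proof (rule K.finsum_cong')
 fix w assume w: "w:C"
 have wc: "f' w:<W>" using w Cf f'c by blast
 have "f' w = h (lin_comb B (?y w))" using coordinates(2)[OF B h'c(1)[OF wc]] h'c(2)[OF wc] by simp
 also have "... = (\<Oplus>.W v\<in>B. ?y w v\<odot>.W h v)" using linear_lin_comb[OF W hh Bf(2)] yc w by auto
 finally have "coordinates K W C (f' w) w = (\<Oplus>v\<in>B. ?y w v\<otimes> ?x v w)"
  using W.coordinates_lin_comb[OF C Bf(1), of h "?y w" w] w yc hc Bf(2) by auto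
 also have "... = (\<Oplus>v\<in>B. ?x v w\<otimes> ?y w v)"
  using xc yc w by (intro K.finsum_cong') (auto simp: K.m_comm)
 finally show "(\<Oplus>v\<in>B. ?x v w\<otimes> ?y w v) = coordinates K W C (f' w) w" by simp
qed (use cC f'c Cf in auto)
finally show ?thesis .
qed

lemma id_lmod_iso: "(%x. x):lmod_iso K V V" by (auto simp: lmod_iso_def lmod_hom_def bij_betw_def)

lemma trace_of_eq:
 assumes "f:lmod_hom K V V" "fin_basis K V B"
 shows "trace_of K V f = (\<Oplus>v\<in>B. coordinates K V B (f v) v)"
proof -
have "fin_basis K V (SOME B. fin_basis K V B)" using assms(2) by (rule someI)
thus ?thesis unfolding trace_of_def Let_def
 using trace_transport[OF left_module_axioms assms(1) _ assms(2) id_lmod_iso assms(1)] by blast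
qed

text \<open>The diagonal coordinate at v is l(v) times the v-coordinate of w; these add up to l
  applied to the expansion of w.\<close>

lemma trace_rank_one:
 assumes B: "fin_basis K V B" and w: "w:<V>" and l: "!!x. x:<V> ==> l x:<K>"
  and add: "!!x y. x:<V> ==> y:<V> ==> l (x \<oplus>.V y) = l x \<oplus> l y"
  and sm: "!!c x. c:<K> ==> x:<V> ==> l (c\<odot>.V x) = c\<otimes> l x"
 shows "(\<Oplus>v\<in>B. coordinates K V B (l v\<odot>.V w) v) = l w"
proof -
note Bf = fin_basisD[OF B] and cB = coordinates_closed[OF B]
have Bc: "v:<V>" if "v:B" for v using Bf that by blast
have l0: "l \<zero>.V = \<zero>" using sm[of \<zero> "\<zero>.V"] l by simp
have "l w = l (lin_comb B (coordinates K V B w))" using coordinates(2)[OF B w] by simp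
also have "... = (\<Oplus>v\<in>B. l (coordinates K V B w v\<odot>.V v))" using l l0 add cB[OF w] Bc lsmult_closed
 by (intro finsum_hom[where f = l] M.abelian_monoid_axioms K.abelian_monoid_axioms) auto
also have "... = (\<Oplus>v\<in>B. coordinates K V B (l v\<odot>.V w) v)"
 using sm l cB[OF w] Bc coordinates_smult[OF B w] by (intro K.finsum_cong') (auto simp: K.m_comm)
finally show ?thesis by simp
qed
end

section \<open>Group algebras\<close>

locale group_algebra = K?: field K + G?: group G for K :: "('f, 'u) ring_scheme" (structure) and G :: "('g, 'v) monoid_scheme" +
 assumes finite_G: "finite <G>"
begin

abbreviation KG where "KG \<equiv> group_ring K G"
abbreviation mon where "mon \<equiv> gmonom K G"

lemma gr_carrier: "<KG> = <G> \<rightarrow>\<^sub>E <K>" by (simp add: group_ring_def)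

lemma gr_add: "a \<oplus>.KG b = (\<lambda>g\<in><G>. a g \<oplus> b g)" by (simp add: group_ring_def)

lemma gr_zero: "\<zero>.KG = (\<lambda>g\<in><G>. \<zero>)" by (simp add: group_ring_def)

lemma gr_one: "\<one>.KG = mon \<one> \<one>.G" by (simp add: group_ring_def gmonom_def)

lemma gr_mult: "a\<otimes>.KG b = (\<lambda>g\<in><G>. \<Oplus>h\<in><G>. a h\<otimes> b (inv .G h\<otimes>.G g))"
 by (simp add: group_ring_def)

lemma gr_at: "a:<KG> ==> g:<G> ==> a g:<K>" by (auto simp: gr_carrier)

lemma gr_eqI:
 assumes "a:<KG>" "b:<KG>" "!!g. g:<G> ==> a g = b g"
 shows "a = b" using assms by (auto simp: gr_carrier intro: PiE_ext)

lemma gr_add_at: "g:<G> ==> (a \<oplus>.KG b) g = a g \<oplus> b g" by (simp add: gr_add)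

lemma gr_zero_at: "g:<G> ==> \<zero>.KG g = \<zero>" by (simp add: gr_zero)

lemma gr_mult_at: "g:<G> ==> (a\<otimes>.KG b) g = (\<Oplus>h\<in><G>. a h\<otimes> b (inv .G h\<otimes>.G g))"
 by (simp add: gr_mult)

lemma mon_at: "x:<G> ==> mon l g x = (if x = g then l else \<zero>)" by (simp add: gmonom_def)

lemma gr_zero_closed: "\<zero>.KG:<KG>" by (auto simp: gr_zero gr_carrier)

lemma gr_add_closed: "a:<KG> ==> b:<KG> ==> a \<oplus>.KG b:<KG>" by (auto simp: gr_add gr_carrier)

lemma mult_term_closed:
 assumes "a:<KG>" "b:<KG>" "h:<G>" "g:<G>"
 shows "a h\<otimes> b (inv .G h\<otimes>.G g):<K>" using assms gr_at by auto

lemma gr_mult_closed: "a:<KG> ==> b:<KG> ==> a\<otimes>.KG b:<KG>"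
 unfolding gr_mult using mult_term_closed[of a b] by (simp add: gr_carrier)

lemma bij_left_translate: "h:<G> ==> bij_betw (%x. h\<otimes>.G x) <G> <G>"
proof (rule bij_betwI[where g = "%x. inv .G h\<otimes>.G x"])
qed (auto simp: G.m_assoc[symmetric])

lemma gr_mult_assoc:
 assumes a: "a:<KG>" and b: "b:<KG>" and c: "c:<KG>"
 shows "(a\<otimes>.KG b)\<otimes>.KG c = a\<otimes>.KG (b\<otimes>.KG c)"
proof (rule gr_eqI)
fix g assume g: "g:<G>"
note at = gr_at[OF a] gr_at[OF b] gr_at[OF c]
have "((a\<otimes>.KG b)\<otimes>.KG c) g = (\<Oplus>h\<in><G>. (\<Oplus>u\<in><G>. a u\<otimes> b (inv .G u\<otimes>.G h))\<otimes> c (inv .G h\<otimes>.G g))"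
 using g at by (auto simp: gr_mult intro!: K.finsum_cong')
also have "... = (\<Oplus>h\<in><G>. \<Oplus>u\<in><G>. a u\<otimes> (b (inv .G u\<otimes>.G h)\<otimes> c (inv .G h\<otimes>.G g)))"
 using g at finite_G by (intro K.finsum_cong') (auto simp: K.finsum_ldistr K.m_assoc intro!: K.finsum_cong')
also have "... = (\<Oplus>u\<in><G>. \<Oplus>h\<in><G>. a u\<otimes> (b (inv .G u\<otimes>.G h)\<otimes> c (inv .G h\<otimes>.G g)))"
 using g at by (intro K.finsum_swap) auto
also have "... = (\<Oplus>u\<in><G>. a u\<otimes> (\<Oplus>v\<in><G>. b v\<otimes> c (inv .G v\<otimes>.G (inv .G u\<otimes>.G g))))"
proof (rule K.finsum_cong')
 fix u assume u: "u:<G>"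
 have "(\<Oplus>h\<in><G>. a u\<otimes> (b (inv .G u\<otimes>.G h)\<otimes> c (inv .G h\<otimes>.G g)))
   = (\<Oplus>v\<in><G>. a u\<otimes> (b (inv .G u\<otimes>.G (u\<otimes>.G v))\<otimes> c (inv .G (u\<otimes>.G v)\<otimes>.G g)))"
  using g u at by (intro K.finsum_reindex_bij[OF bij_left_translate, symmetric]) auto
 also have "... = (\<Oplus>v\<in><G>. a u\<otimes> (b v\<otimes> c (inv .G v\<otimes>.G (inv .G u\<otimes>.G g))))"
  using g u at by (intro K.finsum_cong') (auto simp: G.m_assoc G.inv_mult_group G.m_assoc[of "inv .G u" u, symmetric])
 also have "... = a u\<otimes> (\<Oplus>v\<in><G>. b v\<otimes> c (inv .G v\<otimes>.G (inv .G u\<otimes>.G g)))"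
  using g u at finite_G by (intro K.finsum_rdistr[symmetric]) auto
 finally show "(\<Oplus>h\<in><G>. a u\<otimes> (b (inv .G u\<otimes>.G h)\<otimes> c (inv .G h\<otimes>.G g)))
   = a u\<otimes> (\<Oplus>v\<in><G>. b v\<otimes> c (inv .G v\<otimes>.G (inv .G u\<otimes>.G g)))" .
qed (use g at in \<open>auto intro!: K.finsum_closed\<close>)
also have "... = (a\<otimes>.KG (b\<otimes>.KG c)) g" using g at by (auto simp: gr_mult intro!: K.finsum_cong')
finally show "((a\<otimes>.KG b)\<otimes>.KG c) g = (a\<otimes>.KG (b\<otimes>.KG c)) g" .
qed (use a b c gr_mult_closed in auto)

lemma mon_closed [simp]: "l:<K> ==> mon l g:<KG>" by (auto simp: gr_carrier gmonom_def)

lemma mon_mult_at: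
 assumes "a:<KG>" "l:<K>" "g:<G>" "x:<G>"
 shows "(mon l g\<otimes>.KG a) x = l\<otimes> a (inv .G g\<otimes>.G x)"
proof -
have "(mon l g\<otimes>.KG a) x = (\<Oplus>h\<in><G>. if h = g then l\<otimes> a (inv .G h\<otimes>.G x) else \<zero>)"
 using assms gr_at[OF assms(1)] by (auto simp: gr_mult gmonom_def intro!: K.finsum_cong')
also have "... = l\<otimes> a (inv .G g\<otimes>.G x)"
 using assms gr_at[OF assms(1)] finite_G by (intro K.finsum_delta) auto
finally show ?thesis .
qed

lemma mult_mon_at:
 assumes "a:<KG>" "l:<K>" "g:<G>" "x:<G>"
 shows "(a\<otimes>.KG mon l g) x = a (x\<otimes>.G inv .G g)\<otimes> l"
proof -
have e: "inv .G h\<otimes>.G x = g <-> h = x\<otimes>.G inv .G g" if "h:<G>" for h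
 using that assms by (metis G.inv_solve_left G.inv_solve_right)
have "(a\<otimes>.KG mon l g) x = (\<Oplus>h\<in><G>. if h = x\<otimes>.G inv .G g then a h\<otimes> l else \<zero>)"
 using assms gr_at[OF assms(1)] e by (auto simp: gr_mult gmonom_def intro!: K.finsum_cong')
also have "... = a (x\<otimes>.G inv .G g)\<otimes> l"
 using assms gr_at[OF assms(1)] finite_G by (intro K.finsum_delta) auto
finally show ?thesis .
qed

lemma mon_mult:
 assumes "l:<K>" "m:<K>" "g:<G>" "h:<G>"
 shows "mon l g\<otimes>.KG mon m h = mon (l\<otimes> m) (g\<otimes>.G h)"
proof (rule gr_eqI)
fix x assume x: "x:<G>"
have "inv .G g\<otimes>.G x = h <-> x = g\<otimes>.G h" using assms x by (metis G.inv_solve_left)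
thus "(mon l g\<otimes>.KG mon m h) x = mon (l\<otimes> m) (g\<otimes>.G h) x"
 using assms x mon_mult_at[of "mon m h" l g x] by (simp add: mon_at)
qed (use assms gr_mult_closed in auto)

lemma mon_add: "l:<K> ==> m:<K> ==> mon l g \<oplus>.KG mon m g = mon (l \<oplus> m) g"
 by (auto simp: gr_add gmonom_def)

lemma abelian_group_gr: "abelian_group KG"
proof (rule abelian_groupI)
fix a assume a: "a:<KG>"
have c: "(\<lambda>g\<in><G>. \<ominus> a g):<KG>" using gr_at[OF a] by (auto simp: gr_carrier)
moreover have "(\<lambda>g\<in><G>. \<ominus> a g) \<oplus>.KG a = \<zero>.KG"
 using a c gr_at[OF a] by (intro gr_eqI gr_add_closed gr_zero_closed) (auto simp: gr_add_at gr_zero_at K.l_neg)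
ultimately show "EX b:<KG>. b \<oplus>.KG a = \<zero>.KG" by blast
next
fix a b assume ab: "a:<KG>" "b:<KG>"
thus "a \<oplus>.KG b = b \<oplus>.KG a" by (intro gr_eqI gr_add_closed) (auto simp: gr_add_at gr_at K.a_comm)
fix c assume "c:<KG>"
thus "a \<oplus>.KG b \<oplus>.KG c = a \<oplus>.KG (b \<oplus>.KG c)"
 using ab by (intro gr_eqI gr_add_closed) (auto simp: gr_add_at gr_at K.a_assoc)
next
fix a assume "a:<KG>"
thus "\<zero>.KG \<oplus>.KG a = a"
 by (intro gr_eqI gr_add_closed gr_zero_closed) (auto simp: gr_add_at gr_zero_at gr_at)
qed (use gr_add_closed gr_zero_closed in auto)

lemma gr_distr:
 assumes a: "a:<KG>" and b: "b:<KG>" and c: "c:<KG>"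
 shows "(a \<oplus>.KG b)\<otimes>.KG c = a\<otimes>.KG c \<oplus>.KG b\<otimes>.KG c"
  "c\<otimes>.KG (a \<oplus>.KG b) = c\<otimes>.KG a \<oplus>.KG c\<otimes>.KG b"
proof -
note at = gr_at[OF a] gr_at[OF b] gr_at[OF c]
show "(a \<oplus>.KG b)\<otimes>.KG c = a\<otimes>.KG c \<oplus>.KG b\<otimes>.KG c"
proof (rule gr_eqI)
 fix g assume g: "g:<G>"
 have "((a \<oplus>.KG b)\<otimes>.KG c) g
   = (\<Oplus>h\<in><G>. a h\<otimes> c (inv .G h\<otimes>.G g) \<oplus> b h\<otimes> c (inv .G h\<otimes>.G g))"
  unfolding gr_mult_at[OF g] using at g by (intro K.finsum_cong') (auto simp: gr_add_at K.l_distr)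
 also have "... = (\<Oplus>h\<in><G>. a h\<otimes> c (inv .G h\<otimes>.G g)) \<oplus> (\<Oplus>h\<in><G>. b h\<otimes> c (inv .G h\<otimes>.G g))"
  using at g by (intro K.finsum_addf) auto
 finally show "((a \<oplus>.KG b)\<otimes>.KG c) g = (a\<otimes>.KG c \<oplus>.KG b\<otimes>.KG c) g"
  using g by (simp add: gr_mult_at gr_add_at)
qed (use a b c gr_add_closed gr_mult_closed in auto)
show "c\<otimes>.KG (a \<oplus>.KG b) = c\<otimes>.KG a \<oplus>.KG c\<otimes>.KG b"
proof (rule gr_eqI)
 fix g assume g: "g:<G>"
 have "(c\<otimes>.KG (a \<oplus>.KG b)) g
   = (\<Oplus>h\<in><G>. c h\<otimes> a (inv .G h\<otimes>.G g) \<oplus> c h\<otimes> b (inv .G h\<otimes>.G g))"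
  unfolding gr_mult_at[OF g] using at g by (intro K.finsum_cong') (auto simp: gr_add_at K.r_distr)
 also have "... = (\<Oplus>h\<in><G>. c h\<otimes> a (inv .G h\<otimes>.G g)) \<oplus> (\<Oplus>h\<in><G>. c h\<otimes> b (inv .G h\<otimes>.G g))"
  using at g by (intro K.finsum_addf) auto
 finally show "(c\<otimes>.KG (a \<oplus>.KG b)) g = (c\<otimes>.KG a \<oplus>.KG c\<otimes>.KG b) g"
  using g by (simp add: gr_mult_at gr_add_at)
qed (use a b c gr_add_closed gr_mult_closed in auto)
qed

lemma ring_gr: "ring KG"
proof (rule ringI[OF abelian_group_gr])
show "monoid KG"
proof (rule monoidI)
 fix a assume a: "a:<KG>"
 show "\<one>.KG\<otimes>.KG a = a" "a\<otimes>.KG \<one>.KG = a"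
  using a gr_mult_closed mon_mult_at[OF a, of \<one> "\<one>.G"] mult_mon_at[OF a, of \<one> "\<one>.G"] gr_at[OF a]
  by (auto simp: gr_one intro!: gr_eqI)
qed (use gr_mult_closed gr_mult_assoc gr_one in auto)
qed (use gr_distr in auto)

sublocale KG: ring "group_ring K G" by (rule ring_gr)

text \<open>Since the monomials carry arbitrary scalars, closure under sums alone reaches every
  element; most identities below are checked on monomials.\<close>

lemma gr_induct [consumes 1, case_names mon add]:
 assumes "a:<KG>"
  and mon: "!!l g. l:<K> ==> g:<G> ==> P (mon l g)"
  and add: "!!a b. a:<KG> ==> b:<KG> ==> P a ==> P b ==> P (a \<oplus>.KG b)"
 shows "P a"
proof -
define r where "r S = (\<lambda>x\<in><G>. if x:S then a x else \<zero>)" for S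
have rc: "r S:<KG>" for S using gr_at[OF assms(1)] by (auto simp: gr_carrier r_def)
have "P (r S)" if "finite S" "S <= <G>" for S using that
proof (induction S rule: finite_induct)
 case empty
 have "mon \<zero> \<one>.G = r {}" by (intro gr_eqI rc) (auto simp: r_def mon_at)
 thus ?case using mon[of \<zero> "\<one>.G"] by simp
next
 case (insert g S)
 have "r (insert g S) = mon (a g) g \<oplus>.KG r S" using insert gr_at[OF assms(1)]
  by (intro gr_eqI gr_add_closed rc) (auto simp: r_def gr_add_at mon_at)
 thus ?case using insert add rc mon gr_at[OF assms(1)] by auto
qed
from this[OF finite_G] have "P (r <G>)" by simp
moreover have "r <G> = a" using assms(1) rc by (intro gr_eqI) (auto simp: r_def)
ultimately show ?thesis by simp
qed

lemma scalar_mult_at: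
 "a:<KG> ==> l:<K> ==> x:<G> ==> (mon l \<one>.G\<otimes>.KG a) x = l\<otimes> a x"
 using mon_mult_at[of a l "\<one>.G" x] by auto

lemma scalar_central:
 "a:<KG> ==> l:<K> ==> mon l \<one>.G\<otimes>.KG a = a\<otimes>.KG mon l \<one>.G"
 using mon_mult_at[of a l "\<one>.G"] mult_mon_at[of a l "\<one>.G"] gr_at[of a]
 by (intro gr_eqI) (auto simp: K.m_comm)

lemma vs_res:
 assumes "left_module KG V"
 shows "vector_space K (res K G V)"
proof -
interpret V: left_module KG V by fact
have "left_module K (res K G V)"
proof (rule left_module.intro)
 show "ring K" by (rule K.ring_axioms)
 show "abelian_group (res K G V)"
 proof -
  have "EX y:<V>. y \<oplus>.V x = \<zero>.V" if "x:<V>" for x using that V.M.l_neg by blast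
  thus ?thesis by (intro abelian_groupI) (auto simp: scalar_restriction_def V.M.a_assoc intro: V.M.a_comm)
 qed
 show "left_module_axioms K (res K G V)"
  by (auto simp: left_module_axioms_def scalar_restriction_def V.lsmult_closed V.lsmult_r_distr
   mon_add[symmetric] V.lsmult_l_distr V.lsmult_assoc[symmetric] mon_mult V.lsmult_one gr_one[symmetric])
qed
thus ?thesis using K.field_axioms by (simp add: vector_space_def)
qed
end

text \<open>One step of Horner's scheme for division by y - t: remainder s and quotient D become
  remainder a + t s and quotient s + y D.\<close>

lemma (in ring) synthetic_step:
 assumes "a:<R>" "s:<R>" "t:<R>" "y:<R>" "D:<R>" "y\<otimes> t = t\<otimes> y"
 shows "a \<oplus> y\<otimes> (s \<oplus> (y \<ominus> t)\<otimes> D) = (a \<oplus> t\<otimes> s) \<oplus> (y \<ominus> t)\<otimes> (s \<oplus> y\<otimes> D)"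
proof -
have "y\<otimes> ((y \<ominus> t)\<otimes> D) = (y \<ominus> t)\<otimes> (y\<otimes> D)"
 using assms by (simp add: a_minus_def l_distr r_distr l_minus r_minus m_assoc[symmetric])
moreover have "y\<otimes> s = t\<otimes> s \<oplus> (y \<ominus> t)\<otimes> s"
 using assms by (simp add: a_minus_def l_distr l_minus a_lcomm[of "t\<otimes> s" "y\<otimes> s"] r_neg)
ultimately show ?thesis using assms by (simp add: r_distr a_assoc)
qed

lemma (in group_algebra) galois_action_hom:
 assumes s: "s:ring_hom K K"
 shows "gal G s:ring_hom KG KG" "!!l g. l:<K> ==> gal G s (mon l g) = mon (s l) g"
proof -
have sc: "s x:<K>" if "x:<K>" for x using s that ring_hom_closed by metis
interpret s: ring_hom_ring K K s using s by (intro ring_hom_ringI2 K.ring_axioms)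
have c: "gal G s a:<KG>" if "a:<KG>" for a using gr_at[OF that] by (auto simp: galois_action_def gr_carrier)
have at: "gal G s a g = s (a g)" if "g:<G>" for a g using that by (simp add: galois_action_def)
show m: "gal G s (mon l g) = mon (s l) g" if "l:<K>" for l g using that c by (intro gr_eqI) (auto simp: at mon_at)
show "gal G s:ring_hom KG KG"
proof (rule ring_hom_memI)
 fix a b assume a: "a:<KG>" and b: "b:<KG>"
 show "gal G s (a \<oplus>.KG b) = gal G s a \<oplus>.KG gal G s b"
  using a b c gr_at[OF a] gr_at[OF b] by (intro gr_eqI) (auto simp: at gr_add_at)
 show "gal G s (a\<otimes>.KG b) = gal G s a\<otimes>.KG gal G s b"
 proof (rule gr_eqI)
  fix g assume g: "g:<G>"
  have "s ((a\<otimes>.KG b) g) = (\<Oplus>h\<in><G>. s (a h\<otimes> b (inv .G h\<otimes>.G g)))"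
   unfolding gr_mult_at[OF g] using gr_at[OF a] gr_at[OF b] g by (intro finsum_hom K.abelian_monoid_axioms) auto
  also have "... = (gal G s a\<otimes>.KG gal G s b) g"
   unfolding gr_mult_at[OF g] using gr_at[OF a] gr_at[OF b] g by (intro K.finsum_cong') (auto simp: at)
  finally show "gal G s (a\<otimes>.KG b) g = (gal G s a\<otimes>.KG gal G s b) g" using g at by simp
 qed (use a b c in auto)
qed (use c m gr_one in auto)
qed

section \<open>The group algebra over the closure\<close>

locale closure_group_algebra = group_algebra F G + closure_over_finite F Fp p k
 for F :: "'f ring" (structure) and Fp :: "'f set" and p :: nat and k :: "'f set" and G :: "('g, 'v) monoid_scheme"
begin

lemma finite_coeffs:
 assumes "finite S" "S <= <KG>"
 obtains K where "subfield K F" "finite K" "k <= K" "!!a g. a:S ==> g:<G> ==> a g:K"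
proof -
have "finite (\<Union>a\<in>S. a ` <G>)" "(\<Union>a\<in>S. a ` <G>) <= <F>" using assms finite_G gr_at by auto
from finite_subfield[OF this] obtain K where "subfield K F" "finite K" "(\<Union>a\<in>S. a ` <G>) <= K" "k <= K" .
thus ?thesis using that[of K] by auto
qed

lemma coeffs_mult:
 assumes "subfield K F" "a:<KG>" "b:<KG>"
  "!!g. g:<G> ==> a g:K" "!!g. g:<G> ==> b g:K" "g:<G>"
 shows "(a\<otimes>.KG b) g:K"
proof -
have sub: "subring K F" using assms(1) subfieldE by auto
have "(\<Oplus>h\<in>S. a h\<otimes> b (inv .G h\<otimes>.G g)):K" if "finite S" "S <= <G>" for S using that
proof (induction S rule: finite_induct)
 case (insert h S)
 have c: "a h:<F>" "b (inv .G h\<otimes>.G g):<F>" if "h:<G>" for h using gr_at assms that by auto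
 have "a h\<otimes> b (inv .G h\<otimes>.G g):K" using insert.prems assms by auto
 thus ?case using insert c subringE(7)[OF sub] by (subst K.finsum_insert) auto
qed (use subringE(2)[OF sub] in simp)
from this[OF finite_G] show ?thesis unfolding gr_mult_at[OF assms(6)] by simp
qed

text \<open>The coefficients of a lie in a finite field, which then contains the coefficients of all
  its powers.\<close>

lemma finite_powers:
 assumes "a:<KG>"
 shows "finite (range (%n::nat. a [^].KG n))"
proof -
obtain K where K: "subfield K F" "finite K" "!!g. g:<G> ==> a g:K"
 by (rule finite_coeffs[of "{a}"]) (use assms in auto)
have sub: "subring K F" using K(1) subfieldE by auto
have "a [^].KG n:<G> \<rightarrow>\<^sub>E K" for n :: nat
proof (induction n)
 case 0
 thus ?case using subringE(2,3)[OF sub] by (auto simp: gr_one gmonom_def)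
next
 case (Suc n)
 have c: "a [^].KG n:<KG>" using assms by simp
 have "(a [^].KG Suc n) g:K" if "g:<G>" for g using coeffs_mult[OF K(1) c assms _ K(3) that] Suc by auto
 moreover have "a [^].KG Suc n:<KG>" using assms by (intro KG.nat_pow_closed)
 ultimately show ?case by (auto simp: gr_carrier)
qed
moreover have "finite (<G> \<rightarrow>\<^sub>E K)" using finite_G K(2) by (intro finite_PiE) auto
ultimately show ?thesis by (meson finite_subset image_subsetI)
qed

lemma scalar_idem_cancel:
 assumes "e:<KG>" "e ~= \<zero>.KG" "c:<F>" "d:<F>"
  "mon c \<one>.G\<otimes>.KG e = mon d \<one>.G\<otimes>.KG e"
 shows "c = d"
proof -
obtain g where g: "g:<G>" "e g ~= \<zero>" using assms(1,2) gr_eqI[of e "\<zero>.KG"] by (auto simp: gr_zero_at)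
have "c\<otimes> e g = d\<otimes> e g" using assms scalar_mult_at[of e _ g] g(1) by metis
thus ?thesis using g assms gr_at[OF assms(1) g(1)] K.m_rcancel by blast
qed

text \<open>Orthogonal nonzero idempotents are linearly independent. Over a finite field K holding
  their coefficients, independence says that K^I embeds into the functions from G to K, and
  comparing cardinalities bounds I.\<close>

lemma orth_idems_card:
 assumes "KG.orth_idems I"
 shows "card I <= card <G>"
proof -
have fin: "finite I" and idem: "!!e. e:I ==> e:<KG> & e\<otimes>.KG e = e & e ~= \<zero>.KG"
 and orth: "!!e f. e:I ==> f:I ==> e ~= f ==> e\<otimes>.KG f = \<zero>.KG"
 using assms by (auto simp: KG.orth_idems_def KG.idem_def)
obtain K where K: "subfield K F" "finite K" "k <= K" "!!a g. a:I ==> g:<G> ==> a g:K"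
 using finite_coeffs[OF fin] idem by blast
have sub: "subring K F" "K <= <F>" using K(1) subfieldE by auto
define f where "f c = (\<Oplus>.KG e\<in>I. mon (c e) \<one>.G\<otimes>.KG e)" for c
have sc: "mon (c e) \<one>.G\<otimes>.KG e:<KG>" if "c:I \<rightarrow>\<^sub>E K" "e:I" for c e
 using that sub idem by (auto simp: PiE_iff)
have img: "f c:<G> \<rightarrow>\<^sub>E K" if c: "c:I \<rightarrow>\<^sub>E K" for c
proof -
 have "(\<Oplus>.KG e\<in>J. mon (c e) \<one>.G\<otimes>.KG e):<KG> &
   (ALL g:<G>. (\<Oplus>.KG e\<in>J. mon (c e) \<one>.G\<otimes>.KG e) g:K)" if "finite J" "J <= I" for J using that
 proof (induction J rule: finite_induct)
  case empty
  thus ?case using subringE(2)[OF sub(1)] by (auto simp: gr_zero_at)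
 next
  case (insert e J)
  have "(mon (c e) \<one>.G\<otimes>.KG e) g:K" if "g:<G>" for g
   using insert.prems that c idem sub K(4) subringE(6)[OF sub(1)] by (auto simp: scalar_mult_at PiE_iff)
  moreover have "(\<Oplus>.KG e\<in>insert e J. mon (c e) \<one>.G\<otimes>.KG e)
    = mon (c e) \<one>.G\<otimes>.KG e \<oplus>.KG (\<Oplus>.KG e\<in>J. mon (c e) \<one>.G\<otimes>.KG e)"
   using insert sc[OF c] by (intro KG.finsum_insert) auto
  ultimately show ?case using insert sc[OF c] subringE(7)[OF sub(1)] by (auto simp: gr_add_at)
 qed
 from this[OF fin] show ?thesis unfolding f_def by (auto simp: gr_carrier PiE_iff)
qed
have ext: "f c\<otimes>.KG e = mon (c e) \<one>.G\<otimes>.KG e" if c: "c:I \<rightarrow>\<^sub>E K" and e: "e:I" for c e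
proof -
 have "f c\<otimes>.KG e = (\<Oplus>.KG d\<in>I. (mon (c d) \<one>.G\<otimes>.KG d)\<otimes>.KG e)"
  unfolding f_def using fin sc[OF c] idem e by (intro KG.finsum_ldistr) auto
 also have "... = (\<Oplus>.KG d\<in>I. if d = e then mon (c d) \<one>.G\<otimes>.KG d else \<zero>.KG)"
 proof (rule KG.finsum_cong')
  fix d assume d: "d:I"
  have "mon (c d) \<one>.G:<KG>" using c d sub by auto
  thus "(mon (c d) \<one>.G\<otimes>.KG d)\<otimes>.KG e = (if d = e then mon (c d) \<one>.G\<otimes>.KG d else \<zero>.KG)"
   using idem[OF d] idem[OF e] orth[OF d e] by (auto simp: KG.m_assoc)
 qed (use sc[OF c] in auto)
 also have "... = mon (c e) \<one>.G\<otimes>.KG e" using fin e sc[OF c] by (intro KG.finsum_delta) auto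
 finally show ?thesis .
qed
have "inj_on f (I \<rightarrow>\<^sub>E K)"
proof (rule inj_onI)
 fix c d assume cd: "c:I \<rightarrow>\<^sub>E K" "d:I \<rightarrow>\<^sub>E K" "f c = f d"
 have "c e = d e" if e: "e:I" for e
  using ext[OF cd(1) e] ext[OF cd(2) e] cd scalar_idem_cancel[of e "c e" "d e"] idem[OF e] e sub by auto
 thus "c = d" using cd by (intro PiE_ext)
qed
hence "card (I \<rightarrow>\<^sub>E K) <= card (<G> \<rightarrow>\<^sub>E K)"
 using img finite_G K(2) by (intro card_inj_on_le[of f] finite_PiE) auto
hence "card K ^ card I <= card K ^ card <G>" using fin finite_G by (simp add: card_PiE)
moreover have "card K > 1" using q_gt_1 card_mono[OF K(2,3)] by (simp add: q_def)
ultimately show ?thesis using power_le_imp_le_exp by blast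
qed

sublocale KG: pi_ring "group_ring F G"
proof
show "EX n::nat. n > 0 & KG.idem (x [^].KG n)" if "x:<KG>" for x
 using KG.finite_power_idem[OF that finite_powers[OF that]] .
show "EX N. ALL I. KG.orth_idems I --> card I <= N" using orth_idems_card by blast
qed

text \<open>The polynomial with coefficient list cs, constant term first, evaluated at y with e in
  the role of one.\<close>

primrec lev :: "('g => 'f) => ('g => 'f) => 'f list => 'g => 'f" where
 "lev e y [] = \<zero>.KG"
| "lev e y (c # cs) = mon c \<one>.G\<otimes>.KG e \<oplus>.KG y\<otimes>.KG lev e y cs"

lemma lev_closed [simp]:
 "e:<KG> ==> y:<KG> ==> set cs <= <F> ==> lev e y cs:<KG>" by (induction cs) auto

lemma lev_replicate_zero:
 "e:<KG> ==> y:<KG> ==> set cs <= <F> ==>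
  lev e y (replicate n \<zero> @ cs) = y [^].KG n\<otimes>.KG lev e y cs"
proof (induction n)
case (Suc n)
have "mon \<zero> \<one>.G = \<zero>.KG" by (intro gr_eqI) (auto simp: mon_at gr_zero_at)
moreover have "y [^].KG Suc n = y\<otimes>.KG y [^].KG n" using KG.nat_pow_Suc2 Suc.prems by blast
ultimately show ?case using Suc by (simp add: KG.m_assoc del: KG.nat_pow_Suc)
qed simp

text \<open>Division by y - l e; the remainder is the value at l. The clause on \<open>last\<close>
  says that the quotient inherits the leading coefficient, so it is again a nonzero
  polynomial.\<close>

lemma lev_synthetic:
 assumes e: "KG.idem e" and y: "y:KG.corner e e" and l: "l:<F>" and "set cs <= <F>"
 shows "EX ds. set ds <= <F> & length ds = length cs - 1 & (length cs >= 2 --> last ds = last cs) &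
  lev e y cs = mon (K.eval (rev cs) l) \<one>.G\<otimes>.KG e \<oplus>.KG (y \<ominus>.KG mon l \<one>.G\<otimes>.KG e)\<otimes>.KG lev e y ds"
 using assms(4)
proof (induction cs)
case Nil
have "mon \<zero> \<one>.G = \<zero>.KG" by (intro gr_eqI) (auto simp: mon_at gr_zero_at)
thus ?case using e l KG.cornerD(1)[OF y] by (intro exI[of _ "[]"]) (auto simp: KG.idem_def)
next
case (Cons c cs)
have ec: "e:<KG>" "e\<otimes>.KG e = e" using e by (auto simp: KG.idem_def)
note yc = KG.cornerD[OF y]
have cc: "c:<F>" "set cs <= <F>" using Cons.prems by auto
let ?h = "K.eval (rev cs) l" and ?t = "mon l \<one>.G\<otimes>.KG e"
have h: "?h:<F>" using cc l by (intro K.eval_in_carrier) auto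
have ev: "K.eval (rev (c # cs)) l = ?h\<otimes> l \<oplus> c" using K.eval_append_aux[of "rev cs" c l] cc l by simp
obtain ds where ds: "set ds <= <F>" "length ds = length cs - 1" "length cs >= 2 ==> last ds = last cs"
 "lev e y cs = mon ?h \<one>.G\<otimes>.KG e \<oplus>.KG (y \<ominus>.KG ?t)\<otimes>.KG lev e y ds"
 using Cons.IH[OF cc(2)] by blast
have yt: "y\<otimes>.KG ?t = ?t\<otimes>.KG y"
proof -
 have "y\<otimes>.KG ?t = (y\<otimes>.KG mon l \<one>.G)\<otimes>.KG e" using yc ec l by (simp add: KG.m_assoc)
 also have "... = (mon l \<one>.G\<otimes>.KG y)\<otimes>.KG e" using scalar_central[of y l] yc l by simp
 also have "... = mon l \<one>.G\<otimes>.KG (y\<otimes>.KG e)" using yc ec l by (simp add: KG.m_assoc)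
 also have "... = ?t\<otimes>.KG y" using yc ec l by (simp add: KG.m_assoc)
 finally show ?thesis .
qed
have ts: "?t\<otimes>.KG (mon ?h \<one>.G\<otimes>.KG e) = mon (l\<otimes> ?h) \<one>.G\<otimes>.KG e"
proof -
 have "?t\<otimes>.KG (mon ?h \<one>.G\<otimes>.KG e) = mon l \<one>.G\<otimes>.KG (mon ?h \<one>.G\<otimes>.KG e)\<otimes>.KG e"
  using ec l h scalar_central[of e ?h] by (simp add: KG.m_assoc)
 also have "... = (mon l \<one>.G\<otimes>.KG mon ?h \<one>.G)\<otimes>.KG e" using ec l h by (simp add: KG.m_assoc)
 finally show ?thesis using l h by (simp add: mon_mult)
qed
show ?case
proof (cases "cs = []")
 case True
 thus ?thesis using cc ec yc l by (intro exI[of _ "[]"]) auto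
next
 case False
 let ?D = "lev e y ds"
 have "lev e y (c # cs) = mon c \<one>.G\<otimes>.KG e \<oplus>.KG y\<otimes>.KG (mon ?h \<one>.G\<otimes>.KG e \<oplus>.KG (y \<ominus>.KG ?t)\<otimes>.KG ?D)"
  using ds(4) by simp
 also have "... = (mon c \<one>.G\<otimes>.KG e \<oplus>.KG mon (l\<otimes> ?h) \<one>.G\<otimes>.KG e) \<oplus>.KG (y \<ominus>.KG ?t)\<otimes>.KG lev e y (?h # ds)"
  using KG.synthetic_step[OF _ _ _ _ _ yt, of "mon c \<one>.G\<otimes>.KG e" "mon ?h \<one>.G\<otimes>.KG e" ?D] ts cc h l ec yc ds(1) by simp
 also have "mon c \<one>.G\<otimes>.KG e \<oplus>.KG mon (l\<otimes> ?h) \<one>.G\<otimes>.KG e = mon (K.eval (rev (c # cs)) l) \<one>.G\<otimes>.KG e"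
  unfolding ev using cc h l ec by (simp add: KG.l_distr[symmetric] mon_add K.a_comm K.m_comm)
 finally have c2: "lev e y (c # cs) = mon (K.eval (rev (c # cs)) l) \<one>.G\<otimes>.KG e \<oplus>.KG (y \<ominus>.KG ?t)\<otimes>.KG lev e y (?h # ds)" .
 show ?thesis
 proof (cases "length cs >= 2")
  case True
  thus ?thesis using ds False h c2 by (intro exI[of _ "?h # ds"]) auto
 next
  case short: False
  then obtain c' where c': "cs = [c']" using False by (cases cs; cases "tl cs") auto
  hence "?h = c'" using cc by simp
  thus ?thesis using ds c' h c2 by (intro exI[of _ "?h # ds"]) auto
 qed
qed
qed

text \<open>Take a shortest nonzero polynomial annihilating y and a root l of it in F. If y - l e
  were invertible in the local corner, the quotient by it would be a shorter one. Hence y is a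
  scalar plus a nilpotent element.\<close>

lemma residue:
 assumes e: "KG.prim e" and y: "y:KG.corner e e"
 shows "EX l:<F>. KG.nilp (y \<ominus>.KG mon l \<one>.G\<otimes>.KG e)"
proof -
note ep = KG.prim_idem[OF e] and yc = KG.cornerD[OF y]
define Q where "Q n = (EX cs. length cs = n & set cs <= <F> & cs ~= [] & last cs ~= \<zero> & lev e y cs = \<zero>.KG)" for n
have "~ inj (%n::nat. y [^].KG n)" using finite_powers[OF yc(1)] finite_imageD by blast
then obtain i j :: nat where ij: "i < j" "y [^].KG i = y [^].KG j" unfolding inj_def by (metis linorder_neqE_nat)
let ?m = "j - i - 1"
have rz: "set (replicate m \<zero>) <= <F>" for m by (simp add: set_replicate_conv_if)
\<comment> \<open>The polynomial X^j - X^i.\<close>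
let ?cs = "replicate i \<zero> @ (\<ominus> \<one>) # (replicate ?m \<zero> @ [\<one>])"
have "lev e y ?cs = y [^].KG i\<otimes>.KG (mon (\<ominus> \<one>) \<one>.G\<otimes>.KG e \<oplus>.KG y\<otimes>.KG (y [^].KG ?m\<otimes>.KG e))"
 using lev_replicate_zero[OF ep(3) yc(1), of "(\<ominus> \<one>) # (replicate ?m \<zero> @ [\<one>])" i] lev_replicate_zero[OF ep(3) yc(1), of "[\<one>]" ?m] ep yc rz by (auto simp: gr_one[symmetric])
also have "mon (\<ominus> \<one>) \<one>.G\<otimes>.KG e = \<ominus>.KG e"
proof -
 have "mon (\<ominus> \<one>) \<one>.G \<oplus>.KG \<one>.KG = mon \<zero> \<one>.G" using mon_add[of "\<ominus> \<one>" \<one> "\<one>.G"] by (simp add: gr_one K.l_neg)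
 also have "... = \<zero>.KG" by (intro gr_eqI) (auto simp: mon_at gr_zero_at)
 finally have "mon (\<ominus> \<one>) \<one>.G = \<ominus>.KG \<one>.KG" using KG.minus_equality by simp
 thus ?thesis using ep by (simp add: KG.l_minus)
qed
also have "y [^].KG i\<otimes>.KG (\<ominus>.KG e \<oplus>.KG y\<otimes>.KG (y [^].KG ?m\<otimes>.KG e))
  = \<ominus>.KG (y [^].KG i\<otimes>.KG e) \<oplus>.KG (y [^].KG i\<otimes>.KG y [^].KG Suc ?m)\<otimes>.KG e"
 using ep yc KG.nat_pow_Suc2[of y ?m] by (simp add: KG.r_distr KG.r_minus KG.m_assoc del: KG.nat_pow_Suc)
also have "y [^].KG i\<otimes>.KG y [^].KG Suc ?m = y [^].KG j"
 using ij(1) KG.nat_pow_mult[OF yc(1), of i "Suc ?m"] by simp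
finally have "lev e y ?cs = \<zero>.KG" using ij ep yc by (simp add: KG.l_neg)
hence "Q (length ?cs)" unfolding Q_def by (intro exI[of _ ?cs]) auto
then obtain n where n: "Q n" "!!l. l < n ==> ~ Q l" using exists_least_iff[of Q] by blast
obtain cs where cs: "length cs = n" "set cs <= <F>" "cs ~= []" "last cs ~= \<zero>" "lev e y cs = \<zero>.KG"
 using n(1) unfolding Q_def by blast
\<comment> \<open>A nonzero constant c gives c e, which is not zero; so the polynomial has positive
  degree and hence a root.\<close>
have n2: "n >= 2"
proof (rule ccontr)
 assume "~ n >= 2"
 then obtain c where c: "cs = [c]" using cs(1,3) by (cases cs; cases "tl cs") auto
 hence "mon c \<one>.G\<otimes>.KG e = mon \<zero> \<one>.G\<otimes>.KG e"
  using cs(2,5) ep yc scalar_mult_at[of e \<zero>] gr_at[OF ep(3)] by (auto intro!: gr_eqI simp: gr_zero_at)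
 hence "c = \<zero>" using scalar_idem_cancel[OF ep(3,2)] c cs(2) by auto
 thus False using c cs(4) by simp
qed
have P: "rev cs:carrier (poly_ring F)" using cs by (auto simp: univ_poly_carrier[symmetric] polynomial_def hd_rev)
have "size (roots (rev cs)) = length cs - 1" using roots_over_carrier[OF P] unfolding splitted_def by simp
then obtain l where "l:# roots (rev cs)" using n2 cs(1) by (metis multiset_nonemptyE size_empty One_nat_def diff_is_0_eq not_less_eq_eq numeral_2_eq_2)
hence l: "l:<F>" "K.eval (rev cs) l = \<zero>" using roots_mem_iff_is_root[OF P] unfolding is_root_def by auto
obtain ds where ds: "set ds <= <F>" "length ds = length cs - 1" "length cs >= 2 ==> last ds = last cs"
 "lev e y cs = mon (K.eval (rev cs) l) \<one>.G\<otimes>.KG e \<oplus>.KG (y \<ominus>.KG mon l \<one>.G\<otimes>.KG e)\<otimes>.KG lev e y ds"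
 using lev_synthetic[OF ep(1) y l(1) cs(2)] by blast
let ?z = "y \<ominus>.KG mon l \<one>.G\<otimes>.KG e"
have te: "mon l \<one>.G\<otimes>.KG e:KG.corner e e"
 using ep l scalar_central[of e l] by (auto simp: KG.corner_def KG.m_assoc) (metis KG.m_assoc mon_closed)
have zc: "?z:KG.corner e e" unfolding a_minus_def using KG.corner_add KG.corner_neg ep y te by meson
have "mon \<zero> \<one>.G = \<zero>.KG" by (intro gr_eqI) (auto simp: mon_at gr_zero_at)
hence zD: "?z\<otimes>.KG lev e y ds = \<zero>.KG" using ds(1,4) l cs(5) ep yc by simp
have "~ Q (length ds)" using n(2) ds(2) cs(1) n2 by simp
hence D0: "lev e y ds ~= \<zero>.KG" using ds n2 cs by (auto simp: Q_def)
have "KG.nilp ?z"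
proof (rule ccontr)
 assume "~ KG.nilp ?z"
 then obtain u where u: "u:KG.corner e e" "u\<otimes>.KG ?z = e" using KG.prim_local[OF e zc] by blast
 have "e\<otimes>.KG lev e y ds = u\<otimes>.KG (?z\<otimes>.KG lev e y ds)"
  using u KG.cornerD(1)[OF u(1)] KG.cornerD(1)[OF zc] ds(1) ep yc by (metis KG.m_assoc lev_closed)
 also have "... = \<zero>.KG" using zD KG.cornerD(1)[OF u(1)] by simp
 also have "e\<otimes>.KG lev e y ds = lev e y ds"
 proof (cases ds)
  case (Cons c cs')
  hence c: "c:<F>" "set cs' <= <F>" using ds by auto
  have "e\<otimes>.KG (mon c \<one>.G\<otimes>.KG e) = mon c \<one>.G\<otimes>.KG e"
   using scalar_central[of e c] ep c by (metis KG.m_assoc mon_closed)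
  moreover have "e\<otimes>.KG (y\<otimes>.KG lev e y cs') = y\<otimes>.KG lev e y cs'"
   using ep c yc by (metis KG.m_assoc lev_closed)
  ultimately show ?thesis using Cons c ep yc by (simp add: KG.r_distr)
 qed (use ep in simp)
 finally show False using D0 by simp
qed
thus ?thesis using l by blast
qed
end

section \<open>Simple modules over the closure and their characters\<close>

lemma (in group_algebra) scalar_restriction_simps [simp]:
 "carrier (res K G V) = <V>" "ring.add (res K G V) = ring.add V"
 "ring.zero (res K G V) = ring.zero V" "finsum (res K G V) = finsum V"
 "smult (res K G V) l x = mon l \<one>.G\<odot>.V x"
 by (auto simp: scalar_restriction_def finsum_def finprod_def fun_eq_iff)

lemma (in group_algebra) scalar_left_module_hom:
 assumes "left_module KG V" "a:<KG>"
 shows "(%x. a\<odot>.V x):lmod_hom K (res K G V) (res K G V)"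
proof -
interpret V: left_module KG V by fact
show ?thesis using assms(2) scalar_central[OF assms(2)]
 by (auto simp: lmod_hom_def V.lsmult_closed V.lsmult_r_distr V.lsmult_assoc[symmetric])
qed

lemma (in group_algebra) cyclic_fin_basis:
 assumes "left_module KG V" "v:<V>" "<V> <= (%a. a\<odot>.V v) ` <KG>"
 shows "EX B. fin_basis K (res K G V) B"
proof -
interpret V: left_module KG V by fact
interpret W: vector_space K "res K G V" using vs_res[OF assms(1)] .
define S where "S = (%g. mon \<one> g\<odot>.V v) ` <G>"
have S: "finite S" "S <= carrier (res K G V)" using finite_G assms(2) V.lsmult_closed by (auto simp: S_def)
have "EX c:S -> <K>. a\<odot>.V v = W.lin_comb S c" if "a:<KG>" for a using that
proof (induction a rule: gr_induct)
 case (mon l g)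
 let ?w = "mon \<one> g\<odot>.V v" let ?c = "%u. if u = ?w then l else \<zero>"
 have w: "?w:S" "?w:<V>" using mon S by (auto simp: S_def)
 have uc: "u:<V>" if "u:S" for u using that S by auto
 have "W.lin_comb S ?c = (\<Oplus>.V u\<in>S. if u = ?w then mon l \<one>.G\<odot>.V u else \<zero>.V)"
  unfolding scalar_restriction_simps using mon(1) uc V.lsmult_closed W.lsmult_l_null
  by (intro V.M.finsum_cong') auto
 also have "... = mon l \<one>.G\<odot>.V ?w" using w mon(1) S V.lsmult_closed by (intro V.M.finsum_delta) auto
 also have "... = mon l g\<odot>.V v" using mon assms(2) by (simp add: V.lsmult_assoc[symmetric] mon_mult)
 finally show ?case using mon(1) by (intro bexI[of _ ?c]) auto
next
 case (add a b)
 then obtain c d where cd: "c:S -> <K>" "d:S -> <K>"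
  "a\<odot>.V v = W.lin_comb S c" "b\<odot>.V v = W.lin_comb S d" by blast
 hence "(a \<oplus>.KG b)\<odot>.V v = W.lin_comb S (%u. c u \<oplus> d u)"
  using W.lin_comb_add[OF S(2) cd(1,2)] add assms(2) by (simp add: V.lsmult_l_distr)
 thus ?case using cd(1,2) by (intro bexI[of _ "%u. c u \<oplus> d u"]) auto
qed
hence "EX c:S -> <K>. x = W.lin_comb S c" if "x:carrier (res K G V)" for x using that assms(3) by auto
thus ?thesis using W.exists_fin_basis[OF S] by blast
qed

context closure_group_algebra
begin

text \<open>The linear extension of c to the group algebra; for the character of V it is the trace
  of the action of a (\<open>pair_character\<close>).\<close>

definition pair :: "('g => 'f) => ('g => 'f) => 'f" where
 "pair c a = (\<Oplus>g\<in><G>. a g\<otimes> c g)"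

text \<open>The radical of the form (a, x) -> c(a x). It depends on the character only, yet for a
  simple module it is the annihilator of the module (\<open>Ann_character\<close>).\<close>

definition Ann :: "('g => 'f) => ('g => 'f) set" where
 "Ann c = {a:<KG>. ALL x:<KG>. pair c (a\<otimes>.KG x) = \<zero>}"

lemma pair_add:
 assumes "c:<G> -> <F>" "a:<KG>" "b:<KG>"
 shows "pair c (a \<oplus>.KG b) = pair c a \<oplus> pair c b"
proof -
have "pair c (a \<oplus>.KG b) = (\<Oplus>g\<in><G>. a g\<otimes> c g \<oplus> b g\<otimes> c g)"
 unfolding pair_def using assms gr_at by (intro K.finsum_cong') (auto simp: gr_add_at K.l_distr Pi_iff)
also have "... = pair c a \<oplus> pair c b" unfolding pair_def using assms gr_at by (intro K.finsum_addf) auto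
finally show ?thesis .
qed

lemma pair_mon:
 assumes "c:<G> -> <F>" "l:<F>" "g:<G>"
 shows "pair c (mon l g) = l\<otimes> c g"
proof -
have "pair c (mon l g) = (\<Oplus>h\<in><G>. if h = g then l\<otimes> c h else \<zero>)"
 unfolding pair_def using assms by (intro K.finsum_cong') (auto simp: mon_at Pi_iff)
also have "... = l\<otimes> c g" using assms finite_G by (intro K.finsum_delta) auto
finally show ?thesis .
qed

lemma character_closed:
 assumes "left_module KG V" "fin_basis F (res F G V) B"
 shows "character F G V:<G> \<rightarrow>\<^sub>E <F>"
  "!!g. g:<G> ==> character F G V g
   = (\<Oplus>v\<in>B. coordinates F (res F G V) B (mon \<one> g\<odot>.V v) v)"
proof -
interpret V: left_module KG V by fact
interpret W: vector_space F "res F G V" using vs_res[OF assms(1)] .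
note B = W.fin_basisD[OF assms(2)]
show e: "character F G V g = (\<Oplus>v\<in>B. coordinates F (res F G V) B (mon \<one> g\<odot>.V v) v)"
 if "g:<G>" for g
 using that W.trace_of_eq[OF scalar_left_module_hom[OF assms(1)] assms(2)] by (simp add: character_def)
have "(\<Oplus>v\<in>B. coordinates F (res F G V) B (mon \<one> g\<odot>.V v) v):<F>" if "g:<G>" for g
 using W.coordinates_closed[OF assms(2)] B V.lsmult_closed by (intro K.finsum_closed) auto
thus "character F G V:<G> \<rightarrow>\<^sub>E <F>" using e by (auto simp: character_def)
qed

lemma pair_character:
 assumes "left_module KG V" "fin_basis F (res F G V) B" "a:<KG>"
 shows "pair (character F G V) a = (\<Oplus>v\<in>B. coordinates F (res F G V) B (a\<odot>.V v) v)" using assms(3)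
proof (induction a rule: gr_induct)
interpret V: left_module KG V by fact
interpret W: vector_space F "res F G V" using vs_res[OF assms(1)] .
note B = W.fin_basisD[OF assms(2)] and cc = W.coordinates_closed[OF assms(2)]
have Bc: "v:<V>" if "v:B" for v using B that by auto
note ch = character_closed[OF assms(1,2)]
have chc: "character F G V:<G> -> <F>" using ch(1) by auto
{ case (mon l g)
 have "(\<Oplus>v\<in>B. coordinates F (res F G V) B (mon l g\<odot>.V v) v)
   = (\<Oplus>v\<in>B. l\<otimes> coordinates F (res F G V) B (mon \<one> g\<odot>.V v) v)"
 proof (rule K.finsum_cong')
  fix v assume v: "v:B"
  have "mon l g\<odot>.V v = mon l \<one>.G\<odot>.V (mon \<one> g\<odot>.V v)"
   using mon Bc[OF v] by (simp add: V.lsmult_assoc[symmetric] mon_mult)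
  thus "coordinates F (res F G V) B (mon l g\<odot>.V v) v
    = l\<otimes> coordinates F (res F G V) B (mon \<one> g\<odot>.V v) v"
   using W.coordinates_smult[OF assms(2), of "mon \<one> g\<odot>.V v" l v] mon v Bc[OF v] V.lsmult_closed by auto
 qed (use mon cc Bc V.lsmult_closed in auto)
 also have "... = l\<otimes> character F G V g"
  using ch(2)[OF mon(2)] mon cc Bc V.lsmult_closed B(1) by (simp add: K.finsum_rdistr)
 finally show ?case using pair_mon[OF chc mon] by simp }
{ case (add a b)
 have "(\<Oplus>v\<in>B. coordinates F (res F G V) B ((a \<oplus>.KG b)\<odot>.V v) v)
   = (\<Oplus>v\<in>B. coordinates F (res F G V) B (a\<odot>.V v) v
    \<oplus> coordinates F (res F G V) B (b\<odot>.V v) v)"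
  using W.coordinates_add[OF assms(2)] add(1,2) cc Bc V.lsmult_closed
  by (intro K.finsum_cong') (auto simp: V.lsmult_l_distr)
 also have "... = pair (character F G V) a \<oplus> pair (character F G V) b"
  unfolding add(3,4) using add(1,2) cc Bc V.lsmult_closed by (intro K.finsum_addf) auto
 finally show ?case using pair_add[OF chc add(1,2)] by simp }
qed

text \<open>For primitive e, the image of y in the residue field F of the local corner.\<close>

definition resid where
 "resid e y = (SOME l. l:<F> & KG.nilp (y \<ominus>.KG mon l \<one>.G\<otimes>.KG e))"

context
 fixes e assumes e: "KG.prim e"
begin

lemma scalar_corner: "l:<F> ==> mon l \<one>.G\<otimes>.KG e:KG.corner e e"
 using KG.prim_idem[OF e] scalar_central[of e l] by (auto simp: KG.corner_def KG.m_assoc) (metis KG.m_assoc mon_closed)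

lemma scalar_corner_mult:
 assumes "l:<F>" "y:KG.corner e e"
 shows "(mon l \<one>.G\<otimes>.KG e)\<otimes>.KG y = mon l \<one>.G\<otimes>.KG y"
 using assms KG.prim_idem[OF e] KG.cornerD[OF assms(2)] by (simp add: KG.m_assoc)

lemma nilp_scale:
 assumes "l:<F>" "y:KG.corner e e" "KG.nilp y"
 shows "KG.nilp (mon l \<one>.G\<otimes>.KG y)"
 using KG.nilp_mult[OF e assms(2) scalar_corner[OF assms(1)] assms(3)] scalar_corner_mult[OF assms(1,2)] by simp

lemma scalar_neg: "l:<F> ==> mon (\<ominus> l) \<one>.G = \<ominus>.KG mon l \<one>.G"
proof -
assume l: "l:<F>"
have "mon (\<ominus> l) \<one>.G \<oplus>.KG mon l \<one>.G = mon \<zero> \<one>.G" using l mon_add[of "\<ominus> l" l] by (simp add: K.l_neg)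
also have "... = \<zero>.KG" by (intro gr_eqI) (auto simp: mon_at gr_zero_at)
finally show ?thesis using KG.minus_equality[of "mon (\<ominus> l) \<one>.G" "mon l \<one>.G"] l by simp
qed

lemma nilp_neg: "y:KG.corner e e ==> KG.nilp y ==> KG.nilp (\<ominus>.KG y)"
 using nilp_scale[of "\<ominus> \<one>" y] scalar_neg[of \<one>] KG.cornerD[of y e e] by (simp add: gr_one[symmetric] KG.l_minus)

lemma resid:
 assumes "y:KG.corner e e"
 shows "resid e y:<F>" "KG.nilp (y \<ominus>.KG mon (resid e y) \<one>.G\<otimes>.KG e)"
 using someI_ex[of "%l. l:<F> & KG.nilp (y \<ominus>.KG mon l \<one>.G\<otimes>.KG e)"] residue[OF e assms]
 unfolding resid_def by auto

lemma resid_diff_corner: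
 assumes "y:KG.corner e e" "l:<F>"
 shows "y \<ominus>.KG mon l \<one>.G\<otimes>.KG e:KG.corner e e"
 unfolding a_minus_def using KG.corner_add KG.corner_neg assms scalar_corner KG.prim_idem[OF e] by meson

lemma nilp_scalar_zero:
 assumes "l:<F>" "KG.nilp (mon l \<one>.G\<otimes>.KG e)"
 shows "l = \<zero>"
proof (rule ccontr)
note ep = KG.prim_idem[OF e]
assume "l ~= \<zero>"
hence i: "inv l:<F>" "inv l\<otimes> l = \<one>" using assms(1) by (auto simp: K.field_Units)
have "mon (inv l) \<one>.G\<otimes>.KG (mon l \<one>.G\<otimes>.KG e) = e"
 using i ep assms(1) by (simp add: KG.m_assoc[symmetric] mon_mult gr_one[symmetric])
thus False using KG.nilp_not_unit[OF ep(1,2) scalar_corner[OF assms(1)], of "mon (inv l) \<one>.G"] i assms by auto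
qed

text \<open>The difference of the two scalars, times e, is a difference of nilpotent elements of a
  local corner, hence nilpotent, so the scalar is zero.\<close>

lemma resid_unique:
 assumes y: "y:KG.corner e e" and l: "l:<F>" and n: "KG.nilp (y \<ominus>.KG mon l \<one>.G\<otimes>.KG e)"
 shows "resid e y = l"
proof -
note r = resid[OF y] and ep = KG.prim_idem[OF e]
let ?r = "resid e y" let ?t = "%l. mon l \<one>.G\<otimes>.KG e"
have c: "y:<KG>" "?t l:<KG>" "?t ?r:<KG>" using KG.cornerD(1)[OF y] l r ep by auto
have "KG.nilp ((y \<ominus>.KG ?t l) \<oplus>.KG (\<ominus>.KG (y \<ominus>.KG ?t ?r)))"
 using KG.nilp_add[OF e] nilp_neg resid_diff_corner[OF y] l r n KG.corner_neg ep by meson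
also have "(y \<ominus>.KG ?t l) \<oplus>.KG (\<ominus>.KG (y \<ominus>.KG ?t ?r)) = ?t ?r \<ominus>.KG ?t l"
 using c by (simp add: a_minus_def KG.minus_add KG.a_ac KG.r_neg2)
also have "... = ?t (?r \<ominus> l)"
 using l r(1) ep by (simp add: a_minus_def scalar_neg mon_add[symmetric] KG.l_distr KG.l_minus)
finally have "?r \<ominus> l = \<zero>" using nilp_scalar_zero[of "?r \<ominus> l"] l r(1) by auto
thus ?thesis using l r(1) by simp
qed

lemma resid_nilp: "y:KG.corner e e ==> KG.nilp y ==> resid e y = \<zero>"
proof -
assume y: "y:KG.corner e e" "KG.nilp y"
have "mon \<zero> \<one>.G = \<zero>.KG" by (intro gr_eqI) (auto simp: mon_at gr_zero_at)
thus ?thesis using y KG.prim_idem[OF e] KG.cornerD(1)[OF y(1)] by (intro resid_unique) (auto simp: a_minus_def)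
qed

lemma resid_self: "resid e e = \<one>"
proof -
note ep = KG.prim_idem[OF e]
have "e:KG.corner e e" using ep by (simp add: KG.corner_def)
moreover have "KG.nilp \<zero>.KG" unfolding KG.nilp_def by (intro exI[of _ 1]) simp
ultimately show ?thesis using ep by (intro resid_unique) (auto simp: gr_one[symmetric] a_minus_def KG.r_neg)
qed

lemma resid_add:
 assumes x: "x:KG.corner e e" and y: "y:KG.corner e e"
 shows "resid e (x \<oplus>.KG y) = resid e x \<oplus> resid e y"
proof (rule resid_unique)
note ep = KG.prim_idem[OF e] and r = resid[OF x] resid[OF y]
let ?t = "%l. mon l \<one>.G\<otimes>.KG e"
have c: "x:<KG>" "y:<KG>" "?t (resid e x):<KG>" "?t (resid e y):<KG>"
 using KG.cornerD(1)[OF x] KG.cornerD(1)[OF y] r ep by auto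
show "x \<oplus>.KG y:KG.corner e e" using KG.corner_add x y ep by blast
have "KG.nilp ((x \<ominus>.KG ?t (resid e x)) \<oplus>.KG (y \<ominus>.KG ?t (resid e y)))"
 using KG.nilp_add[OF e] resid_diff_corner x y r by blast
also have "(x \<ominus>.KG ?t (resid e x)) \<oplus>.KG (y \<ominus>.KG ?t (resid e y))
  = (x \<oplus>.KG y) \<ominus>.KG ?t (resid e x \<oplus> resid e y)"
 using c r ep by (simp add: a_minus_def mon_add[symmetric] KG.l_distr KG.minus_add KG.a_ac)
finally show "KG.nilp ((x \<oplus>.KG y) \<ominus>.KG ?t (resid e x \<oplus> resid e y))" .
qed (use resid x y in auto)

lemma resid_scale:
 assumes y: "y:KG.corner e e" and l: "l:<F>"
 shows "resid e (mon l \<one>.G\<otimes>.KG y) = l\<otimes> resid e y"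
proof (rule resid_unique)
note ep = KG.prim_idem[OF e] and r = resid[OF y] and yc = KG.cornerD[OF y]
show "mon l \<one>.G\<otimes>.KG y:KG.corner e e"
 using KG.corner_mult[OF ep(3,3) scalar_corner[OF l] y] scalar_corner_mult[OF l y] by simp
have "KG.nilp (mon l \<one>.G\<otimes>.KG (y \<ominus>.KG mon (resid e y) \<one>.G\<otimes>.KG e))"
 using nilp_scale[OF l resid_diff_corner[OF y r(1)] r(2)] .
also have "mon l \<one>.G\<otimes>.KG (y \<ominus>.KG mon (resid e y) \<one>.G\<otimes>.KG e)
  = mon l \<one>.G\<otimes>.KG y \<ominus>.KG mon (l\<otimes> resid e y) \<one>.G\<otimes>.KG e"
 using l r(1) yc ep by (simp add: a_minus_def KG.r_distr KG.r_minus KG.m_assoc[symmetric] mon_mult)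
finally show "KG.nilp (mon l \<one>.G\<otimes>.KG y \<ominus>.KG mon (l\<otimes> resid e y) \<one>.G\<otimes>.KG e)" .
qed (use resid[OF y] l in auto)

text \<open>If n v were nonzero, simplicity would give a with a n v = v, and the nilpotent element
  (e a e) n would fix v.\<close>

lemma nilp_kills:
 assumes V: "simple_module KG V" and v: "v:<V>" "e\<odot>.V v = v" and n: "n:KG.corner e e" "KG.nilp n"
 shows "n\<odot>.V v = \<zero>.V"
proof (rule ccontr)
interpret V: left_module KG V using V by (simp add: simple_module_def)
note ep = KG.prim_idem[OF e] and nc = KG.cornerD[OF n(1)]
assume nz: "n\<odot>.V v ~= \<zero>.V"
obtain a where a: "a:<KG>" "a\<odot>.V (n\<odot>.V v) = v"
 using V.simple_cyclic[OF V _ nz v(1)] V.lsmult_closed nc v by blast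
let ?y = "(e\<otimes>.KG a\<otimes>.KG e)\<otimes>.KG n"
have "e\<otimes>.KG a\<otimes>.KG e:KG.corner e e" using KG.corner_sandwich ep a by blast
hence "KG.nilp ?y" using KG.nilp_mult[OF e n(1) _ n(2)] by blast
moreover have yc: "?y:<KG>" using a ep nc by simp
have "?y = (e\<otimes>.KG a)\<otimes>.KG n" using a ep nc by (simp add: KG.m_assoc)
hence "?y\<odot>.V v = v" using a nc v ep V.lsmult_closed by (simp add: V.lsmult_assoc)
hence "?y [^].KG i\<odot>.V v = v" for i :: nat
 by (induction i) (use yc v in \<open>auto simp: V.lsmult_assoc V.lsmult_one\<close>)
ultimately have "\<zero>.KG\<odot>.V v = v" unfolding KG.nilp_def by metis
thus False using nz nc v by auto
qed

text \<open>The scalar part of y acts as a scalar and the nilpotent part kills v. By cyclicity of V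
  this makes e V the line through v.\<close>

lemma corner_acts:
 assumes V: "simple_module KG V" and v: "v:<V>" "e\<odot>.V v = v" and y: "y:KG.corner e e"
 shows "y\<odot>.V v = mon (resid e y) \<one>.G\<odot>.V v"
proof -
interpret V: left_module KG V using V by (simp add: simple_module_def)
note ep = KG.prim_idem[OF e] and yc = KG.cornerD[OF y] and r = resid[OF y]
let ?t = "mon (resid e y) \<one>.G\<otimes>.KG e"
have c: "?t:<KG>" "y \<ominus>.KG ?t:<KG>" using r ep yc by auto
have "y = (y \<ominus>.KG ?t) \<oplus>.KG ?t" using c yc by (simp add: a_minus_def KG.a_assoc KG.l_neg)
hence "y\<odot>.V v = (y \<ominus>.KG ?t)\<odot>.V v \<oplus>.V ?t\<odot>.V v" using c v V.lsmult_l_distr by metis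
also have "... = ?t\<odot>.V v"
 using nilp_kills[OF V v resid_diff_corner[OF y r(1)] r(2)] c v V.lsmult_closed by simp
also have "... = mon (resid e y) \<one>.G\<odot>.V v" using r ep v by (simp add: V.lsmult_assoc)
finally show ?thesis .
qed
end

lemma scalar_act_inj:
 assumes "left_module KG V" "v:<V>" "v ~= \<zero>.V" "c:<F>" "mon c \<one>.G\<odot>.V v = \<zero>.V"
 shows "c = \<zero>"
proof (rule ccontr)
interpret V: left_module KG V by fact
assume "c ~= \<zero>"
hence i: "inv c:<F>" "inv c\<otimes> c = \<one>" using assms(4) by (auto simp: K.field_Units)
have "mon (inv c) \<one>.G\<odot>.V (mon c \<one>.G\<odot>.V v) = v"
 using i assms(2,4) by (simp add: V.lsmult_assoc[symmetric] mon_mult gr_one[symmetric] V.lsmult_one)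
thus False using assms i by simp
qed
end

lemma (in abelian_group) add_minus_eq_zero_iff:
 "x:<G> ==> y:<G> ==> x \<oplus> \<ominus> y = \<zero> <-> x = y" by (metis a_inv_closed minus_equality r_neg)

context closure_group_algebra
begin

lemma simple_lm: "simple_module KG V ==> left_module KG V" by (simp add: simple_module_def)

lemma simple_fin_basis:
 assumes "simple_module KG V"
 shows "EX B. fin_basis F (res F G V) B"
proof -
interpret V: left_module KG V using assms simple_lm by blast
obtain v where v: "v:<V>" "v ~= \<zero>.V" using assms unfolding simple_module_def by blast
have "<V> <= (%a. a\<odot>.V v) ` <KG>"
proof
 fix w assume "w:<V>"
 then obtain a where "a:<KG>" "a\<odot>.V v = w" using V.simple_cyclic[OF assms v] by blast
 thus "w:(%a. a\<odot>.V v) ` <KG>" by blast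
qed
thus ?thesis using cyclic_fin_basis[OF simple_lm[OF assms] v(1)] by blast
qed

lemma simple_prim:
 assumes "simple_module KG V" "KG.idem i" "u:<V>" "i\<odot>.V u ~= \<zero>.V"
 obtains e v where "KG.prim e" "e:KG.corner i i" "v:<V>" "v ~= \<zero>.V" "e\<odot>.V v = v"
proof -
interpret V: left_module KG V using assms simple_lm by blast
obtain I where I: "finite I" "ALL e:I. KG.prim e & e:KG.corner i i" "i = (\<Oplus>.KG e\<in>I. e)"
 using KG.prim_decomposition[OF assms(2)] by blast
have Ic: "e:<KG>" "e\<otimes>.KG e = e" if "e:I" for e using I(2) that KG.prim_idem by auto
have "i\<odot>.V u = (\<Oplus>.V e\<in>I. e\<odot>.V u)"
 using V.lsmult_finsum_l[of "%e. e" I u] Ic(1) assms(3) I(3) by auto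
then obtain e where e: "e:I" "e\<odot>.V u ~= \<zero>.V"
 using assms(4) V.M.finsum_zero_eq[of I "%e. e\<odot>.V u"] by auto
show ?thesis
 using that[of e "e\<odot>.V u"] e I(2) Ic[OF e(1)] assms(3) V.lsmult_closed by (auto simp: V.lsmult_assoc[symmetric])
qed

lemma pair_rank_one:
 assumes V: "simple_module KG V" and a: "a:<KG>" and w: "w:<V>"
  and l: "!!u. u:<V> ==> l u:<F>" "!!u. u:<V> ==> a\<odot>.V u = mon (l u) \<one>.G\<odot>.V w"
  and add: "!!x y. x:<V> ==> y:<V> ==> l (x \<oplus>.V y) = l x \<oplus> l y"
  and sm: "!!c x. c:<F> ==> x:<V> ==> l (mon c \<one>.G\<odot>.V x) = c\<otimes> l x"
 shows "pair (character F G V) a = l w"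
proof -
note lm = simple_lm[OF V]
interpret V: left_module KG V by (rule lm)
interpret W: vector_space F "res F G V" using vs_res[OF lm] .
obtain B where B: "fin_basis F (res F G V) B" using simple_fin_basis[OF V] by blast
have Bc: "v:<V>" if "v:B" for v using W.fin_basisD[OF B] that by auto
have "pair (character F G V) a = (\<Oplus>v\<in>B. coordinates F (res F G V) B (a\<odot>.V v) v)"
 using pair_character[OF lm B a] .
also have "... = (\<Oplus>v\<in>B. coordinates F (res F G V) B (mon (l v) \<one>.G\<odot>.V w) v)"
 using l Bc W.coordinates_closed[OF B] V.lsmult_closed w by (intro K.finsum_cong') auto
also have "... = l w" using W.trace_rank_one[OF B, of w l] w l add sm by auto
finally show ?thesis .
qed

text \<open>As e V is the line through v, this is the linear form sending u to the coordinate of e u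
  on that line.\<close>

definition lam where
 "lam V e v u = (THE c. c:<F> & e\<odot>.V u = mon c \<one>.G\<odot>.V v)"

lemma scalar_act_cancel:
 assumes "left_module KG V" "v:<V>" "v ~= \<zero>.V" "c:<F>" "d:<F>"
  "mon c \<one>.G\<odot>.V v = mon d \<one>.G\<odot>.V v"
 shows "c = d"
proof -
interpret V: left_module KG V by fact
have "mon (c \<ominus> d) \<one>.G\<odot>.V v \<oplus>.V mon d \<one>.G\<odot>.V v = mon c \<one>.G\<odot>.V v"
 using assms(2,4,5) by (simp add: V.lsmult_l_distr[symmetric] mon_add a_minus_def K.a_assoc K.l_neg)
hence "mon (c \<ominus> d) \<one>.G\<odot>.V v = \<zero>.V" using assms V.lsmult_closed by auto
hence "c \<ominus> d = \<zero>" using scalar_act_inj[OF assms(1-3)] assms(4,5) by simp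
thus ?thesis using assms(4,5) by simp
qed

lemma lam:
 assumes "simple_module KG V" "KG.prim e" "v:<V>" "v ~= \<zero>.V" "e\<odot>.V v = v" "u:<V>"
 shows "lam V e v u:<F>" "e\<odot>.V u = mon (lam V e v u) \<one>.G\<odot>.V v"
proof -
note lm = simple_lm[OF assms(1)] and ep = KG.prim_idem[OF assms(2)]
interpret V: left_module KG V by (rule lm)
obtain a where a: "a:<KG>" "a\<odot>.V v = u" using V.simple_cyclic[OF assms(1,3,4,6)] by blast
let ?y = "e\<otimes>.KG a\<otimes>.KG e"
have y: "?y:KG.corner e e" using KG.corner_sandwich ep a by blast
have "e\<odot>.V u = ?y\<odot>.V v" using a ep assms(3,5) by (simp add: V.lsmult_assoc)
also have "... = mon (resid e ?y) \<one>.G\<odot>.V v" using corner_acts[OF assms(2,1,3,5) y] .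
finally have ex: "resid e ?y:<F> & e\<odot>.V u = mon (resid e ?y) \<one>.G\<odot>.V v"
 using resid[OF assms(2) y] by simp
hence "EX! c. c:<F> & e\<odot>.V u = mon c \<one>.G\<odot>.V v"
 using scalar_act_cancel[OF lm assms(3,4)] by (intro ex1I[of _ "resid e ?y"]) auto
from theI'[OF this] show "lam V e v u:<F>" "e\<odot>.V u = mon (lam V e v u) \<one>.G\<odot>.V v"
 unfolding lam_def by auto
qed

lemma lam_eqI:
 assumes "simple_module KG V" "KG.prim e" "v:<V>" "v ~= \<zero>.V" "e\<odot>.V v = v" "u:<V>"
  "c:<F>" "e\<odot>.V u = mon c \<one>.G\<odot>.V v"
 shows "lam V e v u = c"
 using scalar_act_cancel[OF simple_lm[OF assms(1)] assms(3,4)] lam[OF assms(1-6)] assms(7,8) by simp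

text \<open>If a u is nonzero, an element x can be built from a primitive idempotent such that a x
  acts with rank one and trace one, so the character detects a. This takes the place of the density
  theorem.\<close>

lemma Ann_character:
 assumes V: "simple_module KG V"
 shows "Ann (character F G V) = {a:<KG>. ALL v:<V>. a\<odot>.V v = \<zero>.V}"
proof -
note lm = simple_lm[OF V]
interpret V: left_module KG V by (rule lm)
interpret W: vector_space F "res F G V" using vs_res[OF lm] .
obtain B where B: "fin_basis F (res F G V) B" using simple_fin_basis[OF V] by blast
have "pair (character F G V) (a\<otimes>.KG x) = \<zero>"
 if "a:<KG>" "ALL v:<V>. a\<odot>.V v = \<zero>.V" "x:<KG>" for a x
 using pair_rank_one[OF V, of "a\<otimes>.KG x" "\<zero>.V" "%_. \<zero>"] that V.lsmult_closed by (auto simp: V.lsmult_assoc)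
moreover have "EX x:<KG>. pair (character F G V) (a\<otimes>.KG x) ~= \<zero>"
 if a: "a:<KG>" and u: "u:<V>" "a\<odot>.V u ~= \<zero>.V" for a u
proof -
 have one: "KG.idem \<one>.KG" by (simp add: KG.idem_def)
 have "u ~= \<zero>.V" using u a by auto
 hence "\<one>.KG\<odot>.V u ~= \<zero>.V" using V.lsmult_one u by simp
 then obtain e v where ev: "KG.prim e" "v:<V>" "v ~= \<zero>.V" "e\<odot>.V v = v"
  using simple_prim[OF V one u(1)] by metis
 note ep = KG.prim_idem[OF ev(1)]
 let ?w = "a\<odot>.V u"
 have w: "?w:<V>" using a u V.lsmult_closed by simp
 obtain y where y: "y:<KG>" "y\<odot>.V v = u" using V.simple_cyclic[OF V ev(2,3) u(1)] by blast
 obtain z where z: "z:<KG>" "z\<odot>.V ?w = v" using V.simple_cyclic[OF V w u(2) ev(2)] by blast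
 define l where "l t = lam V e v (z\<odot>.V t)" for t
 have zc: "z\<odot>.V t:<V>" if "t:<V>" for t using that z V.lsmult_closed by simp
 have l: "l t:<F>" "e\<odot>.V (z\<odot>.V t) = mon (l t) \<one>.G\<odot>.V v" if "t:<V>" for t
  using lam[OF V ev zc[OF that]] unfolding l_def by auto
 \<comment> \<open>Here y sends v to u and z sends \<open>?w\<close> = a u to v, so a
   \<open>?x\<close> acts as t -> l(t) \<open>?w\<close> with l(\<open>?w\<close>) = 1.\<close>
 let ?x = "y\<otimes>.KG e\<otimes>.KG z"
 have "pair (character F G V) (a\<otimes>.KG ?x) = l ?w"
 proof (rule pair_rank_one[OF V])
  fix t assume t: "t:<V>"
  have "(a\<otimes>.KG ?x)\<odot>.V t = (a\<otimes>.KG y)\<odot>.V (e\<odot>.V (z\<odot>.V t))"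
   using a y z t ep V.lsmult_closed by (simp add: V.lsmult_assoc)
  also have "... = ((a\<otimes>.KG y)\<otimes>.KG mon (l t) \<one>.G)\<odot>.V v"
   using l[OF t] a y ev by (simp add: V.lsmult_assoc)
  also have "... = (mon (l t) \<one>.G\<otimes>.KG (a\<otimes>.KG y))\<odot>.V v"
   using scalar_central[of "a\<otimes>.KG y" "l t"] l(1)[OF t] a y by simp
  also have "... = mon (l t) \<one>.G\<odot>.V ?w" using l(1)[OF t] a y ev by (simp add: V.lsmult_assoc)
  finally show "(a\<otimes>.KG ?x)\<odot>.V t = mon (l t) \<one>.G\<odot>.V ?w" .
 next
  fix s t assume st: "s:<V>" "t:<V>"
  show "l (s \<oplus>.V t) = l s \<oplus> l t" unfolding l_def[of "s \<oplus>.V t"] using st l zc z ep ev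
   by (intro lam_eqI[OF V ev]) (auto simp: V.lsmult_r_distr mon_add[symmetric] V.lsmult_l_distr)
 next
  fix c t assume ct: "c:<F>" "t:<V>"
  have "z\<odot>.V (mon c \<one>.G\<odot>.V t) = mon c \<one>.G\<odot>.V (z\<odot>.V t)"
   using ct z scalar_central[OF z(1) ct(1)] by (simp add: V.lsmult_assoc[symmetric])
  hence "e\<odot>.V (z\<odot>.V (mon c \<one>.G\<odot>.V t)) = (e\<otimes>.KG mon c \<one>.G)\<odot>.V (z\<odot>.V t)"
   using ct ep zc by (simp add: V.lsmult_assoc)
  also have "... = mon c \<one>.G\<odot>.V (mon (l t) \<one>.G\<odot>.V v)"
   using ct ep zc l(2)[OF ct(2)] scalar_central[OF ep(3) ct(1)] by (metis V.lsmult_assoc mon_closed)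
  also have "... = mon (c\<otimes> l t) \<one>.G\<odot>.V v"
   using ct l(1)[OF ct(2)] ev by (simp add: V.lsmult_assoc[symmetric] mon_mult)
  finally show "l (mon c \<one>.G\<odot>.V t) = c\<otimes> l t"
   unfolding l_def[of "mon c \<one>.G\<odot>.V t"] using ct l(1)[OF ct(2)] zc V.lsmult_closed
   by (intro lam_eqI[OF V ev]) auto
 qed (use a y z ep w l in auto)
 also have "l ?w = \<one>"
  unfolding l_def using z(2) ev by (intro lam_eqI[OF V ev]) (auto simp: gr_one[symmetric] V.lsmult_one)
 finally show ?thesis using y z ep by (intro bexI[of _ ?x]) auto
qed
ultimately show ?thesis unfolding Ann_def by blast
qed

text \<open>An element b of the algebra kills v exactly if it kills w, because the corner of e acts
  on both vectors by the same residue; so b v -> b w is an isomorphism of V and W.\<close>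

lemma character_eqI:
 assumes V: "simple_module KG V" "v:<V>" "v ~= \<zero>.V" "e\<odot>.V v = v"
  and W: "simple_module KG W" "w:<W>" "w ~= \<zero>.W" "e\<odot>.W w = w" and e: "KG.prim e"
 shows "character F G V = character F G W"
proof -
\<comment> \<open>If b w is nonzero, some c brings it back to w. Then e c b e has residue zero
  because it kills v, although it fixes w.\<close>
have wd: "b\<odot>.W w = \<zero>.W"
 if V: "simple_module KG V" "v:<V>" "v ~= \<zero>.V" "e\<odot>.V v = v"
 and W: "simple_module KG W" "w:<W>" "w ~= \<zero>.W" "e\<odot>.W w = w"
 and b: "b:<KG>" "b\<odot>.V v = \<zero>.V" for b V W v w
proof (rule ccontr)
 interpret V: left_module KG V using V(1) simple_lm by blast
 interpret W: left_module KG W using W(1) simple_lm by blast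
 assume nz: "b\<odot>.W w ~= \<zero>.W"
 obtain c where c: "c:<KG>" "c\<odot>.W (b\<odot>.W w) = w"
  using W.simple_cyclic[OF W(1) _ nz W(2)] W.lsmult_closed b(1) W(2) by blast
 note ep = KG.prim_idem[OF e]
 let ?y = "e\<otimes>.KG (c\<otimes>.KG b)\<otimes>.KG e"
 have y: "?y:KG.corner e e" using KG.corner_sandwich ep c b by simp
 have "?y\<odot>.V v = \<zero>.V" using ep c b V by (simp add: V.lsmult_assoc)
 hence "resid e ?y = \<zero>"
  using corner_acts[OF e V(1,2,4) y] scalar_act_inj[OF simple_lm[OF V(1)] V(2,3) resid(1)[OF e y]] by simp
 moreover have "?y\<odot>.W w = w" using ep c b W by (simp add: W.lsmult_assoc)
 moreover have "mon \<zero> \<one>.G = \<zero>.KG" by (intro gr_eqI) (auto simp: mon_at gr_zero_at)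
 ultimately have "w = \<zero>.W" using corner_acts[OF e W(1,2,4) y] W(2) by simp
 thus False using W(3) by simp
qed
note lV = simple_lm[OF V(1)] and lW = simple_lm[OF W(1)]
interpret V: left_module KG V by (rule lV)
interpret W: left_module KG W by (rule lW)
interpret rV: vector_space F "res F G V" using vs_res[OF lV] .
interpret rW: vector_space F "res F G W" using vs_res[OF lW] .
define h where "h u = (SOME b. b:<KG> & b\<odot>.V v = u)\<odot>.W w" for u
have eq: "b\<odot>.W w = c\<odot>.W w <-> b\<odot>.V v = c\<odot>.V v" if "b:<KG>" "c:<KG>" for b c
proof -
 have d: "b \<ominus>.KG c:<KG>" using that by simp
 have "(b \<ominus>.KG c)\<odot>.V v = \<zero>.V <-> b\<odot>.V v = c\<odot>.V v"
  using that V(2) V.lsmult_closed V.M.add_minus_eq_zero_iff[of "b\<odot>.V v" "c\<odot>.V v"]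
  by (simp add: a_minus_def V.lsmult_l_distr V.lsmult_l_minus)
 moreover have "(b \<ominus>.KG c)\<odot>.W w = \<zero>.W <-> b\<odot>.W w = c\<odot>.W w"
  using that W(2) W.lsmult_closed W.M.add_minus_eq_zero_iff[of "b\<odot>.W w" "c\<odot>.W w"]
  by (simp add: a_minus_def W.lsmult_l_distr W.lsmult_l_minus)
 moreover have "(b \<ominus>.KG c)\<odot>.V v = \<zero>.V <-> (b \<ominus>.KG c)\<odot>.W w = \<zero>.W"
  using wd[OF V W d] wd[OF W V d] by blast
 ultimately show ?thesis by blast
qed
have hb: "h (b\<odot>.V v) = b\<odot>.W w" if "b:<KG>" for b
 unfolding h_def using someI[of "%c. c:<KG> & c\<odot>.V v = b\<odot>.V v" b] that eq by auto
have rep: "EX b:<KG>. u = b\<odot>.V v" if "u:<V>" for u using V.simple_cyclic[OF V(1-3) that] by metis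
have rep': "EX b:<KG>. u = b\<odot>.W w" if "u:<W>" for u using W.simple_cyclic[OF W(1-3) that] by metis
have act: "h (a\<odot>.V u) = a\<odot>.W h u" if "a:<KG>" "u:<V>" for a u
 using rep[OF that(2)] that(1) hb V(2) W(2) by (auto simp: V.lsmult_assoc[symmetric] W.lsmult_assoc[symmetric])
have hc: "h u:<W>" if "u:<V>" for u using rep[OF that] hb W(2) W.lsmult_closed by auto
have "h (x \<oplus>.V y) = h x \<oplus>.W h y" if "x:<V>" "y:<V>" for x y
 using rep[OF that(1)] rep[OF that(2)] hb V(2) W(2) by (auto simp: V.lsmult_l_distr[symmetric] W.lsmult_l_distr[symmetric])
hence "h:lmod_hom F (res F G V) (res F G W)" using hc act by (auto simp: lmod_hom_def)
moreover have "bij_betw h <V> <W>" unfolding bij_betw_def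
proof
 show "inj_on h <V>" using rep hb eq by (intro inj_onI) metis
 show "h ` <V> = <W>" using hc rep' hb V(2) V.lsmult_closed by (auto simp: image_iff) metis
qed
ultimately have iso: "h:lmod_iso F (res F G V) (res F G W)" by (simp add: lmod_iso_def)
obtain B C where BC: "fin_basis F (res F G V) B" "fin_basis F (res F G W) C"
 using simple_fin_basis[OF V(1)] simple_fin_basis[OF W(1)] by blast
have "character F G V g = character F G W g" if "g:<G>" for g
 unfolding character_closed(2)[OF lV BC(1) that] character_closed(2)[OF lW BC(2) that] using act
 by (intro rV.trace_transport[OF rW.left_module_axioms scalar_left_module_hom[OF lV] BC iso scalar_left_module_hom[OF lW]]) auto
thus ?thesis using character_closed(1)[OF lV BC(1)] character_closed(1)[OF lW BC(2)] by (intro PiE_ext) auto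
qed
end

section \<open>Existence of simple modules, and Galois twists\<close>

context closure_group_algebra
begin

text \<open>V is the quotient of the group algebra by the elements x for which all e z x e have
  residue zero. That kernel contains x - x e, and any x outside it generates e modulo it, so the
  quotient is simple.\<close>

lemma exists_simple:
 assumes e: "KG.prim e"
 shows "EX V :: ('g => 'f, nat => 'f) module. simple_module KG V & (EX v:<V>. v ~= \<zero>.V & e\<odot>.V v = v)"
proof -
note ep = KG.prim_idem[OF e]
define N where "N = card <G>"
obtain en where en: "bij_betw en {0..<N} <G>" using ex_bij_betw_nat_finite[OF finite_G] unfolding N_def by blast
have enG: "en n:<G>" if "n < N" for n using en that by (auto simp: bij_betw_def)
define c where "c z x = e\<otimes>.KG (z\<otimes>.KG x)\<otimes>.KG e" for z x
define r where "r z x = resid e (c z x)" for z x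
have cc: "c z x:KG.corner e e" if "z:<KG>" "x:<KG>" for z x unfolding c_def using KG.corner_sandwich ep that by simp
have rc: "r z x:<F>" if "z:<KG>" "x:<KG>" for z x unfolding r_def using resid(1)[OF e cc] that by blast
have radd1: "r (z \<oplus>.KG z') x = r z x \<oplus> r z' x" if "z:<KG>" "z':<KG>" "x:<KG>" for z z' x
proof -
 have "c (z \<oplus>.KG z') x = c z x \<oplus>.KG c z' x" using that ep by (simp add: c_def KG.l_distr KG.r_distr)
 thus ?thesis using resid_add[OF e cc cc] that by (simp add: r_def)
qed
have radd2: "r z (x \<oplus>.KG y) = r z x \<oplus> r z y" if "z:<KG>" "x:<KG>" "y:<KG>" for z x y
proof -
 have "c z (x \<oplus>.KG y) = c z x \<oplus>.KG c z y" using that ep by (simp add: c_def KG.l_distr KG.r_distr)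
 thus ?thesis using resid_add[OF e cc cc] that by (simp add: r_def)
qed
have rscale: "r (mon l g) x = l\<otimes> r (mon \<one> g) x" if "l:<F>" "g:<G>" "x:<KG>" for l g x
proof -
 have "mon l g = mon l \<one>.G\<otimes>.KG mon \<one> g" using that by (simp add: mon_mult)
 hence "c (mon l g) x = (e\<otimes>.KG mon l \<one>.G)\<otimes>.KG (mon \<one> g\<otimes>.KG x\<otimes>.KG e)"
  using that ep by (simp add: c_def KG.m_assoc)
 also have "... = mon l \<one>.G\<otimes>.KG c (mon \<one> g) x"
  unfolding scalar_central[OF ep(3) that(1), symmetric] using that ep by (simp add: c_def KG.m_assoc)
 finally show ?thesis using resid_scale[OF e cc that(1)] that by (simp add: r_def)
qed
have rmult: "r z (a\<otimes>.KG x) = r (z\<otimes>.KG a) x" if "z:<KG>" "a:<KG>" "x:<KG>" for z a x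
 using that by (simp add: r_def c_def KG.m_assoc)
\<comment> \<open>The residues at the finitely many group elements determine x modulo the kernel.
  Recording them as a function on the naturals realizes the quotient in the carrier type that
  \<open>IBr\<close> asks for.\<close>
define f where "f x = (%n::nat. if n < N then r (mon \<one> (en n)) x else \<zero>)" for x
have f_eq: "f x = f y <-> (ALL z:<KG>. r z x = r z y)" if xy: "x:<KG>" "y:<KG>" for x y
proof
 assume "f x = f y"
 hence fn: "f x n = f y n" for n by simp
 have g: "r (mon \<one> g) x = r (mon \<one> g) y" if g: "g:<G>" for g
 proof -
  have "g:en ` {0..<N}" using en g by (simp add: bij_betw_def)
  then obtain n where "n < N" "en n = g" by auto
  thus ?thesis using fn[of n] by (simp add: f_def)
 qed
 show "ALL z:<KG>. r z x = r z y"
 proof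
  fix z assume "z:<KG>"
  thus "r z x = r z y"
  proof (induction z rule: gr_induct)
   case (mon l g)
   show ?case unfolding rscale[OF mon(1,2) xy(1)] rscale[OF mon(1,2) xy(2)] using g[OF mon(2)] by simp
  next
   case (add a b)
   thus ?case using radd1[OF add(1,2) xy(1)] radd1[OF add(1,2) xy(2)] by simp
  qed
 qed
next
 assume "ALL z:<KG>. r z x = r z y"
 hence "r (mon \<one> (en n)) x = r (mon \<one> (en n)) y" for n by simp
 thus "f x = f y" unfolding f_def by (intro ext) auto
qed
have f_add: "(%n. f x n \<oplus> f y n) = f (x \<oplus>.KG y)" if "x:<KG>" "y:<KG>" for x y
 using that radd2 by (auto simp: f_def)
define V :: "('g => 'f, nat => 'f) module" where
 "V = (|carrier = f ` <KG>, monoid.mult = undefined, monoid.one = undefined,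
  ring.zero = f \<zero>.KG, ring.add = (%u v n. u n \<oplus> v n),
  smult = (%a u. f (a\<otimes>.KG (SOME x. x:<KG> & f x = u)))|)"
have Vc: "<V> = f ` <KG>" "\<zero>.V = f \<zero>.KG" by (simp_all add: V_def)
have Vadd: "f x \<oplus>.V f y = f (x \<oplus>.KG y)" if "x:<KG>" "y:<KG>" for x y
 using f_add[OF that] by (simp add: V_def)
have Vsm: "a\<odot>.V f x = f (a\<otimes>.KG x)" if "a:<KG>" "x:<KG>" for a x
proof -
 let ?x = "SOME y. y:<KG> & f y = f x"
 have x: "?x:<KG>" "f ?x = f x" using someI[of "%y. y:<KG> & f y = f x" x] that by auto
 have "f (a\<otimes>.KG ?x) = f (a\<otimes>.KG x)" using f_eq[OF x(1) that(2)] x that rmult by (subst f_eq) auto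
 thus ?thesis by (simp add: V_def)
qed
have lm: "left_module KG V"
proof (intro left_module.intro KG.ring_axioms)
 show "abelian_group V"
 proof (rule abelian_groupI)
  fix u assume "u:<V>"
  then obtain x where x: "x:<KG>" "u = f x" unfolding Vc by blast
  hence "f (\<ominus>.KG x) \<oplus>.V u = \<zero>.V" using Vadd[of "\<ominus>.KG x" x] by (simp add: Vc KG.l_neg)
  thus "EX y:<V>. y \<oplus>.V u = \<zero>.V" using x unfolding Vc by blast
 qed (auto simp: Vc Vadd KG.a_ac)
 show "left_module_axioms KG V" by (auto simp: left_module_axioms_def Vc Vadd Vsm KG.l_distr KG.r_distr KG.m_assoc)
qed
interpret V: left_module KG V by (rule lm)
have fe: "f (x\<otimes>.KG e) = f x" if "x:<KG>" for x
 using that ep by (subst f_eq) (auto simp: r_def c_def KG.m_assoc)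
have f0: "f x = \<zero>.V <-> (ALL z:<KG>. r z x = \<zero>)" if "x:<KG>" for x
proof -
 have "KG.nilp \<zero>.KG" unfolding KG.nilp_def by (intro exI[of _ 1]) simp
 hence "r z \<zero>.KG = \<zero>" if "z:<KG>" for z
  using resid_nilp[OF e cc[OF that, of "\<zero>.KG"]] that ep by (simp add: r_def c_def)
 thus ?thesis unfolding Vc(2) using f_eq[OF that, of "\<zero>.KG"] by simp
qed
\<comment> \<open>A nonzero u has a nonzero residue at some z, and e z u is then that residue times
  the image of e, up to a nilpotent element of the corner, which \<open>f\<close> kills.\<close>
have gen: "f e:U" if U: "submodule U KG V" and u: "u:U" "u ~= \<zero>.V" for U u
proof -
 note Us = V.submoduleD[OF U]
 obtain x where x: "x:<KG>" "u = f x" using u(1) Us(1) unfolding Vc by blast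
 then obtain z where z: "z:<KG>" "r z x ~= \<zero>" using f0 u(2) by blast
 have cz: "c z x:KG.corner e e" using cc z x by blast
 note czc = KG.cornerD[OF cz]
 let ?l = "r z x"
 have l: "?l:<F>" "inv ?l:<F>" "inv ?l\<otimes> ?l = \<one>" using rc z x by (auto simp: K.field_Units)
 have "f (c z x) = f (mon ?l \<one>.G\<otimes>.KG e)"
 proof (subst f_eq)
  show "ALL w:<KG>. r w (c z x) = r w (mon ?l \<one>.G\<otimes>.KG e)"
  proof
   fix w assume w: "w:<KG>"
   let ?n = "c z x \<ominus>.KG mon ?l \<one>.G\<otimes>.KG e"
   have n: "KG.nilp ?n" "?n:KG.corner e e"
    using resid(2)[OF e cz] resid_diff_corner[OF e cz l(1)] by (auto simp: r_def)
   have ewe: "e\<otimes>.KG w\<otimes>.KG e:KG.corner e e" using KG.corner_sandwich ep w by blast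
   have "c w ?n = (e\<otimes>.KG w\<otimes>.KG e)\<otimes>.KG ?n"
    using w ep KG.cornerD[OF n(2)] unfolding c_def by (simp add: KG.m_assoc)
   hence "r w ?n = \<zero>"
    using resid_nilp[OF e _ KG.nilp_mult[OF e n(2) ewe n(1)]] KG.corner_mult[OF ep(3,3) ewe n(2)] by (simp add: r_def)
   moreover have "c z x = ?n \<oplus>.KG mon ?l \<one>.G\<otimes>.KG e"
    using czc l ep by (simp add: a_minus_def KG.a_assoc KG.l_neg)
   hence "r w (c z x) = r w ?n \<oplus> r w (mon ?l \<one>.G\<otimes>.KG e)"
    using radd2[OF w KG.cornerD(1)[OF n(2)], of "mon ?l \<one>.G\<otimes>.KG e"] l ep by simp
   ultimately show "r w (c z x) = r w (mon ?l \<one>.G\<otimes>.KG e)" using rc w l ep by simp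
  qed
 qed (use czc l ep in auto)
 moreover have "f (c z x) = (e\<otimes>.KG z)\<odot>.V u"
  using x z ep fe[of "e\<otimes>.KG (z\<otimes>.KG x)"] by (simp add: c_def Vsm KG.m_assoc)
 moreover have "(e\<otimes>.KG z)\<odot>.V u:U" using Us(4)[of "e\<otimes>.KG z" u] u(1) z(1) ep(3) by simp
 ultimately have "f (mon ?l \<one>.G\<otimes>.KG e):U" by simp
 hence "mon (inv ?l) \<one>.G\<odot>.V f (mon ?l \<one>.G\<otimes>.KG e):U" using Us(4) l by simp
 moreover have "mon (inv ?l) \<one>.G\<otimes>.KG (mon ?l \<one>.G\<otimes>.KG e) = e"
  using l ep by (simp add: KG.m_assoc[symmetric] mon_mult gr_one[symmetric])
 ultimately show ?thesis using l ep by (simp add: Vsm)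
qed
have "c \<one>.KG e = e" using ep by (simp add: c_def)
hence "r \<one>.KG e = \<one>" using resid_self[OF e] by (simp add: r_def)
hence e0: "f e ~= \<zero>.V" using f0[OF ep(3)] by (metis KG.one_closed K.zero_not_one)
have "simple_module KG V" unfolding simple_module_def
proof (intro conjI allI impI lm)
 show "<V> ~= {\<zero>.V}" using e0 ep unfolding Vc(1) by blast
 fix U assume U: "submodule U KG V"
 note Us = V.submoduleD[OF U]
 show "U = {\<zero>.V} \<or> U = <V>"
 proof (cases "U = {\<zero>.V}")
  case False
  then obtain u where "u:U" "u ~= \<zero>.V" using Us(2) by blast
  hence "f e:U" using gen U by blast
  hence "f x:U" if "x:<KG>" for x using Us(4)[OF that, of "f e"] Vsm[OF that ep(3)] fe[OF that] by simp
  thus ?thesis using Us(1) unfolding Vc(1) by blast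
 qed simp
qed
moreover have "e\<odot>.V f e = f e" using Vsm ep by simp
ultimately show ?thesis using e0 ep by (intro exI[of _ V]) (auto simp: Vc)
qed

text \<open>Coefficients act through the inverse t of s. The same basis works for V', with all
  coordinates changed by s; this is what applies s, rather than t, to the traces.\<close>

lemma twist:
 fixes V :: "('g => 'f, 'm) module"
 assumes V: "simple_module KG V" and s: "s:ring_iso F F"
 defines "t \<equiv> inv_into <F> s"
 defines "V' \<equiv> V(|smult := %a v. gal G t a\<odot>.V v|)"
 shows "simple_module KG V'" "character F G V' = gal G s (character F G V)"
proof -
note lm = simple_lm[OF V]
interpret V: left_module KG V by (rule lm)
have bij: "bij_betw s <F> <F>" and sh: "s:ring_hom F F" using s by (auto simp: ring_iso_def)
have t: "t:ring_iso F F" unfolding t_def using ring_iso_set_sym[OF K.ring_axioms] s by blast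
have th: "t:ring_hom F F" using t by (simp add: ring_iso_def)
have sc: "s x:<F>" "t x:<F>" if "x:<F>" for x using that sh th ring_hom_closed by metis+
have ts: "t (s x) = x" if "x:<F>" for x using that bij by (simp add: t_def bij_betw_def)
have st: "s (t x) = x" if "x:<F>" for x using that bij by (simp add: t_def bij_betw_def f_inv_into_f)
note gt = galois_action_hom[OF th] and gs = galois_action_hom[OF sh]
interpret gt: ring_hom_ring KG KG "gal G t" using gt(1) by (intro ring_hom_ringI2 KG.ring_axioms)
interpret gs: ring_hom_ring KG KG "gal G s" using gs(1) by (intro ring_hom_ringI2 KG.ring_axioms)
have gts: "gal G t (gal G s a) = a" if "a:<KG>" for a
proof (rule gr_eqI[OF _ that])
 show "gal G t (gal G s a):<KG>" using gt.hom_closed gs.hom_closed that by blast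
qed (use gr_at[OF that] ts in \<open>auto simp: galois_action_def\<close>)
have V': "<V'> = <V>" "\<zero>.V' = \<zero>.V" "x \<oplus>.V' y = x \<oplus>.V y" "a\<odot>.V' x = gal G t a\<odot>.V x" for x y a
 by (auto simp: V'_def)
have "abelian_group V'"
proof (rule abelian_groupI)
 show "EX y:<V'>. y \<oplus>.V' x = \<zero>.V'" if "x:<V'>" for x using that by (auto simp: V')
qed (auto simp: V' V.M.a_assoc intro: V.M.a_comm)
hence lm': "left_module KG V'"
 by (auto simp: left_module_def left_module_axioms_def KG.ring_axioms V' V.lsmult_closed V.lsmult_l_distr
  V.lsmult_r_distr V.lsmult_assoc V.lsmult_one)
interpret V': left_module KG V' by (rule lm')
show sim: "simple_module KG V'" unfolding simple_module_def
proof (intro conjI allI impI lm')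
 show "<V'> ~= {\<zero>.V'}" using V by (simp add: V' simple_module_def)
 fix U assume "submodule U KG V'"
 note U = V'.submoduleD[OF this]
 have "submodule U KG V"
 proof (rule V.submodule_intro)
  fix a x assume "a:<KG>" "x:U"
  thus "a\<odot>.V x:U" using U(4)[of "gal G s a" x] gts by (simp add: V')
 qed (use U in \<open>auto simp: V'\<close>)
 thus "U = {\<zero>.V'} \<or> U = <V'>" using V by (simp add: simple_module_def V')
qed
interpret W: vector_space F "res F G V" using vs_res[OF lm] .
interpret W': vector_space F "res F G V'" using vs_res[OF lm'] .
obtain B where B: "fin_basis F (res F G V) B" using simple_fin_basis[OF V] by blast
note Bf = W.fin_basisD[OF B]
have Bc: "v:<V>" if "v:B" for v using Bf that by auto
have fs: "finsum V' = finsum V" by (auto simp: V'_def finsum_def)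
have lc: "W'.lin_comb B a = W.lin_comb B (%v. t (a v))" if a: "a:B -> <F>" for a
 unfolding scalar_restriction_simps fs using a Bc sc gt V.lsmult_closed
 by (intro V.M.finsum_cong') (auto simp: V' Pi_iff)
have lcs: "W'.lin_comb B (%v. s (a v)) = W.lin_comb B a" if a: "a:B -> <F>" for a
proof -
 have "W.lin_comb B (%v. t (s (a v))) = W.lin_comb B a"
  using a Bc ts V.lsmult_closed unfolding scalar_restriction_simps by (intro V.M.finsum_cong') (auto simp: Pi_iff)
 thus ?thesis using lc[of "%v. s (a v)"] a sc by auto
qed
have B': "fin_basis F (res F G V') B" unfolding fin_basis_def
proof (intro conjI ballI)
 fix x assume "x:carrier (res F G V')"
 hence x: "x:<V>" by (simp add: V')
 let ?a = "coordinates F (res F G V) B x"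
 have a: "?a:B -> <F>" "W.lin_comb B ?a = x" using W.coordinates[OF B] x by auto
 show "EX! a. a:B \<rightarrow>\<^sub>E <F> & x = W'.lin_comb B a"
 proof (rule ex1I[of _ "\<lambda>v\<in>B. s (?a v)"])
  have "W'.lin_comb B (\<lambda>v\<in>B. s (?a v)) = x"
   using W'.lin_comb_restrict[of B "%v. s (?a v)"] lcs[OF a(1)] a sc Bf by (auto simp: V')
  thus "(\<lambda>v\<in>B. s (?a v)):B \<rightarrow>\<^sub>E <F> & x = W'.lin_comb B (\<lambda>v\<in>B. s (?a v))"
   using a(1) sc by auto
  fix d assume d: "d:B \<rightarrow>\<^sub>E <F> & x = W'.lin_comb B d"
  hence dc: "d:B -> <F>" by auto
  hence "x = W.lin_comb B (%v. t (d v))" using d lc by simp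
  hence "?a v = t (d v)" if "v:B" for v using W.coordinates_unique[OF B, of "%v. t (d v)" v] dc sc that by auto
  thus "d = (\<lambda>v\<in>B. s (?a v))" using d st by (intro PiE_ext[of d B]) (auto simp: PiE_iff)
 qed
qed (use Bf V' in auto)
have coord: "coordinates F (res F G V') B x v = s (coordinates F (res F G V) B x v)"
 if x: "x:<V>" and v: "v:B" for x v
proof -
 let ?a = "coordinates F (res F G V) B x"
 have a: "?a:B -> <F>" "W.lin_comb B ?a = x" using W.coordinates[OF B] x by auto
 have "coordinates F (res F G V') B (W'.lin_comb B (%v. s (?a v))) v = s (?a v)"
  using W'.coordinates_unique[OF B' _ v] a(1) sc by (auto simp: Pi_iff)
 thus ?thesis using lcs[OF a(1)] a(2) by simp
qed
have "character F G V' g = s (character F G V g)" if g: "g:<G>" for g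
proof -
 have t1: "t \<one> = \<one>" using th ring_hom_one by metis
 have mv: "mon \<one> g\<odot>.V v:<V>" if "v:B" for v using Bc[OF that] V.lsmult_closed by simp
 have "character F G V' g = (\<Oplus>v\<in>B. s (coordinates F (res F G V) B (mon \<one> g\<odot>.V v) v))"
  unfolding character_closed(2)[OF lm' B' g] using coord mv W.coordinates_closed[OF B] sc gt(2)[of \<one> g] t1
  by (intro K.finsum_cong') (auto simp: V')
 also have "... = s (\<Oplus>v\<in>B. coordinates F (res F G V) B (mon \<one> g\<odot>.V v) v)"
 proof (rule finsum_hom[symmetric, OF K.abelian_monoid_axioms K.abelian_monoid_axioms])
  show "s \<zero> = \<zero>" using sh K.ring_axioms ring_hom_zero by metis
 qed (use sh sc mv W.coordinates_closed[OF B] ring_hom_add in auto)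
 finally show ?thesis using character_closed(2)[OF lm B g] by simp
qed
thus "character F G V' = gal G s (character F G V)" by (auto simp: galois_action_def character_def)
qed

lemma Ann_ideal:
 assumes "simple_module KG V" "a:Ann (character F G V)"
 shows "a:<KG>" "b:Ann (character F G V) ==> a \<oplus>.KG b:Ann (character F G V)"
  "x:<KG> ==> x\<otimes>.KG a:Ann (character F G V)"
  "x:<KG> ==> a\<otimes>.KG x:Ann (character F G V)"
proof -
interpret V: left_module KG V using assms(1) simple_lm by blast
note A = Ann_character[OF assms(1)]
have a: "a:<KG>" "!!v. v:<V> ==> a\<odot>.V v = \<zero>.V" using assms(2) A by auto
show "a:<KG>" "b:Ann (character F G V) ==> a \<oplus>.KG b:Ann (character F G V)"
 "x:<KG> ==> x\<otimes>.KG a:Ann (character F G V)"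
 "x:<KG> ==> a\<otimes>.KG x:Ann (character F G V)"
 using a unfolding A by (auto simp: V.lsmult_l_distr V.lsmult_assoc V.lsmult_closed)
qed

lemma Ann_prime:
 assumes "simple_module KG V" "a:<KG>" "b:<KG>"
  "!!r. r:<KG> ==> a\<otimes>.KG r\<otimes>.KG b:Ann (character F G V)"
 shows "a:Ann (character F G V) \<or> b:Ann (character F G V)"
proof (rule ccontr)
interpret V: left_module KG V using assms(1) simple_lm by blast
note A = Ann_character[OF assms(1)]
assume "~ ?thesis"
then obtain u v where uv: "u:<V>" "a\<odot>.V u ~= \<zero>.V" "v:<V>" "b\<odot>.V v ~= \<zero>.V"
 using assms(2,3) A by auto
then obtain r where r: "r:<KG>" "r\<odot>.V (b\<odot>.V v) = u"
 using V.simple_cyclic[OF assms(1) _ uv(4,1)] V.lsmult_closed assms(3) by blast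
have "(a\<otimes>.KG r\<otimes>.KG b)\<odot>.V v = \<zero>.V" using assms(4)[OF r(1)] uv A by auto
thus False using r uv assms(2,3) V.lsmult_closed by (simp add: V.lsmult_assoc)
qed
end

section \<open>Irreducible characters of a block\<close>

locale block_algebra = closure_group_algebra F Fp p k G
 for F :: "'f ring" (structure) and Fp :: "'f set" and p :: nat and k :: "'f set" and G :: "('g, 'v) monoid_scheme" +
 fixes b :: "'g => 'f"
 assumes central_b: "central_idempotent (group_ring F G) b"
  and b_in_k: "g:<G> ==> b g:k"
begin

definition irr :: "('g => 'f) set" where "irr = IBr F G b"

lemma b_simps: "b:<KG>" "b\<otimes>.KG b = b" "a:<KG> ==> b\<otimes>.KG a = a\<otimes>.KG b"
 using central_b by (auto simp: central_idempotent_def ring_center_def)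

lemma irr_cases:
 assumes "c:irr"
 obtains V :: "('g => 'f, nat => 'f) module" where "simple_module KG V" "!!x. x:<V> ==> b\<odot>.V x = x" "c = character F G V"
 using assms by (auto simp: irr_def IBr_def)

text \<open>As b is central, its fixed vectors form a submodule; it contains the nonzero b v, so it
  is all of V.\<close>

lemma irr_intro:
 assumes "simple_module KG (V :: ('g => 'f, nat => 'f) module)" "v:<V>" "b\<odot>.V v ~= \<zero>.V"
 shows "character F G V:irr"
proof -
interpret V: left_module KG V using assms(1) simple_lm by blast
let ?U = "{x:<V>. b\<odot>.V x = x}"
have "submodule ?U KG V"
proof (rule V.submodule_intro)
 fix a x assume "a:<KG>" "x:?U"
 thus "a\<odot>.V x:?U" using b_simps(1) b_simps(3)[of a] V.lsmult_closed by auto (metis V.lsmult_assoc)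
qed (use b_simps(1) in \<open>auto simp: V.lsmult_r_distr\<close>)
moreover have "b\<odot>.V v:?U" using assms(2) b_simps(1,2) V.lsmult_closed by (auto simp: V.lsmult_assoc[symmetric])
ultimately have "?U = <V>" using assms(1,3) unfolding simple_module_def by blast
thus ?thesis using assms(1) unfolding irr_def IBr_def by blast
qed

lemma Ann_closed: "c:irr ==> a:Ann c ==> a:<KG>" by (auto simp: Ann_def)

lemma Ann_zero: "c:irr ==> \<zero>.KG:Ann c"
proof (erule irr_cases)
fix V :: "('g => 'f, nat => 'f) module" assume V: "simple_module KG V" "c = character F G V"
interpret V: left_module KG V using V simple_lm by blast
show ?thesis using Ann_character[OF V(1)] V(2) by simp
qed

lemma Ann_add: "c:irr ==> x:Ann c ==> y:Ann c ==> x \<oplus>.KG y:Ann c"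
 by (erule irr_cases) (use Ann_ideal(2) in blast)

lemma Ann_mult: "c:irr ==> y:Ann c ==> x:<KG> ==> x\<otimes>.KG y:Ann c"
 "c:irr ==> y:Ann c ==> x:<KG> ==> y\<otimes>.KG x:Ann c" by (erule irr_cases, use Ann_ideal(3,4) in blast)+

lemma Ann_prime':
 assumes "c:irr" "x:<KG>" "y:<KG>" "!!r. r:<KG> ==> x\<otimes>.KG r\<otimes>.KG y:Ann c"
 shows "x:Ann c \<or> y:Ann c"
proof -
obtain V :: "('g => 'f, nat => 'f) module" where V: "simple_module KG V" "c = character F G V"
 using irr_cases[OF assms(1)] by metis
show ?thesis using Ann_prime[OF V(1) assms(2,3)] assms(4) V(2) by blast
qed

lemma Ann_block:
 assumes "c:irr" "a:<KG>"
 shows "a\<otimes>.KG b:Ann c <-> a:Ann c"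
proof -
obtain V :: "('g => 'f, nat => 'f) module" where V: "simple_module KG V" "!!x. x:<V> ==> b\<odot>.V x = x" "c = character F G V"
 using irr_cases[OF assms(1)] by metis
interpret V: left_module KG V using V simple_lm by blast
show ?thesis using Ann_character[OF V(1)] V(2,3) assms(2) b_simps(1) by (simp add: V.lsmult_assoc)
qed

lemma one_notin_Ann: "c:irr ==> \<one>.KG \<notin> Ann c"
proof (erule irr_cases)
fix V :: "('g => 'f, nat => 'f) module" assume V: "simple_module KG V" "c = character F G V"
interpret V: left_module KG V using V simple_lm by blast
obtain v where "v:<V>" "v ~= \<zero>.V" using V(1) unfolding simple_module_def by blast
thus ?thesis using Ann_character[OF V(1)] V(2) V.lsmult_one by auto
qed

lemma prim_determines:
 assumes "c:irr" "d:irr" "KG.prim e" "e \<notin> Ann c" "e \<notin> Ann d"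
 shows "c = d"
proof -
note ep = KG.prim_idem[OF assms(3)]
obtain V W :: "('g => 'f, nat => 'f) module" where V: "simple_module KG V" "c = character F G V"
 and W: "simple_module KG W" "d = character F G W" using irr_cases[OF assms(1)] irr_cases[OF assms(2)] by metis
interpret V: left_module KG V using V simple_lm by blast
interpret W: left_module KG W using W simple_lm by blast
obtain v w where "v:<V>" "e\<odot>.V v ~= \<zero>.V" "w:<W>" "e\<odot>.W w ~= \<zero>.W"
 using assms(4,5) ep Ann_character[OF V(1)] Ann_character[OF W(1)] V(2) W(2) by auto
thus ?thesis
 using character_eqI[OF V(1) _ _ _ W(1) _ _ _ assms(3), of "e\<odot>.V v" "e\<odot>.W w"] ep V W V.lsmult_closed W.lsmult_closed by (auto simp: V.lsmult_assoc[symmetric] W.lsmult_assoc[symmetric])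
qed

text \<open>A primitive idempotent below i fixes a nonzero vector of some simple module; i and b
  then fix this vector too.\<close>

lemma idem_detected:
 assumes "KG.idem i" "i ~= \<zero>.KG" "b\<otimes>.KG i = i"
 shows "EX c:irr. i \<notin> Ann c"
proof -
obtain e where e: "KG.prim e" "e:KG.corner i i" using KG.prim_below[OF assms(1,2)] by blast
note ep = KG.prim_idem[OF e(1)] and ec = KG.cornerD[OF e(2)]
have ic: "i:<KG>" using assms(1) by (simp add: KG.idem_def)
obtain V :: "('g => 'f, nat => 'f) module" and v where V: "simple_module KG V" "v:<V>" "v ~= \<zero>.V" "e\<odot>.V v = v"
 using exists_simple[OF e(1)] by blast
interpret V: left_module KG V using V simple_lm by blast
have "b\<otimes>.KG e = e" using ec assms(3) ic b_simps(1) by (metis KG.m_assoc)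
hence "b\<odot>.V v = v" using V ep b_simps(1) by (metis V.lsmult_assoc)
hence "character F G V:irr" using irr_intro[OF V(1,2)] V(3) by simp
moreover have "i\<odot>.V v = v" using V ec ic by (metis V.lsmult_assoc)
hence "i \<notin> Ann (character F G V)" using Ann_character[OF V(1)] V(2,3) by auto
ultimately show ?thesis by blast
qed

text \<open>Finitely many primitive idempotents see all characters, and by
  \<open>prim_determines\<close> each sees at most one. Finiteness of \<open>irr\<close> and
  separation of characters both come from this.\<close>

lemma one_decomposition:
 "EX I. finite I & (ALL e:I. KG.prim e) & \<one>.KG = (\<Oplus>.KG e\<in>I. e) & (ALL c:irr. EX e:I. e \<notin> Ann c)"
proof -
obtain I where I: "finite I" "!!e. e:I ==> KG.prim e" "\<one>.KG = (\<Oplus>.KG e\<in>I. e)"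
 using KG.prim_decomposition[of "\<one>.KG"] by (auto simp: KG.idem_def)
have sum: "(\<Oplus>.KG e\<in>J. e):Ann c" if "finite J" "J <= Ann c" "c:irr" for J c using that
proof (induction J rule: finite_induct)
 case (insert e J)
 thus ?case using Ann_add Ann_closed by (subst KG.finsum_insert) (auto simp: subset_iff)
qed (use Ann_zero in simp)
have "EX e:I. e \<notin> Ann c" if "c:irr" for c using sum[OF I(1) _ that] I(3) one_notin_Ann[OF that] by auto
thus ?thesis using I by blast
qed

lemma finite_irr: "finite irr"
proof -
obtain I where I: "finite I" "!!e. e:I ==> KG.prim e" "\<one>.KG = (\<Oplus>.KG e\<in>I. e)" "!!c. c:irr ==> EX e:I. e \<notin> Ann c"
 using one_decomposition by blast
define f where "f c = (SOME e. e:I & e \<notin> Ann c)" for c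
have f: "f c:I" "f c \<notin> Ann c" if "c:irr" for c
 using someI_ex[of "%e. e:I & e \<notin> Ann c"] I(4)[OF that] unfolding f_def by auto
have "inj_on f irr"
proof (rule inj_onI)
 fix c d assume "c:irr" "d:irr" "f c = f d"
 thus "c = d" using prim_determines[of c d "f c"] f[of c] f[of d] I(2)[of "f c"] by simp
qed
moreover have "finite (f ` irr)" using f(1) I(1) finite_subset[of "f ` irr" I] by blast
ultimately show ?thesis using finite_imageD by blast
qed

text \<open>u collects the primitive summands of one that do not annihilate c; the others lie in
  \<open>Ann c\<close>, and those in u lie in \<open>Ann d\<close> for every other d.\<close>

lemma separating_element:
 assumes "c:irr"
 obtains u where "u:<KG>" "\<one>.KG \<ominus>.KG u:Ann c" "!!d. d:irr ==> d ~= c ==> u:Ann d"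
proof -
obtain I where I: "finite I" "!!e. e:I ==> KG.prim e" "\<one>.KG = (\<Oplus>.KG e\<in>I. e)" "!!c. c:irr ==> EX e:I. e \<notin> Ann c"
 using one_decomposition by blast
have Ic: "e:<KG>" if "e:I" for e using I(2)[OF that] KG.prim_idem by blast
have sum: "(\<Oplus>.KG e\<in>J. e):Ann d" if "finite J" "J <= Ann d" "d:irr" for J d using that
proof (induction J rule: finite_induct)
 case (insert e J)
 thus ?case using Ann_add Ann_closed by (subst KG.finsum_insert) auto
qed (use Ann_zero in simp)
let ?J = "{e:I. e \<notin> Ann c}" and ?J' = "{e:I. e:Ann c}"
define u where "u = (\<Oplus>.KG e\<in>?J. e)"
have u: "u:<KG>" unfolding u_def using Ic by (intro KG.finsum_closed) auto
have "?J' \<union> ?J = I" by auto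
hence "\<one>.KG = (\<Oplus>.KG e\<in>?J' \<union> ?J. e)" using I(3) by simp
also have "... = (\<Oplus>.KG e\<in>?J'. e) \<oplus>.KG u"
 unfolding u_def using I(1) Ic by (intro KG.finsum_Un_disjoint) auto
finally have "\<one>.KG \<ominus>.KG u = (\<Oplus>.KG e\<in>?J'. e)"
 using u Ic by (simp add: a_minus_def KG.a_assoc KG.r_neg)
hence "\<one>.KG \<ominus>.KG u:Ann c" using sum[of ?J' c] I(1) assms by auto
moreover have "u:Ann d" if "d:irr" "d ~= c" for d
 unfolding u_def using I prim_determines[OF assms] that by (intro sum) auto
ultimately show ?thesis using that u by blast
qed

lemma galois_iso: "s:galois_group F k ==> s:ring_iso F F" by (simp add: galois_group_def)

text \<open>The twist by s stays in the block because s fixes k, which contains the coefficients of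
  b.\<close>

lemma galois_irr:
 assumes "s:galois_group F k" "c:irr"
 shows "gal G s c:irr"
proof -
obtain V :: "('g => 'f, nat => 'f) module" where V: "simple_module KG V" "!!x. x:<V> ==> b\<odot>.V x = x" "c = character F G V"
 using irr_cases[OF assms(2)] by metis
let ?t = "inv_into <F> s"
let ?V = "V(|smult := %a v. gal G ?t a\<odot>.V v|)"
note tw = twist[OF V(1) galois_iso[OF assms(1)]]
have "?t y = y" if "y:k" for y
proof -
 have "s y = y" "y:<F>" "inj_on s <F>"
  using assms(1) that subfieldE(3)[OF subfield_k] by (auto simp: galois_group_def ring_iso_def bij_betw_def)
 thus ?thesis by (metis inv_into_f_f)
qed
hence "gal G ?t b = b" using b_in_k b_simps(1) by (auto simp: galois_action_def gr_carrier PiE_iff extensional_def)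
hence "ALL x:<?V>. b\<odot>.(?V) x = x" using V(2) by simp
hence "character F G ?V:irr" using tw(1) unfolding irr_def IBr_def by blast
thus ?thesis using tw(2) V(3) by simp
qed

lemma irr_values: "c:irr ==> c:<G> \<rightarrow>\<^sub>E <F>"
 using character_closed(1)[OF simple_lm] simple_fin_basis by (metis irr_cases)

lemma galois_pair:
 assumes "s:ring_hom F F" "c:<G> -> <F>" "a:<KG>"
 shows "pair (gal G s c) (gal G s a) = s (pair c a)"
proof -
have sc: "s x:<F>" if "x:<F>" for x using assms(1) that ring_hom_closed by metis
have "s (pair c a) = (\<Oplus>g\<in><G>. s (a g\<otimes> c g))" unfolding pair_def
proof (rule finsum_hom[OF K.abelian_monoid_axioms K.abelian_monoid_axioms])
 show "s \<zero> = \<zero>" using assms(1) K.ring_axioms ring_hom_zero by metis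
qed (use assms sc gr_at[OF assms(3)] ring_hom_add in auto)
also have "... = pair (gal G s c) (gal G s a)" unfolding pair_def using assms sc gr_at[OF assms(3)]
 by (intro K.finsum_cong') (auto simp: galois_action_def ring_hom_mult Pi_iff)
finally show ?thesis by simp
qed

lemma galois_Ann:
 assumes s: "s:galois_group F k" and c: "c:irr" and a: "a:Ann c"
 shows "gal G s a:Ann (gal G s c)"
proof -
have sh: "s:ring_hom F F" "bij_betw s <F> <F>" using galois_iso[OF s] by (auto simp: ring_iso_def)
let ?t = "inv_into <F> s"
have th: "?t:ring_iso F F" using ring_iso_set_sym[OF K.ring_axioms] galois_iso[OF s] by blast
hence tc: "?t x:<F>" if "x:<F>" for x using that ring_hom_closed by (metis (mono_tags, lifting) ring_iso_def mem_Collect_eq)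
have st: "s (?t x) = x" if "x:<F>" for x using that sh(2) by (simp add: bij_betw_def f_inv_into_f)
note gs = galois_action_hom[OF sh(1)]
interpret gs: ring_hom_ring KG KG "gal G s" using gs(1) by (intro ring_hom_ringI2 KG.ring_axioms)
have ac: "a:<KG>" using Ann_closed c a by blast
have cc: "c:<G> -> <F>" using irr_values[OF c] by auto
have "pair (gal G s c) (gal G s a\<otimes>.KG x) = \<zero>" if x: "x:<KG>" for x
proof -
 let ?x = "gal G ?t x"
 have xc: "?x:<KG>" using tc gr_at[OF x] by (auto simp: galois_action_def gr_carrier)
 have "gal G s ?x = x"
 proof (rule gr_eqI[OF _ x])
  show "gal G s ?x:<KG>" using xc gs.hom_closed by blast
 qed (use st gr_at[OF x] in \<open>auto simp: galois_action_def\<close>)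
 hence "gal G s a\<otimes>.KG x = gal G s (a\<otimes>.KG ?x)" using ac xc by simp
 hence "pair (gal G s c) (gal G s a\<otimes>.KG x) = s (pair c (a\<otimes>.KG ?x))"
  using galois_pair[OF sh(1) cc, of "a\<otimes>.KG ?x"] ac xc by simp
 also have "pair c (a\<otimes>.KG ?x) = \<zero>" using a xc by (simp add: Ann_def)
 finally show ?thesis using sh(1) K.ring_axioms ring_hom_zero by metis
qed
thus ?thesis using gs.hom_closed[OF ac] by (simp add: Ann_def)
qed
end

section \<open>Cyclic groups of order q^n - 1 and the splitting over the closure\<close>

definition cyc :: "nat => nat monoid" where
 "cyc m = (|carrier = {..<m}, monoid.mult = (%i j. (i + j) mod m), monoid.one = 0|)"

lemma cyc_simps [simp]:
 "carrier (cyc m) = {..<m}" "i\<otimes>.(cyc m) j = (i + j) mod m" "\<one>.(cyc m) = 0" by (simp_all add: cyc_def)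

lemma group_cyc: "m > 0 ==> group (cyc m)"
proof (rule groupI)
fix i assume "i:carrier (cyc m)" "m > 0"
thus "EX j:carrier (cyc m). j\<otimes>.(cyc m) i = \<one>.(cyc m)"
 by (intro bexI[of _ "(m - i) mod m"]) (auto simp: mod_simps)
qed (auto simp: mod_simps add.assoc)

lemma finsum_subfield:
 assumes "subfield k F" "f:S -> k" "ring F"
 shows "finsum (F(|carrier := k|)) f S = finsum F f S"
proof -
interpret F: ring F by fact
interpret k: field "F(|carrier := k|)" using F.subfield_iff(2)[OF assms(1)] .
show ?thesis using assms(2) subringE[OF subfieldE(1)[OF assms(1)]]
 by (intro finsum_hom[where f = "%x. x"] F.abelian_monoid_axioms k.abelian_monoid_axioms) auto
qed

locale cyclic_block = block_algebra F Fp p k G b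
 for F :: "'f ring" (structure) and Fp :: "'f set" and p :: nat and k :: "'f set"
  and G :: "('g, 'v) monoid_scheme" and b :: "'g => 'f" +
 fixes n :: nat and E :: "'f set"
 assumes subfield_E: "subfield E F" and finite_E: "finite E" and k_E: "k <= E" and card_E: "card E = q ^ n" and n_pos: "n > 0"
begin

definition m where "m = q ^ n - 1"
text \<open>The group of m-th roots of unity in F; its elements label the linear characters of
  \<open>cyc m\<close>.\<close>

definition mu where "mu = E - {\<zero>}"

abbreviation Y where "Y \<equiv> cyc m \<times>\<times> G"

lemma m_pos: "m > 0" using q_pow_gt[OF n_pos] by (simp add: m_def)

lemma group_L: "group (cyc m)" using group_cyc m_pos by blast

sublocale Y: closure_group_algebra F Fp p k Y
proof -
have "group Y" using DirProd_group[OF group_L G.group_axioms] .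
moreover have "finite <Y>" using finite_G by simp
ultimately show "closure_group_algebra F Fp p k Y" using K.field_axioms closure_over_finite_axioms
 by (simp add: closure_group_algebra_def group_algebra_def group_algebra_axioms_def)
qed

text \<open>The finite k-form \<open>A\<close> sits inside \<open>FY\<close>. Idempotents are wanted
  in \<open>A\<close>, while the cyclic factor splits only over F; hence the interplay of the
  two.\<close>

abbreviation FY where "FY \<equiv> group_ring F Y"
abbreviation A where "A \<equiv> group_ring (F(|carrier := k|)) Y"
abbreviation ymon where "ymon \<equiv> gmonom F Y"

sublocale A: group_algebra "F(|carrier := k|)" Y using K.subfield_iff(2)[OF subfield_k] Y.group_algebra_axioms
 by (simp add: group_algebra_def)

lemma carrier_A: "<A> = {a:<FY>. ALL y:<Y>. a y:k}"
proof -
have "S \<rightarrow>\<^sub>E k = {a:S \<rightarrow>\<^sub>E <F>. ALL y:S. a y:k}" for S :: "(nat \<times> 'g) set"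
 using subfieldE(3)[OF subfield_k] by auto
thus ?thesis unfolding A.gr_carrier Y.gr_carrier by simp
qed

lemma A_sub: "a:<A> ==> a:<FY>" by (simp add: carrier_A)

lemma A_ops: "\<zero>.A = \<zero>.FY" "\<one>.A = \<one>.FY" "x \<oplus>.A y = x \<oplus>.FY y"
 by (auto simp: group_ring_def)

lemma A_mult: "x:<A> ==> y:<A> ==> x\<otimes>.A y = x\<otimes>.FY y"
proof (rule Y.gr_eqI)
assume xy: "x:<A>" "y:<A>"
thus "x\<otimes>.A y:<FY>" "x\<otimes>.FY y:<FY>" using A_sub by auto
fix u assume u: "u:<Y>"
have "x v\<otimes> y (inv .Y v\<otimes>.Y u):k" if "v:<Y>" for v
proof -
 have "inv .Y v\<otimes>.Y u:<Y>" using that u by blast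
 thus ?thesis using xy that subringE(6)[OF subfieldE(1)[OF subfield_k]] unfolding carrier_A by blast
qed
thus "(x\<otimes>.A y) u = (x\<otimes>.FY y) u"
 unfolding A.gr_mult_at[OF u] Y.gr_mult_at[OF u] using finsum_subfield[OF subfield_k _ K.ring_axioms, of _ "<Y>"]
 by simp
qed

sublocale A: finite_ring A
proof
show "finite <A>" using Y.finite_G finite_k unfolding A.gr_carrier by (intro finite_PiE) auto
qed

lemma A_minus: "x:<A> ==> y:<A> ==> x \<ominus>.A y = x \<ominus>.FY y"
proof -
assume xy: "x:<A>" "y:<A>"
have "\<ominus>.A y \<oplus>.FY y = \<zero>.FY" using A.KG.l_neg[OF xy(2)] by (simp add: A_ops)
hence "\<ominus>.A y = \<ominus>.FY y" using Y.KG.minus_equality[of "\<ominus>.A y" y] A_sub xy by simp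
thus ?thesis by (simp add: a_minus_def A_ops)
qed

lemma mu_simps: "z:mu ==> z:<F>" "z:mu ==> z ~= \<zero>" "z:mu ==> z [^] m = \<one>" "finite mu" "card mu = m"
proof -
obtain w where w: "!!x. x:E ==> x ~= \<zero> ==> x [^] (q ^ n - 1) = \<one>"
 using subfield_generator[OF subfield_E finite_E card_E n_pos] by metis
thus "z:mu ==> z [^] m = \<one>" by (simp add: mu_def m_def)
show "z:mu ==> z:<F>" "z:mu ==> z ~= \<zero>" using subfieldE(3)[OF subfield_E] by (auto simp: mu_def)
show "finite mu" "card mu = m"
 using finite_E card_E subringE(2)[OF subfieldE(1)[OF subfield_E]] by (auto simp: mu_def m_def)
qed

lemma mu_pow_mod: "z:mu ==> z [^] (i mod m) = z [^] (i::nat)"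
proof -
assume z: "z:mu"
have "z [^] i = z [^] (m * (i div m) + i mod m)" by simp
also have "... = (z [^] m) [^] (i div m)\<otimes> z [^] (i mod m)"
 using mu_simps(1)[OF z] by (simp add: K.nat_pow_mult K.nat_pow_pow)
finally show ?thesis using mu_simps(1-3)[OF z] by simp
qed

text \<open>Evaluates the cyclic generator at z and inverts the elements of G. The inversion, forced
  by the convention (g, h) m = g m h^(-1), makes it an antihomomorphism.\<close>

definition Psi where "Psi z a = (\<lambda>g\<in><G>. \<Oplus>l\<in>{..<m}. z [^] l\<otimes> a (l, inv .G g))"

lemma Psi_at: "g:<G> ==> Psi z a g = (\<Oplus>l\<in>{..<m}. z [^] l\<otimes> a (l, inv .G g))"
 by (simp add: Psi_def)

lemma FY_at: "a:<FY> ==> l < m ==> g:<G> ==> a (l, g):<F>" using Y.gr_at by auto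

lemma Psi_closed: "z:<F> ==> a:<FY> ==> Psi z a:<KG>" using FY_at by (auto simp: gr_carrier Psi_def)

lemma Psi_add: "z:<F> ==> a:<FY> ==> a':<FY> ==> Psi z (a \<oplus>.FY a') = Psi z a \<oplus>.KG Psi z a'"
proof (rule gr_eqI)
assume h: "z:<F>" "a:<FY>" "a':<FY>"
thus "Psi z (a \<oplus>.FY a'):<KG>" "Psi z a \<oplus>.KG Psi z a':<KG>" using Psi_closed by auto
fix g assume g: "g:<G>"
have "Psi z (a \<oplus>.FY a') g = (\<Oplus>l\<in>{..<m}. z [^] l\<otimes> a (l, inv .G g) \<oplus> z [^] l\<otimes> a' (l, inv .G g))"
 unfolding Psi_at[OF g] using h g FY_at by (intro K.finsum_cong') (auto simp: Y.gr_add_at K.r_distr)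
also have "... = Psi z a g \<oplus> Psi z a' g" unfolding Psi_at[OF g] using h g FY_at by (intro K.finsum_addf) auto
finally show "Psi z (a \<oplus>.FY a') g = (Psi z a \<oplus>.KG Psi z a') g" using g by (simp add: gr_add_at)
qed

lemma Psi_mon:
 assumes "z:<F>" "c:<F>" "i < m" "h:<G>"
 shows "Psi z (ymon c (i, h)) = mon (c\<otimes> z [^] i) (inv .G h)"
proof (rule gr_eqI)
show "Psi z (ymon c (i, h)):<KG>" using assms Psi_closed Y.mon_closed by blast
fix g assume g: "g:<G>"
have e: "inv .G g = h <-> g = inv .G h" using g assms(4) by auto
have "Psi z (ymon c (i, h)) g = (\<Oplus>l\<in>{..<m}. if l = i then (if g = inv .G h then c\<otimes> z [^] l else \<zero>) else \<zero>)"
 unfolding Psi_at[OF g] using assms g by (intro K.finsum_cong') (auto simp: Y.mon_at K.m_comm)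
also have "... = (if g = inv .G h then c\<otimes> z [^] i else \<zero>)" using assms by (intro K.finsum_delta) auto
finally show "Psi z (ymon c (i, h)) g = mon (c\<otimes> z [^] i) (inv .G h) g" using g by (simp add: mon_at)
qed (use assms in auto)

lemma Psi_mult:
 assumes z: "z:mu" and a: "a:<FY>" and a': "a':<FY>"
 shows "Psi z (a\<otimes>.FY a') = Psi z a'\<otimes>.KG Psi z a" using a
proof (induction a rule: Y.gr_induct)
case (mon c y)
obtain i h where y: "y = (i, h)" "i < m" "h:<G>" using mon(2) by auto
have zc: "z:<F>" using mu_simps(1)[OF z] .
from a' show ?case
proof (induction a' rule: Y.gr_induct)
 case (mon d y')
 obtain j g where y': "y' = (j, g)" "j < m" "g:<G>" using mon(2) by auto
 have "ymon c y\<otimes>.FY ymon d y' = ymon (c\<otimes> d) ((i + j) mod m, h\<otimes>.G g)"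
  using Y.mon_mult[OF \<open>c:<F>\<close> mon(1) \<open>y:<Y>\<close> mon(2)] y y' by simp
 hence "Psi z (ymon c y\<otimes>.FY ymon d y') = mon ((c\<otimes> d)\<otimes> z [^] (i + j)) (inv .G (h\<otimes>.G g))"
  using Psi_mon[OF zc, of "c\<otimes> d" "(i + j) mod m" "h\<otimes>.G g"] \<open>c:<F>\<close> mon(1) y y' mu_pow_mod[OF z] by simp
 also have "... = mon (d\<otimes> z [^] j) (inv .G g)\<otimes>.KG mon (c\<otimes> z [^] i) (inv .G h)"
  using \<open>c:<F>\<close> mon(1) y y' zc
  by (simp add: mon_mult G.inv_mult_group K.nat_pow_mult[symmetric] K.m_ac)
 finally show ?case
  using Psi_mon[OF zc \<open>c:<F>\<close> y(2,3)] Psi_mon[OF zc mon(1) y'(2,3)] y(1) y'(1) by simp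
next
 case (add u v)
 thus ?case using Psi_add[OF zc] Psi_closed[OF zc] Y.mon_closed[OF \<open>c:<F>\<close>, of y] Y.gr_mult_closed
  by (simp add: Y.KG.r_distr KG.l_distr)
qed
next
case (add u v)
have zc: "z:<F>" using mu_simps(1)[OF z] .
from add show ?case using Psi_add[OF zc] Psi_closed[OF zc] a' by (simp add: Y.KG.l_distr KG.r_distr)
qed

lemma Psi_one: "z:mu ==> Psi z \<one>.FY = \<one>.KG"
 using Psi_mon[of z \<one> 0 "\<one>.G"] mu_simps(1)[of z] m_pos by (simp add: Y.gr_one gr_one)

lemma Psi_zero: "z:mu ==> Psi z \<zero>.FY = \<zero>.KG"
 using Psi_add[of z "\<zero>.FY" "\<zero>.FY"] mu_simps(1)[of z] Psi_closed[of z "\<zero>.FY"] by auto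

text \<open>For fixed h the coefficients a(l, h) form a polynomial of degree below m which would
  vanish at all m elements of \<open>mu\<close>.\<close>

lemma Psi_inject:
 assumes a: "a:<FY>" and z: "!!z. z:mu ==> Psi z a = \<zero>.KG"
 shows "a = \<zero>.FY"
proof (rule ccontr)
assume "a ~= \<zero>.FY"
then obtain i h where ih: "i < m" "h:<G>" "a (i, h) ~= \<zero>"
 using Y.gr_eqI[OF a Y.gr_zero_closed] by (auto simp: Y.gr_zero_at)
let ?c = "%l. a (l, h)"
have lm: "{..m - 1} = {..<m}" using m_pos by auto
have "(\<Oplus>l\<in>{..m - 1}. ?c l\<otimes> z [^] l) = \<zero>" if "z:mu" for z
proof -
 have "Psi z a (inv .G h) = \<zero>" using z[OF that] ih(2) by (simp add: gr_zero_at)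
 hence "(\<Oplus>l\<in>{..<m}. z [^] l\<otimes> ?c l) = \<zero>" using ih(2) by (simp add: Psi_at)
 moreover have "(\<Oplus>l\<in>{..<m}. z [^] l\<otimes> ?c l) = (\<Oplus>l\<in>{..<m}. ?c l\<otimes> z [^] l)"
  using mu_simps(1)[OF that] FY_at[OF a] ih(2) by (intro K.finsum_cong') (auto simp: K.m_comm)
 ultimately show ?thesis unfolding lm by simp
qed
hence "card mu <= m - 1"
proof -
 have "i <= m - 1" "?c:{..m - 1} -> <F>" "mu <= <F>" using ih FY_at[OF a] mu_simps(1) m_pos by auto
 thus ?thesis using few_roots[of ?c "m - 1" i mu] ih(3) \<open>!!z. z:mu ==> _ = \<zero>\<close> by blast
qed
thus False using mu_simps(5) m_pos by linarith
qed

lemma geometric_zero: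
 assumes "x:<F>" "x [^] m = \<one>" "x ~= \<one>"
 shows "(\<Oplus>l\<in>{..<m}. x [^] l) = \<zero>"
proof -
let ?S = "\<Oplus>l\<in>{..<m}. x [^] l"
obtain r where r: "m = Suc r" using m_pos gr0_implies_Suc by blast
have S: "?S:<F>" using assms(1) by simp
have "x\<otimes> ?S = (\<Oplus>l\<in>{..<m}. x [^] Suc l)"
 using assms(1) by (subst K.finsum_rdistr) (auto simp: K.m_comm)
hence "x\<otimes> ?S \<oplus> \<one> = (\<Oplus>l\<in>{..r}. x [^] Suc l) \<oplus> x [^] (0::nat)"
 unfolding r by (simp add: lessThan_Suc_atMost)
also have "... = (\<Oplus>l\<in>{..Suc r}. x [^] l)" using assms(1) by (subst K.finsum_Suc2) auto
also have "... = x [^] m \<oplus> ?S" using assms(1) unfolding r by (subst K.finsum_Suc) (auto simp: lessThan_Suc_atMost)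
finally have "x\<otimes> ?S = ?S" using assms K.a_comm[of \<one> ?S] by simp
hence "(x \<ominus> \<one>)\<otimes> ?S = \<zero>" using assms(1) by (simp add: a_minus_def K.l_distr K.l_minus K.r_neg)
moreover have "x \<ominus> \<one> ~= \<zero>" using assms by simp
ultimately show ?thesis using assms(1) S K.integral by blast
qed

text \<open>m + 1 = q^n is a multiple of p, so m is minus one in F.\<close>

lemma m_inverse: "EX c:<F>. c\<otimes> (\<Oplus>l\<in>{..<m}. \<one>) = \<one>"
proof -
have p1: "[p] \<cdot> \<one> = \<zero>" using char_p .
obtain r where "q ^ n = p * r" using p_dvd_q n_pos by (metis dvd_def dvd_power dvd_trans)
hence "Suc m = p * r" using q_pow_gt[OF n_pos] by (simp add: m_def)
hence "[Suc m] \<cdot> \<one> = \<zero>" using p1 K.add.nat_pow_pow[of \<one> r p] by simp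
hence "[m] \<cdot> \<one> = \<ominus> \<one>" using K.minus_equality[of "[m] \<cdot> \<one>" \<one>] by simp
hence "(\<Oplus>l\<in>{..<m}. \<one>) = \<ominus> \<one>" by (simp add: K.add.finprod_const)
thus ?thesis by (intro bexI[of _ "\<ominus> \<one>"]) (auto simp: K.l_minus)
qed

text \<open>Inversion of the discrete Fourier transform. With \<open>Psi_inject\<close> it
  identifies \<open>FY\<close> with a product of copies of the opposite of the group algebra of G,
  one for each element of \<open>mu\<close>.\<close>

lemma Psi_surj:
 assumes w: "!!z. z:mu ==> w z:<KG>"
 shows "EX a:<FY>. ALL z:mu. Psi z a = w z"
proof -
obtain c where c: "c:<F>" "c\<otimes> (\<Oplus>l\<in>{..<m}. \<one>) = \<one>" using m_inverse by blast
have wa: "w z g:<F>" if "z:mu" "g:<G>" for z g using gr_at[OF w] that by blast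
have iz: "inv z:<F>" "z\<otimes> inv z = \<one>" if "z:mu" for z using mu_simps(1-3)[OF that] by (auto simp: K.field_Units)
\<comment> \<open>The inverse transform; c is the inverse of m in F.\<close>
define a where "a = (\<lambda>y\<in><Y>. c\<otimes> (\<Oplus>z\<in>mu. (inv z) [^] (fst y)\<otimes> w z (inv .G (snd y))))"
have ac: "a:<FY>" using c wa iz by (auto simp: a_def Y.gr_carrier)
have "Psi z a g = w z g" if z: "z:mu" and g: "g:<G>" for z g
proof -
 have zc: "z:<F>" using mu_simps(1)[OF z] .
 have "Psi z a g = (\<Oplus>l\<in>{..<m}. \<Oplus>y\<in>mu. c\<otimes> ((z\<otimes> inv y) [^] l\<otimes> w y g))"
  unfolding Psi_at[OF g]
 proof (rule K.finsum_cong')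
  fix l assume l: "l:{..<m}"
  have "z [^] l\<otimes> a (l, inv .G g) = (z [^] l\<otimes> c)\<otimes> (\<Oplus>y\<in>mu. (inv y) [^] l\<otimes> w y g)"
   using l g zc c wa iz by (simp add: a_def K.m_assoc)
  also have "... = (\<Oplus>y\<in>mu. (z [^] l\<otimes> c)\<otimes> ((inv y) [^] l\<otimes> w y g))"
   using zc c wa iz g mu_simps(4) by (intro K.finsum_rdistr) auto
  also have "... = (\<Oplus>y\<in>mu. c\<otimes> ((z\<otimes> inv y) [^] l\<otimes> w y g))"
   using zc c wa iz g by (intro K.finsum_cong') (auto simp: K.nat_pow_distrib K.m_ac)
  finally show "z [^] l\<otimes> a (l, inv .G g) = (\<Oplus>y\<in>mu. c\<otimes> ((z\<otimes> inv y) [^] l\<otimes> w y g))" .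
 qed (use zc c wa iz g in \<open>auto intro!: K.finsum_closed\<close>)
 also have "... = (\<Oplus>y\<in>mu. \<Oplus>l\<in>{..<m}. c\<otimes> ((z\<otimes> inv y) [^] l\<otimes> w y g))"
  using zc c wa iz g by (intro K.finsum_swap) auto
 also have "... = (\<Oplus>y\<in>mu. if y = z then w y g else \<zero>)"
 proof (rule K.finsum_cong')
  fix y assume y: "y:mu"
  let ?x = "z\<otimes> inv y"
  have x: "?x:<F>" using zc iz y by simp
  have "(\<Oplus>l\<in>{..<m}. c\<otimes> (?x [^] l\<otimes> w y g)) = (\<Oplus>l\<in>{..<m}. (c\<otimes> w y g)\<otimes> ?x [^] l)"
   using x c wa[OF y g] by (intro K.finsum_cong') (auto simp: K.m_ac)
  also have "... = (c\<otimes> w y g)\<otimes> (\<Oplus>l\<in>{..<m}. ?x [^] l)"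
   using x c wa[OF y g] by (intro K.finsum_rdistr[symmetric]) auto
  also have "... = (if y = z then w y g else \<zero>)"
  proof (cases "y = z")
   case True
   hence "?x = \<one>" using iz(2)[OF y] by simp
   hence "(c\<otimes> w y g)\<otimes> (\<Oplus>l\<in>{..<m}. ?x [^] l) = w y g\<otimes> (c\<otimes> (\<Oplus>l\<in>{..<m}. \<one>))"
    using c(1) wa[OF y g] by (simp add: K.m_ac)
   thus ?thesis using True c wa[OF y g] by simp
  next
   case False
   have yc: "y:<F>" using mu_simps(1)[OF y] .
   have "?x ~= \<one>"
   proof
    assume "?x = \<one>"
    hence "?x\<otimes> y = y" using yc by simp
    moreover have "?x\<otimes> y = z\<otimes> (y\<otimes> inv y)" using zc yc iz(1)[OF y] K.m_comm[of "inv y" y] by (simp add: K.m_assoc)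
    ultimately show False using False iz(2)[OF y] zc by simp
   qed
   moreover have "?x [^] m = \<one>"
   proof -
    have "\<one> = (y\<otimes> inv y) [^] m" using iz(2)[OF y] by simp
    also have "... = y [^] m\<otimes> (inv y) [^] m" using yc iz(1)[OF y] by (rule K.nat_pow_distrib)
    finally have "(inv y) [^] m = \<one>" using mu_simps(3)[OF y] iz(1)[OF y] by simp
    thus ?thesis using mu_simps(3)[OF z] iz[OF y] zc by (simp add: K.nat_pow_distrib)
   qed
   ultimately show ?thesis using geometric_zero[OF x] False c wa[OF y g] by simp
  qed
  finally show "(\<Oplus>l\<in>{..<m}. c\<otimes> (?x [^] l\<otimes> w y g)) = (if y = z then w y g else \<zero>)" .
 qed (use wa g in auto)
 also have "... = w z g" using mu_simps(4) z wa[OF z g] by (intro K.finsum_delta) auto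
 finally show ?thesis .
qed
hence "Psi z a = w z" if "z:mu" for z
 using gr_eqI[OF Psi_closed[OF mu_simps(1)[OF that] ac] w[OF that]] that by blast
thus ?thesis using ac by blast
qed

lemma Psi_galois:
 assumes s: "s:ring_hom F F" and z: "z:<F>" and a: "a:<FY>"
 shows "Psi (s z) (gal Y s a) = gal G s (Psi z a)"
proof -
have sc: "s x:<F>" if "x:<F>" for x using s that ring_hom_closed by metis
interpret s: ring_hom_ring F F s using s by (intro ring_hom_ringI2 K.ring_axioms)
have "Psi (s z) (gal Y s a) g = s (Psi z a g)" if g: "g:<G>" for g
proof -
 have "s (Psi z a g) = (\<Oplus>l\<in>{..<m}. s (z [^] l\<otimes> a (l, inv .G g)))"
  unfolding Psi_at[OF g] using z FY_at[OF a] g by (intro finsum_hom K.abelian_monoid_axioms) auto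
 also have "... = Psi (s z) (gal Y s a) g" unfolding Psi_at[OF g] using z FY_at[OF a] g
  by (intro K.finsum_cong') (auto simp: galois_action_def s.hom_nat_pow)
 finally show ?thesis by simp
qed
thus ?thesis by (auto simp: galois_action_def Psi_def fun_eq_iff)
qed
end

section \<open>Primitive idempotents of the finite algebra and Frobenius orbits\<close>

lemma (in group_algebra) gr_finsum_at:
 assumes "f:I -> <KG>" "g:<G>"
 shows "finsum KG f I g = (\<Oplus>i\<in>I. f i g)" using assms gr_at
 by (intro finsum_hom[where f = "%a. a g"] KG.abelian_monoid_axioms K.abelian_monoid_axioms)
  (auto simp: gr_zero_at gr_add_at)

text \<open>Frobenius shifts the summands by one place, and the last one returns to the
  first.\<close>

lemma (in closure_over_finite) trace_fixed:
 assumes "x:<F>" "(phi ^^ N) x = x" "N > 0"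
 shows "phi (\<Oplus>i\<in>{..<N}. (phi ^^ i) x) = (\<Oplus>i\<in>{..<N}. (phi ^^ i) x)"
proof -
interpret h: ring_hom_ring F F phi using phi_pow_hom[of 1] by (intro ring_hom_ringI2 ring_axioms) simp
have "phi (\<Oplus>i\<in>{..<N}. (phi ^^ i) x) = (\<Oplus>i\<in>{..<N}. phi ((phi ^^ i) x))"
 using assms(1) by (intro finsum_hom abelian_monoid_axioms) auto
also have "... = (\<Oplus>i\<in>{..<N}. (phi ^^ Suc i) x)" by simp
also have "... = (\<Oplus>i\<in>{..<N}. (phi ^^ i) x)"
proof -
 obtain r where r: "N = Suc r" using assms(3) gr0_implies_Suc by blast
 have "(\<Oplus>i\<in>{..r}. (phi ^^ Suc i) x) = (phi ^^ Suc r) x \<oplus> (\<Oplus>i\<in>{..<r}. (phi ^^ Suc i) x)"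
  using assms(1) by (intro add.finprod_Suc3) auto
 moreover have "(\<Oplus>i\<in>{..r}. (phi ^^ i) x) = (\<Oplus>i\<in>{..<r}. (phi ^^ Suc i) x) \<oplus> (phi ^^ 0) x"
 proof (cases r)
  case (Suc l)
  thus ?thesis using assms(1) finsum_Suc2[of "%i. (phi ^^ i) x" l] by (simp add: lessThan_Suc_atMost)
 qed (use assms(1) in simp)
 ultimately show ?thesis using r assms(1,2) by (simp add: lessThan_Suc_atMost a_comm del: funpow.simps)
qed
finally show ?thesis .
qed

lemma galois_action_comp: "gal G s (gal G t c) = gal G (%x. s (t x)) c" by (auto simp: galois_action_def)

context block_algebra
begin

definition cong where "cong c x y <-> x:<KG> & y:<KG> & x \<ominus>.KG y:Ann c"

lemma cong_refl: "c:irr ==> x:<KG> ==> cong c x x" using Ann_zero by (simp add: cong_def a_minus_def KG.r_neg)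

lemma cong_add:
 assumes "c:irr" "cong c x y" "cong c x' y'"
 shows "cong c (x \<oplus>.KG x') (y \<oplus>.KG y')"
proof -
have "(x \<oplus>.KG x') \<ominus>.KG (y \<oplus>.KG y') = (x \<ominus>.KG y) \<oplus>.KG (x' \<ominus>.KG y')"
 using assms by (simp add: cong_def a_minus_def KG.minus_add KG.a_ac)
thus ?thesis using assms Ann_add by (auto simp: cong_def)
qed

lemma cong_mult_left:
 assumes "c:irr" "cong c x y" "r:<KG>"
 shows "cong c (r\<otimes>.KG x) (r\<otimes>.KG y)"
proof -
have "(r\<otimes>.KG x) \<ominus>.KG (r\<otimes>.KG y) = r\<otimes>.KG (x \<ominus>.KG y)"
 using assms by (simp add: cong_def a_minus_def KG.r_distr KG.r_minus)
thus ?thesis using assms Ann_mult(1) by (auto simp: cong_def)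
qed

lemma cong_finsum:
 assumes "c:irr" "!!i. i:I ==> cong c (f i) (g i)"
 shows "cong c (finsum KG f I) (finsum KG g I)" using assms(2)
proof (induction I rule: infinite_finite_induct)
case (insert i I)
have "f:I -> <KG>" "g:I -> <KG>" "f i:<KG>" "g i:<KG>" using insert.prems by (auto simp: cong_def)
thus ?case using insert cong_add[OF assms(1)] by simp
qed (use cong_refl[OF assms(1)] in auto)

lemma cong_galois:
 assumes "s:galois_group F k" "c:irr" "cong c x y"
 shows "cong (gal G s c) (gal G s x) (gal G s y)"
proof -
have "s:ring_hom F F" using galois_iso[OF assms(1)] by (simp add: ring_iso_def)
then interpret gs: ring_hom_ring KG KG "gal G s"
 using galois_action_hom(1) by (intro ring_hom_ringI2 KG.ring_axioms)
show ?thesis using assms(3) galois_Ann[OF assms(1,2), of "x \<ominus>.KG y"] by (auto simp: cong_def a_minus_def)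
qed

lemma cong_Ann: "c:irr ==> x:<KG> ==> cong c x \<zero>.KG <-> x:Ann c" by (simp add: cong_def a_minus_def)
end

context cyclic_block
begin

text \<open>Members of \<open>Pi\<close> label the simple \<open>FY\<close>-modules of the block.
  \<open>PP\<close> is the annihilator contracted to \<open>A\<close>, a prime ideal, and
  \<open>Omega a\<close> consists of the labels at which a survives.\<close>

definition Pi where "Pi = mu \<times> irr"
definition Phi where "Phi i \<pi> = ((phi ^^ i) (fst \<pi>), gal G (phi ^^ i) (snd \<pi>))"
definition PP where "PP \<pi> = {a:<A>. Psi (fst \<pi>) a:Ann (snd \<pi>)}"
definition Omega where "Omega a = {\<pi>:Pi. a \<notin> PP \<pi>}"
text \<open>The block idempotent carried over to \<open>A\<close>; the inverse undoes the one in
  \<open>Psi\<close>, so that \<open>Psi z eA\<close> is b.\<close>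

definition eA where "eA = (\<lambda>y\<in><Y>. if fst y = 0 then b (inv .G (snd y)) else \<zero>)"

lemma Phi_Pi: "\<pi>:Pi ==> Phi i \<pi>:Pi"
proof -
assume p: "\<pi>:Pi"
hence z: "fst \<pi>:mu" by (auto simp: Pi_def)
have "(phi ^^ i) (fst \<pi>):mu"
proof -
 have "x [^] j:E" if "x:E" for x and j :: nat
  by (induction j) (use that subringE[OF subfieldE(1)[OF subfield_E]] in auto)
 hence "(phi ^^ i) (fst \<pi>):E" using z mu_simps(1)[OF z] phi_pow by (auto simp: mu_def)
 moreover have "(phi ^^ i) (fst \<pi>) ~= \<zero>"
 proof
  assume "(phi ^^ i) (fst \<pi>) = \<zero>"
  moreover have "(phi ^^ i) \<zero> = \<zero>" using phi_pow_hom K.ring_axioms ring_hom_zero by metis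
  moreover have "inj_on (phi ^^ i) <F>" using phi_pow_iso by (auto simp: ring_iso_def bij_betw_def)
  ultimately show False using mu_simps(1,2)[OF z] by (metis K.zero_closed inj_onD)
 qed
 ultimately show ?thesis by (simp add: mu_def)
qed
moreover have "gal G (phi ^^ i) (snd \<pi>):irr" using p galois_irr[OF galois_phi] by (auto simp: Pi_def)
ultimately show ?thesis by (simp add: Phi_def Pi_def)
qed

lemma Phi_add: "Phi i (Phi j \<pi>) = Phi (i + j) \<pi>"
 by (simp add: Phi_def galois_action_comp funpow_add comp_def)

text \<open>One finite field containing S, \<open>mu\<close> and all character values gives a single
  N that serves every label and all of S.\<close>

lemma Phi_period:
 assumes "finite S" "S <= <F>"
 obtains K N where "subfield K F" "finite K" "k <= K" "card K = q ^ N" "N > 0" "S <= K"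
  "\<And>\<pi>. \<pi>:Pi ==> Phi N \<pi> = \<pi>" "!!x. x:K ==> (phi ^^ N) x = x"
proof -
let ?T = "S \<union> mu \<union> (\<Union>c\<in>irr. c ` <G>)"
have "finite ?T" using assms(1) mu_simps(4) finite_irr finite_G by simp
moreover have "?T <= <F>"
proof -
 have "c g:<F>" if "c:irr" "g:<G>" for c g using irr_values[OF that(1)] that(2) by (rule PiE_mem)
 thus ?thesis using assms(2) mu_simps(1) by blast
qed
ultimately obtain K where K: "subfield K F" "finite K" "?T <= K" "k <= K" by (rule finite_subfield)
obtain N where N: "N > 0" "card K = q ^ N" using card_subfield[OF K(1,2,4)] by blast
have fx: "(phi ^^ N) x = x" if "x:K" for x
 using subfield_fixed[OF K(1,2) N(2) _ N(1)] that subfieldE(3)[OF K(1)] by blast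
have "Phi N \<pi> = \<pi>" if "\<pi>:Pi" for \<pi>
proof -
 obtain z c where zc: "\<pi> = (z, c)" "z:mu" "c:irr" using \<open>\<pi>:Pi\<close> by (auto simp: Pi_def)
 have "gal G (phi ^^ N) c = c"
 proof (rule PiE_ext[of _ "<G>" "%_. <F>"])
  show "gal G (phi ^^ N) c:<G> \<rightarrow>\<^sub>E <F>" "c:<G> \<rightarrow>\<^sub>E <F>"
   using irr_values galois_irr[OF galois_phi] zc(3) by auto
  show "gal G (phi ^^ N) c g = c g" if "g:<G>" for g
  proof -
   have "c g:K" using K(3) zc(3) that by blast
   thus ?thesis using fx that by (simp add: galois_action_def)
  qed
 qed
 thus ?thesis using fx K(3) zc by (auto simp: Phi_def)
qed
thus ?thesis using that K N fx by blast
qed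

lemma Phi_inverse: "\<pi>:Pi ==> EX j. Phi j (Phi i \<pi>) = \<pi>"
proof -
assume p: "\<pi>:Pi"
obtain N where N: "N > 0" "\<And>\<pi>. \<pi>:Pi ==> Phi N \<pi> = \<pi>" using Phi_period[of "{}"] by (metis empty_subsetI finite.emptyI)
have Nm: "Phi (N * Suc r) \<pi> = \<pi>" for r
proof (induction r)
 case (Suc r)
 have "Phi (N * Suc (Suc r)) \<pi> = Phi N (Phi (N * Suc r) \<pi>)" by (simp add: Phi_add)
 thus ?case using Suc N(2)[OF p] by simp
qed (use N(2) p in simp)
have "i <= N * Suc i" using N(1) by (cases N) auto
hence "Phi (N * Suc i - i) (Phi i \<pi>) = \<pi>" using Phi_add[of "N * Suc i - i" i \<pi>] Nm[of i] by simp
thus ?thesis by blast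
qed

text \<open>Galois descent. The indicator of W is lifted to \<open>FY\<close> by separating elements
  and \<open>Psi_surj\<close>. Scaling by an element t of trace one and summing the Frobenius
  conjugates over a full period N gives coefficients in k, and the indicator survives because W is
  stable under Frobenius.\<close>

lemma orbit_separation:
 assumes W: "W <= Pi" "\<And>\<pi> i. \<pi>:Pi ==> Phi i \<pi>:W <-> \<pi>:W"
 shows "EX a:<A>. ALL \<pi>:Pi. cong (snd \<pi>) (Psi (fst \<pi>) a) (if \<pi>:W then \<one>.KG else \<zero>.KG)"
proof -
have "EX u. u:<KG> & \<one>.KG \<ominus>.KG u:Ann c & (ALL d:irr. d ~= c --> u:Ann d)" if "c:irr" for c
 using separating_element[OF that] by metis
then obtain u where u: "!!c. c:irr ==> u c:<KG>" "!!c. c:irr ==> \<one>.KG \<ominus>.KG u c:Ann c"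
 "!!c d. c:irr ==> d:irr ==> d ~= c ==> u c:Ann d" by metis
define \<delta> where "\<delta> \<pi> = (if \<pi>:W then \<one>.KG else \<zero>.KG)" for \<pi>
define w where "w z = (\<Oplus>.KG c\<in>irr. if (z, c):W then u c else \<zero>.KG)" for z
have wc: "w z:<KG>" for z unfolding w_def using u(1) by (intro KG.finsum_closed) auto
have dc: "\<delta> \<pi>:<KG>" for \<pi> by (simp add: \<delta>_def)
have w: "cong c (w z) (\<delta> (z, c))" if c: "c:irr" for z c
proof -
 have "cong c (w z) (\<Oplus>.KG d\<in>irr. if d = c then \<delta> (z, d) else \<zero>.KG)" unfolding w_def
 proof (rule cong_finsum[OF c])
  fix d assume d: "d:irr"
  have "u c \<ominus>.KG \<one>.KG = (\<ominus>.KG \<one>.KG)\<otimes>.KG (\<one>.KG \<ominus>.KG u c)"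
   using u(1)[OF c] by (simp add: a_minus_def KG.l_minus KG.minus_add KG.a_comm)
  hence "cong c (u c) \<one>.KG" using Ann_mult(1)[OF c u(2)[OF c], of "\<ominus>.KG \<one>.KG"] u(1)[OF c] by (simp add: cong_def)
  thus "cong c (if (z, d):W then u d else \<zero>.KG) (if d = c then \<delta> (z, d) else \<zero>.KG)"
   using u(1,3)[OF d] c cong_Ann[OF c] cong_refl[OF c] by (auto simp: \<delta>_def)
 qed
 also have "(\<Oplus>.KG d\<in>irr. if d = c then \<delta> (z, d) else \<zero>.KG) = \<delta> (z, c)"
  using finite_irr c dc by (intro KG.finsum_delta) auto
 finally show ?thesis .
qed
obtain a0 where a0: "a0:<FY>" "!!z. z:mu ==> Psi z a0 = w z" using Psi_surj[of w] wc by blast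
have "finite (a0 ` <Y>)" "a0 ` <Y> <= <F>" using Y.finite_G Y.gr_at[OF a0(1)] by auto
then obtain K N where K: "subfield K F" "finite K" "k <= K" "card K = q ^ N" "N > 0" "a0 ` <Y> <= K"
 and N: "\<And>\<pi>. \<pi>:Pi ==> Phi N \<pi> = \<pi>" "!!x. x:K ==> (phi ^^ N) x = x" using Phi_period by metis
obtain t where t: "t:K" "(\<Oplus>i\<in>{..<N}. (phi ^^ i) t) = \<one>" using trace_one[OF K(1-5)] by blast
have tc: "t:<F>" using t(1) subfieldE(3)[OF K(1)] by blast
let ?ta = "ymon t \<one>.Y\<otimes>.FY a0"
have tac: "?ta:<FY>" using a0 tc Y.mon_closed by blast
have at: "?ta y:K" if "y:<Y>" for y
 using Y.scalar_mult_at[OF a0(1) tc that] K(6) t(1) that subringE(6)[OF subfieldE(1)[OF K(1)]] by auto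
define g where "g i = gal Y (phi ^^ i) ?ta" for i
have gc: "g i:<FY>" for i unfolding g_def using Y.galois_action_hom(1)[OF phi_pow_hom] tac ring_hom_closed by metis
define a where "a = finsum FY g {..<N}"
have aFY: "a:<FY>" unfolding a_def using gc by (intro Y.KG.finsum_closed) auto
have "a y:k" if y: "y:<Y>" for y
proof -
 have "a y = (\<Oplus>i\<in>{..<N}. (phi ^^ i) (?ta y))"
  unfolding a_def using Y.gr_finsum_at[of g "{..<N}" y] gc y by (simp add: g_def galois_action_def)
 moreover have "?ta y:<F>" using Y.gr_at[OF tac y] .
 ultimately show ?thesis using trace_fixed[of "?ta y" N] N(2)[OF at[OF y]] K(5) phi_fixed[of "a y"] by simp
qed
hence aA: "a:<A>" using aFY by (simp add: carrier_A)
have "cong (snd \<pi>) (Psi (fst \<pi>) a) (\<delta> \<pi>)" if \<pi>: "\<pi>:Pi" for \<pi>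
proof -
 obtain z c where zc: "\<pi> = (z, c)" "z:mu" "c:irr" using \<pi> by (auto simp: Pi_def)
 have zF: "z:<F>" using mu_simps(1) zc by blast
 have "Psi z a = (\<Oplus>.KG i\<in>{..<N}. Psi z (g i))"
  unfolding a_def using gc Psi_closed[OF zF] Psi_zero[OF zc(2)] Psi_add[OF zF]
  by (intro finsum_hom[where f = "Psi z", OF Y.KG.abelian_monoid_axioms KG.abelian_monoid_axioms]) auto
 moreover have "cong c (\<Oplus>.KG i\<in>{..<N}. Psi z (g i)) (\<Oplus>.KG i\<in>{..<N}. mon ((phi ^^ i) t) \<one>.G\<otimes>.KG \<delta> \<pi>)"
 proof (rule cong_finsum[OF zc(3)])
  fix i assume "i:{..<N}"
  hence i: "i + (N - i) = N" by simp
  \<comment> \<open>The value at this label of the i-th conjugate is the conjugate of the value at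
    the label i steps earlier, which is N - i steps later.\<close>
  let ?\<pi> = "Phi (N - i) \<pi>"
  obtain z' c' where zc': "?\<pi> = (z', c')" "z':mu" "c':irr" using Phi_Pi[OF \<pi>, of "N - i"] by (auto simp: Pi_def)
  have "Phi i ?\<pi> = \<pi>" using Phi_add i N(1)[OF \<pi>] by simp
  hence eq: "(phi ^^ i) z' = z" "gal G (phi ^^ i) c' = c" using zc zc' by (auto simp: Phi_def)
  have "Psi z' ?ta = w z'\<otimes>.KG mon t \<one>.G"
   using Psi_mult[OF zc'(2) Y.mon_closed[OF tc] a0(1)] a0(2)[OF zc'(2)] Psi_mon[OF mu_simps(1)[OF zc'(2)] tc m_pos G.one_closed] tc by simp
  also have "... = mon t \<one>.G\<otimes>.KG w z'" using scalar_central[OF wc tc] by simp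
  finally have P: "Psi z' ?ta = mon t \<one>.G\<otimes>.KG w z'" .
  have "cong c' (mon t \<one>.G\<otimes>.KG w z') (mon t \<one>.G\<otimes>.KG \<delta> \<pi>)"
   using cong_mult_left[OF zc'(3) w[OF zc'(3), of z']] tc W(2)[OF \<pi>, of "N - i"] zc'(1) by (simp add: \<delta>_def)
  hence "cong c (gal G (phi ^^ i) (Psi z' ?ta)) (gal G (phi ^^ i) (mon t \<one>.G\<otimes>.KG \<delta> \<pi>))"
   using cong_galois[OF galois_phi zc'(3)] P eq(2) by metis
  moreover have "gal G (phi ^^ i) (Psi z' ?ta) = Psi z (g i)"
   using Psi_galois[OF phi_pow_hom mu_simps(1)[OF zc'(2)] tac, of i] unfolding eq(1) g_def by (rule sym)
  moreover have "gal G (phi ^^ i) (mon t \<one>.G\<otimes>.KG \<delta> \<pi>) = mon ((phi ^^ i) t) \<one>.G\<otimes>.KG \<delta> \<pi>"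
  proof -
   interpret gs: ring_hom_ring KG KG "gal G (phi ^^ i)"
    using galois_action_hom(1)[OF phi_pow_hom] by (intro ring_hom_ringI2 KG.ring_axioms)
   show ?thesis using galois_action_hom(2)[OF phi_pow_hom tc] tc by (simp add: \<delta>_def)
  qed
  ultimately show "cong c (Psi z (g i)) (mon ((phi ^^ i) t) \<one>.G\<otimes>.KG \<delta> \<pi>)" by simp
 qed
 moreover have "(\<Oplus>.KG i\<in>{..<N}. mon ((phi ^^ i) t) \<one>.G\<otimes>.KG \<delta> \<pi>) = \<delta> \<pi>"
 proof -
  have "(\<Oplus>.KG i\<in>{..<N}. mon ((phi ^^ i) t) \<one>.G\<otimes>.KG \<delta> \<pi>) = (\<Oplus>.KG i\<in>{..<N}. mon ((phi ^^ i) t) \<one>.G)\<otimes>.KG \<delta> \<pi>"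
   using dc tc by (intro KG.finsum_ldistr[symmetric]) auto
  also have "(\<Oplus>.KG i\<in>{..<N}. mon ((phi ^^ i) t) \<one>.G) = mon (\<Oplus>i\<in>{..<N}. (phi ^^ i) t) \<one>.G"
  proof (rule finsum_hom[symmetric, OF K.abelian_monoid_axioms KG.abelian_monoid_axioms])
   show "mon \<zero> \<one>.G = \<zero>.KG" by (intro gr_eqI) (auto simp: mon_at gr_zero_at)
  qed (use tc mon_add in auto)
  finally show ?thesis using t(2) dc by (simp add: gr_one[symmetric])
 qed
 ultimately show ?thesis using zc by simp
qed
thus ?thesis using aA unfolding \<delta>_def by blast
qed

lemma PP_mult:
 assumes "\<pi>:Pi" "a:PP \<pi>" "x:<A>"
 shows "x\<otimes>.A a:PP \<pi>" "a\<otimes>.A x:PP \<pi>"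
proof -
obtain z c where zc: "\<pi> = (z, c)" "z:mu" "c:irr" using assms(1) by (auto simp: Pi_def)
have "a:<A>" "Psi z a:Ann c" "Psi z x:<KG>" using assms zc Psi_closed[OF mu_simps(1)] A_sub by (auto simp: PP_def)
thus "x\<otimes>.A a:PP \<pi>" "a\<otimes>.A x:PP \<pi>"
 using assms(3) zc Psi_mult[OF zc(2)] A_sub Ann_mult[OF zc(3)] A.gr_mult_closed by (auto simp: PP_def A_mult)
qed

lemma PP_add:
 assumes "\<pi>:Pi" "a:PP \<pi>" "x:PP \<pi>"
 shows "a \<oplus>.A x:PP \<pi>"
proof -
obtain z c where zc: "\<pi> = (z, c)" "z:mu" "c:irr" using assms(1) by (auto simp: Pi_def)
thus ?thesis
 using assms Psi_add[OF mu_simps(1)[OF zc(2)]] A_sub Ann_add[OF zc(3)] A.gr_add_closed by (auto simp: PP_def A_ops)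
qed

lemma PP_zero: "\<pi>:Pi ==> \<zero>.A:PP \<pi>"
 using Psi_zero Ann_zero A.gr_zero_closed by (auto simp: PP_def Pi_def A_ops)

text \<open>The monomials with coefficient one lie in \<open>A\<close> and span the group algebra
  over F, so a condition tested on \<open>A\<close> extends to all of it, where
  \<open>Ann_prime'\<close> applies.\<close>

lemma PP_prime:
 assumes "\<pi>:Pi" "x:<A>" "y:<A>" "!!r. r:<A> ==> x\<otimes>.A r\<otimes>.A y:PP \<pi>"
 shows "x:PP \<pi> \<or> y:PP \<pi>"
proof -
obtain z c where zc: "\<pi> = (z, c)" "z:mu" "c:irr" using assms(1) by (auto simp: Pi_def)
note zF = mu_simps(1)[OF zc(2)] and xy = A_sub[OF assms(2)] A_sub[OF assms(3)]
have P: "Psi z x:<KG>" "Psi z y:<KG>" using Psi_closed zF xy by auto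
have "Psi z y\<otimes>.KG r\<otimes>.KG Psi z x:Ann c" if "r:<KG>" for r using that
proof (induction r rule: gr_induct)
 case (mon l g)
 have oA: "A.mon \<one> (0, inv .G g):<A>" using subringE(3)[OF subfieldE(1)[OF subfield_k]] by (intro A.mon_closed) simp
 have "A.mon \<one> (0, inv .G g) = ymon \<one> (0, inv .G g)" unfolding gmonom_def by (intro ext) simp
 hence "Psi z (A.mon \<one> (0, inv .G g)) = mon \<one> g"
  using Psi_mon[OF zF K.one_closed m_pos, of "inv .G g"] mon(2) by simp
 moreover have "Psi z (x\<otimes>.A A.mon \<one> (0, inv .G g)\<otimes>.A y):Ann c" using assms(4)[OF oA] zc(1) by (simp add: PP_def)
 ultimately have "Psi z y\<otimes>.KG (mon \<one> g\<otimes>.KG Psi z x):Ann c"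
  using Psi_mult[OF zc(2)] xy A_sub[OF oA] A_mult assms(2,3) oA A.gr_mult_closed by simp
 hence "mon l \<one>.G\<otimes>.KG (Psi z y\<otimes>.KG (mon \<one> g\<otimes>.KG Psi z x)):Ann c"
  using Ann_mult(1)[OF zc(3)] mon(1) by simp
 also have "mon l \<one>.G\<otimes>.KG (Psi z y\<otimes>.KG (mon \<one> g\<otimes>.KG Psi z x)) = (mon l \<one>.G\<otimes>.KG Psi z y)\<otimes>.KG (mon \<one> g\<otimes>.KG Psi z x)"
  using P mon by (simp add: KG.m_assoc)
 also have "... = Psi z y\<otimes>.KG (mon l \<one>.G\<otimes>.KG mon \<one> g)\<otimes>.KG Psi z x"
  unfolding scalar_central[OF P(2) mon(1)] using P mon by (simp add: KG.m_assoc)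
 finally show ?case using mon by (simp add: mon_mult)
next
 case (add r s)
 thus ?case using P Ann_add[OF zc(3)] by (simp add: KG.r_distr KG.l_distr)
qed
hence "Psi z y:Ann c \<or> Psi z x:Ann c" using Ann_prime'[OF zc(3)] P by blast
thus ?thesis using assms(2,3) zc(1) by (auto simp: PP_def)
qed

text \<open>Idempotency may be checked after applying every \<open>Psi z\<close>, by
  \<open>Psi_inject\<close>, and there it is idempotency of b.\<close>

lemma eA_facts: "eA:<A>" "z:mu ==> Psi z eA = b" "eA\<otimes>.A eA = eA"
proof -
show eA: "eA:<A>" using b_in_k subringE(2)[OF subfieldE(1)[OF subfield_k]] by (auto simp: A.gr_carrier eA_def)
have P: "Psi z eA = b" if z: "z:mu" for z
proof (rule gr_eqI[OF Psi_closed[OF mu_simps(1)[OF z] A_sub[OF eA]] b_simps(1)])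
 fix g assume g: "g:<G>"
 have "Psi z eA g = (\<Oplus>l\<in>{..<m}. if l = 0 then z [^] l\<otimes> b g else \<zero>)"
  unfolding Psi_at[OF g] using g gr_at[OF b_simps(1) g] mu_simps(1)[OF z] by (intro K.finsum_cong') (auto simp: eA_def)
 also have "... = z [^] (0::nat)\<otimes> b g" using m_pos gr_at[OF b_simps(1) g] by (intro K.finsum_delta) auto
 finally show "Psi z eA g = b g" using gr_at[OF b_simps(1) g] by simp
qed
thus "z:mu ==> Psi z eA = b" .
have "eA\<otimes>.FY eA \<ominus>.FY eA = \<zero>.FY"
proof (rule Psi_inject)
 fix z assume z: "z:mu"
 let ?x = "eA\<otimes>.FY eA" and ?d = "eA\<otimes>.FY eA \<ominus>.FY eA"
 have c: "?x:<FY>" "?d:<FY>" using A_sub[OF eA] by auto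
 have "Psi z ?d \<oplus>.KG Psi z eA = Psi z (?d \<oplus>.FY eA)"
  using Psi_add[OF mu_simps(1)[OF z] c(2) A_sub[OF eA]] by simp
 also have "?d \<oplus>.FY eA = ?x" using A_sub[OF eA] by (simp add: a_minus_def Y.KG.a_assoc Y.KG.l_neg)
 also have "Psi z ?x = b" using Psi_mult[OF z] A_sub[OF eA] P[OF z] b_simps(2) by simp
 finally show "Psi z ?d = \<zero>.KG" using P[OF z] Psi_closed[OF mu_simps(1)[OF z] c(2)] b_simps(1) by auto
qed (use A_sub[OF eA] Y.KG.minus_closed in auto)
hence "eA\<otimes>.FY eA = eA" using A_sub[OF eA] by simp
thus "eA\<otimes>.A eA = eA" using A_mult eA by simp
qed

text \<open>By \<open>Psi_inject\<close> some \<open>Psi z a\<close> is a nonzero idempotent of the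
  block, which a character of the block detects.\<close>

lemma Omega_nonempty:
 assumes "A.KG.prim a" "eA\<otimes>.A a = a"
 shows "Omega a ~= {}"
proof -
note ap = A.KG.prim_idem[OF assms(1)]
have aF: "a:<FY>" using A_sub ap by blast
obtain z where z: "z:mu" "Psi z a ~= \<zero>.KG" using Psi_inject[OF aF] ap(2) by (auto simp: A_ops)
have "Psi z a\<otimes>.KG Psi z a = Psi z a" using Psi_mult[OF z(1) aF aF] A_mult[OF ap(3,3)] ap(4) by simp
hence "KG.idem (Psi z a)" using Psi_closed[OF mu_simps(1)[OF z(1)] aF] by (simp add: KG.idem_def)
moreover have "b\<otimes>.KG Psi z a = Psi z a"
 using Psi_mult[OF z(1) A_sub[OF eA_facts(1)] aF] A_mult[OF eA_facts(1) ap(3)] assms(2) eA_facts(2)[OF z(1)] b_simps(3)[of "Psi z a"] Psi_closed[OF mu_simps(1)[OF z(1)] aF] by simp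
ultimately obtain c where "c:irr" "Psi z a \<notin> Ann c" using idem_detected z(2) by blast
thus ?thesis using z(1) by (auto simp: Omega_def Pi_def PP_def)
qed

text \<open>Coefficients in k are fixed by Frobenius, so moving z moves \<open>Psi z a\<close> by
  the Galois action.\<close>

lemma PP_Phi: "\<pi>:Pi ==> a:PP \<pi> ==> a:PP (Phi i \<pi>)"
proof -
assume p: "\<pi>:Pi" and a: "a:PP \<pi>"
obtain z c where zc: "\<pi> = (z, c)" "z:mu" "c:irr" using p by (auto simp: Pi_def)
have aA: "a:<A>" "Psi z a:Ann c" using a zc by (auto simp: PP_def)
have "(phi ^^ i) x = x" if "x:k" for x using galois_phi[of i] that by (simp add: galois_group_def)
hence "gal Y (phi ^^ i) a = a"
 using aA(1) by (auto simp: galois_action_def A.gr_carrier fun_eq_iff PiE_iff extensional_def)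
hence "Psi ((phi ^^ i) z) a = gal G (phi ^^ i) (Psi z a)"
 using Psi_galois[OF phi_pow_hom mu_simps(1)[OF zc(2)] A_sub[OF aA(1)], of i] by simp
thus "a:PP (Phi i \<pi>)"
 using galois_Ann[OF galois_phi zc(3) aA(2), of i] aA(1) zc(1) by (simp add: PP_def Phi_def)
qed

lemma Omega_Phi: "\<pi>:Pi ==> Phi i \<pi>:Omega a <-> \<pi>:Omega a"
proof -
assume p: "\<pi>:Pi"
obtain j where "Phi j (Phi i \<pi>) = \<pi>" using Phi_inverse[OF p] by blast
hence "a:PP (Phi i \<pi>) ==> a:PP \<pi>" using PP_Phi[OF Phi_Pi[OF p]] by metis
thus ?thesis using p Phi_Pi[OF p] PP_Phi[OF p] unfolding Omega_def by blast
qed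

text \<open>Let d in \<open>A\<close> be one on the orbit of a label of \<open>Omega a\<close> and
  zero off it. In the local corner of a, the element a d a is nilpotent or invertible. Nilpotent is
  impossible, as a d a agrees with a on the orbit; and where an invertible one vanishes, so does
  a.\<close>

lemma Omega_orbit:
 assumes a: "A.KG.prim a" and p: "\<pi>:Omega a"
 shows "Omega a = {Phi i \<pi> | i. True}"
proof
have pP: "\<pi>:Pi" using p by (simp add: Omega_def)
let ?O = "{Phi i \<pi> | i. True}"
show "?O <= Omega a" using Omega_Phi[OF pP] p by auto
have OP: "?O <= Pi" using Phi_Pi[OF pP] by auto
have "Phi i \<rho>:?O <-> \<rho>:?O" if r: "\<rho>:Pi" for \<rho> i
proof
 assume "Phi i \<rho>:?O"
 then obtain j where "Phi i \<rho> = Phi j \<pi>" by blast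
 moreover obtain l where "Phi l (Phi i \<rho>) = \<rho>" using Phi_inverse[OF r] by blast
 ultimately have "\<rho> = Phi (l + j) \<pi>" using Phi_add by metis
 thus "\<rho>:?O" by blast
next
 assume "\<rho>:?O"
 then obtain j where "\<rho> = Phi j \<pi>" by blast
 hence "Phi i \<rho> = Phi (i + j) \<pi>" using Phi_add by simp
 thus "Phi i \<rho>:?O" by blast
qed
then obtain d where d: "d:<A>" "\<And>\<rho>. \<rho>:Pi ==> cong (snd \<rho>) (Psi (fst \<rho>) d) (if \<rho>:?O then \<one>.KG else \<zero>.KG)"
 using orbit_separation[OF OP] by blast
note ap = A.KG.prim_idem[OF a]
let ?c = "a\<otimes>.A d\<otimes>.A a"
have cc: "?c:A.KG.corner a a" using A.KG.corner_sandwich ap d(1) by blast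
note cd = A.KG.cornerD[OF cc]
show "Omega a <= ?O"
proof
 fix \<rho> assume rho: "\<rho>:Omega a"
 hence rP: "\<rho>:Pi" "a \<notin> PP \<rho>" by (auto simp: Omega_def)
 show "\<rho>:?O"
 proof (rule ccontr)
  assume nO: "\<rho> \<notin> ?O"
  have "d:PP \<rho>"
  proof -
   have "Psi (fst \<rho>) d:<KG>" "snd \<rho>:irr" using d(2)[OF rP(1)] rP(1) by (auto simp: cong_def Pi_def)
   thus ?thesis using d(2)[OF rP(1)] nO cong_Ann[of "snd \<rho>"] d(1) by (simp add: PP_def)
  qed
  hence cP: "?c:PP \<rho>" using PP_mult[OF rP(1)] ap by blast
  show False
  proof (cases "A.KG.nilp ?c")
   case False
   then obtain u where "u:A.KG.corner a a" "u\<otimes>.A ?c = a" using A.prim_local[OF a cc] by blast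
   thus False using PP_mult(1)[OF rP(1) cP, of u] A.KG.cornerD rP(2) by auto
  next
   case True
   then obtain j :: nat where j: "?c [^].A j = \<zero>.A" by (auto simp: A.KG.nilp_def)
   have pO: "\<pi>:?O"
   proof -
    obtain l where "Phi l (Phi 1 \<pi>) = \<pi>" using Phi_inverse[OF pP] by blast
    hence "\<pi> = Phi (l + 1) \<pi>" using Phi_add by metis
    thus ?thesis by blast
   qed
   \<comment> \<open>a - a d a = -a (d - 1) a, and d is congruent to one at this label.\<close>
   have ac: "a \<ominus>.A ?c:PP \<pi>"
   proof -
    have z: "fst \<pi>:mu" "snd \<pi>:irr" using pP by (auto simp: Pi_def)
    note zF = mu_simps(1)[OF z(1)]
    have "Psi (fst \<pi>) (d \<ominus>.FY \<one>.FY) \<oplus>.KG Psi (fst \<pi>) \<one>.FY = Psi (fst \<pi>) d"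
     using Psi_add[OF zF, of "d \<ominus>.FY \<one>.FY" "\<one>.FY"] A_sub[OF d(1)]
     by (simp add: a_minus_def Y.KG.a_assoc Y.KG.l_neg)
    hence "Psi (fst \<pi>) (d \<ominus>.FY \<one>.FY) = Psi (fst \<pi>) d \<ominus>.KG \<one>.KG"
     using Psi_one[OF z(1)] Psi_closed[OF zF] A_sub[OF d(1)] KG.add.inv_solve_right[of "Psi (fst \<pi>) (d \<ominus>.FY \<one>.FY)" "Psi (fst \<pi>) d" "\<one>.KG"]
     by (simp add: a_minus_def)
    hence "d \<ominus>.A \<one>.A:PP \<pi>"
     using d(2)[OF pP] pO A_minus[OF d(1) A.KG.one_closed] A.KG.minus_closed[OF d(1) A.KG.one_closed]
     by (simp add: PP_def cong_def A_ops)
    hence "(\<ominus>.A a)\<otimes>.A (d \<ominus>.A \<one>.A)\<otimes>.A a:PP \<pi>" using PP_mult[OF pP] ap by simp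
    also have "(\<ominus>.A a)\<otimes>.A (d \<ominus>.A \<one>.A)\<otimes>.A a = a \<ominus>.A ?c"
     using ap d(1) by (simp add: a_minus_def A.KG.l_distr A.KG.r_distr A.KG.l_minus A.KG.r_minus A.KG.a_comm)
    finally show ?thesis .
   qed
   \<comment> \<open>Modulo the ideal, a agrees with every positive power of \<open>?c\<close>; a
     vanishing power puts a into the ideal.\<close>
   have "a \<ominus>.A ?c [^].A Suc i:PP \<pi>" for i
   proof (induction i)
    case (Suc i)
    let ?p = "?c [^].A Suc i"
    have pc: "?p:<A>" using cd by (intro A.KG.nat_pow_closed)
    have "(a \<ominus>.A ?p)\<otimes>.A ?c \<oplus>.A (a \<ominus>.A ?c):PP \<pi>"
     using PP_add[OF pP PP_mult(2)[OF pP Suc cd(1)] ac] .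
    also have "(a \<ominus>.A ?p)\<otimes>.A ?c \<oplus>.A (a \<ominus>.A ?c) = a \<ominus>.A ?p\<otimes>.A ?c"
    proof -
     have "(a \<ominus>.A ?p)\<otimes>.A ?c = ?c \<ominus>.A ?p\<otimes>.A ?c"
      using cd ap by (simp add: a_minus_def A.KG.l_distr A.KG.l_minus del: A.KG.nat_pow_Suc)
     thus ?thesis using cd(1) ap(3) A.KG.m_closed[OF pc cd(1)]
      by (simp add: a_minus_def A.KG.a_ac A.KG.r_neg2 del: A.KG.m_closed)
    qed
    finally show ?case by simp
   qed (use ac cd in simp)
   from this[of j] have "a:PP \<pi>" using j cd ap by (simp add: a_minus_def)
   thus False using p by (simp add: Omega_def)
  qed
 qed
qed
qed

text \<open>\<open>eA\<close> survives at every label, so one of its primitive summands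
  does.\<close>

lemma Omega_covers:
 assumes "\<pi>:Pi"
 shows "EX a. A.KG.prim a & eA\<otimes>.A a = a & \<pi>:Omega a"
proof -
have "A.KG.idem eA" using eA_facts by (simp add: A.KG.idem_def)
then obtain I where I: "finite I" "ALL i:I. A.KG.prim i & i:A.KG.corner eA eA" "eA = (\<Oplus>.A i\<in>I. i)"
 using A.prim_decomposition[OF \<open>A.KG.idem eA\<close>] by (elim exE conjE)
have Ic: "i:<A>" if "i:I" for i using I(2) that A.KG.prim_idem by blast
have sum: "(\<Oplus>.A e\<in>J. e):PP \<pi>" if "finite J" "J <= PP \<pi>" for J using that
proof (induction J rule: finite_induct)
 case (insert e J)
 hence "e:<A>" "J <= <A>" by (auto simp: PP_def)
 thus ?case using insert PP_add[OF assms] by (subst A.KG.finsum_insert) auto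
qed (use PP_zero[OF assms] in simp)
obtain z c where zc: "\<pi> = (z, c)" "z:mu" "c:irr" using assms by (auto simp: Pi_def)
have "eA \<notin> PP \<pi>"
 using zc eA_facts(2)[OF zc(2)] Ann_block[OF zc(3) KG.one_closed] one_notin_Ann[OF zc(3)] b_simps(1) by (simp add: PP_def)
then obtain a where "a:I" "a \<notin> PP \<pi>" using sum[OF I(1)] I(3) by auto
moreover have "A.KG.prim a" "eA\<otimes>.A a = a" using I(2) \<open>a:I\<close> A.KG.cornerD by auto
ultimately show ?thesis using assms unfolding Omega_def by blast
qed

text \<open>With \<open>Omega_orbit\<close> and \<open>Omega_covers\<close>: classes of primitive
  idempotents in the block correspond to Frobenius orbits of labels.\<close>

lemma Omega_equiv:
 assumes "A.KG.prim a" "A.KG.prim a'"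
 shows "Omega a \<inter> Omega a' ~= {} ==> A.KG.idem_equiv a a'" "A.KG.idem_equiv a a' ==> Omega a = Omega a'"
proof -
assume "Omega a \<inter> Omega a' ~= {}"
then obtain \<pi> where "\<pi>:Pi" "a \<notin> PP \<pi>" "a' \<notin> PP \<pi>" by (auto simp: Omega_def)
thus "A.KG.idem_equiv a a'" using A.prime_ideal_prim_equiv[OF PP_zero PP_prime assms, of \<pi>] by blast
next
have half: "a':PP \<pi>" if e: "A.KG.idem_equiv a a'" and pa: "A.KG.prim a'" "\<pi>:Pi" "a:PP \<pi>" for a a' \<pi>
proof -
 obtain x y where xy: "x:A.KG.corner a a'" "y:A.KG.corner a' a" "x\<otimes>.A y = a" "y\<otimes>.A x = a'"
  using e by (auto simp: A.KG.idem_equiv_def)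
 note c = A.KG.cornerD[OF xy(1)] A.KG.cornerD[OF xy(2)]
 have "y\<otimes>.A a\<otimes>.A x:PP \<pi>" using PP_mult[OF pa(2)] pa(3) c by blast
 also have "y\<otimes>.A a\<otimes>.A x = a'" using c xy(4) by simp
 finally show ?thesis .
qed
assume e: "A.KG.idem_equiv a a'"
hence "A.KG.idem_equiv a' a" by (auto simp: A.KG.idem_equiv_def)
thus "Omega a = Omega a'" using half e assms by (auto simp: Omega_def)
qed
end

section \<open>Groups by generators and relations, and tensor products\<close>

lemma free_hom_diff:
 assumes "comm_group B" "h:hom (free_Abelian_group S) B" "x:carrier (free_Abelian_group S)" "y:carrier (free_Abelian_group S)"
 shows "h (x - y) = h x\<otimes>.B inv .B h y"
proof -
interpret B: comm_group B by fact
interpret h: group_hom "free_Abelian_group S" B h using assms(2) by (simp add: group_hom_def group_hom_axioms_def)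
have "h (x\<otimes>.(free_Abelian_group S) inv .(free_Abelian_group S) y) = h x\<otimes>.B inv .B h y"
 using assms(3) h.hom_inv[OF assms(4)] h.G.inv_closed[OF assms(4)] by (simp only: h.hom_mult)
moreover have "x\<otimes>.(free_Abelian_group S) inv .(free_Abelian_group S) y = x - y" using assms(4) by simp
ultimately show ?thesis by metis
qed

lemma free_diff_closed:
 "x:carrier (free_Abelian_group S) ==> y:carrier (free_Abelian_group S) ==> x - y:carrier (free_Abelian_group S)"
 using keys_diff[of x y] by auto

locale presentation =
 fixes S :: "'a set" and Rel :: "('a \<Rightarrow>\<^sub>0 int) set"
 assumes Rel: "Rel \<subseteq> carrier (free_Abelian_group S)"
begin

abbreviation "Free \<equiv> free_Abelian_group S"
abbreviation "Quo \<equiv> presented_group S Rel"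
abbreviation "cls \<equiv> presented_class S Rel"

lemma normal: "generate Free Rel \<lhd> Free"
 using group.generate_is_subgroup[OF group_free_Abelian_group Rel] comm_group.subgroup_imp_normal abelian_free_Abelian_group by blast

lemma comm_group_Quo: "comm_group Quo"
proof -
have "subgroup (generate Free Rel) Free" using normal by (rule normal_imp_subgroup)
thus ?thesis unfolding presented_group_def by (rule comm_group.abelian_FactGroup[OF abelian_free_Abelian_group])
qed

sublocale Quo: comm_group Quo by (rule comm_group_Quo)

lemma cls_hom: "cls:hom Free Quo"
 using normal.r_coset_hom_Mod[OF normal] unfolding presented_group_def presented_class_def by simp

lemma cls_closed: "c:<Free> ==> cls c:<Quo>" using cls_hom by (rule hom_in_carrier)

lemma cls_diff: "c:<Free> ==> d:<Free> ==> cls (c - d) = cls c\<otimes>.Quo inv .Quo cls d"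
 using free_hom_diff[OF comm_group_Quo cls_hom] .

lemma cls_self: "c:<Free> ==> c:cls c"
 unfolding presented_class_def using group.rcos_self[OF group_free_Abelian_group] normal_imp_subgroup[OF normal] by blast

lemma cls_member: "c:<Free> ==> d:cls c ==> d:<Free> & cls d = cls c"
proof -
assume c: "c:<Free>" and d: "d:cls c"
have sub: "subgroup (generate Free Rel) Free" using normal by (rule normal_imp_subgroup)
have "d:<Free>"
 using d monoid.r_coset_subset_G[OF group.is_monoid[OF group_free_Abelian_group] subgroup.subset[OF sub] c] unfolding presented_class_def by blast
moreover have "cls c = cls d"
 using group.repr_independence[OF group_free_Abelian_group _ c sub, of d] d unfolding presented_class_def by blast
ultimately show ?thesis by simp
qed

lemma cls_surj: "Y:<Quo> ==> EX c:<Free>. Y = cls c"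
 unfolding presented_group_def presented_class_def by (auto simp: FactGroup_def RCOSETS_def)

lemma cls_rel: "r:Rel ==> cls r = \<one>.Quo"
proof -
assume r: "r:Rel"
have sub: "subgroup (generate Free Rel) Free" using normal by (rule normal_imp_subgroup)
have "generate Free Rel #>.Free r = generate Free Rel"
 using group.coset_join2[OF group_free_Abelian_group _ sub generate.incl[OF r]] r Rel by blast
thus ?thesis unfolding presented_group_def presented_class_def by (simp add: FactGroup_def)
qed

lemma cls_frag_relation:
 assumes "frag_of u - frag_of v - frag_of w:Rel" "u:S" "v:S" "w:S"
 shows "cls (frag_of u) = cls (frag_of v)\<otimes>.Quo cls (frag_of w)"
proof -
have c: "frag_of s:<Free>" if "s:S" for s using that by auto
note cc = cls_closed[OF c[OF assms(2)]] cls_closed[OF c[OF assms(3)]] cls_closed[OF c[OF assms(4)]]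
have "cls (frag_of u)\<otimes>.Quo inv .Quo cls (frag_of v)\<otimes>.Quo inv .Quo cls (frag_of w) = \<one>.Quo"
 using cls_rel[OF assms(1)] cls_diff[OF free_diff_closed[OF c[OF assms(2)] c[OF assms(3)]] c[OF assms(4)]] cls_diff[OF c[OF assms(2)] c[OF assms(3)]] by simp
hence "cls (frag_of u)\<otimes>.Quo inv .Quo cls (frag_of v) = cls (frag_of w)"
 using cc Quo.inv_equality[of "cls (frag_of u)\<otimes>.Quo inv .Quo cls (frag_of v)" "inv .Quo cls (frag_of w)"] by simp
thus ?thesis using cc Quo.inv_solve_right[of "cls (frag_of w)" "cls (frag_of u)" "cls (frag_of v)"] Quo.m_comm by simp
qed

lemma Quo_induct:
 assumes "Y:<Quo>" "P \<one>.Quo" "!!s. s:S ==> P (cls (frag_of s))"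
  and "!!Y Z. Y:<Quo> ==> Z:<Quo> ==> P Y ==> P Z ==> P (Y\<otimes>.Quo inv .Quo Z)"
 shows "P Y"
proof -
obtain c where c: "Poly_Mapping.keys c <= S" "Y = cls c" using cls_surj[OF assms(1)] by auto
have "P (cls c) & Poly_Mapping.keys c <= S" using c(1)
proof (induction c rule: frag_induction)
 case zero
 thus ?case using assms(2) hom_one[OF cls_hom group_free_Abelian_group Quo.is_group] by simp
next
 case (one x)
 thus ?case using assms(3) by simp
next
 case (diff a b)
 thus ?case using assms(4) cls_diff[of a b] cls_closed keys_diff[of a b] by auto
qed
thus ?thesis using c(2) by simp
qed

lemma universal:
 assumes "comm_group B" "h:hom Free B" "!!r. r:Rel ==> h r = \<one>.B"
 shows "EX g:hom Quo B. ALL c:<Free>. g (cls c) = h c"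
proof -
interpret B: comm_group B by fact
interpret h: group_hom Free B h using assms(2) by (simp add: group_hom_def group_hom_axioms_def)
have "generate Free Rel <= kernel Free B h"
 using assms(3) subsetD[OF Rel] by (intro h.G.generate_subgroup_incl[OF _ h.subgroup_kernel] subsetI) (simp only: kernel_def mem_Collect_eq)
then obtain g where "g:hom (Free Mod generate Free Rel) B" "!!x. x:<Free> ==> g (r_coset Free (generate Free Rel) x) = h x"
 using h.FactGroup_universal_kernel[OF normal] by metis
thus ?thesis unfolding presented_group_def presented_class_def by blast
qed

lemma universal_gen:
 assumes "comm_group B" "f ` S <= <B>"
  and "!!h r. h:hom Free B ==> (!!s. s:S ==> h (frag_of s) = f s) ==> r:Rel ==> h r = \<one>.B"
 shows "EX g:hom Quo B. ALL s:S. g (cls (frag_of s)) = f s"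
proof -
interpret B: comm_group B by fact
obtain h where h: "h:hom Free B" "!!s. s:S ==> h (frag_of s) = f s"
 using B.free_Abelian_group_universal[OF assms(2)] by blast
then obtain g where "g:hom Quo B" "ALL c:<Free>. g (cls c) = h c"
 using universal[OF assms(1) h(1)] assms(3)[OF h] by blast
thus ?thesis using h(2) by (intro bexI[of _ g]) auto
qed
end

locale tensor_product = bimodule A B M + N: left_module B N
 for A :: "('a, 'y) ring_scheme" and B :: "('b, 'z) ring_scheme"
  and M :: "('a, 'b, 'm, 'u) bimodule_scheme" and N :: "('b, 'n, 'v) module_scheme"
begin

abbreviation "Gens \<equiv> <M> \<times> <N>"
abbreviation "Rels \<equiv> tensor_rels B M N"
abbreviation TT where "TT \<equiv> tensor_left B M N"

definition pure where "pure x y = presented_class Gens Rels (frag_of (x, y))"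

sublocale P: presentation Gens Rels
proof
have f: "frag_of (x, y):carrier (free_Abelian_group Gens)" if "x:<M>" "y:<N>" for x y using that by simp
show "Rels <= carrier (free_Abelian_group Gens)" unfolding tensor_rels_def
 using N.lsmult_closed rsmult_closed by (auto intro!: free_diff_closed f)
qed

lemma TT_simps: "<TT> = <P.Quo>" "x \<oplus>.TT y = x\<otimes>.P.Quo y" "\<zero>.TT = \<one>.P.Quo"
 by (simp_all add: tensor_left_def Let_def)

lemma abelian_group_TT: "abelian_group TT"
proof (rule abelian_groupI)
fix x assume "x:<TT>"
thus "EX y:<TT>. y \<oplus>.TT x = \<zero>.TT" by (intro bexI[of _ "inv .P.Quo x"]) (auto simp: TT_simps)
qed (auto simp: TT_simps P.Quo.m_ac)

sublocale TT: abelian_group TT by (rule abelian_group_TT)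

lemma TT_minus: "x:<TT> ==> \<ominus>.TT x = inv .P.Quo x"
 using TT.minus_equality[of "inv .P.Quo x" x] by (simp add: TT_simps)

lemma pure_closed: "x:<M> ==> y:<N> ==> pure x y:<TT>" unfolding pure_def using P.cls_closed by (simp add: TT_simps)

lemma pure_add_left:
 "x:<M> ==> x':<M> ==> y:<N> ==> pure (x \<oplus>.M x') y = pure x y \<oplus>.TT pure x' y"
 unfolding pure_def TT_simps by (rule P.cls_frag_relation) (auto simp: tensor_rels_def)

lemma pure_add_right:
 "x:<M> ==> y:<N> ==> y':<N> ==> pure x (y \<oplus>.N y') = pure x y \<oplus>.TT pure x y'"
 unfolding pure_def TT_simps by (rule P.cls_frag_relation) (auto simp: tensor_rels_def)

lemma pure_balanced:
 assumes "x:<M>" "q:<B>" "y:<N>"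
 shows "pure (x \<star>.M q) y = pure x (q\<odot>.N y)"
proof -
have r: "frag_of (x \<star>.M q, y) - frag_of (x, q\<odot>.N y):Rels" using assms by (auto simp: tensor_rels_def)
have c: "frag_of (x \<star>.M q, y):<P.Free>" "frag_of (x, q\<odot>.N y):<P.Free>"
 using assms rsmult_closed N.lsmult_closed by auto
have "P.cls (frag_of (x \<star>.M q, y))\<otimes>.P.Quo inv .P.Quo P.cls (frag_of (x, q\<odot>.N y)) = \<one>.P.Quo"
 using P.cls_rel[OF r] P.cls_diff[OF c] by simp
thus ?thesis unfolding pure_def
 using P.cls_closed[OF c(1)] P.cls_closed[OF c(2)] P.Quo.inv_equality[of "P.cls (frag_of (x \<star>.M q, y))" "inv .P.Quo P.cls (frag_of (x, q\<odot>.N y))"] by simp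
qed

lemma TT_universal:
 assumes C: "abelian_group C" and f: "!!x y. x:<M> ==> y:<N> ==> f x y:<C>"
  and l: "!!x x' y. x:<M> ==> x':<M> ==> y:<N> ==> f (x \<oplus>.M x') y = f x y \<oplus>.C f x' y"
  and r: "!!x y y'. x:<M> ==> y:<N> ==> y':<N> ==> f x (y \<oplus>.N y') = f x y \<oplus>.C f x y'"
  and b: "!!x q y. x:<M> ==> q:<B> ==> y:<N> ==> f (x \<star>.M q) y = f x (q\<odot>.N y)"
 shows "EX h. h:<TT> -> <C> & (ALL s:<TT>. ALL t:<TT>. h (s \<oplus>.TT t) = h s \<oplus>.C h t) &
  (ALL x:<M>. ALL y:<N>. h (pure x y) = f x y)"
proof -
interpret C: abelian_group C by fact
let ?C = "add_monoid C"
have "EX g:hom P.Quo ?C. ALL s:Gens. g (P.cls (frag_of s)) = (%(x, y). f x y) s"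
proof (rule P.universal_gen[OF C.a_comm_group])
 show "(%(x, y). f x y) ` Gens <= <?C>" using f by auto
 fix h rel assume h: "h:hom P.Free ?C" "!!s. s:Gens ==> h (frag_of s) = (%(x, y). f x y) s" and rel: "rel:Rels"
 have c: "frag_of (x, y):<P.Free>" if "x:<M>" "y:<N>" for x y using that by auto
 have d: "h (s - t) = h s \<ominus>.C h t" if "s:<P.Free>" "t:<P.Free>" for s t
  using free_hom_diff[OF C.a_comm_group h(1) that] by (simp add: a_minus_def a_inv_def)
 have hf: "h (frag_of (x, y)) = f x y" if "x:<M>" "y:<N>" for x y using h(2)[of "(x, y)"] that by simp
 have d3: "h (frag_of (x, y) - frag_of (x', y') - frag_of (x'', y'')) = f x y \<ominus>.C f x' y' \<ominus>.C f x'' y''"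
  if "x:<M>" "y:<N>" "x':<M>" "y':<N>" "x'':<M>" "y'':<N>" for x y x' y' x'' y''
  using d[OF free_diff_closed[OF c[OF that(1,2)] c[OF that(3,4)]] c[OF that(5,6)]] d[OF c[OF that(1,2)] c[OF that(3,4)]] hf that by simp
 have z: "u \<oplus>.C v \<ominus>.C u \<ominus>.C v = \<zero>.C" if "u:<C>" "v:<C>" for u v
 proof -
  have "u \<oplus>.C v \<ominus>.C u \<ominus>.C v = (u \<oplus>.C v) \<oplus>.C \<ominus>.C (u \<oplus>.C v)"
   using that by (simp add: a_minus_def C.minus_add C.a_assoc)
  thus ?thesis using that by (simp add: C.r_neg)
 qed
 from rel show "h rel = \<one>.(?C)" unfolding tensor_rels_def
 proof (elim UnE CollectE exE conjE, goal_cases)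
  case (1 x x' y)
  thus ?thesis using d3 l z f by simp
 next
  case (2 x y y')
  thus ?thesis using d3 r z f by simp
 next
  case (3 x q y)
  thus ?thesis
   using d[OF c c, of "x \<star>.M q" y x "q\<odot>.N y"] hf b f rsmult_closed N.lsmult_closed by (simp add: a_minus_def C.r_neg)
 qed
qed
then obtain g where g: "g:hom P.Quo ?C" "ALL s:Gens. g (P.cls (frag_of s)) = (%(x, y). f x y) s" by blast
thus ?thesis by (intro exI[of _ g]) (auto simp: hom_def TT_simps pure_def)
qed

lemma TT_induct [consumes 1, case_names pure add]:
 assumes "t:<TT>" "!!x y. x:<M> ==> y:<N> ==> Q (pure x y)"
  and "!!s t. s:<TT> ==> t:<TT> ==> Q s ==> Q t ==> Q (s \<oplus>.TT t)"
 shows "Q t"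
proof -
have p0: "pure \<zero>.M y = \<zero>.TT" if "y:<N>" for y
 using pure_add_left[of "\<zero>.M" "\<zero>.M" y] that pure_closed[of "\<zero>.M" y] by auto
have pm: "\<ominus>.TT pure x y = pure (\<ominus>.M x) y" if "x:<M>" "y:<N>" for x y
 using TT.minus_equality[of "pure (\<ominus>.M x) y" "pure x y"] pure_add_left[of "\<ominus>.M x" x y] that pure_closed p0
 by (simp add: M.l_neg)
\<comment> \<open>\<open>Quo_induct\<close> builds elements as differences, so the negative is
  carried along; the negative of a pure tensor is again pure.\<close>
have "Q t & Q (\<ominus>.TT t)" using assms(1)[unfolded TT_simps]
proof (rule P.Quo_induct)
 have "\<one>.P.Quo = pure \<zero>.M \<zero>.N" using p0 by (simp add: TT_simps)
 moreover have "\<ominus>.TT \<one>.P.Quo = \<one>.P.Quo" using TT_minus[of "\<one>.P.Quo"] by (simp add: TT_simps)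
 ultimately show "Q \<one>.P.Quo & Q (\<ominus>.TT \<one>.P.Quo)" using assms(2) M.zero_closed N.M.zero_closed by metis
next
 fix s assume "s:Gens"
 thus "Q (P.cls (frag_of s)) & Q (\<ominus>.TT P.cls (frag_of s))"
  using assms(2) pm unfolding pure_def by (cases s) auto
next
 fix Y Z assume YZ: "Y:<P.Quo>" "Z:<P.Quo>" "Q Y & Q (\<ominus>.TT Y)" "Q Z & Q (\<ominus>.TT Z)"
 hence c: "Y:<TT>" "Z:<TT>" by (auto simp: TT_simps)
 have e: "Y\<otimes>.P.Quo inv .P.Quo Z = Y \<oplus>.TT \<ominus>.TT Z" using TT_minus[OF c(2)] by (simp add: TT_simps)
 have "\<ominus>.TT (Y \<oplus>.TT \<ominus>.TT Z) = \<ominus>.TT Y \<oplus>.TT Z" using c by (simp add: TT.minus_add)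
 thus "Q (Y\<otimes>.P.Quo inv .P.Quo Z) & Q (\<ominus>.TT (Y\<otimes>.P.Quo inv .P.Quo Z))"
  unfolding e using assms(3) YZ(3,4) c TT.a_inv_closed by metis
qed
thus ?thesis by simp
qed

text \<open>\<open>tensor_left\<close> defines the action as a union over representatives. The
  universal property supplies an honest endomorphism \<open>g0\<close>; every member of the union
  equals its value, so the union collapses to it.\<close>

lemma smult_cls:
 assumes a: "a:<A>"
 defines "\<psi> \<equiv> frag_extend (%(x, y :: 'n). frag_of (a\<odot>.M x, y))"
 shows "(%Y. a\<odot>.TT Y):hom P.Quo P.Quo" "x:<M> ==> y:<N> ==> a\<odot>.TT pure x y = pure (a\<odot>.M x) y"
proof -
obtain g0 where g0: "g0:<TT> -> <TT>" "ALL s:<TT>. ALL t:<TT>. g0 (s \<oplus>.TT t) = g0 s \<oplus>.TT g0 t"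
  "ALL x:<M>. ALL y:<N>. g0 (pure x y) = pure (a\<odot>.M x) y"
proof -
 have "EX h. h:<TT> -> <TT> & (ALL s:<TT>. ALL t:<TT>. h (s \<oplus>.TT t) = h s \<oplus>.TT h t) &
  (ALL x:<M>. ALL y:<N>. h (pure x y) = pure (a\<odot>.M x) y)"
  using a lsmult_closed pure_closed pure_add_left pure_add_right pure_balanced lr_assoc[symmetric] lsmult_r_distr
  by (intro TT_universal abelian_group_TT) auto
 thus ?thesis using that by blast
qed
have gh: "g0:hom P.Quo P.Quo" using g0(1,2) by (auto simp: hom_def TT_simps)
have \<psi>c: "\<psi> c:<P.Free> & P.cls (\<psi> c) = g0 (P.cls c)" if "c:<P.Free>" for c
proof -
 have "Poly_Mapping.keys c <= Gens" using that by simp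
 hence "\<psi> c:<P.Free> & P.cls (\<psi> c) = g0 (P.cls c) & c:<P.Free>"
 proof (induction c rule: frag_induction)
  case zero
  have "P.cls 0 = \<one>.P.Quo" using hom_one[OF P.cls_hom group_free_Abelian_group P.Quo.is_group] by simp
  thus ?case using hom_one[OF gh P.Quo.is_group P.Quo.is_group] by (simp add: \<psi>_def)
 next
  case (one s)
  obtain x y where s: "s = (x, y)" by (cases s)
  hence "x:<M>" "y:<N>" using one by auto
  thus ?case using g0(3) a lsmult_closed s by (simp add: \<psi>_def pure_def)
 next
  case (diff c d)
  have e: "\<psi> (c - d) = \<psi> c - \<psi> d" by (simp add: \<psi>_def frag_extend_diff)
  have 1: "P.cls (\<psi> c - \<psi> d) = g0 (P.cls c)\<otimes>.P.Quo inv .P.Quo g0 (P.cls d)" using P.cls_diff[of "\<psi> c" "\<psi> d"] diff by simp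
  interpret g0: group_hom P.Quo P.Quo g0 using gh by (simp add: group_hom_def group_hom_axioms_def)
  have 2: "g0 (P.cls (c - d)) = g0 (P.cls c)\<otimes>.P.Quo inv .P.Quo g0 (P.cls d)"
   using P.cls_diff[of c d] P.cls_closed[of c] P.cls_closed[of d] diff by simp
  show ?case using 1 2 diff free_diff_closed[of "\<psi> c" Gens "\<psi> d"] free_diff_closed[of c Gens d] unfolding e by simp
 qed
 thus ?thesis by simp
qed
have "a\<odot>.TT Y = g0 Y" if Y: "Y:<P.Quo>" for Y
proof -
 obtain c where c: "c:<P.Free>" "Y = P.cls c" using P.cls_surj[OF Y] by blast
 have "P.cls (\<psi> d) = g0 Y" if "d:Y" for d using P.cls_member[OF c(1), of d] that c(2) \<psi>c[of d] by simp
 moreover have "a\<odot>.TT Y = (\<Union>d\<in>Y. P.cls (\<psi> d))" by (simp add: tensor_left_def Let_def \<psi>_def)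
 moreover have "c:Y" using P.cls_self[OF c(1)] c(2) by simp
 ultimately show ?thesis by (metis (no_types, lifting) SUP_eq_const empty_iff)
qed
thus "(%Y. a\<odot>.TT Y):hom P.Quo P.Quo" "x:<M> ==> y:<N> ==> a\<odot>.TT pure x y = pure (a\<odot>.M x) y"
 using gh g0(3) pure_closed[of x y] by (auto simp: hom_def TT_simps)
qed

lemma left_module_TT: "left_module A TT"
proof -
have c: "a\<odot>.TT t:<TT>" if "a:<A>" "t:<TT>" for a t
 using smult_cls(1)[OF that(1)] that(2) by (auto simp: hom_def TT_simps)
have add: "a\<odot>.TT (s \<oplus>.TT t) = a\<odot>.TT s \<oplus>.TT a\<odot>.TT t" if "a:<A>" "s:<TT>" "t:<TT>" for a s t
 using smult_cls(1)[OF that(1)] that(2,3) by (auto simp: hom_def TT_simps)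
have "(a \<oplus>.A a')\<odot>.TT t = a\<odot>.TT t \<oplus>.TT a'\<odot>.TT t & (a\<otimes>.A a')\<odot>.TT t = a\<odot>.TT (a'\<odot>.TT t)"
 if a: "a:<A>" "a':<A>" and t: "t:<TT>" for a a' t using t
proof (induction t rule: TT_induct)
 case (pure x y)
 thus ?case using a smult_cls(2) lsmult_closed lsmult_l_distr lsmult_assoc pure_add_left by simp
next
 case (add s t)
 thus ?case using a c \<open>!!a s t. _ ==> _ ==> _ ==> a\<odot>.TT (s \<oplus>.TT t) = _\<close> by (simp add: TT.a_ac)
qed
moreover have "\<one>.A\<odot>.TT t = t" if "t:<TT>" for t using that
proof (induction t rule: TT_induct)
 case (pure x y)
 thus ?case using smult_cls(2)[of "\<one>.A"] lsmult_one by simp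
qed (use add in auto)
ultimately show ?thesis
 using c add abelian_group_TT A.ring_axioms by (simp add: left_module_def left_module_axioms_def)
qed
end

section \<open>Homomorphisms and direct summands\<close>

lemma (in abelian_group) add_minus_cancel: "x:<G> ==> y:<G> ==> x \<oplus> (y \<oplus> \<ominus> x) = y"
 by (simp add: a_comm[of y "\<ominus> x"] r_neg2)

lemma lmod_homD:
 assumes "f:lmod_hom A M N"
 shows "x:<M> ==> f x:<N>" "x:<M> ==> y:<M> ==> f (x \<oplus>.M y) = f x \<oplus>.N f y"
  "a:<A> ==> x:<M> ==> f (a\<odot>.M x) = a\<odot>.N f x" using assms by (auto simp: lmod_hom_def)

lemma lmod_homI:
 assumes "!!x. x:<M> ==> f x:<N>"
  "!!x y. x:<M> ==> y:<M> ==> f (x \<oplus>.M y) = f x \<oplus>.N f y"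
  "!!a x. a:<A> ==> x:<M> ==> f (a\<odot>.M x) = a\<odot>.N f x"
 shows "f:lmod_hom A M N" using assms by (auto simp: lmod_hom_def)

lemma lmod_hom_comp: "f:lmod_hom A M N ==> g:lmod_hom A N P ==> (%x. g (f x)):lmod_hom A M P"
 by (auto simp: lmod_hom_def Pi_iff)

lemma lmod_hom_zero:
 assumes "left_module A M" "left_module A N" "f:lmod_hom A M N"
 shows "f \<zero>.M = \<zero>.N" "x:<M> ==> f (\<ominus>.M x) = \<ominus>.N f x"
proof -
interpret M: left_module A M by fact
interpret N: left_module A N by fact
note f = lmod_homD[OF assms(3)]
show z: "f \<zero>.M = \<zero>.N" using f(3)[of "\<zero>.A" "\<zero>.M"] f(1)[of "\<zero>.M"] by simp
show "x:<M> ==> f (\<ominus>.M x) = \<ominus>.N f x"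
 using f(2)[of "\<ominus>.M x" x] f(1) z N.M.minus_equality[of "f (\<ominus>.M x)" "f x"] by (simp add: M.M.l_neg)
qed

context left_module
begin

lemma kernel_submodule:
 assumes "left_module A N" "f:lmod_hom A M N"
 shows "submodule {x:<M>. f x = \<zero>.N} A M"
proof -
interpret N: left_module A N by fact
show ?thesis using lmod_homD[OF assms(2)] lmod_hom_zero(1)[OF left_module_axioms assms] lsmult_closed
 by (intro submodule_intro) auto
qed

lemma image_submodule:
 assumes "left_module A N" "f:lmod_hom A N M"
 shows "submodule (f ` <N>) A M"
proof -
interpret N: left_module A N by fact
note f = lmod_homD[OF assms(2)]
show ?thesis
proof (rule submodule_intro)
 show "\<zero>.M:f ` <N>" using lmod_hom_zero(1)[OF assms(1) left_module_axioms assms(2)] N.M.zero_closed by (metis image_eqI)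
next
 fix x y assume "x:f ` <N>" "y:f ` <N>"
 then obtain u v where "u:<N>" "v:<N>" "x = f u" "y = f v" by blast
 thus "x \<oplus>.M y:f ` <N>" using f(2) N.M.a_closed by (metis image_eqI)
next
 fix a x assume "a:<A>" "x:f ` <N>"
 then obtain u where "u:<N>" "x = f u" by blast
 thus "a\<odot>.M x:f ` <N>" using f(3) N.lsmult_closed \<open>a:<A>\<close> by (metis image_eqI)
qed (use f(1) in auto)
qed

lemma split_minus:
 assumes "e:lmod_hom A M M" "!!x. x:<M> ==> e (e x) = e x" "x:<M>"
 shows "x \<ominus>.M e x:<M>" "e (x \<ominus>.M e x) = \<zero>.M" "e x \<oplus>.M (x \<ominus>.M e x) = x"
 using lmod_homD[OF assms(1)] lmod_hom_zero[OF left_module_axioms left_module_axioms assms(1)] assms(2,3)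
 by (simp_all add: a_minus_def M.r_neg M.a_ac)

lemma retraction_internal_direct_sum:
 assumes e: "e:lmod_hom A M M" "!!x. x:<M> ==> e (e x) = e x"
 shows "internal_direct_sum A M (e ` <M>) {x:<M>. e x = \<zero>.M}"
proof -
note ed = lmod_homD[OF e(1)]
have s: "submodule (e ` <M>) A M" "submodule {x:<M>. e x = \<zero>.M} A M"
 using image_submodule[OF left_module_axioms e(1)] kernel_submodule[OF left_module_axioms e(1)] by auto
have "e ` <M> \<inter> {x:<M>. e x = \<zero>.M} = {\<zero>.M}" using submoduleD(2)[OF s(1)] e(2) by auto
moreover have "e ` <M> <+>.M {x:<M>. e x = \<zero>.M} = <M>"
proof
 show "e ` <M> <+>.M {x:<M>. e x = \<zero>.M} <= <M>" using ed(1) by (auto simp: set_add_def')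
 show "<M> <= e ` <M> <+>.M {x:<M>. e x = \<zero>.M}"
 proof
  fix x assume x: "x:<M>"
  have "x = e x \<oplus>.M (x \<ominus>.M e x)" "x \<ominus>.M e x:{x:<M>. e x = \<zero>.M}"
   using split_minus[OF e x] by auto
  thus "x:e ` <M> <+>.M {x:<M>. e x = \<zero>.M}" using x unfolding set_add_def' by blast
 qed
qed
ultimately show ?thesis using s unfolding internal_direct_sum_def by blast
qed

lemma ids_retraction:
 assumes "internal_direct_sum A M U W"
 shows "EX e:lmod_hom A M M. (ALL x:<M>. e x:U & x \<ominus>.M e x:W) & (ALL x:U. e x = x)"
proof -
have U: "submodule U A M" and W: "submodule W A M" and UW: "U \<inter> W = {\<zero>.M}" "U <+>.M W = <M>"
 using assms by (auto simp: internal_direct_sum_def)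
note Ud = submoduleD[OF U] and Wd = submoduleD[OF W]
have uniq: "u = u'" if "u:U" "u':U" "x:<M>" "x \<ominus>.M u:W" "x \<ominus>.M u':W" for x u u'
proof -
 have c: "u:<M>" "u':<M>" using that Ud by auto
 have "(x \<ominus>.M u') \<oplus>.M \<ominus>.M (x \<ominus>.M u):W" using that Wd by blast
 also have "(x \<ominus>.M u') \<oplus>.M \<ominus>.M (x \<ominus>.M u) = u \<ominus>.M u'"
  using c that(3) by (simp add: a_minus_def M.minus_add M.a_ac M.add_minus_cancel)
 finally have "u \<ominus>.M u':U \<inter> W" using that Ud by (simp add: a_minus_def)
 hence "u \<ominus>.M u' = \<zero>.M" using UW(1) by blast
 thus ?thesis using M.add_minus_eq_zero_iff c by (simp add: a_minus_def)
qed
have ex: "EX u. u:U & x \<ominus>.M u:W" if x: "x:<M>" for x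
proof -
 obtain u w where uw: "u:U" "w:W" "x = u \<oplus>.M w" using x UW(2) unfolding set_add_def' by blast
 hence "x \<ominus>.M u = w" using Ud(1) Wd(1) by (auto simp: a_minus_def M.a_assoc M.add_minus_cancel subset_iff)
 thus ?thesis using uw by blast
qed
define e where "e x = (SOME u. u:U & x \<ominus>.M u:W)" for x
have e: "e x:U" "x \<ominus>.M e x:W" if "x:<M>" for x using someI_ex[OF ex[OF that]] unfolding e_def by auto
have eq: "e x = u" if "u:U" "x:<M>" "x \<ominus>.M u:W" for x u
 using uniq[OF e(1)[OF that(2)] that(1,2) e(2)[OF that(2)] that(3)] .
have ec: "e x:<M>" if "x:<M>" for x using e that Ud by blast
have "e:lmod_hom A M M"
proof (rule lmod_homI)
 fix x y assume xy: "x:<M>" "y:<M>"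
 have "(x \<oplus>.M y) \<ominus>.M (e x \<oplus>.M e y) = (x \<ominus>.M e x) \<oplus>.M (y \<ominus>.M e y)"
  using xy ec by (simp add: a_minus_def M.minus_add M.a_ac)
 thus "e (x \<oplus>.M y) = e x \<oplus>.M e y" using xy e Ud Wd by (intro eq) auto
next
 fix a x assume ax: "a:<A>" "x:<M>"
 have "a\<odot>.M x \<ominus>.M a\<odot>.M e x = a\<odot>.M (x \<ominus>.M e x)"
  using ax ec by (simp add: a_minus_def lsmult_r_distr lsmult_r_minus)
 thus "e (a\<odot>.M x) = a\<odot>.M e x" using ax e Ud Wd lsmult_closed by (intro eq) auto
qed (use ec in auto)
moreover have "e x = x" if "x:U" for x using that Ud Wd by (intro eq) (auto simp: a_minus_def M.r_neg)
ultimately show ?thesis using e by blast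
qed

lemma direct_summand_iff:
 "direct_summand A M U <-> U <= <M> & (EX e:lmod_hom A M M. (ALL x:<M>. e x:U) & (ALL x:U. e x = x))"
proof
assume "direct_summand A M U"
then obtain W where W: "internal_direct_sum A M U W" by (auto simp: direct_summand_def)
hence "U <= <M>" using submoduleD(1) by (auto simp: internal_direct_sum_def)
thus "U <= <M> & (EX e:lmod_hom A M M. (ALL x:<M>. e x:U) & (ALL x:U. e x = x))" using ids_retraction[OF W] by blast
next
assume "U <= <M> & (EX e:lmod_hom A M M. (ALL x:<M>. e x:U) & (ALL x:U. e x = x))"
then obtain e where e: "U <= <M>" "e:lmod_hom A M M" "ALL x:<M>. e x:U" "ALL x:U. e x = x" by blast
hence "U = e ` <M>" by force
thus "direct_summand A M U"
 using retraction_internal_direct_sum[OF e(2)] e(3,4) unfolding direct_summand_def by (metis (no_types, lifting))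
qed

lemma summand_submod: "direct_summand A M U ==> submodule U A M"
 by (auto simp: direct_summand_def internal_direct_sum_def)

lemma direct_summand_trans:
 assumes "direct_summand A M U" "direct_summand A (M(|carrier := U|)) V"
 shows "direct_summand A M V"
proof -
interpret U: left_module A "M(|carrier := U|)" using lm_submod[OF summand_submod[OF assms(1)]] .
obtain e where e: "U <= <M>" "e:lmod_hom A M M" "ALL x:<M>. e x:U" "ALL x:U. e x = x"
 using assms(1) unfolding direct_summand_iff by blast
obtain d where d: "V <= U" "d:lmod_hom A (M(|carrier := U|)) (M(|carrier := U|))" "ALL x:U. d x:V" "ALL x:V. d x = x"
 using assms(2) unfolding U.direct_summand_iff by auto
have "(%x. d (e x)):lmod_hom A M M" using lmod_homD[OF e(2)] lmod_homD[OF d(2)] e(1,3) by (intro lmod_homI) auto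
thus ?thesis unfolding direct_summand_iff using d e by (intro conjI bexI[of _ "%x. d (e x)"]) auto
qed

text \<open>The working form of the notion: retracts compose and can be transported along
  homomorphisms without mention of complements.\<close>

lemma iso_to_summand_iff:
 assumes "left_module A N"
 shows "iso_to_summand A N M <-> (EX i:lmod_hom A N M. EX r:lmod_hom A M N. ALL x:<N>. r (i x) = x)"
proof
interpret N: left_module A N by fact
{
 assume "iso_to_summand A N M"
 then obtain U f where U: "direct_summand A M U" and f: "f:lmod_hom A N (M(|carrier := U|))" "bij_betw f <N> U"
  by (auto simp: iso_to_summand_def lmod_iso_def)
 obtain e where e: "U <= <M>" "e:lmod_hom A M M" "ALL x:<M>. e x:U" "ALL x:U. e x = x"
  using U unfolding direct_summand_iff by blast
 let ?g = "inv_into <N> f"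
 have g: "?g u:<N>" "f (?g u) = u" if "u:U" for u using f(2) that by (auto simp: bij_betw_def)
 have gf: "?g (f x) = x" if "x:<N>" for x using f(2) that by (simp add: bij_betw_def)
 note fd = lmod_homD[OF f(1), simplified] and ed = lmod_homD[OF e(2)]
 have "(%x. ?g (e x)):lmod_hom A M N"
 proof (rule lmod_homI)
  fix x y assume xy: "x:<M>" "y:<M>"
  hence "e (x \<oplus>.M y) = f (?g (e x) \<oplus>.N ?g (e y))" using fd(2) g e(3) ed(2) by simp
  thus "?g (e (x \<oplus>.M y)) = ?g (e x) \<oplus>.N ?g (e y)" using gf g e(3) xy by simp
 next
  fix a x assume ax: "a:<A>" "x:<M>"
  hence "e (a\<odot>.M x) = f (a\<odot>.N ?g (e x))" using fd(3) g e(3) ed(3) by simp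
  thus "?g (e (a\<odot>.M x)) = a\<odot>.N ?g (e x)" using gf g e(3) ax N.lsmult_closed by simp
 qed (use g e(3) in auto)
 moreover have "f:lmod_hom A N M" using fd e(1) by (intro lmod_homI) auto
 moreover have "ALL x:<N>. ?g (e (f x)) = x" using gf fd(1) e(4) by simp
 ultimately show "EX i:lmod_hom A N M. EX r:lmod_hom A M N. ALL x:<N>. r (i x) = x"
  by (intro bexI[of _ f] bexI[of _ "%x. ?g (e x)"])
next
 assume "EX i:lmod_hom A N M. EX r:lmod_hom A M N. ALL x:<N>. r (i x) = x"
 then obtain i r where i: "i:lmod_hom A N M" "r:lmod_hom A M N" "ALL x:<N>. r (i x) = x" by blast
 note id = lmod_homD[OF i(1)] and rd = lmod_homD[OF i(2)]
 have "direct_summand A M (i ` <N>)"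
 proof -
  have "i ` <N> <= <M>" "ALL x:<M>. i (r x):i ` <N>" using id(1) rd(1) by auto
  moreover have "ALL x:i ` <N>. i (r x) = x" using i(3) by auto
  ultimately show ?thesis unfolding direct_summand_iff using lmod_hom_comp[OF i(2,1)] by (intro conjI bexI[of _ "%x. i (r x)"])
 qed
 moreover have "i:lmod_iso A N (M(|carrier := i ` <N>|))"
 proof -
  have "i:lmod_hom A N (M(|carrier := i ` <N>|))" using id by (intro lmod_homI) auto
  moreover have "inj_on i <N>" using i(3) by (intro inj_on_inverseI[of _ r]) simp
  ultimately show ?thesis by (simp add: lmod_iso_def bij_betw_def)
 qed
 ultimately show "iso_to_summand A N M" unfolding iso_to_summand_def by blast
}
qed
end

section \<open>Projective modules\<close>

definition regular where
 "regular A = (|carrier = <A>, monoid.mult = monoid.mult A, monoid.one = monoid.one A,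
   ring.zero = ring.zero A, ring.add = ring.add A, smult = monoid.mult A|)"

lemma regular_simps [simp]: "carrier (regular A) = <A>" "x \<oplus>.(regular A) y = x \<oplus>.A y" "\<zero>.(regular A) = \<zero>.A"
 "a\<odot>.(regular A) x = a\<otimes>.A x" by (simp_all add: regular_def)

lemma (in ring) left_module_regular: "left_module R (regular R)"
proof -
have "abelian_group (regular R)"
proof (rule abelian_groupI)
 fix x assume "x:carrier (regular R)"
 thus "EX y:carrier (regular R). y \<oplus>.(regular R) x = \<zero>.(regular R)" by auto
qed (auto simp: a_ac)
thus ?thesis using ring_axioms by (simp add: left_module_def left_module_axioms_def l_distr r_distr m_assoc)
qed

text \<open>The maps that factor through a finitely generated free module, written as finite sums of
  terms f(x) u.\<close>

inductive factors for A M where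
 zero: "factors A M (%x. \<zero>.M)"
| add: "factors A M \<phi> ==> f:lmod_hom A M (regular A) ==> u:<M> ==> factors A M (%x. \<phi> x \<oplus>.M f x\<odot>.M u)"

text \<open>The dual basis characterization of finitely generated projective modules.\<close>

definition projective where
 "projective A M <-> (EX \<phi>. factors A M \<phi> & (ALL x:<M>. \<phi> x = x))"

context left_module
begin

lemma factors_closed: "factors A M \<phi> ==> x:<M> ==> \<phi> x:<M>"
proof (induction rule: factors.induct)
case (add \<phi> f u)
thus ?case using lmod_homD(1)[OF add(2)] lsmult_closed by simp
qed simp

lemma factors_transport:
 assumes "factors A M \<phi>" "left_module A N" and i: "i:lmod_hom A N M" and r: "r:lmod_hom A M N"
 shows "EX \<psi>. factors A N \<psi> & (ALL x:<N>. \<psi> x = r (\<phi> (i x)))" using assms(1)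
proof (induction rule: factors.induct)
case zero
thus ?case using lmod_hom_zero(1)[OF left_module_axioms assms(2) r] factors.zero by force
next
case (add \<phi> f u)
then obtain \<psi> where \<psi>: "factors A N \<psi>" "ALL x:<N>. \<psi> x = r (\<phi> (i x))" by blast
have "factors A N (%x. \<psi> x \<oplus>.N f (i x)\<odot>.N r u)"
 using factors.add[OF \<psi>(1) lmod_hom_comp[OF i add(2)]] lmod_homD(1)[OF r add(3)] by blast
moreover have "\<psi> x \<oplus>.N f (i x)\<odot>.N r u = r (\<phi> (i x) \<oplus>.M f (i x)\<odot>.M u)" if x: "x:<N>" for x
 using lmod_homD[OF r] lmod_homD(1)[OF i x] lmod_homD(1)[OF add(2)] add(3) factors_closed[OF add(1)] \<psi>(2) x lsmult_closed by simp
ultimately show ?case by blast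
qed

lemma factors_sum:
 assumes "factors A M \<phi>" "factors A M \<psi>"
 shows "EX \<chi>. factors A M \<chi> & (ALL x:<M>. \<chi> x = \<phi> x \<oplus>.M \<psi> x)" using assms(2)
proof (induction rule: factors.induct)
case zero
thus ?case using assms(1) factors_closed by force
next
case (add \<psi> f u)
then obtain \<chi> where \<chi>: "factors A M \<chi>" "ALL x:<M>. \<chi> x = \<phi> x \<oplus>.M \<psi> x" by blast
have "\<chi> x \<oplus>.M f x\<odot>.M u = \<phi> x \<oplus>.M (\<psi> x \<oplus>.M f x\<odot>.M u)" if "x:<M>" for x
 using \<chi>(2) factors_closed[OF assms(1) that] factors_closed[OF add(1) that] lmod_homD(1)[OF add(2)] add(3) that lsmult_closed
 by (simp add: M.a_assoc)
thus ?case using factors.add[OF \<chi>(1) add(2,3)] by blast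
qed

lemma projective_retract:
 assumes "projective A M" "left_module A N" "iso_to_summand A N M"
 shows "projective A N"
proof -
obtain i r where ir: "i:lmod_hom A N M" "r:lmod_hom A M N" "ALL x:<N>. r (i x) = x"
 using assms(3) unfolding iso_to_summand_iff[OF assms(2)] by blast
obtain \<phi> where \<phi>: "factors A M \<phi>" "ALL x:<M>. \<phi> x = x" using assms(1) unfolding projective_def by blast
obtain \<psi> where "factors A N \<psi>" "ALL x:<N>. \<psi> x = r (\<phi> (i x))"
 using factors_transport[OF \<phi>(1) assms(2) ir(1,2)] by blast
thus ?thesis using \<phi>(2) ir(3) lmod_homD(1)[OF ir(1)] unfolding projective_def by auto
qed

lemma projective_sum:
 assumes "internal_direct_sum A M U W" "projective A (M(|carrier := U|))" "projective A (M(|carrier := W|))"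
 shows "projective A M"
proof -
have s: "submodule U A M" "submodule W A M" using assms(1) by (auto simp: internal_direct_sum_def)
interpret U: left_module A "M(|carrier := U|)" using lm_submod[OF s(1)] .
interpret W: left_module A "M(|carrier := W|)" using lm_submod[OF s(2)] .
obtain e where e: "e:lmod_hom A M M" "ALL x:<M>. e x:U & x \<ominus>.M e x:W" "ALL x:U. e x = x"
 using ids_retraction[OF assms(1)] by blast
note ed = lmod_homD[OF e(1)]
have eU: "e:lmod_hom A M (M(|carrier := U|))" using ed e(2) by (intro lmod_homI) auto
have eW: "(%x. x \<ominus>.M e x):lmod_hom A M (M(|carrier := W|))"
 using ed e(2) by (intro lmod_homI) (auto simp: a_minus_def M.minus_add M.a_ac lsmult_r_distr lsmult_r_minus)
have inc: "(%x. x):lmod_hom A (M(|carrier := U|)) M" "(%x. x):lmod_hom A (M(|carrier := W|)) M"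
 using submoduleD(1)[OF s(1)] submoduleD(1)[OF s(2)] by (auto intro!: lmod_homI)
obtain \<phi> where \<phi>: "factors A (M(|carrier := U|)) \<phi>" "ALL x:U. \<phi> x = x" using assms(2) by (auto simp: projective_def)
obtain \<psi> where \<psi>: "factors A (M(|carrier := W|)) \<psi>" "ALL x:W. \<psi> x = x" using assms(3) by (auto simp: projective_def)
obtain \<phi>' where \<phi>': "factors A M \<phi>'" "ALL x:<M>. \<phi>' x = \<phi> (e x)" using U.factors_transport[OF \<phi>(1) left_module_axioms eU inc(1)] by blast
obtain \<psi>' where \<psi>': "factors A M \<psi>'" "ALL x:<M>. \<psi>' x = \<psi> (x \<ominus>.M e x)" using W.factors_transport[OF \<psi>(1) left_module_axioms eW inc(2)] by blast
obtain \<chi> where \<chi>: "factors A M \<chi>" "ALL x:<M>. \<chi> x = \<phi>' x \<oplus>.M \<psi>' x" using factors_sum[OF \<phi>'(1) \<psi>'(1)] by blast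
have "\<chi> x = x" if "x:<M>" for x
 using \<chi>(2) \<phi>'(2) \<psi>'(2) \<phi>(2) \<psi>(2) e(2) that ed(1)[OF that] by (simp add: a_minus_def M.add_minus_cancel)
thus ?thesis using \<chi>(1) unfolding projective_def by blast
qed
end

text \<open>Some value f(u) of a linear form is not nilpotent, since otherwise the dual basis would
  give an endless nonzero product of nilpotents. A power of it is an idempotent, and a primitive a
  below that yields the summand generated by w, a copy of R a.\<close>

lemma (in finite_ring) projective_split:
 assumes "left_module R M" "projective R M" "<M> ~= {\<zero>.M}"
 shows "EX a w f. prim a & w:<M> & f:lmod_hom R M (regular R) & a\<odot>.M w = w & f w = a"
proof -
interpret M: left_module R M by fact
obtain \<phi> where \<phi>: "factors R M \<phi>" "ALL x:<M>. \<phi> x = x" using assms(2) by (auto simp: projective_def)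
\<comment> \<open>Closed under products, since f(u) g(v) = g(f(u) v).\<close>
define S where "S = {f u | f u. f:lmod_hom R M (regular R) & u:<M>}"
have SR: "S <= <R>" using lmod_homD(1) unfolding S_def by fastforce
have Smult: "s\<otimes> t:S" if st: "s:S" "t:S" for s t
proof -
 obtain f u g v where d: "s = f u" "t = g v" "f:lmod_hom R M (regular R)" "u:<M>" "g:lmod_hom R M (regular R)" "v:<M>"
  using st[unfolded S_def] by (elim CollectE exE conjE)
 have "s:<R>" using st(1) SR by blast
 hence "s\<otimes> t = g (s\<odot>.M v)" "s\<odot>.M v:<M>" using lmod_homD(3)[OF d(5) _ d(6)] d M.lsmult_closed by auto
 thus ?thesis using d(5) unfolding S_def by blast
qed
have step: "EX g u'. g:lmod_hom R M (regular R) & u':<M> & v\<otimes> g u\<otimes> f u' ~= \<zero>"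
 if "factors R M \<psi>" "f:lmod_hom R M (regular R)" "v:<R>" "u:<M>" "v\<otimes> f (\<psi> u) ~= \<zero>" for \<psi> f v u
 using that(1,5)
proof (induction rule: factors.induct)
 case zero
 thus ?case using lmod_hom_zero(1)[OF M.left_module_axioms left_module_regular that(2)] that(3) by simp
next
 case (add \<psi> g u')
 have c: "\<psi> u:<M>" "g u:<R>" using M.factors_closed[OF add(1)] lmod_homD(1)[OF add(2)] that(4) by auto
 have fc: "f (\<psi> u):<R>" "f u':<R>" using lmod_homD(1)[OF that(2)] c add(3) by auto
 have "v\<otimes> f (\<psi> u \<oplus>.M g u\<odot>.M u') = v\<otimes> f (\<psi> u) \<oplus> v\<otimes> g u\<otimes> f u'"
  using lmod_homD(2)[OF that(2)] lmod_homD(3)[OF that(2)] c fc add(3) that(3) M.lsmult_closed by (simp add: r_distr m_assoc)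
 hence "v\<otimes> f (\<psi> u) ~= \<zero> \<or> v\<otimes> g u\<otimes> f u' ~= \<zero>" using add.prems by auto
 thus ?case using add(2,3) add.IH by blast
qed
have "EX s:S. ~ nilp s"
proof (rule ccontr)
 assume n: "~ (EX s:S. ~ nilp s)"
 obtain x where x: "x:<M>" "x ~= \<zero>.M" using assms(3) by blast
 have "EX f. f:lmod_hom R M (regular R) & f x ~= \<zero>"
 proof (rule ccontr)
  assume z: "~ (EX f. f:lmod_hom R M (regular R) & f x ~= \<zero>)"
  have "factors R M \<psi> ==> \<psi> x = \<zero>.M" for \<psi> by (induction rule: factors.induct) (use z in auto)
  thus False using \<phi> x by metis
 qed
 then obtain f where f: "f:lmod_hom R M (regular R)" "f x ~= \<zero>" by blast
 \<comment> \<open>The first component is the product built so far. Expanding the second by the dual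
   basis finds a further factor that keeps the product with f nonzero.\<close>
 define I where "I p <-> fst p:<R> & snd p:<M> & fst p\<otimes> f (snd p) ~= \<zero>" for p
 have I0: "I (\<one>, x)" using f x lmod_homD(1)[OF f(1)] by (simp add: I_def)
 have nxt: "EX p'. I p' & (EX s:S. fst p' = fst p\<otimes> s)" if p: "I p" for p
 proof -
  have pc: "fst p:<R>" "snd p:<M>" "fst p\<otimes> f (\<phi> (snd p)) ~= \<zero>" using p \<phi>(2) by (auto simp: I_def)
  obtain g u' where g: "g:lmod_hom R M (regular R)" "u':<M>" "fst p\<otimes> g (snd p)\<otimes> f u' ~= \<zero>"
   using step[OF \<phi>(1) f(1) pc] by blast
  have "g (snd p):S" using g(1) pc(2) unfolding S_def by blast
  moreover from this have "g (snd p):<R>" using SR by blast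
  ultimately show ?thesis using g pc by (intro exI[of _ "(fst p\<otimes> g (snd p), u')"]) (auto simp: I_def)
 qed
 define nx where "nx p = (SOME p'. I p' & (EX s:S. fst p' = fst p\<otimes> s))" for p :: "'a \<times> 'c"
 have nx: "I (nx p)" "EX s:S. fst (nx p) = fst p\<otimes> s" if "I p" for p
  using someI_ex[OF nxt[OF that]] unfolding nx_def by auto
 define v where "v n = fst ((nx ^^ n) (\<one>, x))" for n
 have In: "I ((nx ^^ n) (\<one>, x))" for n by (induction n) (use I0 nx(1) in auto)
 have "EX n. v n = \<zero>"
 proof (rule nil_chain_zero[of S])
  show "EX s:S. v (Suc n) = v n\<otimes> s" for n using nx(2)[OF In[of n]] by (simp add: v_def)
  show "v n:<R>" for n using In[of n] by (simp add: v_def I_def)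
 qed (use SR Smult n in auto)
 then obtain n where "v n = \<zero>" by blast
 thus False using In[of n] lmod_homD(1)[OF f(1)] by (auto simp: v_def I_def)
qed
then obtain s where s: "s:S" "~ nilp s" by blast
hence sc: "s:<R>" using SR by blast
have "finite (range (%n::nat. s [^] n))" using finite_carrier sc by (rule_tac finite_subset[of _ "<R>"]) auto
then obtain n :: nat where n: "n > 0" "idem (s [^] n)" using finite_power_idem[OF sc] by blast
\<comment> \<open>This power of s lies in S, so it is itself a value of a linear form.\<close>
define e where "e = s [^] n"
have "s [^] Suc i:S" for i by (induction i) (use s Smult sc in auto)
hence "e:S" using n(1) unfolding e_def by (metis Suc_pred)
then obtain f u where fu: "f:lmod_hom R M (regular R)" "u:<M>" "f u = e" unfolding S_def by blast
have e: "idem e" "e ~= \<zero>" using n(2) s(2) unfolding e_def nilp_def by auto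
obtain a where a: "prim a" "a:corner e e" using prim_below[OF e] by blast
note ac = prim_idem[OF a(1)] cornerD[OF a(2)]
define w where "w = a\<odot>.M u"
have "w:<M>" "a\<odot>.M w = w" "f w = a"
 using fu ac M.lsmult_closed lmod_homD(3)[OF fu(1) _ fu(2), of a] unfolding w_def by (auto simp: M.lsmult_assoc[symmetric])
thus ?thesis using a(1) fu(1) by blast
qed

section \<open>Counting homomorphisms, and copies of modules\<close>

text \<open>Extensionality makes a homomorphism determined by its values on the carrier, so the set
  can be counted.\<close>

definition ext_homs where "ext_homs A M N = {f:lmod_hom A M N. f:extensional <M>}"

lemma finite_ext_homs:
 assumes "finite <M>" "finite <N>"
 shows "finite (ext_homs A M N)"
proof -
have "finite (<M> \<rightarrow>\<^sub>E <N>)" using assms by (simp add: finite_PiE)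
thus ?thesis by (rule finite_subset[rotated]) (auto simp: ext_homs_def lmod_hom_def PiE_def)
qed

lemma restrict_lmod_hom:
 assumes "left_module A M" "f:lmod_hom A M N"
 shows "restrict f <M>:ext_homs A M N"
proof -
interpret M: left_module A M by fact
show ?thesis using lmod_homD[OF assms(2)] M.lsmult_closed by (auto simp: ext_homs_def intro!: lmod_homI)
qed

lemma ext_homs_pos:
 assumes "left_module A M" "left_module A N" "finite <M>" "finite <N>"
 shows "card (ext_homs A M N) > 0"
proof -
interpret N: left_module A N by fact
have "(%x. \<zero>.N):lmod_hom A M N" by (intro lmod_homI) auto
hence "ext_homs A M N ~= {}" using restrict_lmod_hom[OF assms(1)] by blast
thus ?thesis using finite_ext_homs assms(3,4) by (simp add: card_gt_0_iff)
qed

text \<open>A split sequence makes M the direct sum of L and N, and homomorphisms into Z are pairs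
  of homomorphisms.\<close>

lemma card_ext_homs_split:
 assumes "left_module A L" "left_module A M" "left_module A N" "left_module A Z"
  and i: "i:lmod_hom A L M" and j: "j:lmod_hom A M N" and s: "s:lmod_hom A N M"
  and inj: "inj_on i <L>" and ker: "i ` <L> = {x:<M>. j x = \<zero>.N}"
  and js: "!!x. x:<N> ==> j (s x) = x"
 shows "card (ext_homs A M Z) = card (ext_homs A L Z) * card (ext_homs A N Z)"
proof -
interpret L: left_module A L by fact
interpret M: left_module A M by fact
interpret N: left_module A N by fact
interpret Zm: left_module A Z by fact
note id = lmod_homD[OF i] and jd = lmod_homD[OF j] and sd = lmod_homD[OF s]
\<comment> \<open>The retraction onto L belonging to the section s.\<close>
define r where "r x = inv_into <L> i (x \<ominus>.M s (j x))" for x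
have ker0: "x \<ominus>.M s (j x):i ` <L>" if "x:<M>" for x
 using that jd sd js lmod_hom_zero(2)[OF M.left_module_axioms N.left_module_axioms j]
 unfolding ker by (simp add: a_minus_def N.M.r_neg)
have r: "r x:<L>" "i (r x) = x \<ominus>.M s (j x)" if "x:<M>" for x
 using ker0[OF that] by (auto simp: r_def inv_into_into f_inv_into_f)
have split: "i (r x) \<oplus>.M s (j x) = x" if "x:<M>" for x
 using r(2)[OF that] that jd(1) sd(1) by (simp add: a_minus_def M.M.a_assoc M.M.l_neg)
have ri: "r (i l) = l" if "l:<L>" for l
proof -
 have "j (i l) = \<zero>.N" using ker that by blast
 hence "i (r (i l)) = i l"
  using r(2)[OF id(1)[OF that]] lmod_hom_zero(1)[OF N.left_module_axioms M.left_module_axioms s] id(1)[OF that] by (simp add: a_minus_def)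
 thus ?thesis using inj that r(1)[OF id(1)[OF that]] by (simp add: inj_on_eq_iff)
qed
have rs: "r (s x) = \<zero>.L" if "x:<N>" for x
proof -
 have "i (r (s x)) = i \<zero>.L"
  using r(2)[OF sd(1)[OF that]] js[OF that] sd(1)[OF that] lmod_hom_zero(1)[OF L.left_module_axioms M.left_module_axioms i]
  by (simp add: a_minus_def M.M.r_neg)
 thus ?thesis using inj r(1)[OF sd(1)[OF that]] by (simp add: inj_on_eq_iff)
qed
have rhom: "r:lmod_hom A M L"
proof (rule lmod_homI)
 fix x y assume xy: "x:<M>" "y:<M>"
 have "i (r (x \<oplus>.M y)) = i (r x \<oplus>.L r y)"
  using xy r id(2) jd sd by (simp add: a_minus_def M.M.minus_add M.M.a_ac)
 thus "r (x \<oplus>.M y) = r x \<oplus>.L r y" using inj r(1) xy by (simp add: inj_on_eq_iff)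
next
 fix a x assume ax: "a:<A>" "x:<M>"
 have "i (r (a\<odot>.M x)) = i (a\<odot>.L r x)"
  using ax r id(3) jd sd M.lsmult_closed by (simp add: a_minus_def M.lsmult_r_distr M.lsmult_r_minus)
 thus "r (a\<odot>.M x) = a\<odot>.L r x" using inj r(1) ax L.lsmult_closed M.lsmult_closed by (simp add: inj_on_eq_iff)
qed (use r in auto)
let ?F = "%f. (restrict (%x. f (i x)) <L>, restrict (%x. f (s x)) <N>)"
have "bij_betw ?F (ext_homs A M Z) (ext_homs A L Z \<times> ext_homs A N Z)"
proof (rule bij_betw_imageI)
 show "inj_on ?F (ext_homs A M Z)"
 proof (rule inj_onI)
  fix f g assume f: "f:ext_homs A M Z" and g: "g:ext_homs A M Z" and e: "?F f = ?F g"
  have fi: "f (i x) = g (i x)" if "x:<L>" for x using fun_cong[OF arg_cong[OF e, of fst], of x] that by simp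
  have fs: "f (s x) = g (s x)" if "x:<N>" for x using fun_cong[OF arg_cong[OF e, of snd], of x] that by simp
  have fh: "f:lmod_hom A M Z" "g:lmod_hom A M Z" using f g by (auto simp: ext_homs_def)
  have "f x = g x" if x: "x:<M>" for x
  proof -
   have "f (i (r x) \<oplus>.M s (j x)) = g (i (r x) \<oplus>.M s (j x))"
    using lmod_homD(2)[OF fh(1)] lmod_homD(2)[OF fh(2)] fi fs r(1) id(1) jd(1) sd(1) x by simp
   thus ?thesis using split[OF x] by simp
  qed
  thus "f = g" using f g by (intro extensionalityI[of _ "<M>"]) (auto simp: ext_homs_def)
 qed
 show "?F ` ext_homs A M Z = ext_homs A L Z \<times> ext_homs A N Z"
 proof (intro equalityI subsetI)
  fix p assume "p:?F ` ext_homs A M Z"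
  then obtain f where f: "p = ?F f" "f:lmod_hom A M Z" by (auto simp: ext_homs_def)
  show "p:ext_homs A L Z \<times> ext_homs A N Z"
   unfolding f(1) using restrict_lmod_hom[OF assms(1) lmod_hom_comp[OF i f(2)]] restrict_lmod_hom[OF assms(3) lmod_hom_comp[OF s f(2)]] by simp
 next
  fix p assume "p:ext_homs A L Z \<times> ext_homs A N Z"
  then obtain g h where p: "p = (g, h)" "g:lmod_hom A L Z" "h:lmod_hom A N Z" "g:extensional <L>" "h:extensional <N>"
   by (auto simp: ext_homs_def)
  let ?f = "%x. g (r x) \<oplus>.Z h (j x)"
  note gd = lmod_homD[OF lmod_hom_comp[OF rhom p(2)]] and hd = lmod_homD[OF lmod_hom_comp[OF j p(3)]]
  have fh: "?f:lmod_hom A M Z" using gd hd by (intro lmod_homI) (auto simp: Zm.M.a_ac Zm.lsmult_r_distr)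
  have ji: "j (i x) = \<zero>.N" if "x:<L>" for x using ker that by blast
  have gl: "g (r (i x)) \<oplus>.Z h (j (i x)) = g x" if "x:<L>" for x
   using ri[OF that] ji[OF that] lmod_hom_zero(1)[OF N.left_module_axioms Zm.left_module_axioms p(3)] lmod_homD(1)[OF p(2) that] by simp
  have hl: "g (r (s x)) \<oplus>.Z h (j (s x)) = h x" if "x:<N>" for x
   using rs[OF that] js[OF that] lmod_hom_zero(1)[OF L.left_module_axioms Zm.left_module_axioms p(2)] lmod_homD(1)[OF p(3) that] by simp
  have "(\<lambda>x\<in><L>. restrict ?f <M> (i x)) = g"
  proof (rule extensionalityI[OF restrict_extensional p(4)])
   fix x assume x: "x:<L>"
   show "(\<lambda>x\<in><L>. restrict ?f <M> (i x)) x = g x"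
    unfolding restrict_def using x id(1)[OF x] gl[OF x] by simp
  qed
  moreover have "(\<lambda>x\<in><N>. restrict ?f <M> (s x)) = h"
  proof (rule extensionalityI[OF restrict_extensional p(5)])
   fix x assume x: "x:<N>"
   show "(\<lambda>x\<in><N>. restrict ?f <M> (s x)) x = h x"
    unfolding restrict_def using x sd(1)[OF x] hl[OF x] by simp
  qed
  ultimately have "?F (restrict ?f <M>) = (g, h)" by blast
  hence "p = ?F (restrict ?f <M>)" unfolding p(1) by (rule sym)
  thus "p:?F ` ext_homs A M Z" by (rule image_eqI[OF _ restrict_lmod_hom[OF assms(2) fh]])
 qed
qed
from bij_betw_same_card[OF this] show ?thesis by (simp add: card_cartesian_product)
qed

text \<open>The hypotheses say that M is a copy of A a with w in the place of a; evaluation at w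
  identifies the homomorphisms into Z with a Z.\<close>

lemma card_ext_homs_cyclic:
 assumes "ring A" "left_module A M" "left_module A Z" "a:<A>" "a\<otimes>.A a = a"
  and w: "w:<M>" "a\<odot>.M w = w" and f: "f:lmod_hom A M (regular A)" "f w = a"
  and gen: "!!x. x:<M> ==> f x\<odot>.M w = x"
 shows "card (ext_homs A M Z) = card {x:<Z>. a\<odot>.Z x = x}"
proof -
interpret A: ring A by fact
interpret M: left_module A M by fact
interpret Zm: left_module A Z by fact
note fd = lmod_homD[OF f(1), simplified]
have "bij_betw (%h. h w) (ext_homs A M Z) {x:<Z>. a\<odot>.Z x = x}"
proof (rule bij_betw_imageI)
 show "inj_on (%h. h w) (ext_homs A M Z)"
 proof (rule inj_onI)
  fix g h assume g: "g:ext_homs A M Z" and h: "h:ext_homs A M Z" and e: "g w = h w"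
  have gh: "g:lmod_hom A M Z" "h:lmod_hom A M Z" using g h by (auto simp: ext_homs_def)
  have "g x = h x" if x: "x:<M>" for x
   using lmod_homD(3)[OF gh(1) fd(1)[OF x] w(1)] lmod_homD(3)[OF gh(2) fd(1)[OF x] w(1)] gen[OF x] e by simp
  thus "g = h" using g h by (intro extensionalityI[of _ "<M>"]) (auto simp: ext_homs_def)
 qed
 show "(%h. h w) ` ext_homs A M Z = {x:<Z>. a\<odot>.Z x = x}"
 proof (intro equalityI subsetI)
  fix x assume "x:(%h. h w) ` ext_homs A M Z"
  then obtain h where h: "x = h w" "h:lmod_hom A M Z" by (auto simp: ext_homs_def)
  show "x:{x:<Z>. a\<odot>.Z x = x}"
   using lmod_homD(1)[OF h(2) w(1)] lmod_homD(3)[OF h(2) assms(4) w(1)] w(2) h(1) by simp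
 next
  fix x assume x: "x:{x:<Z>. a\<odot>.Z x = x}"
  have "(%y. f y\<odot>.Z x):lmod_hom A M Z"
   using x fd Zm.lsmult_closed by (intro lmod_homI) (auto simp: Zm.lsmult_l_distr Zm.lsmult_assoc)
  from restrict_lmod_hom[OF assms(2) this] show "x:(%h. h w) ` ext_homs A M Z"
   using x w f(2) by (intro image_eqI[of _ _ "restrict (%y. f y\<odot>.Z x) <M>"]) auto
 qed
qed
thus ?thesis by (rule bij_betw_same_card)
qed

lemma left_module_cong:
 assumes "left_module A M" "<M'> = <M>" "\<zero>.M' = \<zero>.M"
  "!!x y. x:<M> ==> y:<M> ==> x \<oplus>.M' y = x \<oplus>.M y"
  "!!a x. a:<A> ==> x:<M> ==> a\<odot>.M' x = a\<odot>.M x"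
 shows "left_module A M'"
proof -
interpret M: left_module A M by fact
have "abelian_group M'"
proof (rule abelian_groupI)
 fix x assume "x:<M'>"
 thus "EX y:<M'>. y \<oplus>.M' x = \<zero>.M'" using assms(2-4) M.M.l_neg M.M.a_inv_closed by metis
qed (simp_all add: assms(2-4) M.M.a_ac)
thus ?thesis using M.A.ring_axioms M.lsmult_closed M.lsmult_l_distr M.lsmult_r_distr M.lsmult_assoc M.lsmult_one
 by (simp add: left_module_def left_module_axioms_def assms(2-5))
qed

text \<open>Transport of structure along an injection, used to move modules to the universe of
  functions on the naturals.\<close>

definition module_copy where
 "module_copy \<iota> N = (|carrier = \<iota> ` <N>, monoid.mult = undefined, monoid.one = undefined, ring.zero = \<iota> \<zero>.N,
  ring.add = (%x y. \<iota> (inv_into <N> \<iota> x \<oplus>.N inv_into <N> \<iota> y)),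
  smult = (%a x. \<iota> (a\<odot>.N inv_into <N> \<iota> x))|)"

lemma module_copy:
 assumes "left_module A N" "inj_on \<iota> <N>"
 shows "left_module A (module_copy \<iota> N)" "\<iota>:lmod_iso A N (module_copy \<iota> N)"
  "inv_into <N> \<iota>:lmod_hom A (module_copy \<iota> N) N" "carrier (module_copy \<iota> N) = \<iota> ` <N>"
proof -
interpret N: left_module A N by fact
note i = inv_into_f_f[OF assms(2)]
have "abelian_group (module_copy \<iota> N)"
proof (rule abelian_groupI)
 fix x assume "x:carrier (module_copy \<iota> N)"
 then obtain u where "u:<N>" "x = \<iota> u" by (auto simp: module_copy_def)
 thus "EX y:carrier (module_copy \<iota> N). y \<oplus>.(module_copy \<iota> N) x = \<zero>.(module_copy \<iota> N)"
  by (intro bexI[of _ "\<iota> (\<ominus>.N u)"]) (auto simp: module_copy_def i N.M.l_neg)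
qed (auto simp: module_copy_def i N.M.a_ac)
thus "left_module A (module_copy \<iota> N)" using N.A.ring_axioms N.lsmult_closed
 by (auto simp: left_module_def left_module_axioms_def module_copy_def i N.lsmult_l_distr N.lsmult_r_distr N.lsmult_assoc N.lsmult_one)
show "\<iota>:lmod_iso A N (module_copy \<iota> N)"
 using assms(2) by (auto simp: lmod_iso_def bij_betw_def module_copy_def intro!: lmod_homI)
show "inv_into <N> \<iota>:lmod_hom A (module_copy \<iota> N) N"
 using N.lsmult_closed by (intro lmod_homI) (auto simp: module_copy_def i)
qed (simp add: module_copy_def)

lemma iso_to_summand_trans:
 assumes "left_module A M" "left_module A N" "left_module A P" "iso_to_summand A M N" "iso_to_summand A N P"
 shows "iso_to_summand A M P"
proof -
obtain i r where i: "i:lmod_hom A M N" "r:lmod_hom A N M" "ALL x:<M>. r (i x) = x"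
 using assms(4) unfolding left_module.iso_to_summand_iff[OF assms(2,1)] by blast
obtain j s where j: "j:lmod_hom A N P" "s:lmod_hom A P N" "ALL x:<N>. s (j x) = x"
 using assms(5) unfolding left_module.iso_to_summand_iff[OF assms(3,2)] by blast
have "ALL x:<M>. r (s (j (i x))) = x" using i(3) j(3) lmod_homD(1)[OF i(1)] by simp
thus ?thesis
 unfolding left_module.iso_to_summand_iff[OF assms(3,1)] using lmod_hom_comp[OF i(1) j(1)] lmod_hom_comp[OF j(2) i(2)]
 by (intro bexI[of _ "%x. j (i x)"] bexI[of _ "%x. r (s x)"])
qed

lemma (in left_module) direct_summand_iso_to_summand:
 assumes "direct_summand A M U"
 shows "iso_to_summand A (M(|carrier := U|)) M"
proof -
have "(%x. x):lmod_iso A (M(|carrier := U|)) (M(|carrier := U|))"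
 by (auto simp: lmod_iso_def bij_betw_def intro!: lmod_homI)
thus ?thesis using assms unfolding iso_to_summand_def by blast
qed

lemma (in left_module) factors_add:
 "factors A M \<phi> ==> x:<M> ==> y:<M> ==> \<phi> (x \<oplus>.M y) = \<phi> x \<oplus>.M \<phi> y"
proof (induction rule: factors.induct)
case (add \<phi> f u)
thus ?case using lmod_homD[OF add(2)] factors_closed[OF add(1)] lsmult_closed by (simp add: lsmult_l_distr M.a_ac)
qed simp

section \<open>Induced modules and vertices\<close>

context group_algebra
begin

definition extend where "extend Q q = (\<lambda>x\<in><G>. if x:Q then q x else \<zero>)"

abbreviation KQ where "KQ Q \<equiv> group_ring K (G(|carrier := Q|))"

lemma group_algebra_subgroup: "subgroup Q G ==> group_algebra K (G(|carrier := Q|))"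
 using G.subgroup_imp_group[of Q] finite_G K.field_axioms finite_subset[OF subgroup.subset[of Q G]]
 by (simp add: group_algebra_def group_algebra_axioms_def)

lemma extend_simps:
 assumes Q: "subgroup Q G"
 shows "g:Q ==> extend Q (gmonom K (G(|carrier := Q|)) l g) = mon l g"
  and "q:carrier (KQ Q) ==> extend Q q:<KG>"
  and "q:carrier (KQ Q) ==> r:carrier (KQ Q) ==> extend Q (q \<oplus>.(KQ Q) r) = extend Q q \<oplus>.KG extend Q r"
  and "q:carrier (KQ Q) ==> r:carrier (KQ Q) ==> extend Q (q\<otimes>.(KQ Q) r) = extend Q q\<otimes>.KG extend Q r"
  and "extend Q \<one>.(KQ Q) = \<one>.KG"
proof -
interpret Q: group_algebra K "G(|carrier := Q|)" using group_algebra_subgroup[OF Q] .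
note QG = subgroup.mem_carrier[OF Q]
show m: "extend Q (gmonom K (G(|carrier := Q|)) l g) = mon l g" if "g:Q" for l g
 using that by (auto simp: extend_def gmonom_def)
show c: "extend Q q:<KG>" if "q:carrier (KQ Q)" for q using Q.gr_at[OF that] by (auto simp: extend_def gr_carrier)
show a: "extend Q (q \<oplus>.(KQ Q) r) = extend Q q \<oplus>.KG extend Q r" if "q:carrier (KQ Q)" "r:carrier (KQ Q)" for q r
 using that c by (intro gr_eqI) (auto simp: gr_add_at Q.gr_add_at extend_def)
show "extend Q (q\<otimes>.(KQ Q) r) = extend Q q\<otimes>.KG extend Q r" if q: "q:carrier (KQ Q)" and r: "r:carrier (KQ Q)"
 using q
proof (induction q rule: Q.gr_induct)
 case (mon l g)
 from r show ?case
 proof (induction r rule: Q.gr_induct)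
  case (mon l' g')
  thus ?case
   using Q.mon_mult[OF \<open>l:<K>\<close> mon(1) \<open>g:_\<close> mon(2)] \<open>l:<K>\<close> \<open>g:_\<close> QG subgroup.m_closed[OF Q]
   by (simp add: m mon_mult)
 next
  case (add u v)
  thus ?case using Q.mon_closed[OF \<open>l:<K>\<close>, of g] a c by (simp add: Q.KG.r_distr KG.r_distr)
 qed
next
 case (add u v)
 thus ?case using r a c by (simp add: Q.KG.l_distr KG.l_distr)
qed
show "extend Q \<one>.(KQ Q) = \<one>.KG" using m subgroup.one_closed[OF Q] by (simp add: Q.gr_one gr_one)
qed

lemma sub_simps:
 "carrier (group_ring_over_subgroup K G Q) = <KG>" "x \<oplus>.(group_ring_over_subgroup K G Q) y = x \<oplus>.KG y"
 "\<zero>.(group_ring_over_subgroup K G Q) = \<zero>.KG" "a\<odot>.(group_ring_over_subgroup K G Q) x = a\<otimes>.KG x"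
 "x \<star>.(group_ring_over_subgroup K G Q) q = x\<otimes>.KG extend Q q"
 by (simp_all add: group_ring_over_subgroup_def Let_def extend_def)

lemma tensor_product_over:
 assumes "subgroup Q G" "left_module (KQ Q) L"
 shows "tensor_product KG (KQ Q) (group_ring_over_subgroup K G Q) L"
proof -
interpret L: left_module "KQ Q" L by fact
have "left_module KG (group_ring_over_subgroup K G Q)"
 by (rule left_module_cong[OF KG.left_module_regular]) (simp_all add: sub_simps)
thus ?thesis using extend_simps[OF assms(1)] L.A.ring_axioms assms(2)
 by (simp add: tensor_product_def bimodule_def bimodule_axioms_def sub_simps KG.l_distr KG.r_distr KG.m_assoc)
qed

text \<open>Tensoring with the group algebra over itself changes nothing; this makes the whole group
  admissible, so that vertices exist.\<close>

lemma induced_whole: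
 assumes "left_module KG N"
 shows "iso_to_summand KG N (induced_module K G <G> N)"
proof -
interpret N: left_module KG N by fact
have sg: "subgroup <G> G" by (rule G.subgroup_self)
interpret T: tensor_product KG KG "group_ring_over_subgroup K G <G>" N
 using tensor_product_over[OF sg] assms by simp
interpret TT: left_module KG T.TT using T.left_module_TT .
have I: "induced_module K G <G> N = T.TT" by (simp add: induced_module_def)
have e: "extend <G> a = a" if "a:<KG>" for a
 using that by (auto simp: extend_def gr_carrier PiE_iff extensional_def)
have "EX r. r:<T.TT> -> <N> & (ALL s:<T.TT>. ALL t:<T.TT>. r (s \<oplus>.T.TT t) = r s \<oplus>.N r t) &
 (ALL a:carrier (group_ring_over_subgroup K G <G>). ALL x:<N>. r (T.pure a x) = a\<odot>.N x)" using N.lsmult_closed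
 by (intro T.TT_universal N.M.abelian_group_axioms) (auto simp: sub_simps e N.lsmult_l_distr N.lsmult_r_distr N.lsmult_assoc)
then obtain r where r: "r:<T.TT> -> <N>" "ALL s:<T.TT>. ALL t:<T.TT>. r (s \<oplus>.T.TT t) = r s \<oplus>.N r t"
 "ALL a:<KG>. ALL x:<N>. r (T.pure a x) = a\<odot>.N x" by (auto simp: sub_simps)
have "r (a\<odot>.T.TT t) = a\<odot>.N r t" if a: "a:<KG>" and t: "t:<T.TT>" for a t using t
proof (induction t rule: T.TT_induct)
 case (pure x y)
 thus ?case using r(3) a T.smult_cls(2)[OF a] by (simp add: sub_simps N.lsmult_assoc)
next
 case (add s t)
 thus ?case using r a TT.lsmult_closed by (simp add: TT.lsmult_r_distr N.lsmult_r_distr Pi_iff)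
qed
hence rh: "r:lmod_hom KG T.TT N" using r by (intro lmod_homI) auto
have "T.pure \<one>.KG (a\<odot>.N x) = a\<odot>.T.TT T.pure \<one>.KG x" if "a:<KG>" "x:<N>" for a x
 using T.pure_balanced[of "\<one>.KG" a x] T.smult_cls(2)[OF that(1), of "\<one>.KG" x] that by (simp add: sub_simps e)
hence ih: "T.pure \<one>.KG:lmod_hom KG N T.TT"
 using T.pure_closed T.pure_add_right by (intro lmod_homI) (auto simp: sub_simps)
show ?thesis unfolding I TT.iso_to_summand_iff[OF assms]
 using ih rh r(3) N.lsmult_one by (intro bexI[of _ "T.pure \<one>.KG"] bexI[of _ r]) auto
qed

lemma trivial_subgroup: "subgroup {\<one>.G} G" by (rule G.triv_subgroup)

lemma extend_trivial:
 assumes "q:carrier (KQ {\<one>.G})"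
 shows "extend {\<one>.G} q = mon (q \<one>.G) \<one>.G" "q = gmonom K (G(|carrier := {\<one>.G}|)) (q \<one>.G) \<one>.G" "q \<one>.G:<K>"
 using assms by (auto simp: extend_def gmonom_def group_ring_def PiE_iff extensional_def)

text \<open>Induction from the trivial subgroup gives a free module with basis the tensors of one
  with v, for v in B.\<close>

lemma induced_trivial_projective:
 assumes L: "left_module (KQ {\<one>.G}) L" and B: "fin_basis K (res K (G(|carrier := {\<one>.G}|)) L) B"
 shows "left_module KG (induced_module K G {\<one>.G} L)" "projective KG (induced_module K G {\<one>.G} L)"
proof -
let ?Q = "{\<one>.G}" and ?G1 = "G(|carrier := {\<one>.G}|)" and ?A = "group_ring_over_subgroup K G {\<one>.G}"
let ?V = "res K ?G1 L"
interpret Q: group_algebra K ?G1 using group_algebra_subgroup[OF trivial_subgroup] .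
interpret L: left_module "KQ ?Q" L by fact
interpret V: vector_space K ?V using Q.vs_res[OF L] .
interpret T: tensor_product KG "KQ ?Q" ?A L using tensor_product_over[OF trivial_subgroup L] .
interpret TT: left_module KG T.TT using T.left_module_TT .
have I: "induced_module K G ?Q L = T.TT" by (simp add: induced_module_def)
show "left_module KG (induced_module K G {\<one>.G} L)" unfolding I using T.left_module_TT .
let ?c = "%x v. coordinates K ?V B x v" and ?s = "%l. gmonom K ?G1 l \<one>.G"
note Bd = V.fin_basisD[OF B]
have BL: "v:<L>" if "v:B" for v using Bd that by auto
have cc: "?c x v:<K>" if "x:<L>" "v:B" for x v using V.coordinates_closed[OF B] that by simp
have f: "EX f. f:lmod_hom KG T.TT (regular KG) & (ALL a:<KG>. ALL x:<L>. f (T.pure a x) = a\<otimes>.KG mon (?c x v) \<one>.G)"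
 if v: "v:B" for v
proof -
 interpret R: left_module KG "regular KG" by (rule KG.left_module_regular)
 have "EX f. f:<T.TT> -> carrier (regular KG) & (ALL s:<T.TT>. ALL t:<T.TT>. f (s \<oplus>.T.TT t) = f s \<oplus>.(regular KG) f t) &
  (ALL a:<?A>. ALL x:<L>. f (T.pure a x) = a\<otimes>.KG mon (?c x v) \<one>.G)"
 proof (rule T.TT_universal[OF R.M.abelian_group_axioms])
  fix a q y assume h: "a:<?A>" "q:carrier (KQ ?Q)" "y:<L>"
  note q = extend_trivial[OF h(2)]
  have "q\<odot>.L y = q \<one>.G\<odot>.(?V) y" using q(2) by simp
  hence "?c (q\<odot>.L y) v = q \<one>.G\<otimes> ?c y v" using V.coordinates_smult[OF B _ q(3), of y] v h(3) by simp
  thus "(a \<star>.(?A) q)\<otimes>.KG mon (?c y v) \<one>.G = a\<otimes>.KG mon (?c (q\<odot>.L y) v) \<one>.G"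
   using h cc[OF h(3) v] q by (simp add: sub_simps KG.m_assoc mon_mult)
 qed (use v cc V.coordinates_add[OF B] in \<open>auto simp: sub_simps KG.l_distr KG.r_distr[symmetric] mon_add\<close>)
 then obtain f where f: "f:<T.TT> -> <KG>" "ALL s:<T.TT>. ALL t:<T.TT>. f (s \<oplus>.T.TT t) = f s \<oplus>.KG f t"
  "ALL a:<KG>. ALL x:<L>. f (T.pure a x) = a\<otimes>.KG mon (?c x v) \<one>.G" by (auto simp: sub_simps)
 have "f (a\<odot>.T.TT t) = a\<otimes>.KG f t" if a: "a:<KG>" and t: "t:<T.TT>" for a t using t
 proof (induction t rule: T.TT_induct)
  case (pure x y)
  thus ?case using f(3) a v cc T.smult_cls(2)[OF a] by (simp add: sub_simps KG.m_assoc)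
 next
  case (add s t)
  thus ?case using f a TT.lsmult_closed by (simp add: TT.lsmult_r_distr KG.r_distr Pi_iff)
 qed
 thus ?thesis using f by (intro exI[of _ f]) (auto intro!: lmod_homI)
qed
\<comment> \<open>The identity is assembled one basis vector at a time; each step adds the
  coordinate form of v times the tensor of one with v.\<close>
have "EX \<phi>. factors KG T.TT \<phi> & (ALL a:<KG>. ALL x:<L>. \<phi> (T.pure a x) = T.pure a (\<Oplus>.(?V)v\<in>B'. ?c x v\<odot>.(?V) v))"
 if "finite B'" "B' <= B" for B' using that
proof (induction B' rule: finite_induct)
 case empty
 have "T.pure a \<zero>.L = \<zero>.T.TT" if "a:<KG>" for a
  using T.pure_add_right[of a "\<zero>.L" "\<zero>.L"] T.pure_closed[of a "\<zero>.L"] that by (auto simp: sub_simps)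
 thus ?case using factors.zero[of KG T.TT] by (intro exI) auto
next
 case (insert v B')
 hence "B' <= B" by simp
 from insert.IH[OF this] obtain \<phi> where \<phi>: "factors KG T.TT \<phi>" "ALL a:<KG>. ALL x:<L>. \<phi> (T.pure a x) = T.pure a (\<Oplus>.(?V)v\<in>B'. ?c x v\<odot>.(?V) v)" by (elim exE conjE)
 have v: "v:B" using insert by simp
 obtain f where fv: "f:lmod_hom KG T.TT (regular KG)" "ALL a:<KG>. ALL x:<L>. f (T.pure a x) = a\<otimes>.KG mon (?c x v) \<one>.G"
  using f[OF v] by blast
 have p1: "T.pure \<one>.KG v:<T.TT>" using T.pure_closed BL[OF v] by (simp add: sub_simps)
 have "\<phi> (T.pure a x) \<oplus>.T.TT f (T.pure a x)\<odot>.T.TT T.pure \<one>.KG v = T.pure a (\<Oplus>.(?V)v\<in>insert v B'. ?c x v\<odot>.(?V) v)"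
  if a: "a:<KG>" and x: "x:<L>" for a x
 proof -
  have k: "?c x v:<K>" using cc[OF x v] .
  have sc: "?s (?c x v):carrier (KQ ?Q)" using Q.mon_closed[OF k] by simp
  have "f (T.pure a x)\<odot>.T.TT T.pure \<one>.KG v = T.pure (a\<otimes>.KG mon (?c x v) \<one>.G) v"
   using fv(2) a x k T.smult_cls(2)[of "a\<otimes>.KG mon (?c x v) \<one>.G" "\<one>.KG" v] BL[OF v] by (simp add: sub_simps)
  also have "... = T.pure (a \<star>.(?A) ?s (?c x v)) v"
   using extend_simps(1)[OF trivial_subgroup, of "\<one>.G"] by (simp add: sub_simps)
  also have "... = T.pure a (?c x v\<odot>.(?V) v)" using T.pure_balanced[OF _ sc BL[OF v], of a] a by (simp add: sub_simps)
  finally have 1: "f (T.pure a x)\<odot>.T.TT T.pure \<one>.KG v = T.pure a (?c x v\<odot>.(?V) v)" .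
  have vc: "(%v. ?c x v\<odot>.(?V) v):insert v B' -> <?V>" using insert.prems cc[OF x] BL V.lsmult_closed by auto
  hence 2: "T.pure a (?c x v\<odot>.(?V) v \<oplus>.(?V) (\<Oplus>.(?V)v\<in>B'. ?c x v\<odot>.(?V) v))
    = T.pure a (?c x v\<odot>.(?V) v) \<oplus>.T.TT T.pure a (\<Oplus>.(?V)v\<in>B'. ?c x v\<odot>.(?V) v)"
   using T.pure_add_right[of a "?c x v\<odot>.(?V) v" "\<Oplus>.(?V)v\<in>B'. ?c x v\<odot>.(?V) v"] a by (simp add: sub_simps)
  have 3: "(\<Oplus>.(?V)v\<in>insert v B'. ?c x v\<odot>.(?V) v) = ?c x v\<odot>.(?V) v \<oplus>.(?V) (\<Oplus>.(?V)v\<in>B'. ?c x v\<odot>.(?V) v)"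
   using insert.hyps vc by (intro V.M.finsum_insert) auto
  have 4: "T.pure a (?c x v\<odot>.(?V) v):<T.TT>" "\<phi> (T.pure a x):<T.TT>"
   using T.pure_closed a x vc TT.factors_closed[OF \<phi>(1)] by (auto simp: sub_simps)
  have 5: "\<phi> (T.pure a x) = T.pure a (\<Oplus>.(?V)v\<in>B'. ?c x v\<odot>.(?V) v)" using \<phi>(2) a x by blast
  show ?thesis unfolding 1 2 3 5[symmetric] using 4 by (intro T.TT.a_comm)
 qed
 thus ?case using factors.add[OF \<phi>(1) fv(1) p1]
  by (intro exI[of _ "%x. \<phi> x \<oplus>.T.TT f x\<odot>.T.TT T.pure \<one>.KG v"] conjI ballI)
qed
from this[OF Bd(1) subset_refl] obtain \<phi> where \<phi>: "factors KG T.TT \<phi>"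
 "ALL a:<KG>. ALL x:<L>. \<phi> (T.pure a x) = T.pure a (\<Oplus>.(?V)v\<in>B. ?c x v\<odot>.(?V) v)" by (elim exE conjE)
have "\<phi> t = t" if "t:<T.TT>" for t using that
proof (induction t rule: T.TT_induct)
 case (pure a x)
 thus ?case using \<phi>(2) V.coordinates(2)[OF B, of x] by (simp add: sub_simps)
qed (use TT.factors_add[OF \<phi>(1)] in simp)
thus "projective KG (induced_module K G {\<one>.G} L)" unfolding I projective_def using \<phi>(1) by blast
qed
end

lemma (in left_module) internal_direct_sum_sym:
 assumes "internal_direct_sum A M U W"
 shows "internal_direct_sum A M W U"
proof -
have s: "U <= <M>" "W <= <M>" using assms submoduleD(1) unfolding internal_direct_sum_def by auto
have "W <+>.M U = U <+>.M W" unfolding set_add_def' using s M.a_comm by (fastforce simp: subset_iff)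
thus ?thesis using assms unfolding internal_direct_sum_def by (simp add: Int_commute)
qed

context group_algebra
begin

lemma finite_module_fin_basis:
 assumes "left_module KG N" "finite <N>"
 shows "EX B. fin_basis K (res K G N) B"
proof -
interpret V: vector_space K "res K G N" using vs_res[OF assms(1)] .
interpret N: left_module KG N by fact
have "EX a:<N> -> <K>. x = (\<Oplus>.N v\<in><N>. mon (a v) \<one>.G\<odot>.N v)" if x: "x:<N>" for x
proof -
 have z: "mon \<zero> \<one>.G = \<zero>.KG" by (intro gr_eqI) (auto simp: mon_at gr_zero_at)
 have "(\<Oplus>.N v\<in><N>. mon (if v = x then \<one> else \<zero>) \<one>.G\<odot>.N v) = (\<Oplus>.N v\<in><N>. if v = x then v else \<zero>.N)"
  by (intro N.M.finsum_cong') (auto simp: z gr_one[symmetric] N.lsmult_one)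
 also have "... = x" using N.M.finsum_delta[OF assms(2) x, of "%v. v"] x by simp
 finally show ?thesis by (intro bexI[of _ "%v. if v = x then \<one> else \<zero>"]) auto
qed
thus ?thesis using V.exists_fin_basis[of "<N>"] assms(2) by auto
qed

lemma relatively_projective_whole:
 fixes N :: "('g => 'f, nat => 'f, 'w) module_scheme"
 assumes "left_module KG N" "finite <N>"
 shows "relatively_projective K G <G> N"
proof -
define L :: "('g => 'f, nat => 'f) module" where "L = (|carrier = <N>, monoid.mult = undefined, monoid.one = undefined, ring.zero = ring.zero N, ring.add = ring.add N, smult = smult N|)"
have L: "left_module KG L" by (rule left_module_cong[OF assms(1)]) (simp_all add: L_def)
have "(%x. x):lmod_hom KG N L" "(%x. x):lmod_hom KG L N" by (auto simp: L_def intro!: lmod_homI)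
hence "iso_to_summand KG N L"
 unfolding left_module.iso_to_summand_iff[OF L assms(1)] by (intro bexI[of _ "%x. x"]) auto
moreover have "left_module KG (induced_module K G <G> L)"
proof -
 interpret T: tensor_product KG KG "group_ring_over_subgroup K G <G>" L
  using tensor_product_over[OF G.subgroup_self] L by simp
 show ?thesis using T.left_module_TT by (simp add: induced_module_def)
qed
ultimately have "iso_to_summand KG N (induced_module K G <G> L)"
 using iso_to_summand_trans[OF assms(1) L _ _ induced_whole[OF L]] by blast
moreover obtain B where "fin_basis K (res K G L) B"
 using finite_module_fin_basis[OF L] assms(2) by (auto simp: L_def)
ultimately show ?thesis using L unfolding relatively_projective_def by (intro exI[of _ L]) auto
qed

text \<open>The whole group is admissible by \<open>relatively_projective_whole\<close>, and a
  finite family of subgroups has a minimal member.\<close>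

lemma exists_vertex:
 fixes N :: "('g => 'f, nat => 'f, 'w) module_scheme"
 assumes "left_module KG N" "finite <N>"
 shows "EX D. is_vertex K G N D"
proof -
let ?S = "{Q. subgroup Q G & relatively_projective K G Q N}"
have "finite ?S" using finite_G by (rule_tac finite_subset[of _ "Pow <G>"]) (auto dest: subgroup.subset)
moreover have "<G>:?S" using relatively_projective_whole[OF assms] G.subgroup_self by simp
ultimately obtain D where "D:?S" "ALL Q:?S. Q <= D --> Q = D" using finite_has_minimal2[of ?S "<G>"] by blast
thus ?thesis unfolding is_vertex_def by (intro exI[of _ D]) auto
qed

lemma relatively_projective_trivial:
 assumes "left_module KG N" "relatively_projective K G {\<one>.G} N"
 shows "projective KG N"
proof -
obtain L :: "('g => 'f, nat => 'f) module" and B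
 where L: "left_module (KQ {\<one>.G}) L" "fin_basis K (res K (G(|carrier := {\<one>.G}|)) L) B"
  "iso_to_summand KG N (induced_module K G {\<one>.G} L)"
 using assms(2) unfolding relatively_projective_def by blast
show ?thesis
 using left_module.projective_retract[OF induced_trivial_projective(1)[OF L(1,2)] induced_trivial_projective(2)[OF L(1,2)] assms(1) L(3)] .
qed

text \<open>The regular module is induced from the one-dimensional module of the trivial
  subgroup.\<close>

lemma projective_relatively_projective_trivial:
 assumes "left_module KG N" "iso_to_summand KG N (regular KG)"
 shows "relatively_projective K G {\<one>.G} N"
proof -
let ?Q = "{\<one>.G}" and ?G1 = "G(|carrier := {\<one>.G}|)" and ?A = "group_ring_over_subgroup K G {\<one>.G}"
interpret Q: group_algebra K ?G1 using group_algebra_subgroup[OF trivial_subgroup] .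
\<comment> \<open>An element of the algebra of the trivial group is a single scalar; constant
  functions house it in the universe type.\<close>
define \<iota> :: "('g => 'f) => nat => 'f" where "\<iota> q = (%_. q \<one>.G)" for q
have inj: "inj_on \<iota> (carrier (KQ ?Q))" using extend_trivial(2) by (intro inj_onI) (metis \<iota>_def)
define L :: "('g => 'f, nat => 'f) module" where "L = module_copy \<iota> (regular (KQ ?Q))"
note c = module_copy[OF Q.KG.left_module_regular, of \<iota>, unfolded regular_simps, OF inj, folded L_def]
interpret L: left_module "KQ ?Q" L using c(1) .
have i: "\<iota>:lmod_hom (KQ ?Q) (regular (KQ ?Q)) L" using c(2) by (simp add: lmod_iso_def)
let ?j = "inv_into (carrier (KQ ?Q)) \<iota>"
note id = lmod_homD[OF i, simplified] and jd = lmod_homD[OF c(3), simplified]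
let ?e = "\<iota> \<one>.(KQ ?Q)"
have e: "?e:<L>" using id(1) by simp
have "<L> <= (%a. a\<odot>.L ?e) ` carrier (KQ ?Q)"
proof
 fix x assume "x:<L>"
 then obtain q where "q:carrier (KQ ?Q)" "x = \<iota> q" by (auto simp: L_def module_copy_def)
 thus "x:(%a. a\<odot>.L ?e) ` carrier (KQ ?Q)" using id(3)[of q "\<one>.(KQ ?Q)"] by (intro image_eqI[of _ _ q]) auto
qed
then obtain B where B: "fin_basis K (res K ?G1 L) B" using Q.cyclic_fin_basis[OF c(1) e] by blast
interpret T: tensor_product KG "KQ ?Q" ?A L using tensor_product_over[OF trivial_subgroup c(1)] .
interpret TT: left_module KG T.TT using T.left_module_TT .
interpret R: left_module KG "regular KG" by (rule KG.left_module_regular)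
have "EX r. r:<T.TT> -> carrier (regular KG) & (ALL s:<T.TT>. ALL t:<T.TT>. r (s \<oplus>.T.TT t) = r s \<oplus>.(regular KG) r t) &
 (ALL a:<?A>. ALL x:<L>. r (T.pure a x) = a\<otimes>.KG extend ?Q (?j x))"
 using jd extend_simps[OF trivial_subgroup]
 by (intro T.TT_universal R.M.abelian_group_axioms) (auto simp: sub_simps KG.l_distr KG.r_distr KG.m_assoc)
then obtain r where r: "r:<T.TT> -> <KG>" "ALL s:<T.TT>. ALL t:<T.TT>. r (s \<oplus>.T.TT t) = r s \<oplus>.KG r t"
 "ALL a:<KG>. ALL x:<L>. r (T.pure a x) = a\<otimes>.KG extend ?Q (?j x)" by (auto simp: sub_simps)
have "r (a\<odot>.T.TT t) = a\<otimes>.KG r t" if a: "a:<KG>" and t: "t:<T.TT>" for a t using t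
proof (induction t rule: T.TT_induct)
 case (pure x y)
 thus ?case using r(3) a T.smult_cls(2)[OF a] jd(1) extend_simps(2)[OF trivial_subgroup]
  by (simp add: sub_simps KG.m_assoc)
next
 case (add s t)
 thus ?case using r a TT.lsmult_closed by (simp add: TT.lsmult_r_distr KG.r_distr Pi_iff)
qed
hence rh: "r:lmod_hom KG T.TT (regular KG)" using r by (intro lmod_homI) auto
have ih: "(%a. T.pure a ?e):lmod_hom KG (regular KG) T.TT"
 using T.pure_closed T.pure_add_left T.smult_cls(2) e by (intro lmod_homI) (auto simp: sub_simps)
have "r (T.pure a ?e) = a" if "a:<KG>" for a
 using r(3) that e inv_into_f_f[OF inj, of "\<one>.(KQ ?Q)"] extend_simps(5)[OF trivial_subgroup] by simp
hence "iso_to_summand KG (regular KG) T.TT"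
 unfolding TT.iso_to_summand_iff[OF KG.left_module_regular] using ih rh by (intro bexI[of _ "%a. T.pure a ?e"]) auto
hence "iso_to_summand KG N (induced_module K G ?Q L)"
 using iso_to_summand_trans[OF assms(1) KG.left_module_regular T.left_module_TT assms(2)] by (simp add: induced_module_def)
thus ?thesis using c(1) B unfolding relatively_projective_def by blast
qed

lemma trivial_vertex:
 assumes "is_vertex K G N D" "relatively_projective K G {\<one>.G} N"
 shows "D = {\<one>.G}"
proof -
have "subgroup D G" using assms(1) by (simp add: is_vertex_def)
hence "{\<one>.G} <= D" using subgroup.one_closed by blast
thus ?thesis using assms trivial_subgroup unfolding is_vertex_def by blast
qed

text \<open>An indecomposable summand whose vertices are trivial is projective; splitting off summands reduces
 to the indecomposable case.\<close>

lemma trivial_vertices_projective: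
 fixes N :: "('g => 'f, nat => 'f, 'w) module_scheme"
 assumes N: "left_module KG N" "finite <N>"
  and D: "!!U D. [|direct_summand KG N U; indecomposable KG (N(|carrier := U|)); is_vertex K G (N(|carrier := U|)) D|] ==> D = {\<one>.G}"
 shows "projective KG N"
proof -
interpret N: left_module KG N by fact
\<comment> \<open>The claim ranges over all summands of N, because the hypothesis on vertices does;
  N itself is one of them.\<close>
have "direct_summand KG N U ==> projective KG (N(|carrier := U|))" for U
proof (induction "card U" arbitrary: U rule: less_induct)
 case less
 note U = N.summand_submod[OF less.prems]
 interpret U: left_module KG "N(|carrier := U|)" using N.lm_submod[OF U] .
 have fU: "finite U" using N(2) N.submoduleD(1)[OF U] finite_subset by blast
 show ?case
 proof (cases "indecomposable KG (N(|carrier := U|))")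
  case True
  obtain E where E: "is_vertex K G (N(|carrier := U|)) E" using exists_vertex[OF U.left_module_axioms] fU by auto
  hence "relatively_projective K G {\<one>.G} (N(|carrier := U|))"
   using D[OF less.prems True E] by (auto simp: is_vertex_def)
  thus ?thesis using relatively_projective_trivial[OF U.left_module_axioms] by blast
 next
  case False
  show ?thesis
  proof (cases "U = {\<zero>.N}")
   case True
   thus ?thesis using factors.zero[of KG "N(|carrier := U|)"] unfolding projective_def by force
  next
   case nz: False
   then obtain V W where VW: "internal_direct_sum KG (N(|carrier := U|)) V W" "V ~= {\<zero>.N}" "W ~= {\<zero>.N}"
    using False unfolding indecomposable_def by auto
   hence VW': "internal_direct_sum KG (N(|carrier := U|)) W V" using U.internal_direct_sum_sym by blast
   have lt: "card V' < card U & direct_summand KG N V'"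
    if "internal_direct_sum KG (N(|carrier := U|)) V' W'" "W' ~= {\<zero>.N}" for V' W'
   proof -
    have s: "submodule V' KG (N(|carrier := U|))" "submodule W' KG (N(|carrier := U|))" "V' \<inter> W' = {\<zero>.N}"
     using that(1) by (auto simp: internal_direct_sum_def)
    have "V' <= U" "W' <= U" using U.submoduleD(1)[OF s(1)] U.submoduleD(1)[OF s(2)] by auto
    moreover have "V' ~= U" using s(3) that(2) \<open>W' <= U\<close> by auto
    ultimately have "card V' < card U" using fU by (intro psubset_card_mono) auto
    moreover have "direct_summand KG (N(|carrier := U|)) V'" using that(1) unfolding direct_summand_def by blast
    ultimately show ?thesis using N.direct_summand_trans[OF less.prems] by simp
   qed
   have "projective KG (N(|carrier := V|))" "projective KG (N(|carrier := W|))"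
    using less.hyps lt[OF VW(1,3)] lt[OF VW' VW(2)] by auto
   thus ?thesis using U.projective_sum[OF VW(1)] by simp
  qed
 qed
qed
moreover have "direct_summand KG N <N>"
 unfolding N.direct_summand_iff by (intro conjI bexI[of _ "%x. x"]) (auto intro!: lmod_homI)
ultimately have "projective KG (N(|carrier := <N>|))" by blast
thus ?thesis by simp
qed
end

section \<open>Bimodules as modules over the product group\<close>

locale product_algebra = K?: field K + L: group L + G: group G
 for K :: "('f, 'u) ring_scheme" (structure) and L :: "('l, 'v) monoid_scheme" and G :: "('g, 'w) monoid_scheme" +
 assumes finite_K: "finite <K>" and finite_L: "finite <L>" and finite_G: "finite <G>"
begin

abbreviation Y where "Y \<equiv> L \<times>\<times> G"

sublocale LA: group_algebra K L
 using K.field_axioms finite_L by (simp add: group_algebra_def group_algebra_axioms_def)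

sublocale GA: group_algebra K G
 using K.field_axioms finite_G by (simp add: group_algebra_def group_algebra_axioms_def)

sublocale A: group_algebra K Y
 using K.field_axioms DirProd_group[OF L.group_axioms G.group_axioms] finite_L finite_G
 by (simp add: group_algebra_def group_algebra_axioms_def)

abbreviation pm where "pm \<equiv> as_product_module K L G"

definition emb_left where "emb_left a = (\<lambda>y\<in><Y>. if snd y = \<one>.G then a (fst y) else \<zero>)"
text \<open>The inverse turns right multiplication into a left action, so this is an
  antihomomorphism (\<open>emb_right_mult\<close>).\<close>

definition emb_right where "emb_right q = (\<lambda>y\<in><Y>. if fst y = \<one>.L then q (inv .G (snd y)) else \<zero>)"

lemma emb_left:
 shows "a:<LA.KG> ==> emb_left a:<A.KG>" "emb_left (a \<oplus>.LA.KG a') = emb_left a \<oplus>.A.KG emb_left a'"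
  and "emb_left (LA.mon l g) = A.mon l (g, \<one>.G)"
 using LA.gr_at by (auto simp: A.gr_carrier emb_left_def A.gr_add LA.gr_add gmonom_def)

lemma emb_right:
 shows "a:<GA.KG> ==> emb_right a:<A.KG>" "emb_right (a \<oplus>.GA.KG a') = emb_right a \<oplus>.A.KG emb_right a'"
  and "h:<G> ==> emb_right (GA.mon l h) = A.mon l (\<one>.L, inv .G h)"
proof -
show "h:<G> ==> emb_right (GA.mon l h) = A.mon l (\<one>.L, inv .G h)"
 by (auto simp: emb_right_def gmonom_def fun_eq_iff)
qed (use GA.gr_at in \<open>auto simp: A.gr_carrier emb_right_def A.gr_add GA.gr_add\<close>)

lemma pm_simps [simp]: "carrier (pm M) = <M>" "x \<oplus>.(pm M) y = x \<oplus>.M y" "\<zero>.(pm M) = \<zero>.M"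
 by (simp_all add: as_product_module_def)

lemma pm_smult: "a\<odot>.(pm M) x = (\<Oplus>.M y\<in><Y>. (LA.mon (a y) (fst y)\<odot>.M x) \<star>.M GA.mon \<one> (inv .G (snd y)))"
 by (simp add: as_product_module_def case_prod_beta')

context
 fixes M :: "('l => 'f, 'g => 'f, 'm, 'z) bimodule_scheme" and c :: "'l => 'f" and b :: "'g => 'f"
 assumes blk: "block_bimodule K L c G b M"
begin

interpretation M: bimodule LA.KG GA.KG M using blk by (simp add: block_bimodule_def)

lemma scalars: "l:<K> ==> x:<M> ==> LA.mon l \<one>.L\<odot>.M x = x \<star>.M GA.mon l \<one>.G"
 using blk by (simp add: block_bimodule_def)

lemma pm_term_closed:
 assumes "x:<M>" "a:<A.KG>"
 shows "(%y. (LA.mon (a y) (fst y)\<odot>.M x) \<star>.M GA.mon \<one> (inv .G (snd y))):<Y> -> <M>"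
 using A.gr_at[OF assms(2)] assms(1) M.lsmult_closed M.rsmult_closed by auto

lemma pm_smult_mon:
 assumes "x:<M>" "l:<K>" "g:<L>" "h:<G>"
 shows "A.mon l (g, h)\<odot>.(pm M) x = (LA.mon l g\<odot>.M x) \<star>.M GA.mon \<one> (inv .G h)"
proof -
let ?f = "%y. (LA.mon l (fst y)\<odot>.M x) \<star>.M GA.mon \<one> (inv .G (snd y))"
have z: "LA.mon \<zero> u = \<zero>.LA.KG" for u by (auto simp: gmonom_def LA.gr_zero)
have "\<zero>.M \<star>.M r = \<zero>.M" if "r:<GA.KG>" for r
 using M.rsmult_l_distr[of "\<zero>.M" "\<zero>.M" r] M.rsmult_closed[of "\<zero>.M" r] that by auto
hence "A.mon l (g, h)\<odot>.(pm M) x = (\<Oplus>.M y\<in><Y>. if y = (g, h) then ?f y else \<zero>.M)"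
 unfolding pm_smult using assms M.lsmult_closed M.rsmult_closed by (intro M.M.finsum_cong') (auto simp: A.mon_at z)
also have "... = ?f (g, h)"
 using assms finite_L finite_G M.lsmult_closed M.rsmult_closed by (intro M.M.finsum_delta) auto
finally show ?thesis by simp
qed

lemma left_module_pm: "left_module A.KG (pm M)"
proof -
note tc = pm_term_closed
have cl: "a\<odot>.(pm M) x:<M>" if "a:<A.KG>" "x:<M>" for a x
 unfolding pm_smult using tc[OF that(2,1)] by (rule M.M.finsum_closed)
have ld: "(a \<oplus>.A.KG a')\<odot>.(pm M) x = a\<odot>.(pm M) x \<oplus>.M a'\<odot>.(pm M) x"
 if h: "a:<A.KG>" "a':<A.KG>" "x:<M>" for a a' x
proof -
 have "(a \<oplus>.A.KG a')\<odot>.(pm M) x = (\<Oplus>.M y\<in><Y>. ((LA.mon (a y) (fst y)\<odot>.M x) \<star>.M GA.mon \<one> (inv .G (snd y)))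
   \<oplus>.M ((LA.mon (a' y) (fst y)\<odot>.M x) \<star>.M GA.mon \<one> (inv .G (snd y))))"
  unfolding pm_smult using tc[OF h(3,1)] tc[OF h(3,2)] A.gr_at[OF h(1)] A.gr_at[OF h(2)] h(3) M.lsmult_closed
  by (intro M.M.finsum_cong') (auto simp: A.gr_add LA.mon_add[symmetric] M.lsmult_l_distr M.rsmult_l_distr)
 also have "... = a\<odot>.(pm M) x \<oplus>.M a'\<odot>.(pm M) x"
  unfolding pm_smult using tc[OF h(3,1)] tc[OF h(3,2)] by (rule M.M.finsum_addf)
 finally show ?thesis .
qed
have rd: "a\<odot>.(pm M) (x \<oplus>.M y) = a\<odot>.(pm M) x \<oplus>.M a\<odot>.(pm M) y"
 if h: "a:<A.KG>" "x:<M>" "y:<M>" for a x y using h(1)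
proof (induction a rule: A.gr_induct)
 case (mon l u)
 thus ?case using h(2,3) pm_smult_mon[of _ l "fst u" "snd u"] M.lsmult_closed
  by (auto simp: M.lsmult_r_distr M.rsmult_l_distr)
next
 case (add a a')
 thus ?case using ld h(2,3) cl by (simp add: M.M.a_ac)
qed
have as: "(a\<otimes>.A.KG a')\<odot>.(pm M) x = a\<odot>.(pm M) (a'\<odot>.(pm M) x)"
 if h: "a:<A.KG>" "a':<A.KG>" "x:<M>" for a a' x using h(1)
proof (induction a rule: A.gr_induct)
 case (mon l u)
 obtain g k where u: "u = (g, k)" "g:<L>" "k:<G>" using mon(2) by auto
 from h(2) show ?case
 proof (induction a' rule: A.gr_induct)
  case (mon l' v)
  obtain g' k' where v: "v = (g', k')" "g':<L>" "k':<G>" using mon(2) by auto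
  let ?x' = "LA.mon l' g'\<odot>.M x"
  have x': "?x':<M>" using h(3) mon(1) M.lsmult_closed by simp
  have "A.mon l u\<otimes>.A.KG A.mon l' v = A.mon (l\<otimes> l') (g\<otimes>.L g', k\<otimes>.G k')"
   using A.mon_mult[OF \<open>l:<K>\<close> mon(1) \<open>u:<Y>\<close> mon(2)] u v by simp
  hence "(A.mon l u\<otimes>.A.KG A.mon l' v)\<odot>.(pm M) x = (LA.mon (l\<otimes> l') (g\<otimes>.L g')\<odot>.M x) \<star>.M GA.mon \<one> (inv .G (k\<otimes>.G k'))"
   using pm_smult_mon[OF h(3), of "l\<otimes> l'" "g\<otimes>.L g'" "k\<otimes>.G k'"] u v mon(1) \<open>l:<K>\<close> by simp
  also have "... = (LA.mon l g\<odot>.M ?x') \<star>.M (GA.mon \<one> (inv .G k')\<otimes>.GA.KG GA.mon \<one> (inv .G k))"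
   using u v mon(1) \<open>l:<K>\<close> h(3) by (simp add: LA.mon_mult[symmetric] GA.mon_mult G.inv_mult_group M.lsmult_assoc)
  also have "... = ((LA.mon l g\<odot>.M ?x') \<star>.M GA.mon \<one> (inv .G k')) \<star>.M GA.mon \<one> (inv .G k)"
   using x' \<open>l:<K>\<close> M.lsmult_closed by (intro M.rsmult_assoc) auto
  also have "(LA.mon l g\<odot>.M ?x') \<star>.M GA.mon \<one> (inv .G k') = LA.mon l g\<odot>.M (?x' \<star>.M GA.mon \<one> (inv .G k'))"
   using x' \<open>l:<K>\<close> by (intro M.lr_assoc) auto
  finally show ?case
   using pm_smult_mon[OF h(3) mon(1) v(2,3)] pm_smult_mon[of "?x' \<star>.M GA.mon \<one> (inv .G k')" l g k] x' \<open>l:<K>\<close> u v M.rsmult_closed by simp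
 next
  case (add a a')
  thus ?case using A.mon_closed[OF \<open>l:<K>\<close>, of u] ld rd cl h(3) by (simp add: A.KG.r_distr)
 qed
next
 case (add d d')
 thus ?case using ld h(2,3) cl by (simp add: A.KG.l_distr)
qed
have on: "\<one>.A.KG\<odot>.(pm M) x = x" if "x:<M>" for x
 using pm_smult_mon[OF that, of \<one> "\<one>.L" "\<one>.G"] that M.lsmult_one M.rsmult_one
 by (simp add: A.gr_one LA.gr_one[symmetric] GA.gr_one[symmetric])
have "abelian_group (pm M)"
proof (rule abelian_groupI)
 fix x assume "x:carrier (pm M)"
 thus "EX y:carrier (pm M). y \<oplus>.(pm M) x = \<zero>.(pm M)" by auto
qed (auto simp: M.M.a_ac)
thus ?thesis using cl ld rd as on A.KG.ring_axioms by (simp add: left_module_def left_module_axioms_def)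
qed

interpretation P: left_module A.KG "pm M" by (rule left_module_pm)

text \<open>The left and right actions are recovered from the product algebra. The right one uses
  that scalars act equally from both sides.\<close>

lemma pm_emb:
 assumes x: "x:<M>"
 shows "a:<LA.KG> ==> emb_left a\<odot>.(pm M) x = a\<odot>.M x" "q:<GA.KG> ==> emb_right q\<odot>.(pm M) x = x \<star>.M q"
proof -
show "a:<LA.KG> ==> emb_left a\<odot>.(pm M) x = a\<odot>.M x"
proof (induction a rule: LA.gr_induct)
 case (mon l g)
 thus ?case using pm_smult_mon[OF x mon, of "\<one>.G"] x M.lsmult_closed M.rsmult_one
  by (simp add: emb_left GA.gr_one[symmetric])
next
 case (add a a')
 thus ?case using x emb_left P.lsmult_l_distr by (simp add: M.lsmult_l_distr)
qed
show "q:<GA.KG> ==> emb_right q\<odot>.(pm M) x = x \<star>.M q"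
proof (induction q rule: GA.gr_induct)
 case (mon l h)
 have "emb_right (GA.mon l h)\<odot>.(pm M) x = (x \<star>.M GA.mon l \<one>.G) \<star>.M GA.mon \<one> h"
  using pm_smult_mon[OF x mon(1), of "\<one>.L" "inv .G h"] mon scalars[OF mon(1) x] by (simp add: emb_right)
 also have "... = x \<star>.M GA.mon l h" using mon x by (simp add: M.rsmult_assoc[symmetric] GA.mon_mult)
 finally show ?case .
next
 case (add a a')
 thus ?case using x emb_right P.lsmult_l_distr by (simp add: M.rsmult_r_distr)
qed
qed
end

lemma bimod_hom_iff:
 assumes M: "block_bimodule K L c G b M" and N: "block_bimodule K L c' G b' N"
 shows "bimod_hom LA.KG GA.KG M N = lmod_hom A.KG (pm M) (pm N)"
proof -
interpret M: bimodule LA.KG GA.KG M using M by (simp add: block_bimodule_def)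
interpret PM: left_module A.KG "pm M" by (rule left_module_pm[OF M])
interpret PN: left_module A.KG "pm N" by (rule left_module_pm[OF N])
have "f:lmod_hom A.KG (pm M) (pm N)" if f: "f:bimod_hom LA.KG GA.KG M N" for f
proof (rule lmod_homI)
 have fl: "f:lmod_hom LA.KG M N" using f by (simp add: bimod_hom_def)
 note fd = lmod_homD[OF fl]
 have fr: "f (x \<star>.M q) = f x \<star>.N q" if "x:<M>" "q:<GA.KG>" for x q using f that by (simp add: bimod_hom_def)
 show "x:carrier (pm M) ==> f x:carrier (pm N)" for x using fd(1) by simp
 show "x:carrier (pm M) ==> y:carrier (pm M) ==> f (x \<oplus>.(pm M) y) = f x \<oplus>.(pm N) f y" for x y using fd(2) by simp
 fix a x assume a: "a:<A.KG>" and "x:carrier (pm M)"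
 hence x: "x:<M>" by simp
 from a show "f (a\<odot>.(pm M) x) = a\<odot>.(pm N) f x"
 proof (induction a rule: A.gr_induct)
  case (mon l u)
  then obtain g k where u: "u = (g, k)" "g:<L>" "k:<G>" by auto
  show ?case unfolding u(1) pm_smult_mon[OF M x mon(1) u(2,3)] pm_smult_mon[OF N fd(1)[OF x] mon(1) u(2,3)]
   using fd fr x mon(1) M.lsmult_closed by simp
 next
  case (add a a')
  thus ?case using x fd PM.lsmult_closed by (simp add: PM.lsmult_l_distr[simplified] PN.lsmult_l_distr[simplified])
 qed
qed
moreover have "f:bimod_hom LA.KG GA.KG M N" if f: "f:lmod_hom A.KG (pm M) (pm N)" for f
proof -
 note fd = lmod_homD[OF f, simplified]
 have "f (a\<odot>.M x) = a\<odot>.N f x" if "a:<LA.KG>" "x:<M>" for a x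
  using fd(3)[OF emb_left(1)[OF that(1)] that(2)] pm_emb(1)[OF M that(2,1)] pm_emb(1)[OF N fd(1)[OF that(2)] that(1)] by simp
 moreover have "f (x \<star>.M q) = f x \<star>.N q" if "q:<GA.KG>" "x:<M>" for q x
  using fd(3)[OF emb_right(1)[OF that(1)] that(2)] pm_emb(2)[OF M that(2,1)] pm_emb(2)[OF N fd(1)[OF that(2)] that(1)] by simp
 ultimately show ?thesis using fd unfolding bimod_hom_def by (auto intro!: lmod_homI)
qed
ultimately show ?thesis by blast
qed

text \<open>Undoes \<open>pm\<close>: the images of the two embeddings commute, so they give
  commuting left and right actions.\<close>

definition to_bimod where
 "to_bimod N = (|carrier = <N>, monoid.mult = undefined, monoid.one = undefined, ring.zero = ring.zero N,
  ring.add = ring.add N, smult = (%a x. emb_left a\<odot>.N x), rsmult = (%x q. emb_right q\<odot>.N x)|)"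

lemma to_bimod_simps [simp]: "carrier (to_bimod N) = <N>" "x \<oplus>.(to_bimod N) y = x \<oplus>.N y" "\<zero>.(to_bimod N) = \<zero>.N"
 "a\<odot>.(to_bimod N) x = emb_left a\<odot>.N x" "x \<star>.(to_bimod N) q = emb_right q\<odot>.N x"
 by (simp_all add: to_bimod_def)

lemma emb_left_mult:
 assumes "a:<LA.KG>" "a':<LA.KG>"
 shows "emb_left (a\<otimes>.LA.KG a') = emb_left a\<otimes>.A.KG emb_left a'" using assms(1)
proof (induction a rule: LA.gr_induct)
case (mon l g)
from assms(2) show ?case
proof (induction a' rule: LA.gr_induct)
 case (mon l' g')
 thus ?case using \<open>l:<K>\<close> \<open>g:<L>\<close> by (simp add: LA.mon_mult emb_left A.mon_mult)
next
 case (add d d')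
 thus ?case using LA.mon_closed[OF \<open>l:<K>\<close>, of g] emb_left(1,2) by (simp add: LA.KG.r_distr A.KG.r_distr)
qed
next
case (add d d')
thus ?case using assms(2) emb_left by (simp add: LA.KG.l_distr A.KG.l_distr)
qed

lemma emb_right_mult:
 assumes "a:<GA.KG>" "a':<GA.KG>"
 shows "emb_right (a\<otimes>.GA.KG a') = emb_right a'\<otimes>.A.KG emb_right a" using assms(1)
proof (induction a rule: GA.gr_induct)
case (mon l g)
from assms(2) show ?case
proof (induction a' rule: GA.gr_induct)
 case (mon l' g')
 thus ?case using \<open>l:<K>\<close> \<open>g:<G>\<close>
  by (simp add: GA.mon_mult emb_right A.mon_mult G.inv_mult_group K.m_comm)
next
 case (add d d')
 thus ?case using GA.mon_closed[OF \<open>l:<K>\<close>, of g] emb_right(1,2) by (simp add: GA.KG.r_distr A.KG.l_distr)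
qed
next
case (add d d')
thus ?case using assms(2) emb_right(1,2) by (simp add: GA.KG.l_distr A.KG.r_distr)
qed

lemma emb_commute:
 assumes "a:<LA.KG>" "q:<GA.KG>"
 shows "emb_left a\<otimes>.A.KG emb_right q = emb_right q\<otimes>.A.KG emb_left a" using assms(1)
proof (induction a rule: LA.gr_induct)
case (mon l g)
from assms(2) show ?case
proof (induction q rule: GA.gr_induct)
 case (mon l' g')
 thus ?case using \<open>l:<K>\<close> \<open>g:<L>\<close> by (simp add: emb_left emb_right A.mon_mult K.m_comm)
next
 case (add d d')
 thus ?case using LA.mon_closed[OF \<open>l:<K>\<close>, of g] emb_left(1) emb_right(1,2) by (simp add: A.KG.l_distr A.KG.r_distr)
qed
next
case (add d d')
thus ?case using assms(2) emb_left(1,2) emb_right(1) by (simp add: A.KG.l_distr A.KG.r_distr)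
qed

lemma block_bimodule_to_bimod:
 assumes N: "left_module A.KG N" and b: "!!x. x:<N> ==> emb_right b\<odot>.N x = x"
 shows "block_bimodule K L \<one>.LA.KG G b (to_bimod N)"
proof -
interpret N: left_module A.KG N by fact
have o: "emb_left \<one>.LA.KG = \<one>.A.KG" "emb_right \<one>.GA.KG = \<one>.A.KG"
 by (simp_all add: LA.gr_one GA.gr_one A.gr_one emb_left emb_right)
have "abelian_group (to_bimod N)"
proof (rule abelian_groupI)
 fix x assume "x:carrier (to_bimod N)"
 thus "EX y:carrier (to_bimod N). y \<oplus>.(to_bimod N) x = \<zero>.(to_bimod N)" by auto
qed (auto simp: N.M.a_ac)
hence "bimodule LA.KG GA.KG (to_bimod N)"
 using emb_left(1,2) emb_right(1,2) emb_commute LA.KG.ring_axioms GA.KG.ring_axioms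
 by (simp add: bimodule_def left_module_def left_module_axioms_def bimodule_axioms_def emb_left_mult emb_right_mult o
  N.lsmult_closed N.lsmult_l_distr N.lsmult_r_distr N.lsmult_assoc[symmetric] N.lsmult_one)
thus ?thesis using b N.lsmult_one by (simp add: block_bimodule_def o emb_left(3) emb_right(3))
qed

lemma pm_to_bimod:
 assumes N: "left_module A.KG N" and b: "!!x. x:<N> ==> emb_right b\<odot>.N x = x"
  and "a:<A.KG>" "x:<N>"
 shows "a\<odot>.(pm (to_bimod N)) x = a\<odot>.N x" using assms(3)
proof (induction a rule: A.gr_induct)
interpret N: left_module A.KG N by fact
note blk = block_bimodule_to_bimod[OF N b]
{
 case (mon l u)
 then obtain g k where u: "u = (g, k)" "g:<L>" "k:<G>" by auto
 show ?case unfolding u(1) using pm_smult_mon[OF blk _ mon(1) u(2,3), of x] assms(4) u mon(1) N.lsmult_assoc[of "A.mon \<one> (\<one>.L, k)" "A.mon l (g, \<one>.G)" x] by (simp add: emb_left(3) emb_right(3) A.mon_mult)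
next
 case (add d d')
 interpret P: left_module A.KG "pm (to_bimod N)" by (rule left_module_pm[OF blk])
 show ?case using add assms(4) P.lsmult_l_distr[of d d' x] N.lsmult_l_distr by simp
}
qed
end

text \<open>The sum inside \<open>pm\<close> refers to the carrier, so shrinking the carrier before
  or after \<open>pm\<close> gives records whose actions agree on the carrier but need not be
  equal.\<close>

definition module_eq where
 "module_eq A M N <-> <N> = <M> & add N = add M & ring.zero N = ring.zero M &
  (ALL a:<A>. ALL x:<M>. a\<odot>.N x = a\<odot>.M x)"

lemma module_eq_iso: "module_eq A M N ==> lmod_iso A N P = lmod_iso A M P"
 by (auto simp: module_eq_def lmod_iso_def lmod_hom_def)

lemma module_eq_left_module: "module_eq A M N ==> left_module A M ==> left_module A N"
 by (rule left_module_cong[of A M]) (simp_all add: module_eq_def)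

lemma module_eq_smult: "module_eq A M N ==> a:<A> ==> x:<M> ==> a\<odot>.N x = a\<odot>.M x"
 by (simp add: module_eq_def)

lemma module_eq_sym: "module_eq A M N ==> module_eq A N M" by (simp add: module_eq_def)

lemma module_eq_submodule:
 assumes e: "module_eq A M N" and M: "left_module A M" and U: "submodule U A M"
 shows "submodule U A N" using left_module.submoduleD[OF M U] e
 by (intro left_module.submodule_intro[OF module_eq_left_module[OF e M]]) (auto simp: module_eq_def)

lemma module_eq_indecomposable:
 assumes e: "module_eq A M N" and M: "left_module A M"
 shows "indecomposable A M <-> indecomposable A N"
proof -
have "submodule U A M <-> submodule U A N" for U
 using module_eq_submodule e module_eq_sym[OF e] M module_eq_left_module[OF e M] by metis
moreover have "U <+>.N W = U <+>.M W" for U W using e by (simp add: module_eq_def set_add_def')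
ultimately have "internal_direct_sum A M U W <-> internal_direct_sum A N U W" for U W
 using e by (simp add: module_eq_def internal_direct_sum_def)
thus ?thesis using e by (simp add: indecomposable_def module_eq_def)
qed

lemma module_eq_vertex: "module_eq (group_ring K G) M N ==> is_vertex K G M D <-> is_vertex K G N D"
 by (simp add: is_vertex_def relatively_projective_def iso_to_summand_def module_eq_iso)

lemma module_eq_hom: "module_eq A M N ==> lmod_hom A N P = lmod_hom A M P" "module_eq A M N ==> lmod_hom A P N = lmod_hom A P M"
 by (auto simp: module_eq_def lmod_hom_def Pi_iff)

context group_algebra
begin

lemma sum_of_monomials:
 assumes "c:<G> -> <K>"
 shows "(\<Oplus>.KG y\<in><G>. mon (c y) y) = restrict c <G>"
proof (rule gr_eqI)
show "restrict c <G>:<KG>" using assms by (auto simp: gr_carrier)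
show "(\<Oplus>.KG y\<in><G>. mon (c y) y):<KG>" using assms by (intro KG.finsum_closed) (simp add: Pi_iff)
fix u assume u: "u:<G>"
have "(\<Oplus>.KG y\<in><G>. mon (c y) y) u = (\<Oplus>y\<in><G>. mon (c y) y u)"
 using assms u gr_at by (intro finsum_hom[where f = "%a. a u", OF KG.abelian_monoid_axioms K.abelian_monoid_axioms]) (simp_all add: gr_zero gr_add Pi_iff)
also have "... = (\<Oplus>y\<in><G>. if y = u then c y else \<zero>)"
 using assms u by (intro K.finsum_cong') (auto simp: mon_at)
also have "... = c u" using assms u finite_G by (intro K.finsum_delta) auto
finally show "(\<Oplus>.KG y\<in><G>. mon (c y) y) u = restrict c <G> u" using u by simp
qed

text \<open>The group elements form a basis of the regular module that the group permutes.\<close>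

lemma permutation_module_copy:
 assumes "inj_on \<iota> <KG>"
 shows "permutation_module K G (module_copy \<iota> (regular KG))" (is "permutation_module K G ?M")
proof -
let ?v = "%y. \<iota> (mon \<one> y)" and ?V = "res K G ?M"
have c: "left_module KG ?M" "\<iota>:lmod_hom KG (regular KG) ?M" "<?M> = \<iota> ` <KG>"
 using module_copy[OF KG.left_module_regular, of \<iota>] assms by (auto simp: lmod_iso_def)
interpret S: vector_space K ?V by (rule vs_res[OF c(1)])
note id = lmod_homD[OF c(2), simplified]
have inj: "inj_on ?v <G>"
proof (rule inj_onI)
 fix y y' assume y: "y:<G>" "y':<G>" "?v y = ?v y'"
 hence "mon \<one> y = mon \<one> y'" using assms by (simp add: inj_on_eq_iff)
 hence "mon \<one> y y = mon \<one> y' y" by simp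
 thus "y = y'" using y(1) by (simp add: mon_at split: if_splits)
qed
have sum: "(\<Oplus>.(?V)v\<in>?v ` <G>. a v\<odot>.(?V) v) = \<iota> (\<lambda>y\<in><G>. a (?v y))" if a: "a:?v ` <G> -> <K>" for a
proof -
 have ac: "(%y. a (?v y)):<G> -> <K>" using a by auto
 have m: "a (?v y)\<odot>.(?V) ?v y = \<iota> (mon (a (?v y)) y)" if "y:<G>" for y
  using that ac id(3)[of "mon (a (?v y)) \<one>.G" "mon \<one> y"] mon_mult[of "a (?v y)" \<one> "\<one>.G" y] by (auto simp: Pi_iff)
 have "(\<Oplus>.(?V)v\<in>?v ` <G>. a v\<odot>.(?V) v) = (\<Oplus>.(?V)y\<in><G>. a (?v y)\<odot>.(?V) ?v y)"
  using inj a c(3) S.lsmult_closed by (intro S.M.finsum_reindex) (auto simp: Pi_iff)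
 also have "... = (\<Oplus>.(?V)y\<in><G>. \<iota> (mon (a (?v y)) y))"
  using m ac c(3) by (intro S.M.finsum_cong') (auto simp: Pi_iff)
 also have "... = \<iota> (\<Oplus>.KG y\<in><G>. mon (a (?v y)) y)"
  using ac id lmod_hom_zero(1)[OF KG.left_module_regular c(1,2)]
  by (intro finsum_hom[symmetric, OF KG.abelian_monoid_axioms S.M.abelian_monoid_axioms]) (auto simp: Pi_iff)
 finally show ?thesis using sum_of_monomials[OF ac] by simp
qed
have "fin_basis K ?V (?v ` <G>)" unfolding fin_basis_def
proof (intro conjI ballI)
 fix x assume "x:<?V>"
 then obtain d where d: "d:<KG>" "x = \<iota> d" using c(3) by auto
 have key: "x = (\<Oplus>.(?V)v\<in>?v ` <G>. a v\<odot>.(?V) v) <-> (ALL y:<G>. a (?v y) = d y)"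
  if a: "a:?v ` <G> \<rightarrow>\<^sub>E <K>" for a
 proof -
  have ap: "a:?v ` <G> -> <K>" using a by auto
  hence "(\<lambda>y\<in><G>. a (?v y)):<KG>" by (auto simp: gr_carrier)
  hence "x = (\<Oplus>.(?V)v\<in>?v ` <G>. a v\<odot>.(?V) v) <-> d = (\<lambda>y\<in><G>. a (?v y))"
   unfolding sum[OF ap] d(2) using d(1) assms by (simp add: inj_on_eq_iff)
  also have "... <-> (ALL y:<G>. a (?v y) = d y)" using d(1) by (auto simp: gr_carrier fun_eq_iff)
  finally show ?thesis .
 qed
 define a where "a = (\<lambda>v\<in>?v ` <G>. d (inv_into <G> ?v v))"
 have a: "a:?v ` <G> \<rightarrow>\<^sub>E <K>" "ALL y:<G>. a (?v y) = d y"
  using gr_at[OF d(1)] inv_into_f_f[OF inj] by (auto simp: a_def)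
 show "EX! a. a:?v ` <G> \<rightarrow>\<^sub>E <K> & x = (\<Oplus>.(?V)v\<in>?v ` <G>. a v\<odot>.(?V) v)"
 proof (rule ex1I[of _ a])
  show "a:?v ` <G> \<rightarrow>\<^sub>E <K> & x = (\<Oplus>.(?V)v\<in>?v ` <G>. a v\<odot>.(?V) v)" using a key by blast
  fix a' assume "a':?v ` <G> \<rightarrow>\<^sub>E <K> & x = (\<Oplus>.(?V)v\<in>?v ` <G>. a' v\<odot>.(?V) v)"
  hence a': "a':?v ` <G> \<rightarrow>\<^sub>E <K>" "ALL y:<G>. a' (?v y) = d y" using key by blast+
  show "a' = a" by (rule PiE_ext[OF a'(1) a(1)]) (use a'(2) a(2) in auto)
 qed
qed (use c(3) finite_G in auto)
moreover have "mon \<one> x\<odot>.(?M) ?v y:?v ` <G>" if "x:<G>" "y:<G>" for x y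
proof -
 have "mon \<one> x\<odot>.(?M) ?v y = ?v (x\<otimes>.G y)"
  using id(3)[of "mon \<one> x" "mon \<one> y"] mon_mult[of \<one> \<one> x y] that by simp
 thus ?thesis using G.m_closed[OF that] by blast
qed
ultimately show ?thesis using c(1) unfolding permutation_module_def by blast
qed
end

section \<open>Diagonal bimodules when the left group has order prime to p\<close>

locale block_product = product_algebra K L G
 for K :: "('f, 'u) ring_scheme" (structure) and L :: "('l, 'v) monoid_scheme" and G :: "('g, 'w) monoid_scheme" +
 fixes p :: nat and b :: "'g => 'f"
 assumes prime_p: "Factorial_Ring.prime p" and p_L: "~ p dvd card <L>"
  and b: "b:carrier (group_ring K G)" "b\<otimes>.(group_ring K G) b = b"
   "!!a. a:carrier (group_ring K G) ==> b\<otimes>.(group_ring K G) a = a\<otimes>.(group_ring K G) b"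
begin

sublocale A: finite_ring A.KG
proof
show "finite <A.KG>" using finite_K finite_L finite_G unfolding A.gr_carrier by (intro finite_PiE) auto
qed

abbreviation blk where "blk M \<equiv> block_bimodule K L \<one>.LA.KG G b M"

definition eb where "eb = emb_right b"

lemma eb: "eb:<A.KG>" "eb\<otimes>.A.KG eb = eb" "a:<A.KG> ==> eb\<otimes>.A.KG a = a\<otimes>.A.KG eb"
proof -
show c: "eb:<A.KG>" "eb\<otimes>.A.KG eb = eb"
 using emb_right(1) emb_right_mult[OF b(1,1)] b(1,2) by (simp_all add: eb_def)
show "a:<A.KG> ==> eb\<otimes>.A.KG a = a\<otimes>.A.KG eb"
proof (induction a rule: A.gr_induct)
 case (mon l u)
 then obtain g h where u: "u = (g, h)" "g:<L>" "h:<G>" by auto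
 let ?x = "emb_left (LA.mon l g)" and ?y = "emb_right (GA.mon \<one> (inv .G h))"
 have xy: "?x:<A.KG>" "?y:<A.KG>" using emb_left(1) emb_right(1) mon(1) by auto
 have s: "A.mon l u = ?x\<otimes>.A.KG ?y" using u mon(1) by (simp add: emb_left(3) emb_right(3) A.mon_mult)
 have 1: "eb\<otimes>.A.KG ?x = ?x\<otimes>.A.KG eb" using emb_commute[OF _ b(1)] mon(1) by (simp add: eb_def)
 have "GA.mon \<one> (inv .G h):<GA.KG>" by simp
 hence 2: "eb\<otimes>.A.KG ?y = ?y\<otimes>.A.KG eb" using emb_right_mult[OF _ b(1)] emb_right_mult[OF b(1)] b(3) by (simp add: eb_def)
 have "eb\<otimes>.A.KG (?x\<otimes>.A.KG ?y) = ?x\<otimes>.A.KG (eb\<otimes>.A.KG ?y)" using xy c(1) 1 by (simp add: A.KG.m_assoc[symmetric])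
 thus ?case unfolding s using xy c(1) 2 by (simp add: A.KG.m_assoc)
qed (use c(1) in \<open>simp add: A.KG.l_distr A.KG.r_distr\<close>)
qed

definition TG :: "('f, 'l, 'g) univ_bimodule set" where "TG = T_gens p K L \<one>.LA.KG G b"

lemma TG_iff:
 "M:TG <-> blk M & (EX V :: ('l \<times> 'g => 'f, nat => 'f) module. permutation_module K Y V & iso_to_summand A.KG (pm M) V) &
  (ALL U D. direct_summand A.KG (pm M) U --> indecomposable A.KG ((pm M)(|carrier := U|)) -->
   is_vertex K Y ((pm M)(|carrier := U|)) D --> twisted_diagonal p L G D)"
 unfolding TG_def T_gens_def diagonal_bimodule_def p_permutation_bimodule_def Let_def by blast

text \<open>P is a p-subgroup of L, hence trivial by Lagrange, and Q is isomorphic to P.\<close>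

lemma twisted_diagonal_trivial:
 assumes "twisted_diagonal p L G D"
 shows "D = {\<one>.Y}"
proof -
obtain P Q f where d: "p_subgroup p L P" "p_subgroup p G Q" "f:iso (G(|carrier := Q|)) (L(|carrier := P|))" "D = (%q. (f q, q)) ` Q"
 using assms by (auto simp: twisted_diagonal_def)
then obtain n where n: "subgroup P L" "card P = p ^ n" by (auto simp: p_subgroup_def)
have "card P dvd card <L>" using L.lagrange[OF n(1)] by (metis dvd_triv_right order_def)
hence "n = 0" using n(2) p_L by (metis dvd_power dvd_trans gr0I)
hence "card P = 1" using n(2) by simp
hence P: "P = {\<one>.L}" using subgroup.one_closed[OF n(1)] by (metis card_1_singletonE singletonD)
have "bij_betw f Q P" using d(3) by (simp add: iso_def)
hence f: "f ` Q = {\<one>.L}" "inj_on f Q" using P by (auto simp: bij_betw_def)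
have "\<one>.G:Q" using d(2) subgroup.one_closed by (auto simp: p_subgroup_def)
moreover from this have "x = \<one>.G" if "x:Q" for x using f that by (metis imageI inj_on_eq_iff singletonD)
ultimately have "Q = {\<one>.G}" by blast
thus ?thesis using d(4) f(1) by auto
qed

lemma trivial_twisted_diagonal: "twisted_diagonal p L G {\<one>.Y}"
proof -
have "(%_. \<one>.L):iso (G(|carrier := {\<one>.G}|)) (L(|carrier := {\<one>.L}|))" by (auto simp: iso_def hom_def)
moreover have "p_subgroup p L {\<one>.L}" "p_subgroup p G {\<one>.G}"
 using L.triv_subgroup G.triv_subgroup by (auto simp: p_subgroup_def intro: exI[of _ 0])
ultimately show ?thesis unfolding twisted_diagonal_def
 by (intro exI[of _ "{\<one>.L}"] exI[of _ "{\<one>.G}"] exI[of _ "%_. \<one>.L"]) auto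
qed

text \<open>All vertices are trivial, so \<open>trivial_vertices_projective\<close> applies;
  finiteness comes from the finite basis of the permutation module over the finite field.\<close>

lemma TG_proj:
 assumes "M:TG"
 shows "blk M" "left_module A.KG (pm M)" "finite <M>" "projective A.KG (pm M)"
proof -
show B: "blk M" using assms by (simp add: TG_iff)
show P: "left_module A.KG (pm M)" by (rule left_module_pm[OF B])
obtain V :: "('l \<times> 'g => 'f, nat => 'f) module" where V: "permutation_module K Y V" "iso_to_summand A.KG (pm M) V"
 using assms by (auto simp: TG_iff)
obtain C where C: "left_module A.KG V" "fin_basis K (res K Y V) C" using V(1) by (auto simp: permutation_module_def)
have "<V> <= (%a. \<Oplus>.(res K Y V)v\<in>C. a v\<odot>.(res K Y V) v) ` (C \<rightarrow>\<^sub>E <K>)"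
 using C(2) unfolding fin_basis_def by auto
moreover have "finite (C \<rightarrow>\<^sub>E <K>)" using C(2) finite_K by (auto simp: fin_basis_def intro: finite_PiE)
ultimately have fV: "finite <V>" using finite_subset by blast
obtain i r where i: "i:lmod_hom A.KG (pm M) V" "ALL x:carrier (pm M). r (i x) = x"
 using V(2) unfolding left_module.iso_to_summand_iff[OF C(1) P] by blast
have "inj_on i <M>" using i(2) by (intro inj_on_inverseI[of _ r]) simp
moreover have "i ` <M> <= <V>" using lmod_homD(1)[OF i(1)] by auto
ultimately show fin: "finite <M>" using fV by (metis finite_imageD finite_subset)
show "projective A.KG (pm M)"
 using assms twisted_diagonal_trivial fin by (intro A.trivial_vertices_projective[OF P]) (auto simp: TG_iff)
qed

lemma pm_submodule:
 assumes B: "blk M" and U: "submodule U A.KG (pm M)"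
 shows "blk (M(|carrier := U|))" "module_eq A.KG ((pm M)(|carrier := U|)) (pm (M(|carrier := U|)))"
proof -
interpret P: left_module A.KG "pm M" by (rule left_module_pm[OF B])
interpret M: bimodule LA.KG GA.KG M using B by (simp add: block_bimodule_def)
note Ud = P.submoduleD[OF U, simplified]
have UM: "x:<M>" if "x:U" for x using Ud(1) that by blast
have cl: "a\<odot>.M x:U" if "a:<LA.KG>" "x:U" for a x
 using Ud(4)[OF emb_left(1)[OF that(1)] that(2)] pm_emb(1)[OF B UM[OF that(2)] that(1)] by simp
have cr: "x \<star>.M q:U" if "q:<GA.KG>" "x:U" for q x
 using Ud(4)[OF emb_right(1)[OF that(1)] that(2)] pm_emb(2)[OF B UM[OF that(2)] that(1)] by simp
have "submodule U LA.KG M" using Ud(1-3) cl by (intro M.submodule_intro) auto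
hence "left_module LA.KG (M(|carrier := U|))" by (rule M.lm_submod)
hence "bimodule LA.KG GA.KG (M(|carrier := U|))" using cr GA.KG.ring_axioms UM
 by (simp add: bimodule_def bimodule_axioms_def M.rsmult_l_distr M.rsmult_r_distr M.rsmult_assoc M.rsmult_one M.lr_assoc)
thus B': "blk (M(|carrier := U|))" using B UM by (simp add: block_bimodule_def)
interpret P': left_module A.KG "pm (M(|carrier := U|))" by (rule left_module_pm[OF B'])
have "a\<odot>.(pm (M(|carrier := U|))) x = a\<odot>.(pm M) x" if "a:<A.KG>" and x: "x:U" for a x using that(1)
proof (induction a rule: A.gr_induct)
 case (mon l u)
 then obtain g h where u: "u = (g, h)" "g:<L>" "h:<G>" by auto
 show ?case unfolding u(1) using pm_smult_mon[OF B UM[OF x] mon(1) u(2,3)] pm_smult_mon[OF B' _ mon(1) u(2,3), of x] x by simp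
next
 case (add a a')
 thus ?case using P'.lsmult_l_distr[of a a' x] P.lsmult_l_distr[of a a' x] x UM by simp
qed
thus "module_eq A.KG ((pm M)(|carrier := U|)) (pm (M(|carrier := U|)))"
 by (simp add: module_eq_def as_product_module_def)
qed

lemma TG_summand:
 assumes M: "M:TG" and U: "direct_summand A.KG (pm M) U"
 shows "M(|carrier := U|):TG"
proof -
note f = TG_proj[OF M]
interpret P: left_module A.KG "pm M" by (rule f(2))
note s = pm_submodule[OF f(1) P.summand_submod[OF U]]
note lU = left_module_pm[OF s(1)]
have isoU: "iso_to_summand A.KG (pm (M(|carrier := U|))) (pm M)"
 using P.direct_summand_iso_to_summand[OF U] unfolding iso_to_summand_def module_eq_iso[OF s(2)] .
obtain V :: "('l \<times> 'g => 'f, nat => 'f) module" where V: "permutation_module K Y V" "iso_to_summand A.KG (pm M) V"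
 using M by (auto simp: TG_iff)
hence "left_module A.KG V" by (simp add: permutation_module_def)
hence "iso_to_summand A.KG (pm (M(|carrier := U|))) V" using iso_to_summand_trans[OF lU f(2) _ isoU V(2)] by blast
moreover have "twisted_diagonal p L G D"
 if W: "direct_summand A.KG (pm (M(|carrier := U|))) W" and i: "indecomposable A.KG ((pm (M(|carrier := U|)))(|carrier := W|))"
  and v: "is_vertex K Y ((pm (M(|carrier := U|)))(|carrier := W|)) D" for W D
proof -
 interpret PU: left_module A.KG "(pm M)(|carrier := U|)" by (rule P.lm_submod[OF P.summand_submod[OF U]])
 have "W <= U" using W unfolding left_module.direct_summand_iff[OF lU] by simp
 hence e: "module_eq A.KG ((pm M)(|carrier := W|)) ((pm (M(|carrier := U|)))(|carrier := W|))"
  using s(2) by (auto simp: module_eq_def)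
 have "direct_summand A.KG ((pm M)(|carrier := U|)) W"
  using W unfolding left_module.direct_summand_iff[OF lU] PU.direct_summand_iff module_eq_hom(1)[OF s(2)] module_eq_hom(2)[OF s(2)] by simp
 hence d: "direct_summand A.KG (pm M) W" by (rule P.direct_summand_trans[OF U])
 thus ?thesis
  using M i v module_eq_indecomposable[OF e P.lm_submod[OF P.summand_submod[OF d]]] module_eq_vertex[OF e] unfolding TG_iff by blast
qed
ultimately show ?thesis using s(1) V(1) unfolding TG_iff by blast
qed

text \<open>Reads an element of the algebra along an enumeration of the group, which embeds the
  algebra into the universe type.\<close>

definition \<iota> :: "('l \<times> 'g => 'f) => nat => 'f" where
 "\<iota> x = (%i. x ((SOME h. bij_betw h {..<card <Y>} <Y>) i))"

lemma inj_iota: "inj_on \<iota> <A.KG>"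
proof (rule inj_onI)
fix x y assume xy: "x:<A.KG>" "y:<A.KG>" "\<iota> x = \<iota> y"
define h where "h = (SOME h. bij_betw h {..<card <Y>} <Y>)"
have "EX h. bij_betw h {..<card <Y>} <Y>"
 using ex_bij_betw_nat_finite[OF A.finite_G] by (simp add: atLeast0LessThan)
hence h: "bij_betw h {..<card <Y>} <Y>" unfolding h_def by (rule someI_ex)
show "x = y"
proof (rule A.gr_eqI[OF xy(1,2)])
 fix u assume "u:<Y>"
 then obtain i where "u = h i" using h by (auto simp: bij_betw_def)
 thus "x u = y u" using fun_cong[OF xy(3), of i] by (simp add: \<iota>_def h_def)
qed
qed

abbreviation VA :: "('l \<times> 'g => 'f, nat => 'f) module" where "VA \<equiv> module_copy \<iota> (regular A.KG)"
abbreviation ii where "ii \<equiv> inv_into <A.KG> \<iota>"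

lemma VA:
 shows "left_module A.KG VA" "\<iota>:lmod_hom A.KG (regular A.KG) VA" "ii:lmod_hom A.KG VA (regular A.KG)" "<VA> = \<iota> ` <A.KG>"
  "x:<A.KG> ==> ii (\<iota> x) = x"
 using module_copy[OF A.KG.left_module_regular, of \<iota>] inj_iota by (auto simp: lmod_iso_def)

lemma VA_simps:
 assumes "x:<A.KG>"
 shows "a:<A.KG> ==> a\<odot>.VA \<iota> x = \<iota> (a\<otimes>.A.KG x)" "y:<A.KG> ==> \<iota> x \<oplus>.VA \<iota> y = \<iota> (x \<oplus>.A.KG y)"
 using lmod_homD[OF VA(2)] assms by auto

lemma permutation_module_VA: "permutation_module K Y VA" by (rule A.permutation_module_copy[OF inj_iota])

text \<open>A copy of the left ideal A \<open>eb\<close>; as a bimodule it contains every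
  \<open>PB a\<close> as a summand.\<close>

definition N0 where "N0 = VA(|carrier := \<iota> ` {x:<A.KG>. eb\<otimes>.A.KG x = x}|)"
definition M0 where "M0 = to_bimod N0"

lemma N0_summand: "direct_summand A.KG VA (\<iota> ` {x:<A.KG>. eb\<otimes>.A.KG x = x})"
proof -
interpret V: left_module A.KG VA by (rule VA(1))
have "eb\<odot>.VA (r\<odot>.VA v) = r\<odot>.VA (eb\<odot>.VA v)" if "r:<A.KG>" "v:<VA>" for r v
 using V.lsmult_assoc[OF eb(1) that] V.lsmult_assoc[OF that(1) eb(1) that(2)] eb(3)[OF that(1)] by simp
hence "(%v. eb\<odot>.VA v):lmod_hom A.KG VA VA" using eb(1) V.lsmult_closed V.lsmult_r_distr by (intro lmod_homI)
moreover have "eb\<odot>.VA v:\<iota> ` {x:<A.KG>. eb\<otimes>.A.KG x = x}" if v: "v:<VA>" for v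
proof -
 obtain x where x: "x:<A.KG>" "v = \<iota> x" using v VA(4) by blast
 hence "eb\<odot>.VA v = \<iota> (eb\<otimes>.A.KG x)" "eb\<otimes>.A.KG (eb\<otimes>.A.KG x) = eb\<otimes>.A.KG x"
  using VA_simps(1)[OF x(1) eb(1)] eb(1,2) by (simp_all add: A.KG.m_assoc[symmetric])
 thus ?thesis using x eb(1) by blast
qed
moreover have "eb\<odot>.VA v = v" if "v:\<iota> ` {x:<A.KG>. eb\<otimes>.A.KG x = x}" for v using that VA_simps(1)[OF _ eb(1)] by auto
moreover have "\<iota> ` {x:<A.KG>. eb\<otimes>.A.KG x = x} <= <VA>" using VA(4) by blast
ultimately show ?thesis unfolding V.direct_summand_iff by (intro conjI bexI[of _ "%v. eb\<odot>.VA v"] ballI)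
qed

lemma M0:
 shows "blk M0" "module_eq A.KG N0 (pm M0)" "left_module A.KG N0"
proof -
interpret V: left_module A.KG VA by (rule VA(1))
show N: "left_module A.KG N0" unfolding N0_def by (rule V.lm_submod[OF V.summand_submod[OF N0_summand]])
have e: "emb_right b\<odot>.N0 v = v" if "v:<N0>" for v
 using that VA_simps(1)[OF _ eb(1)] by (auto simp: N0_def eb_def[symmetric])
show "blk M0" unfolding M0_def by (rule block_bimodule_to_bimod[OF N e])
show "module_eq A.KG N0 (pm M0)"
 using pm_to_bimod[OF N e] by (simp add: module_eq_def M0_def as_product_module_def to_bimod_def)
qed

text \<open>Every summand is a summand of the regular module, so all its vertices are trivial, and
  the trivial subgroup is a twisted diagonal.\<close>

lemma M0_TG: "M0:TG"
proof -
interpret V: left_module A.KG VA by (rule VA(1))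
note lM = left_module_pm[OF M0(1)]
interpret P: left_module A.KG "pm M0" by (rule lM)
have i: "iso_to_summand A.KG (pm M0) VA"
 using V.direct_summand_iso_to_summand[OF N0_summand] unfolding iso_to_summand_def module_eq_iso[OF M0(2)] N0_def .
have r: "iso_to_summand A.KG VA (regular A.KG)"
 unfolding left_module.iso_to_summand_iff[OF A.KG.left_module_regular VA(1)] using VA by (intro bexI[of _ ii]) auto
have "twisted_diagonal p L G D"
 if U: "direct_summand A.KG (pm M0) U" and v: "is_vertex K Y ((pm M0)(|carrier := U|)) D" for U D
proof -
 have lU: "left_module A.KG ((pm M0)(|carrier := U|))" by (rule P.lm_submod[OF P.summand_submod[OF U]])
 have "iso_to_summand A.KG ((pm M0)(|carrier := U|)) (regular A.KG)"
  using iso_to_summand_trans[OF lU lM A.KG.left_module_regular P.direct_summand_iso_to_summand[OF U]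
    iso_to_summand_trans[OF lM VA(1) A.KG.left_module_regular i r]] .
 hence "D = {\<one>.Y}" using A.trivial_vertex[OF v A.projective_relatively_projective_trivial[OF lU]] by blast
 thus ?thesis using trivial_twisted_diagonal by simp
qed
thus ?thesis using M0(1) permutation_module_VA i unfolding TG_iff by blast
qed

text \<open>The left ideal A a as a bimodule; for a in the block it is a summand of
  \<open>M0\<close>.\<close>

definition PB where "PB a = M0(|carrier := \<iota> ` {x:<A.KG>. x\<otimes>.A.KG a = x}|)"

lemma PB:
 assumes a: "A.KG.idem a" "eb\<otimes>.A.KG a = a"
 shows "PB a:TG" "ii:lmod_hom A.KG (pm (PB a)) (regular A.KG)" "carrier (PB a) = \<iota> ` {x:<A.KG>. x\<otimes>.A.KG a = x}"
  "r:<A.KG> ==> x:<A.KG> ==> x\<otimes>.A.KG a = x ==> r\<odot>.(pm (PB a)) \<iota> x = \<iota> (r\<otimes>.A.KG x)"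
proof -
interpret V: left_module A.KG VA by (rule VA(1))
note lM = left_module_pm[OF M0(1)]
interpret P: left_module A.KG "pm M0" by (rule lM)
let ?U = "\<iota> ` {x:<A.KG>. x\<otimes>.A.KG a = x}"
have ac: "a:<A.KG>" "a\<otimes>.A.KG a = a" using a(1) by (auto simp: A.KG.idem_def)
have sub: "eb\<otimes>.A.KG x = x" if "x:<A.KG>" "x\<otimes>.A.KG a = x" for x
proof -
 have "eb\<otimes>.A.KG x = x\<otimes>.A.KG (eb\<otimes>.A.KG a)" using eb(1) that ac by (metis A.KG.m_assoc eb(3))
 thus ?thesis using a(2) that(2) by simp
qed
have c0: "carrier (pm M0) = \<iota> ` {x:<A.KG>. eb\<otimes>.A.KG x = x}" by (simp add: M0_def N0_def)
have d: "direct_summand A.KG (pm M0) ?U" unfolding P.direct_summand_iff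
proof (intro conjI bexI)
 have "(%v. \<iota> (ii v\<otimes>.A.KG a)):lmod_hom A.KG N0 N0"
 proof (rule lmod_homI)
  fix v assume "v:<N0>"
  then obtain x where "x:<A.KG>" "eb\<otimes>.A.KG x = x" "v = \<iota> x" by (auto simp: N0_def)
  thus "\<iota> (ii v\<otimes>.A.KG a):<N0>" using VA(5) ac eb(1) by (auto simp: N0_def A.KG.m_assoc[symmetric])
 qed (use VA(5) VA_simps ac in \<open>auto simp: N0_def A.KG.l_distr A.KG.m_assoc\<close>)
 thus "(%v. \<iota> (ii v\<otimes>.A.KG a)):lmod_hom A.KG (pm M0) (pm M0)"
  unfolding module_eq_hom(1)[OF M0(2)] module_eq_hom(2)[OF M0(2)] .
qed (use c0 sub VA(5) ac in \<open>auto simp: A.KG.m_assoc\<close>)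
show "PB a:TG" unfolding PB_def by (rule TG_summand[OF M0_TG d])
show c: "carrier (PB a) = ?U" by (simp add: PB_def)
have e: "r\<odot>.(pm (PB a)) v = r\<odot>.VA v" if "r:<A.KG>" "v:?U" for r v
proof -
 have "v:<N0>" using that sub by (auto simp: N0_def)
 hence "r\<odot>.(pm M0) v = r\<odot>.VA v" using module_eq_smult[OF M0(2) that(1)] by (simp add: N0_def)
 moreover have "r\<odot>.(pm (PB a)) v = r\<odot>.(pm M0) v"
  using module_eq_smult[OF pm_submodule(2)[OF M0(1) P.summand_submod[OF d]] that(1), of v] that(2) by (simp add: PB_def)
 ultimately show ?thesis by simp
qed
thus "r:<A.KG> ==> x:<A.KG> ==> x\<otimes>.A.KG a = x ==> r\<odot>.(pm (PB a)) \<iota> x = \<iota> (r\<otimes>.A.KG x)"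
 using VA_simps by simp
have UV: "v:<VA>" if "v:?U" for v using that VA(4) by auto
show "ii:lmod_hom A.KG (pm (PB a)) (regular A.KG)"
 using lmod_homD[OF VA(3)] e UV by (intro lmod_homI) (auto simp: PB_def M0_def N0_def)
qed
end

section \<open>The class group of projective bimodules\<close>

lemma (in left_module) submodule_split:
 assumes "e:lmod_hom A M M" "!!x. x:<M> ==> e (e x) = e x"
 shows "(%x. x \<ominus>.M e x):lmod_hom A M M" "direct_summand A M {x:<M>. e x = \<zero>.M}"
proof -
note ed = lmod_homD[OF assms(1)]
show "(%x. x \<ominus>.M e x):lmod_hom A M M"
 using ed by (intro lmod_homI) (auto simp: a_minus_def M.minus_add M.a_ac lsmult_r_distr lsmult_r_minus)
show "direct_summand A M {x:<M>. e x = \<zero>.M}"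
 using internal_direct_sum_sym[OF retraction_internal_direct_sum[OF assms]] unfolding direct_summand_def by blast
qed

definition real_group :: "real monoid" where "real_group = (|carrier = UNIV, monoid.mult = (+), one = 0|)"

lemma real_group: "comm_group real_group" "x\<otimes>.real_group y = x + y" "\<one>.real_group = 0" "inv .real_group x = - x" "<real_group> = UNIV"
proof -
show g: "comm_group real_group" by (rule comm_groupI) (auto simp: real_group_def intro: exI[of _ "- x" for x])
interpret comm_group real_group by (rule g)
show "inv .real_group x = - x" by (rule inv_equality) (auto simp: real_group_def)
qed (simp_all add: real_group_def)

context block_product
begin

abbreviation TR where "TR \<equiv> T_rels p K L \<one>.LA.KG G b"

sublocale T: presentation TG TR
proof
show "TR <= carrier (free_Abelian_group TG)" unfolding T_rels_def TG_def by (auto intro!: free_diff_closed)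
qed

definition cl where "cl M = T.cls (frag_of M)"

lemma cl_closed: "M:TG ==> cl M:<T.Quo>" unfolding cl_def by (rule T.cls_closed) simp

lemma cl_split:
 assumes "N:TG" "M:TG" "P:TG" "split_exact LA.KG GA.KG N M P"
 shows "cl M = cl N\<otimes>.T.Quo cl P"
 unfolding cl_def using assms by (intro T.cls_frag_relation) (auto simp: T_rels_def TG_def)

lemma cl_zero:
 assumes "M:TG" "<M> = {\<zero>.M}"
 shows "cl M = \<one>.T.Quo"
proof -
note f = TG_proj[OF assms(1)]
have "(%x. x):bimod_hom LA.KG GA.KG M M" unfolding bimod_hom_iff[OF f(1) f(1)] by (auto intro: lmod_homI)
hence "split_exact LA.KG GA.KG M M M" unfolding split_exact_def using assms(2) by (intro bexI[of _ "%x. x"]) auto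
hence "cl M = cl M\<otimes>.T.Quo cl M" by (rule cl_split[OF assms(1) assms(1) assms(1)])
thus ?thesis using cl_closed[OF assms(1)] T.Quo.r_cancel_one' by metis
qed

text \<open>\<open>Top a\<close> is the projective module A a, and \<open>Rad a\<close> is its
  radical: the x that no left multiplication brings back to a unit of the corner of a.\<close>

definition Top where "Top a = (regular A.KG)(|carrier := {x:<A.KG>. x\<otimes>.A.KG a = x}|)"
definition Rad where "Rad a = (regular A.KG)(|carrier := {x:<A.KG>. x\<otimes>.A.KG a = x &
 (ALL y:<A.KG>. A.KG.nilp (a\<otimes>.A.KG y\<otimes>.A.KG x))}|)"

lemma lm_Top_Rad:
 assumes a: "A.KG.prim a"
 shows "left_module A.KG (Top a)" "left_module A.KG (Rad a)"
proof -
interpret R: left_module A.KG "regular A.KG" by (rule A.KG.left_module_regular)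
note ac = A.KG.prim_idem[OF a]
have "submodule {x:<A.KG>. x\<otimes>.A.KG a = x} A.KG (regular A.KG)"
 using ac by (intro R.submodule_intro) (auto simp: A.KG.l_distr A.KG.m_assoc)
thus "left_module A.KG (Top a)" unfolding Top_def by (rule R.lm_submod)
have "submodule {x:<A.KG>. x\<otimes>.A.KG a = x & (ALL y:<A.KG>. A.KG.nilp (a\<otimes>.A.KG y\<otimes>.A.KG x))} A.KG (regular A.KG)"
 (is "submodule ?W _ _")
proof (rule R.submodule_intro)
 show "\<zero>.(regular A.KG):?W" using ac by (auto simp: A.KG.nilp_def intro!: exI[of _ 1])
 fix x x' assume h: "x:?W" "x':?W"
 have "A.KG.nilp (a\<otimes>.A.KG y\<otimes>.A.KG (x \<oplus>.A.KG x'))" if y: "y:<A.KG>" for y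
 proof -
  have c: "a\<otimes>.A.KG y\<otimes>.A.KG z:A.KG.corner a a" if "z:?W" for z
   using that ac y unfolding A.KG.corner_def by (auto simp: A.KG.m_assoc) (metis A.KG.m_assoc A.KG.m_closed)
  show ?thesis using A.nilp_add[OF a c[OF h(1)] c[OF h(2)]] h y ac by (simp add: A.KG.r_distr)
 qed
 thus "x \<oplus>.(regular A.KG) x':?W" using h ac by (auto simp: A.KG.l_distr)
next
 fix r x assume h: "r:<A.KG>" "x:?W"
 have "A.KG.nilp (a\<otimes>.A.KG y\<otimes>.A.KG (r\<otimes>.A.KG x))" if y: "y:<A.KG>" for y
 proof -
  have "a\<otimes>.A.KG y\<otimes>.A.KG (r\<otimes>.A.KG x) = a\<otimes>.A.KG (y\<otimes>.A.KG r)\<otimes>.A.KG x" using h y ac by (simp add: A.KG.m_assoc)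
  thus ?thesis using h y by simp
 qed
 thus "r\<odot>.(regular A.KG) x:?W" using h ac by (auto simp: A.KG.m_assoc)
qed auto
thus "left_module A.KG (Rad a)" unfolding Rad_def by (rule R.lm_submod)
qed

text \<open>For projective M this is the logarithm of the number of homomorphisms to the simple
  quotient of A a; written as a difference it avoids forming that quotient. The logarithm makes it
  additive.\<close>

definition theta where
 "theta a M = ln (real (card (ext_homs A.KG (pm M) (Top a)))) - ln (real (card (ext_homs A.KG (pm M) (Rad a))))"

lemma theta_split:
 assumes a: "A.KG.prim a" and T: "N:TG" "M:TG" "P:TG" "split_exact LA.KG GA.KG N M P"
 shows "theta a M = theta a N + theta a P"
proof -
note f = TG_proj[OF T(1)] TG_proj[OF T(2)] TG_proj[OF T(3)]
obtain i j s where h: "i:lmod_hom A.KG (pm N) (pm M)" "j:lmod_hom A.KG (pm M) (pm P)" "s:lmod_hom A.KG (pm P) (pm M)"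
  "inj_on i <N>" "i ` <N> = {x:<M>. j x = \<zero>.P}" "ALL x:<P>. j (s x) = x"
 using T(4) unfolding split_exact_def bimod_hom_iff[OF f(1,5)] bimod_hom_iff[OF f(5,9)] bimod_hom_iff[OF f(9,5)] by (elim bexE conjE)
have fin: "finite (carrier (Top a))" "finite (carrier (Rad a))" using A.finite_carrier by (auto simp: Top_def Rad_def)
have c: "card (ext_homs A.KG (pm M) Z) = card (ext_homs A.KG (pm N) Z) * card (ext_homs A.KG (pm P) Z)"
 if "left_module A.KG Z" for Z :: "('l \<times> 'g => 'f, 'l \<times> 'g => 'f) module"
 using h by (intro card_ext_homs_split[OF f(2,6,10) that h(1-3)]) auto
have pos: "card (ext_homs A.KG (pm Q) Z) > 0" if "Q:TG" "left_module A.KG Z" "finite <Z>"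
 for Z :: "('l \<times> 'g => 'f, 'l \<times> 'g => 'f) module" and Q
 using TG_proj[OF that(1)] that(2,3) by (intro ext_homs_pos) auto
show ?thesis unfolding theta_def c[OF lm_Top_Rad(1)[OF a]] c[OF lm_Top_Rad(2)[OF a]]
 using pos[OF T(1) lm_Top_Rad(1)[OF a] fin(1)] pos[OF T(1) lm_Top_Rad(2)[OF a] fin(2)] pos[OF T(3) lm_Top_Rad(1)[OF a] fin(1)] pos[OF T(3) lm_Top_Rad(2)[OF a] fin(2)]
 by (simp add: ln_mult)
qed

text \<open>Homomorphisms from A d to Z are counted by d Z. If a and d are not equivalent, all of d
  A a is radical by \<open>idem_equivI\<close>; for d = a the idempotent a is not.\<close>

lemma theta_PB:
 assumes a: "A.KG.prim a" "eb\<otimes>.A.KG a = a" and d: "A.KG.prim d" "eb\<otimes>.A.KG d = d"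
 shows "~ A.KG.idem_equiv a d ==> theta a (PB d) = 0" "theta a (PB a) > 0"
proof -
have card: "card (ext_homs A.KG (pm (PB d)) Z) = card {x:<Z>. d\<odot>.Z x = x}"
 if d: "A.KG.prim d" "eb\<otimes>.A.KG d = d" and Z: "left_module A.KG Z"
 for Z :: "('l \<times> 'g => 'f, 'l \<times> 'g => 'f) module" and d
proof -
 note dd = A.KG.prim_idem[OF d(1)] and P = PB[OF A.KG.prim_idem(1)[OF d(1)] d(2)]
 have w: "\<iota> d:carrier (pm (PB d))" using P(3) dd by auto
 show ?thesis
 proof (rule card_ext_homs_cyclic[OF A.KG.ring_axioms TG_proj(2)[OF P(1)] Z dd(3,4) w _ P(2)])
  show "d\<odot>.(pm (PB d)) \<iota> d = \<iota> d" using P(4)[OF dd(3,3,4)] dd by simp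
  show "ii (\<iota> d) = d" using VA(5) dd by simp
  fix v assume "v:carrier (pm (PB d))"
  then obtain x where x: "x:<A.KG>" "x\<otimes>.A.KG d = x" "v = \<iota> x" using P(3) by auto
  thus "ii v\<odot>.(pm (PB d)) \<iota> d = v" using P(4)[OF x(1) dd(3,4)] VA(5) by simp
 qed
qed
note ac = A.KG.prim_idem[OF a(1)] and dc = A.KG.prim_idem[OF d(1)] and lm = lm_Top_Rad[OF a(1)]
{
 assume n: "~ A.KG.idem_equiv a d"
 have "A.KG.nilp (a\<otimes>.A.KG y\<otimes>.A.KG x)" if "x:<A.KG>" "x\<otimes>.A.KG a = x" "d\<otimes>.A.KG x = x" "y:<A.KG>" for x y
 proof (rule ccontr)
  assume nn: "~ A.KG.nilp (a\<otimes>.A.KG y\<otimes>.A.KG x)"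
  have 1: "a\<otimes>.A.KG y\<otimes>.A.KG d:A.KG.corner a d" using A.KG.corner_sandwich ac dc that(4) by blast
  have 2: "x:A.KG.corner d a" using that by (simp add: A.KG.corner_def)
  have "a\<otimes>.A.KG y\<otimes>.A.KG d\<otimes>.A.KG x = a\<otimes>.A.KG y\<otimes>.A.KG x" using that ac dc by (simp add: A.KG.m_assoc)
  thus False using A.idem_equivI[OF a(1) d(1) 1 2] nn n by simp
 qed
 hence "{x:carrier (Top a). d\<odot>.(Top a) x = x} = {x:carrier (Rad a). d\<odot>.(Rad a) x = x}"
  by (auto simp: Top_def Rad_def)
 thus "theta a (PB d) = 0" unfolding theta_def card[OF d lm(1)] card[OF d lm(2)] by simp
}
have "{x:carrier (Rad a). a\<odot>.(Rad a) x = x} \<subset> {x:carrier (Top a). a\<odot>.(Top a) x = x}"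
proof
 show "{x:carrier (Rad a). a\<odot>.(Rad a) x = x} <= {x:carrier (Top a). a\<odot>.(Top a) x = x}" by (auto simp: Top_def Rad_def)
 have "~ A.KG.nilp (a\<otimes>.A.KG a\<otimes>.A.KG a)"
  using A.KG.nilp_not_unit[of a a a] ac by (simp add: A.KG.corner_def)
 hence "a \<notin> carrier (Rad a)" by (auto simp: Rad_def)
 moreover have "a:{x:carrier (Top a). a\<odot>.(Top a) x = x}" using ac by (simp add: Top_def)
 ultimately show "{x:carrier (Rad a). a\<odot>.(Rad a) x = x} ~= {x:carrier (Top a). a\<odot>.(Top a) x = x}" by blast
qed
moreover have "finite {x:carrier (Top a). a\<odot>.(Top a) x = x}" using A.finite_carrier by (simp add: Top_def)
ultimately have lt: "card {x:carrier (Rad a). a\<odot>.(Rad a) x = x} < card {x:carrier (Top a). a\<odot>.(Top a) x = x}"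
 by (rule psubset_card_mono[rotated])
note P = TG_proj[OF PB(1)[OF ac(1) a(2)]]
have "0 < card (ext_homs A.KG (pm (PB a)) (Rad a))"
 using P lm A.finite_carrier by (intro ext_homs_pos) (auto simp: Rad_def)
thus "theta a (PB a) > 0" using lt unfolding theta_def card[OF a lm(1)] card[OF a lm(2)] by simp
qed

text \<open>\<open>projective_split\<close> finds a copy of some A c inside M, and c may be replaced
  by an equivalent representative a. The complement W is smaller, so induction on the size expresses
  every class by those of the \<open>PB a\<close>.\<close>

lemma split_off:
 assumes M: "M:TG" "<M> ~= {\<zero>.M}"
  and I: "!!a. A.KG.prim a ==> eb\<otimes>.A.KG a = a ==> EX d:I. A.KG.prim d & eb\<otimes>.A.KG d = d & A.KG.idem_equiv a d"
 shows "EX a:I. EX W. W:TG & card <W> < card <M> & cl M = cl (PB a)\<otimes>.T.Quo cl W"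
proof -
note f = TG_proj[OF M(1)]
interpret P: left_module A.KG "pm M" by (rule f(2))
obtain c v g where g: "A.KG.prim c" "v:<M>" "g:lmod_hom A.KG (pm M) (regular A.KG)" "c\<odot>.(pm M) v = v" "g v = c"
 using A.projective_split[OF f(2,4)] M(2) by auto
note cc = A.KG.prim_idem[OF g(1)]
have "eb\<odot>.(pm M) v = v" using pm_emb(2)[OF f(1) g(2) b(1)] f(1) g(2) by (simp add: eb_def block_bimodule_def)
hence "eb\<otimes>.A.KG c = c" using lmod_homD(3)[OF g(3) eb(1), of v] g by simp
then obtain a where a: "a:I" "A.KG.prim a" "eb\<otimes>.A.KG a = a" "A.KG.idem_equiv c a" using I[OF g(1)] by blast
obtain x y where xy: "x:A.KG.corner c a" "y:A.KG.corner a c" "x\<otimes>.A.KG y = c" "y\<otimes>.A.KG x = a"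
 using a(4) by (auto simp: A.KG.idem_equiv_def)
note xd = A.KG.cornerD[OF xy(1)] and yd = A.KG.cornerD[OF xy(2)] and ac = A.KG.prim_idem[OF a(2)]
\<comment> \<open>w and h are the vector v and the form g carried from c to a along the equivalence,
  so that h w = a.\<close>
define w where "w = y\<odot>.(pm M) v"
define h where "h m = g m\<otimes>.A.KG x" for m
note gd = lmod_homD[OF g(3), simplified]
have w: "w:<M>" "a\<odot>.(pm M) w = w"
 using P.lsmult_closed[of y v] yd g(2) ac P.lsmult_assoc[of a y v] by (auto simp: w_def)
have hw: "h w = a" using gd(3)[OF yd(1) g(2)] g(5) yd xy(4) by (simp add: h_def w_def)
have hc: "h m:<A.KG>" "h m\<otimes>.A.KG a = h m" if "m:<M>" for m
 using gd(1)[OF that] xd ac by (auto simp: h_def A.KG.m_assoc)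
have hadd: "h (m \<oplus>.M m') = h m \<oplus>.A.KG h m'" if "m:<M>" "m':<M>" for m m'
 using gd that xd by (simp add: h_def A.KG.l_distr)
have hsm: "h (r\<odot>.(pm M) m) = r\<otimes>.A.KG h m" if "r:<A.KG>" "m:<M>" for r m
 using gd that xd by (simp add: h_def A.KG.m_assoc)
\<comment> \<open>The projection of M onto the copy of A a generated by w.\<close>
define e where "e m = h m\<odot>.(pm M) w" for m
have eh: "e:lmod_hom A.KG (pm M) (pm M)"
 using hc(1) hadd hsm w(1) P.lsmult_closed P.lsmult_l_distr P.lsmult_assoc unfolding e_def by (intro lmod_homI) auto
have hx: "h (z\<odot>.(pm M) w) = z" if "z:<A.KG>" "z\<otimes>.A.KG a = z" for z using hsm[OF that(1) w(1)] hw that by simp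
have ee: "e (e m) = e m" if "m:carrier (pm M)" for m using hx hc that by (simp add: e_def)
note sp = P.submodule_split[OF eh ee]
let ?W = "M(|carrier := {x:carrier (pm M). e x = \<zero>.(pm M)}|)"
have W: "?W:TG" by (rule TG_summand[OF M(1) sp(2)])
have ew: "e w = w" using hw w by (simp add: e_def)
have "w ~= \<zero>.M"
proof
 assume "w = \<zero>.M"
 hence "h w = h (\<zero>.A.KG\<odot>.(pm M) w)" using w(1) by simp
 hence "a = \<zero>.A.KG" using hsm[OF A.KG.zero_closed w(1)] hw ac(3) by simp
 thus False using ac(2) by simp
qed
hence "w \<notin> <?W>" using ew by simp
hence "<?W> \<subset> <M>" using w(1) by auto
hence lt: "card <?W> < card <M>" using f(3) by (rule psubset_card_mono[rotated])
note Pa = PB[OF ac(1) a(3)]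
have ih: "(%u. ii u\<odot>.(pm M) w):lmod_hom A.KG (pm (PB a)) (pm M)"
 using lmod_homD[OF Pa(2)] w(1) P.lsmult_closed P.lsmult_l_distr P.lsmult_assoc by (intro lmod_homI) auto
have jh: "(%x. x \<ominus>.(pm M) e x):lmod_hom A.KG (pm M) (pm ?W)"
proof -
 have "(%x. x \<ominus>.(pm M) e x):lmod_hom A.KG (pm M) ((pm M)(|carrier := {x:carrier (pm M). e x = \<zero>.(pm M)}|))"
  using lmod_homD[OF sp(1)] P.split_minus(2)[OF eh ee] by (intro lmod_homI) auto
 thus ?thesis using module_eq_hom(2)[OF pm_submodule(2)[OF f(1) P.summand_submod[OF sp(2)]], of "pm M"] by blast
qed
have sh: "(%x. x):lmod_hom A.KG (pm ?W) (pm M)"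
proof -
 have "(%x. x):lmod_hom A.KG ((pm M)(|carrier := {x:carrier (pm M). e x = \<zero>.(pm M)}|)) (pm M)" by (auto intro!: lmod_homI)
 thus ?thesis using module_eq_hom(1)[OF pm_submodule(2)[OF f(1) P.summand_submod[OF sp(2)]], of "pm M"] by blast
qed
have m0: "\<ominus>.(pm M) \<zero>.M = \<zero>.M"
 using P.M.minus_equality[of "\<zero>.M" "\<zero>.M"] P.M.zero_closed P.M.l_zero[of "\<zero>.M"] by simp
note TW = TG_proj[OF W]
have "split_exact LA.KG GA.KG (PB a) M ?W"
 unfolding split_exact_def bimod_hom_iff[OF TG_proj(1)[OF Pa(1)] f(1)] bimod_hom_iff[OF f(1) TW(1)] bimod_hom_iff[OF TW(1) f(1)]
proof (intro bexI[OF _ ih] bexI[OF _ jh] bexI[OF _ sh] conjI ballI)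
 show "inj_on (%u. ii u\<odot>.(pm M) w) (carrier (PB a))"
 proof (rule inj_on_inverseI)
  fix u assume "u:carrier (PB a)"
  then obtain z where z: "z:<A.KG>" "z\<otimes>.A.KG a = z" "u = \<iota> z" unfolding Pa(3) by blast
  thus "\<iota> (h (ii u\<odot>.(pm M) w)) = u" using hx[OF z(1,2)] VA(5)[OF z(1)] by simp
 qed
 show "(%x. x \<ominus>.(pm M) e x) ` <M> = <?W>"
 proof
  show "(%x. x \<ominus>.(pm M) e x) ` <M> <= <?W>" using lmod_homD(1)[OF jh] by auto
  have "x \<ominus>.(pm M) e x = x" if "x:<?W>" for x using that m0 P.M.r_zero[of x] by (simp add: a_minus_def)
  thus "<?W> <= (%x. x \<ominus>.(pm M) e x) ` <M>" by force
 qed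
 show "(%u. ii u\<odot>.(pm M) w) ` carrier (PB a) = {x:<M>. x \<ominus>.(pm M) e x = \<zero>.(?W)}"
 proof (intro equalityI subsetI)
  fix m assume "m:(%u. ii u\<odot>.(pm M) w) ` carrier (PB a)"
  then obtain z where z: "z:<A.KG>" "z\<otimes>.A.KG a = z" "m = ii (\<iota> z)\<odot>.(pm M) w" unfolding Pa(3) by blast
  hence "m:<M>" "e m = m" using hx[OF z(1,2)] VA(5)[OF z(1)] P.lsmult_closed[of z w] w(1) by (simp_all add: e_def)
  thus "m:{x:<M>. x \<ominus>.(pm M) e x = \<zero>.(?W)}" using P.M.r_neg[of m] by (simp add: a_minus_def)
 next
  fix m assume "m:{x:<M>. x \<ominus>.(pm M) e x = \<zero>.(?W)}"
  hence m: "m:<M>" "m = e m"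
   using P.M.add_minus_eq_zero_iff[of m "e m"] lmod_homD(1)[OF eh, of m] by (auto simp: a_minus_def)
  have "\<iota> (h m):carrier (PB a)" using hc[OF m(1)] unfolding Pa(3) by blast
  moreover have "m = ii (\<iota> (h m))\<odot>.(pm M) w" using m(2) VA(5)[OF hc(1)[OF m(1)]] by (simp add: e_def)
  ultimately show "m:(%u. ii u\<odot>.(pm M) w) ` carrier (PB a)" by blast
 qed
 show "x \<ominus>.(pm M) e x = x" if "x:<?W>" for x using that m0 P.M.r_zero[of x] by (simp add: a_minus_def)
qed
from cl_split[OF Pa(1) M(1) W this] show ?thesis using a(1) W lt by blast
qed
end

section \<open>Dual bases and ranks over R\<close>

text \<open>The normalization h i (u i) = 1 makes the trace of the identity equal to the number of
  indices, counted in R.\<close>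

definition dual_basis where
 "dual_basis R M I u h <-> finite I & (ALL i:I. u i:<M> & h i:lmod_hom R M (regular R) & h i (u i) = \<one>.R) &
  (ALL x:<M>. x = (\<Oplus>.M i\<in>I. h i x\<odot>.M u i))"

lemma lmod_hom_finsum:
 assumes "left_module A M" "left_module A N" "f:lmod_hom A M N" "g:I -> <M>"
 shows "f (finsum M g I) = (\<Oplus>.N i\<in>I. f (g i))"
proof -
interpret M: left_module A M by fact
interpret N: left_module A N by fact
show ?thesis using lmod_homD[OF assms(3)] lmod_hom_zero(1)[OF assms(1-3)] assms(4)
 by (intro finsum_hom M.M.abelian_monoid_axioms N.M.abelian_monoid_axioms) auto
qed

lemma (in ring) dual_basis_expand:
 assumes M: "left_module R M" and "dual_basis R M I u h" "f:lmod_hom R M (regular R)" "x:<M>"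
 shows "f x = (\<Oplus>i\<in>I. h i x\<otimes> f (u i))"
proof -
interpret M: left_module R M by fact
have d: "u i:<M>" "h i x:<R>" if "i:I" for i
 using assms(2,4) lmod_homD(1)[of "h i" R M "regular R"] that by (auto simp: dual_basis_def)
have "f x = f (\<Oplus>.M i\<in>I. h i x\<odot>.M u i)" using assms(2,4) by (auto simp: dual_basis_def)
also have "... = (\<Oplus>.(regular R)i\<in>I. f (h i x\<odot>.M u i))"
 using d M.lsmult_closed by (intro lmod_hom_finsum[OF M left_module_regular assms(3)]) auto
also have "... = (\<Oplus>i\<in>I. f (h i x\<odot>.M u i))" using d M.lsmult_closed lmod_homD(1)[OF assms(3)]
 by (intro finsum_hom[where f = "%x. x"] left_module.axioms(2)[OF left_module_regular, THEN abelian_group.axioms(1)] abelian_monoid_axioms) auto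
also have "... = (\<Oplus>i\<in>I. h i x\<otimes> f (u i))"
 using d lmod_homD[OF assms(3)] by (intro finsum_cong') auto
finally show ?thesis .
qed

text \<open>Both sides are the double sum of \<open>h i (\<tau>\<inverse> (v j))\<otimes> k j (\<tau> (u i))\<close>: the trace of the
 identity, computed on either module.\<close>

lemma (in cring) dual_basis_card:
 assumes M: "left_module R M" "dual_basis R M I u h" and N: "left_module R N" "dual_basis R N J v k"
  and t: "\<tau>:lmod_iso R M N"
 shows "[card I] \<cdot> \<one> = [card J] \<cdot> \<one>"
proof -
interpret M: left_module R M by fact
interpret N: left_module R N by fact
have fin: "finite I" "finite J" using assms by (auto simp: dual_basis_def)
let ?s = "inv_into <M> \<tau>"
have th: "\<tau>:lmod_hom R M N" and bij: "bij_betw \<tau> <M> <N>" using t by (auto simp: lmod_iso_def)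
note td = lmod_homD[OF th]
have s: "?s y:<M>" "\<tau> (?s y) = y" if "y:<N>" for y
 using that bij by (auto simp: bij_betw_def inv_into_into f_inv_into_f)
have st: "?s (\<tau> x) = x" if "x:<M>" for x using that bij by (simp add: bij_betw_def)
have sh: "?s:lmod_hom R N M"
proof (rule lmod_homI)
 fix x y assume xy: "x:<N>" "y:<N>"
 hence "x \<oplus>.N y = \<tau> (?s x \<oplus>.M ?s y)" using td(2) s by simp
 thus "?s (x \<oplus>.N y) = ?s x \<oplus>.M ?s y" using st s xy by simp
next
 fix a x assume ax: "a:<R>" "x:<N>"
 hence "a\<odot>.N x = \<tau> (a\<odot>.M ?s x)" using td(3) s by simp
 thus "?s (a\<odot>.N x) = a\<odot>.M ?s x" using st s ax M.lsmult_closed by simp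
qed (use s in auto)
have u: "u i:<M>" "h i:lmod_hom R M (regular R)" "h i (u i) = \<one>" if "i:I" for i using M(2) that by (auto simp: dual_basis_def)
have v: "v j:<N>" "k j:lmod_hom R N (regular R)" "k j (v j) = \<one>" if "j:J" for j using N(2) that by (auto simp: dual_basis_def)
have c: "h i (?s (v j)):<R>" "k j (\<tau> (u i)):<R>" if "i:I" "j:J" for i j
 using lmod_homD(1)[OF u(2)[OF that(1)] s(1)[OF v(1)[OF that(2)]]] lmod_homD(1)[OF v(2)[OF that(2)] td(1)[OF u(1)[OF that(1)]]] by auto
\<comment> \<open>Expanding the form h i composed with the inverse of \<tau> in the dual basis of N,
  at the image of u i.\<close>
have 1: "(\<Oplus>j\<in>J. k j (\<tau> (u i))\<otimes> h i (?s (v j))) = \<one>" if i: "i:I" for i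
 using dual_basis_expand[OF N lmod_hom_comp[OF sh u(2)[OF i]] td(1)[OF u(1)[OF i]]] st[OF u(1)[OF i]] u(3)[OF i] by simp
have 2: "(\<Oplus>i\<in>I. h i (?s (v j))\<otimes> k j (\<tau> (u i))) = \<one>" if j: "j:J" for j
 using dual_basis_expand[OF M lmod_hom_comp[OF th v(2)[OF j]] s(1)[OF v(1)[OF j]]] s(2)[OF v(1)[OF j]] v(3)[OF j] by simp
have "(\<Oplus>i\<in>I. \<one>) = (\<Oplus>i\<in>I. \<Oplus>j\<in>J. k j (\<tau> (u i))\<otimes> h i (?s (v j)))"
 using 1 by (intro finsum_cong') auto
also have "... = (\<Oplus>j\<in>J. \<Oplus>i\<in>I. k j (\<tau> (u i))\<otimes> h i (?s (v j)))" using c by (intro finsum_swap) auto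
also have "... = (\<Oplus>j\<in>J. \<Oplus>i\<in>I. h i (?s (v j))\<otimes> k j (\<tau> (u i)))"
 using c m_comm by (intro finsum_cong') auto
also have "... = (\<Oplus>j\<in>J. \<one>)" using 2 by (intro finsum_cong') auto
finally show ?thesis by (simp add: add.finprod_const)
qed

lemma bimodule_ring_as_int:
 assumes "ring R"
 shows "bimodule R \<Z> (ring_as_int_bimodule R)"
proof -
interpret R: ring R by fact
have "left_module R (ring_as_int_bimodule R)"
 by (rule left_module_cong[OF R.left_module_regular]) (simp_all add: ring_as_int_bimodule_def)
moreover have "ring \<Z>" using int_is_cring cring.axioms(1) by blast
ultimately show ?thesis
 by (simp add: bimodule_def bimodule_axioms_def ring_as_int_bimodule_def R.add.int_pow_mult R.add.int_pow_distrib R.add.int_pow_pow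
  R.add_pow_rdistr_int)
qed

context block_product
begin

abbreviation TD where "TD \<equiv> T_Delta p K L \<one>.LA.KG G b"

lemma TD_simps: "<TD> = <T.Quo>" "x \<oplus>.TD y = x\<otimes>.T.Quo y" "\<zero>.TD = \<one>.T.Quo" "n\<odot>.TD x = x [^].T.Quo n"
 by (simp_all add: T_Delta_def Let_def TG_def)

lemma left_module_TD: "left_module \<Z> TD"
proof -
have "abelian_group TD"
proof (rule abelian_groupI)
 fix x assume "x:<TD>"
 thus "EX y:<TD>. y \<oplus>.TD x = \<zero>.TD" by (intro bexI[of _ "inv .T.Quo x"]) (auto simp: TD_simps)
qed (auto simp: TD_simps T.Quo.m_ac)
moreover have "ring \<Z>" using int_is_cring cring.axioms(1) by blast
ultimately show ?thesis
 by (simp add: left_module_def left_module_axioms_def TD_simps T.Quo.int_pow_mult T.Quo.int_pow_distrib T.Quo.int_pow_pow mult.commute)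
qed

context
 fixes I
 assumes finI: "finite I" and I: "!!a. a:I ==> A.KG.prim a & eb\<otimes>.A.KG a = a"
  and inequiv: "!!a d. a:I ==> d:I ==> a ~= d ==> ~ A.KG.idem_equiv a d"
  and covers: "!!a. A.KG.prim a ==> eb\<otimes>.A.KG a = a ==> EX d:I. A.KG.idem_equiv a d"
begin

lemma PB_I: "a:I ==> PB a:TG" using PB(1) I A.KG.prim_idem(1) by blast

text \<open>By \<open>split_off\<close> the classes of the \<open>PB a\<close> with a in I generate
  the group.\<close>

lemma T_induct:
 assumes t: "t:<T.Quo>" and 1: "Q \<one>.T.Quo" and PB: "!!a. a:I ==> Q (cl (PB a))"
  and m: "!!s t. s:<T.Quo> ==> t:<T.Quo> ==> Q s ==> Q t ==> Q (s\<otimes>.T.Quo t) & Q (s\<otimes>.T.Quo inv .T.Quo t)"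
 shows "Q t"
proof -
have "M:TG ==> Q (cl M)" for M
proof (induction "card <M>" arbitrary: M rule: less_induct)
 case less
 show ?case
 proof (cases "<M> = {\<zero>.M}")
  case True
  thus ?thesis using cl_zero[OF less.prems] 1 by simp
 next
  case False
  obtain a W where "a:I" "W:TG" "card <W> < card <M>" "cl M = cl (PB a)\<otimes>.T.Quo cl W"
   using split_off[OF less.prems False, of I] covers I by blast
  thus ?thesis using less.hyps PB m cl_closed PB_I by simp
 qed
qed
thus ?thesis using t 1 m by (intro T.Quo_induct[of t Q]) (auto simp: cl_def)
qed

text \<open>\<open>theta a\<close> is a real-valued homomorphism that vanishes on every other
  generator. Since the \<open>PB d\<close> generate, its values are integer multiples of its value
  at \<open>PB a\<close>; dividing gives an integer coordinate.\<close>

lemma coefficient: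
 assumes a: "a:I"
 shows "EX c :: _ => int. (ALL s:<T.Quo>. ALL t:<T.Quo>. c (s\<otimes>.T.Quo t) = c s + c t) & (ALL d:I. c (cl (PB d)) = (if d = a then 1 else 0))"
proof -
have "EX g:hom T.Quo real_group. ALL M:TG. g (T.cls (frag_of M)) = theta a M"
proof (rule T.universal_gen[OF real_group(1)])
 fix h r assume h: "h:hom T.Free real_group" "!!M. M:TG ==> h (frag_of M) = theta a M" and r: "r:TR"
 then obtain N M P where rel: "r = frag_of M - frag_of N - frag_of P" "N:TG" "M:TG" "P:TG" "split_exact LA.KG GA.KG N M P"
  by (auto simp: T_rels_def TG_def)
 thus "h r = \<one>.real_group"
  using free_hom_diff[OF real_group(1) h(1), of "frag_of M - frag_of N" "frag_of P"] free_hom_diff[OF real_group(1) h(1), of "frag_of M" "frag_of N"] free_diff_closed[of "frag_of M" TG "frag_of N"] h(2) theta_split[OF conjunct1[OF I[OF a]] rel(2-5)] by (simp add: real_group(2-5))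
qed (simp add: real_group(5))
then obtain g where g: "g:hom T.Quo real_group" "ALL M:TG. g (cl M) = theta a M" by (auto simp: cl_def)
interpret g: group_hom T.Quo real_group g
 using g(1) comm_group.axioms(2)[OF real_group(1)] by (simp add: group_hom_def group_hom_axioms_def)
let ?D = "theta a (PB a)"
have D: "?D > 0" using theta_PB(2) I[OF a] by blast
have gP: "g (cl (PB d)) = (if d = a then ?D else 0)" if "d:I" for d
 using g(2) PB_I[OF that] theta_PB(1)[of a d] I[OF a] I[OF that] inequiv[OF a that] by auto
have int: "EX n :: int. g t = of_int n * ?D" if "t:<T.Quo>" for t using that
proof (rule T_induct)
 show "EX n :: int. g \<one>.T.Quo = of_int n * ?D" by (intro exI[of _ 0]) (simp add: real_group(3))
 show "EX n :: int. g (cl (PB d)) = of_int n * ?D" if "d:I" for d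
  using gP[OF that] by (intro exI[of _ "if d = a then 1 else 0"]) auto
 fix s t assume st: "s:<T.Quo>" "t:<T.Quo>" "EX n :: int. g s = of_int n * ?D" "EX n :: int. g t = of_int n * ?D"
 then obtain i j :: int where ij: "g s = of_int i * ?D" "g t = of_int j * ?D" by blast
 have "g (s\<otimes>.T.Quo t) = of_int (i + j) * ?D" "g (s\<otimes>.T.Quo inv .T.Quo t) = of_int (i - j) * ?D"
  using st ij by (simp_all add: real_group(2,4) algebra_simps)
 thus "(EX n :: int. g (s\<otimes>.T.Quo t) = of_int n * ?D) & (EX n :: int. g (s\<otimes>.T.Quo inv .T.Quo t) = of_int n * ?D)" by blast
qed
\<comment> \<open>The quotient is an integer already; the floor only changes its type.\<close>
define c where "c t = \<lfloor>g t / ?D\<rfloor>" for t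
have ce: "c t = n" if "g t = of_int n * ?D" for t n using that D by (simp add: c_def)
have "c (s\<otimes>.T.Quo t) = c s + c t" if st: "s:<T.Quo>" "t:<T.Quo>" for s t
proof -
 obtain i j :: int where ij: "g s = of_int i * ?D" "g t = of_int j * ?D" using int st by blast
 have "g (s\<otimes>.T.Quo t) = of_int (i + j) * ?D" using st ij by (simp add: real_group(2) algebra_simps)
 from ce[OF this] show ?thesis using ce[OF ij(1)] ce[OF ij(2)] by simp
qed
moreover have "c (cl (PB d)) = (if d = a then 1 else 0)" if "d:I" for d using gP[OF that] by (intro ce) auto
ultimately show ?thesis by blast
qed

text \<open>The vectors are the tensors of one with the class of \<open>PB a\<close>, and the forms
  send a tensor of r and t to the coefficient of t at a, times r.\<close>

lemma RT_dual_basis: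
 assumes R: "cring R"
 shows "left_module R (RT_Delta R p K L \<one>.LA.KG G b)" "EX u h. dual_basis R (RT_Delta R p K L \<one>.LA.KG G b) I u h"
proof -
interpret R: cring R by fact
interpret X: tensor_product R \<Z> "ring_as_int_bimodule R" TD
 using bimodule_ring_as_int[OF R.ring_axioms] left_module_TD by (simp add: tensor_product_def)
interpret Z: left_module R X.TT by (rule X.left_module_TT)
have e: "RT_Delta R p K L \<one>.LA.KG G b = X.TT" by (simp add: RT_Delta_def)
show "left_module R (RT_Delta R p K L \<one>.LA.KG G b)" unfolding e by (rule X.left_module_TT)
have rs: "carrier (ring_as_int_bimodule R) = <R>" "x \<oplus>.(ring_as_int_bimodule R) y = x \<oplus>.R y" "r\<odot>.(ring_as_int_bimodule R) x = r\<otimes>.R x"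
 "x \<star>.(ring_as_int_bimodule R) n = [n] \<cdot>.R x" for x y r and n :: int by (simp_all add: ring_as_int_bimodule_def)
have h: "EX h. h:lmod_hom R X.TT (regular R) & (ALL r:<R>. ALL d:I. h (X.pure r (cl (PB d))) = (if d = a then r else \<zero>.R))" if a: "a:I" for a
proof -
 obtain c :: "_ => int" where c0: "ALL s:<T.Quo>. ALL t:<T.Quo>. c (s\<otimes>.T.Quo t) = c s + c t"
  "ALL d:I. c (cl (PB d)) = (if d = a then 1 else 0)" using coefficient[OF a] by (elim exE conjE)
 note c = c0(1)[rule_format] c0(2)[rule_format]
 have c1: "c \<one>.T.Quo = 0" using c(1)[of "\<one>.T.Quo" "\<one>.T.Quo"] by simp
 have ci: "c (inv .T.Quo t) = - c t" if "t:<T.Quo>" for t using c(1)[of "inv .T.Quo t" t] that c1 by simp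
 have cn: "c (t [^].T.Quo (n :: nat)) = int n * c t" if "t:<T.Quo>" for t n
 proof (induction n)
  case (Suc n)
  thus ?case using c(1)[of "t [^].T.Quo n" t] that by (simp add: algebra_simps)
 qed (simp add: c1)
 have cp: "c (t [^].T.Quo n) = n * c t" if "t:<T.Quo>" for t and n :: int
 proof (cases n rule: int_cases2)
  case (nonpos k)
  have "t [^].T.Quo n = inv .T.Quo (t [^].T.Quo k)" using that nonpos T.Quo.int_pow_neg_int by simp
  thus ?thesis using nonpos ci[of "t [^].T.Quo k"] cn[OF that, of k] that by simp
 qed (use cn[OF that] in \<open>simp add: int_pow_int\<close>)
 have "EX h. h:<X.TT> -> <R> & (ALL s:<X.TT>. ALL t:<X.TT>. h (s \<oplus>.X.TT t) = h s \<oplus>.R h t) &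
   (ALL r:carrier (ring_as_int_bimodule R). ALL t:<TD>. h (X.pure r t) = [c t] \<cdot>.R r)"
 proof (intro X.TT_universal R.abelian_group_axioms)
  fix r t and n :: int assume "r:carrier (ring_as_int_bimodule R)" "t:<TD>"
  thus "[c t] \<cdot>.R (r \<star>.(ring_as_int_bimodule R) n) = [c (n\<odot>.TD t)] \<cdot>.R r"
   using cp[of t n] R.add.int_pow_pow[of r "c t" n] by (simp add: rs TD_simps)
 next
  fix r s t assume "r:carrier (ring_as_int_bimodule R)" "s:<TD>" "t:<TD>"
  thus "[c (s \<oplus>.TD t)] \<cdot>.R r = [c s] \<cdot>.R r \<oplus>.R [c t] \<cdot>.R r"
   using c(1) by (simp add: rs TD_simps R.add.int_pow_mult)
 qed (simp_all add: rs R.add.int_pow_distrib)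
 then obtain h where h: "h:<X.TT> -> <R>" "ALL s:<X.TT>. ALL t:<X.TT>. h (s \<oplus>.X.TT t) = h s \<oplus>.R h t"
  "ALL r:<R>. ALL t:<T.Quo>. h (X.pure r t) = [c t] \<cdot>.R r" unfolding rs TD_simps by (elim exE conjE)
 have "h (r\<odot>.X.TT x) = r\<otimes>.R h x" if r: "r:<R>" and x: "x:<X.TT>" for r x using x
 proof (induction x rule: X.TT_induct)
  case (pure s t)
  thus ?case using h(3) r X.smult_cls(2)[OF r] by (simp add: rs TD_simps R.add_pow_rdistr_int)
 next
  case (add s t)
  thus ?case using h r Z.lsmult_closed by (simp add: Z.lsmult_r_distr R.r_distr Pi_iff)
 qed
 hence "h:lmod_hom R X.TT (regular R)" using h by (intro lmod_homI) auto
 moreover have "h (X.pure r (cl (PB d))) = (if d = a then r else \<zero>.R)" if "r:<R>" "d:I" for r d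
  using h(3) c(2)[OF that(2)] cl_closed[OF PB_I[OF that(2)]] that(1) by (auto simp: add_pow_def[of _ "0 :: int"])
 ultimately show ?thesis by blast
qed
then obtain h where hh: "!!a. a:I ==> h a:lmod_hom R X.TT (regular R)"
 "!!a r d. a:I ==> r:<R> ==> d:I ==> h a (X.pure r (cl (PB d))) = (if d = a then r else \<zero>.R)" by metis
let ?u = "%a. X.pure \<one>.R (cl (PB a))"
have pc: "X.pure r t:<X.TT>" if "r:<R>" "t:<T.Quo>" for r t using X.pure_closed that by (simp add: rs TD_simps)
have uc: "?u a:<X.TT>" if "a:I" for a using pc cl_closed[OF PB_I[OF that]] by simp
\<comment> \<open>E is to be the identity. It is additive, so pure tensors suffice, and for these
  \<open>T_induct\<close> reduces to the classes of the \<open>PB d\<close>.\<close>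
define E where "E x = (\<Oplus>.X.TT a\<in>I. h a x\<odot>.X.TT ?u a)" for x
have hc: "h a x:<R>" if "a:I" "x:<X.TT>" for a x using lmod_homD(1)[OF hh(1)[OF that(1)] that(2)] by simp
have Ec: "E x:<X.TT>" if "x:<X.TT>" for x
 unfolding E_def using hc uc that Z.lsmult_closed by (intro X.TT.finsum_closed) auto
have Eadd: "E (x \<oplus>.X.TT y) = E x \<oplus>.X.TT E y" if xy: "x:<X.TT>" "y:<X.TT>" for x y
proof -
 have "E (x \<oplus>.X.TT y) = (\<Oplus>.X.TT a\<in>I. h a x\<odot>.X.TT ?u a \<oplus>.X.TT h a y\<odot>.X.TT ?u a)"
  unfolding E_def using hc uc xy lmod_homD(2)[OF hh(1)] Z.lsmult_closed
  by (intro X.TT.finsum_cong') (auto simp: Z.lsmult_l_distr)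
 also have "... = E x \<oplus>.X.TT E y" unfolding E_def using hc uc xy Z.lsmult_closed by (intro X.TT.finsum_addf) auto
 finally show ?thesis .
qed
have E0: "E \<zero>.X.TT = \<zero>.X.TT" using Eadd[of "\<zero>.X.TT" "\<zero>.X.TT"] Ec[of "\<zero>.X.TT"] by auto
have EP: "E (X.pure r t) = X.pure r t" if r: "r:<R>" and t: "t:<T.Quo>" for r t using t
proof (rule T_induct)
 have padd: "X.pure r (s\<otimes>.T.Quo t) = X.pure r s \<oplus>.X.TT X.pure r t" if "s:<T.Quo>" "t:<T.Quo>" for s t
  using X.pure_add_right[of r s t] r that by (simp add: rs TD_simps)
 have p1: "X.pure r \<one>.T.Quo = \<zero>.X.TT"
  using padd[of "\<one>.T.Quo" "\<one>.T.Quo"] pc[OF r, of "\<one>.T.Quo"] by auto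
 show "E (X.pure r \<one>.T.Quo) = X.pure r \<one>.T.Quo" unfolding p1 by (rule E0)
 show "E (X.pure r (cl (PB d))) = X.pure r (cl (PB d))" if d: "d:I" for d
 proof -
  have "E (X.pure r (cl (PB d))) = (\<Oplus>.X.TT a\<in>I. if a = d then r\<odot>.X.TT ?u a else \<zero>.X.TT)"
   unfolding E_def using hh(2)[OF _ r d] uc r Z.lsmult_closed by (intro X.TT.finsum_cong') auto
  also have "... = r\<odot>.X.TT ?u d" using uc[OF d] r Z.lsmult_closed finI d by (intro X.TT.finsum_delta) auto
  also have "... = X.pure r (cl (PB d))" using X.smult_cls(2)[OF r, of "\<one>.R" "cl (PB d)"] cl_closed[OF PB_I[OF d]] r by (simp add: rs TD_simps)
  finally show ?thesis .
 qed
 fix s t assume st: "s:<T.Quo>" "t:<T.Quo>" "E (X.pure r s) = X.pure r s" "E (X.pure r t) = X.pure r t"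
 have i: "E (X.pure r (inv .T.Quo t)) = X.pure r (inv .T.Quo t)"
 proof -
  have "E (X.pure r (inv .T.Quo t)) \<oplus>.X.TT X.pure r t = X.pure r (inv .T.Quo t) \<oplus>.X.TT X.pure r t"
   using Eadd[OF pc[OF r T.Quo.inv_closed[OF st(2)]] pc[OF r st(2)]] padd[OF T.Quo.inv_closed[OF st(2)] st(2)] st E0 p1 by simp
  thus ?thesis using pc[OF r] st Ec by (simp add: X.TT.add.r_cancel)
 qed
 show "E (X.pure r (s\<otimes>.T.Quo t)) = X.pure r (s\<otimes>.T.Quo t) & E (X.pure r (s\<otimes>.T.Quo inv .T.Quo t)) = X.pure r (s\<otimes>.T.Quo inv .T.Quo t)"
  using st i padd pc[OF r] Eadd by simp
qed
have "E x = x" if "x:<X.TT>" for x using that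
proof (induction x rule: X.TT_induct)
 case (pure r t)
 thus ?case using EP by (simp add: rs TD_simps)
qed (simp add: Eadd)
hence "dual_basis R X.TT I ?u h" using finI uc hh unfolding dual_basis_def E_def by auto
thus "EX u h. dual_basis R (RT_Delta R p K L \<one>.LA.KG G b) I u h" unfolding e by blast
qed
end
end

section \<open>Orbits and periods of permutations\<close>

text \<open>A permutation \<open>f\<close> of a finite set \<open>V\<close>, given through its iterates.\<close>

locale finite_cycles =
 fixes V :: "'a set" and f :: "'a => 'a"
 assumes finite_V: "finite V" and bij: "bij_betw f V V"
begin

lemma pow_closed: "x:V ==> (f ^^ i) x:V" by (induction i) (use bij in \<open>auto simp: bij_betw_def\<close>)

lemma pow_inj: "x:V ==> y:V ==> (f ^^ i) x = (f ^^ i) y ==> x = y"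
proof (induction i)
case (Suc i)
hence "(f ^^ i) x = (f ^^ i) y" using bij pow_closed by (auto simp: bij_betw_def inj_on_def)
thus ?case using Suc by simp
qed simp

lemma returns: "x:V ==> EX n>0. (f ^^ n) x = x"
proof -
assume x: "x:V"
have "~ inj (%n. (f ^^ n) x)"
 using finite_V pow_closed[OF x] by (metis finite_imageD finite_subset image_subsetI infinite_UNIV_nat)
then obtain i j :: nat where ij: "i < j" "(f ^^ i) x = (f ^^ j) x" unfolding inj_def by (metis linorder_neqE_nat)
have "(f ^^ i) ((f ^^ (j - i)) x) = (f ^^ i) x" using ij by (simp add: funpow_add[symmetric, THEN fun_cong, unfolded comp_def])
hence "(f ^^ (j - i)) x = x" using pow_inj pow_closed x by blast
thus ?thesis using ij(1) by (intro exI[of _ "j - i"]) simp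
qed

definition period where "period x = (LEAST n. n > 0 & (f ^^ n) x = x)"

lemma period: "x:V ==> period x > 0 & (f ^^ period x) x = x"
 unfolding period_def using LeastI_ex[OF returns] by simp

lemma pow_mod_period: "x:V ==> (f ^^ (i mod period x)) x = (f ^^ i) x"
proof -
assume x: "x:V"
have "(f ^^ (period x * r)) x = x" for r by (induction r) (use period[OF x] in \<open>auto simp: funpow_add\<close>)
hence "(f ^^ (i mod period x + period x * (i div period x))) x = (f ^^ (i mod period x)) x" unfolding funpow_add by simp
thus ?thesis by simp
qed

lemma pow_fixed_iff: "x:V ==> (f ^^ i) x = x <-> period x dvd i"
proof -
assume x: "x:V"
have "i mod period x = 0" if "(f ^^ i) x = x"
proof (rule ccontr)
 assume "i mod period x ~= 0"
 hence "period x <= i mod period x"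
  unfolding period_def using pow_mod_period[OF x, of i] that by (intro Least_le) (simp add: period_def)
 moreover have "i mod period x < period x" using period[OF x] by simp
 ultimately show False by linarith
qed
thus ?thesis using pow_mod_period[OF x, of i] by auto
qed

definition orb where "orb x = {(f ^^ i) x | i. True}"

lemma orb:
 assumes x: "x:V"
 shows "orb x <= V" "x:orb x" "finite (orb x)" "card (orb x) = period x" "y:orb x ==> orb y = orb x" "y:orb x ==> period y = period x"
proof -
show s: "orb x <= V" using pow_closed[OF x] by (auto simp: orb_def)
thus "finite (orb x)" using finite_V finite_subset by blast
have "x = (f ^^ 0) x" by simp
thus "x:orb x" unfolding orb_def by blast
have e: "orb x = (%i. (f ^^ i) x) ` {..<period x}"
proof
 show "orb x <= (%i. (f ^^ i) x) ` {..<period x}"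
 proof
  fix y assume "y:orb x"
  then obtain i where "y = (f ^^ i) x" by (auto simp: orb_def)
  thus "y:(%i. (f ^^ i) x) ` {..<period x}"
   using pow_mod_period[OF x, of i] period[OF x] by (intro image_eqI[of _ _ "i mod period x"]) auto
 qed
qed (auto simp: orb_def)
have "inj_on (%i. (f ^^ i) x) {..<period x}"
proof (rule linorder_inj_onI)
 fix i j assume ij: "i < j" "i:{..<period x}" "j:{..<period x}"
 show "(f ^^ i) x ~= (f ^^ j) x"
 proof
  assume "(f ^^ i) x = (f ^^ j) x"
  hence "(f ^^ i) x = (f ^^ i) ((f ^^ (j - i)) x)" using ij(1) by (simp add: funpow_add[symmetric, THEN fun_cong, unfolded comp_def])
  hence "period x dvd j - i" using pow_inj[OF x pow_closed[OF x]] pow_fixed_iff[OF x] by metis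
  thus False using ij by (auto dest: dvd_imp_le)
 qed
qed auto
thus "card (orb x) = period x" unfolding e by (simp add: card_image)
assume "y:orb x"
then obtain i where i: "y = (f ^^ i) x" by (auto simp: orb_def)
have yV: "y:V" using i pow_closed x by simp
have y: "(f ^^ j) y = (f ^^ (j + i)) x" for j using i by (simp add: funpow_add)
have "(f ^^ j) x:orb y" for j
proof -
 have "i <= period x * i" using period[OF x] by simp
 hence "j + (period x * i - i) + i = j + period x * i" by arith
 hence "(f ^^ (j + (period x * i - i))) y = (f ^^ (j + period x * i)) x" unfolding y by (rule arg_cong)
 also have "... = (f ^^ j) x" using pow_mod_period[OF x, of "j + period x * i"] pow_mod_period[OF x, of j] by simp
 finally show ?thesis unfolding orb_def by (metis (mono_tags, lifting) mem_Collect_eq)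
qed
thus "orb y = orb x" using y by (auto simp: orb_def)
have "(f ^^ j) y = y <-> (f ^^ j) x = x" for j
proof -
 have "(f ^^ j) y = (f ^^ i) ((f ^^ j) x)" unfolding y by (simp add: add.commute[of j i] funpow_add)
 thus ?thesis using i pow_inj[OF pow_closed[OF x] x] by metis
qed
thus "period y = period x" unfolding period_def by simp
qed

text \<open>An orbit of length t contributes t terms 1/t.\<close>

lemma card_orbits: "real (card (orb ` V)) = (\<Sum>x\<in>V. 1 / real (period x))"
proof -
have "(\<Sum>x\<in>V. 1 / real (period x)) = (\<Sum>o'\<in>orb ` V. \<Sum>x\<in>{x:V. orb x = o'}. 1 / real (period x))"
 by (rule sum.image_gen[OF finite_V])
also have "... = (\<Sum>o'\<in>orb ` V. 1)"
proof (rule sum.cong)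
 fix o' assume "o':orb ` V"
 then obtain y where y: "y:V" "o' = orb y" by blast
 have "x:orb y" if "x:V" "orb x = orb y" for x using orb(2)[OF that(1)] that(2) by simp
 hence "{x:V. orb x = o'} = orb y" using orb(1,5)[OF y(1)] y(2) by blast
 moreover have "(\<Sum>x\<in>orb y. 1 / real (period x)) = (\<Sum>x\<in>orb y. 1 / real (period y))" using orb(6)[OF y(1)] by (intro sum.cong) auto
 ultimately show "(\<Sum>x\<in>{x:V. orb x = o'}. 1 / real (period x)) = 1"
  using orb(4)[OF y(1)] period[OF y(1)] by simp
qed simp
finally show ?thesis by simp
qed
end

text \<open>A triangular system for divisibility with nonzero diagonal entries w, solved upwards
  from small divisors.\<close>

lemma divisor_sum_cancel:
 fixes u v w :: "nat => real"
 assumes "N > 0" "!!t. t dvd N ==> w t ~= 0"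
  and eq: "!!a. a dvd N ==> (\<Sum>t | t dvd a. w t * u t) = (\<Sum>t | t dvd a. w t * v t)"
 shows "a dvd N ==> u a = v a"
proof (induction a rule: less_induct)
case (less a)
have a: "a > 0" using less.prems assms(1) by auto
have fin: "finite {t. t dvd a}" using a by simp
have "w t * u t = w t * v t" if "t:{t. t dvd a} - {a}" for t
proof -
 have "t dvd a" "t ~= a" using that by auto
 hence "t < a" "t dvd N" using dvd_imp_le[OF _ a] dvd_trans[OF _ less.prems] by (auto simp: le_neq_implies_less)
 thus ?thesis using less.IH by simp
qed
hence "(\<Sum>t\<in>{t. t dvd a} - {a}. w t * u t) = (\<Sum>t\<in>{t. t dvd a} - {a}. w t * v t)" by (rule sum.cong[OF refl])
hence "w a * u a = w a * v a" using eq[OF less.prems] sum.remove[OF fin, of a "%t. w t * u t"] sum.remove[OF fin, of a "%t. w t * v t"] by simp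
thus ?case using assms(2)[OF less.prems] by simp
qed

text \<open>The dual triangular system, solved downwards from N.\<close>

lemma multiple_sum_cancel:
 fixes u v :: "nat => real"
 assumes "N > 0"
  and eq: "!!a. a dvd N ==> (\<Sum>t | t dvd N & a dvd t. u t) = (\<Sum>t | t dvd N & a dvd t. v t)"
 shows "a dvd N ==> u a = v a"
proof (induction "N - a" arbitrary: a rule: less_induct)
case less
have fin: "finite {t. t dvd N & a dvd t}" using assms(1) by simp
have "u t = v t" if "t:{t. t dvd N & a dvd t} - {a}" for t
proof -
 have t: "t dvd N" "a dvd t" "t ~= a" "t > 0" "t <= N" using that assms(1) by auto
 hence "a < t" by auto
 thus ?thesis using less.hyps[of t] t by simp
qed
hence "(\<Sum>t\<in>{t. t dvd N & a dvd t} - {a}. u t) = (\<Sum>t\<in>{t. t dvd N & a dvd t} - {a}. v t)" by (rule sum.cong[OF refl])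
thus ?case using eq[OF less.prems] less.prems sum.remove[OF fin, of a u] sum.remove[OF fin, of a v] by simp
qed

text \<open>Writing \<open>1 / lcm a m\<close> as \<open>gcd a m / (a m)\<close> and the gcd as the sum of the totients of the common
 divisors turns the hypothesis into three triangular systems.\<close>

lemma periods_determined:
 fixes P :: "'a => nat" and P' :: "'b => nat" and w :: "nat => real"
 assumes fin: "finite V" "finite V'" and N: "N > 0" and w: "!!t. t dvd N ==> w t ~= 0"
  and P: "!!x. x:V ==> P x dvd N" "!!x. x:V' ==> P' x dvd N"
  and eq: "!!n. n dvd N ==> (\<Sum>a | a dvd n. w a * (\<Sum>x\<in>V. 1 / real (lcm a (P x)))) = (\<Sum>a | a dvd n. w a * (\<Sum>x\<in>V'. 1 / real (lcm a (P' x))))"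
 shows "card {x:V. P x = t} = card {x:V'. P' x = t}"
proof -
have pos: "t > 0" if "t dvd N" for t using that N by auto
let ?B = "%V P t. \<Sum>x\<in>V. if t dvd P x then 1 / real (P x) else 0"
have gcd_sum: "real a * (\<Sum>x\<in>V. 1 / real (lcm a (P x))) = (\<Sum>t | t dvd a. real (phi' t) * ?B V P t)"
 if a: "a dvd N" and V: "finite V" "!!x. x:V ==> P x dvd N" for a and V :: "'c set" and P
proof -
 have "real a / real (lcm a (P x)) = (\<Sum>t | t dvd a. real (phi' t) * (if t dvd P x then 1 / real (P x) else 0))" if x: "x:V" for x
 proof -
  have p: "a > 0" "P x > 0" using pos a V(2)[OF x] by auto
  have "real a * real (P x) = real (gcd a (P x)) * real (lcm a (P x))" using prod_gcd_lcm_nat[of a "P x"] by (metis of_nat_mult)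
  hence "real a / real (lcm a (P x)) = real (gcd a (P x)) / real (P x)" using p by (simp add: field_simps)
  also have "real (gcd a (P x)) = (\<Sum>t | t dvd gcd a (P x). real (phi' t))"
   using sum_phi'_factors[of "gcd a (P x)"] p by (metis gcd_pos_nat of_nat_sum less_numeral_extra(3))
  also have "... = (\<Sum>t | t dvd a. if t dvd P x then real (phi' t) else 0)"
   using p by (intro sum.mono_neutral_cong_left) auto
  finally show ?thesis by (auto simp: sum_divide_distrib intro!: sum.cong)
 qed
 hence "real a * (\<Sum>x\<in>V. 1 / real (lcm a (P x))) = (\<Sum>x\<in>V. \<Sum>t | t dvd a. real (phi' t) * (if t dvd P x then 1 / real (P x) else 0))"
  by (simp add: sum_distrib_left)
 also have "... = (\<Sum>t | t dvd a. \<Sum>x\<in>V. real (phi' t) * (if t dvd P x then 1 / real (P x) else 0))" by (rule sum.swap)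
 finally show ?thesis by (simp only: sum_distrib_left)
qed
have phi: "real (phi' t) ~= 0" if "t dvd N" for t using phi'_nonzero[OF pos[OF that]] by simp
have 1: "(\<Sum>x\<in>V. 1 / real (lcm a (P x))) = (\<Sum>x\<in>V'. 1 / real (lcm a (P' x)))" if "a dvd N" for a
 by (rule divisor_sum_cancel[OF N w eq that])
have 2: "?B V P t = ?B V' P' t" if "t dvd N" for t
proof (rule divisor_sum_cancel[OF N phi _ that, where u = "?B V P" and v = "?B V' P'"])
 fix a assume a: "a dvd N"
 show "(\<Sum>t | t dvd a. real (phi' t) * ?B V P t) = (\<Sum>t | t dvd a. real (phi' t) * ?B V' P' t)"
  using trans[OF gcd_sum[OF a fin(1) P(1), symmetric] trans[OF arg_cong[OF 1[OF a], of "%x. real a * x"] gcd_sum[OF a fin(2) P(2)]]] .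
qed
\<comment> \<open>Grouping by the exact period t turns these sums into sums over the multiples of
  a.\<close>
have level: "?B V P a = (\<Sum>t | t dvd N & a dvd t. real (card {x:V. P x = t}) / real t)"
 if V: "finite V" "!!x. x:V ==> P x dvd N" for a and V :: "'c set" and P
proof -
 have "?B V P a = (\<Sum>x\<in>{x:V. a dvd P x}. 1 / real (P x))" using V(1) by (simp add: sum.If_cases Int_def)
 also have "... = (\<Sum>t\<in>{t. t dvd N & a dvd t}. \<Sum>x\<in>{x:{x:V. a dvd P x}. P x = t}. 1 / real (P x))"
  using V N by (intro sum.group[symmetric]) auto
 also have "... = (\<Sum>t | t dvd N & a dvd t. real (card {x:V. P x = t}) / real t)"
 proof (rule sum.cong)
  fix t assume "t:{t. t dvd N & a dvd t}"
  hence "{x:{x:V. a dvd P x}. P x = t} = {x:V. P x = t}" by auto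
  thus "(\<Sum>x\<in>{x:{x:V. a dvd P x}. P x = t}. 1 / real (P x)) = real (card {x:V. P x = t}) / real t" by simp
 qed simp
 finally show ?thesis .
qed
have "real (card {x:V. P x = t}) / real t = real (card {x:V'. P' x = t}) / real t" if "t dvd N"
proof (rule multiple_sum_cancel[OF N _ that, where u = "%t. real (card {x:V. P x = t}) / real t" and v = "%t. real (card {x:V'. P' x = t}) / real t"])
 fix a assume a: "a dvd N"
 show "(\<Sum>t | t dvd N & a dvd t. real (card {x:V. P x = t}) / real t)
   = (\<Sum>t | t dvd N & a dvd t. real (card {x:V'. P' x = t}) / real t)"
  using trans[OF level[OF fin(1) P(1), symmetric] trans[OF 2[OF a] level[OF fin(2) P(2)]]] .
qed
hence yes: "card {x:V. P x = t} = card {x:V'. P' x = t}" if "t dvd N" using that pos[OF that] by simp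
have no: "{x:V. P x = t} = {}" "{x:V'. P' x = t} = {}" if "~ t dvd N" using that P by auto
show ?thesis by (cases "t dvd N") (simp_all add: yes no)
qed

text \<open>Match the orbit of x with an orbit of equal length and remove both; the period counts of
  the remainders still agree.\<close>

lemma equivariant_bijection:
 assumes "finite_cycles V f" "finite_cycles V' f'"
  and "!!t. card {x:V. finite_cycles.period f x = t} = card {x:V'. finite_cycles.period f' x = t}"
 shows "EX I. bij_betw I V V' & (ALL x:V. I (f x) = f' (I x))" using assms
proof (induction "card V" arbitrary: V V' rule: less_induct)
case less
interpret C: finite_cycles V f by fact
interpret C': finite_cycles V' f' by fact
show ?case
proof (cases "V = {}")
 case True
 have "y \<notin> V'" for y
 proof
  assume "y:V'"
  hence "card {u:V'. C'.period u = C'.period y} > 0" using C'.finite_V by (auto simp: card_gt_0_iff)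
  thus False using less.prems(3)[of "C'.period y"] True by simp
 qed
 hence "V' = {}" by blast
 thus ?thesis using True by (auto simp: bij_betw_def)
next
 case False
 then obtain x where x: "x:V" by blast
 have "card {y:V. C.period y = C.period x} > 0" using x C.finite_V by (auto simp: card_gt_0_iff)
 hence "{y:V'. C'.period y = C.period x} ~= {}" unfolding less.prems(3) by (auto simp: card_gt_0_iff)
 then obtain x' where x': "x':V'" "C'.period x' = C.period x" by blast
 let ?W = "V - C.orb x" and ?W' = "V' - C'.orb x'"
 have cyc: "finite_cycles (U - finite_cycles.orb g y) g" if "finite_cycles U g" "y:U" for U :: "'c set" and g y
 proof -
  interpret U: finite_cycles U g by fact
  have "g u:U.orb y <-> u:U.orb y" if u: "u:U" for u
  proof -
   have "g u = (g ^^ 1) u" by simp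
   hence "g u:U.orb u" unfolding U.orb_def by blast
   hence "U.orb (g u) = U.orb u" "g u:U" using U.orb(1,5)[OF u] by auto
   thus ?thesis using U.orb(2,5) u \<open>y:U\<close> by metis
  qed
  hence "u:g ` (U - U.orb y)" if "u:U - U.orb y" for u
  proof -
   obtain v where "v:U" "u = g v" using U.bij \<open>u:U - U.orb y\<close> by (auto simp: bij_betw_def)
   thus ?thesis using \<open>u:U - U.orb y\<close> \<open>!!u. u:U ==> _\<close> by blast
  qed
  hence "g ` (U - U.orb y) = U - U.orb y" using U.bij \<open>!!u. u:U ==> _\<close> by (auto simp: bij_betw_def)
  thus ?thesis using U.finite_V U.bij by (auto simp: finite_cycles_def bij_betw_def intro: inj_on_subset)
 qed
 have cnt: "card {u:U - finite_cycles.orb g y. finite_cycles.period g u = t}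
   = card {u:U. finite_cycles.period g u = t} - (if t = finite_cycles.period g y then t else 0)"
  if "finite_cycles U g" "y:U" for U :: "'c set" and g y t
 proof -
  interpret U: finite_cycles U g by fact
  note o = U.orb[OF \<open>y:U\<close>]
  have "{u:U - U.orb y. U.period u = t} = {u:U. U.period u = t} - (if t = U.period y then U.orb y else {})" using o(6) by auto
  moreover have "(if t = U.period y then U.orb y else {}) <= {u:U. U.period u = t}" using o(1,6) by auto
  ultimately show ?thesis using o(3,4) by (simp add: card_Diff_subset)
 qed
 have "card ?W < card V" using x C.orb(2)[OF x] C.finite_V by (intro psubset_card_mono) auto
 then obtain I where I: "bij_betw I ?W ?W'" "ALL u:?W. I (f u) = f' (I u)"
  using less.hyps[OF _ cyc[OF less.prems(1) x] cyc[OF less.prems(2) x'(1)]] cnt[OF less.prems(1) x] cnt[OF less.prems(2) x'(1)] x'(2) less.prems(3) by auto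
 \<comment> \<open>J sends the i-th iterate of x to that of x'. It is well defined and injective
   because equal periods make iterates on the two sides coincide simultaneously.\<close>
 define J where "J u = (f' ^^ (SOME i. u = (f ^^ i) x)) x'" for u
 have eqv: "(f' ^^ i) x' = (f' ^^ j) x' <-> (f ^^ i) x = (f ^^ j) x" if "i <= j" for i j
 proof -
  have j: "j = i + (j - i)" using that by simp
  have "(f ^^ i) x = (f ^^ j) x <-> C.period x dvd j - i"
   using C.pow_inj[OF x C.pow_closed[OF x, of "j - i"], of i] C.pow_fixed_iff[OF x, of "j - i"] by (subst j) (auto simp: funpow_add)
  moreover have "(f' ^^ i) x' = (f' ^^ j) x' <-> C.period x dvd j - i"
   using C'.pow_inj[OF x'(1) C'.pow_closed[OF x'(1), of "j - i"], of i] C'.pow_fixed_iff[OF x'(1), of "j - i"] x'(2) by (subst j) (auto simp: funpow_add)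
  ultimately show ?thesis by simp
 qed
 have eqv': "(f' ^^ i) x' = (f' ^^ j) x' <-> (f ^^ i) x = (f ^^ j) x" for i j
  using eqv[of i j] eqv[of j i] by (metis nle_le)
 have J: "J ((f ^^ i) x) = (f' ^^ i) x'" for i
 proof -
  have "(f ^^ i) x = (f ^^ (SOME j. (f ^^ i) x = (f ^^ j) x)) x" by (rule someI[of _ i]) simp
  thus ?thesis unfolding J_def eqv'[symmetric] by simp
 qed
 have "bij_betw J (C.orb x) (C'.orb x')"
  unfolding bij_betw_def inj_on_def C.orb_def C'.orb_def using J eqv' by (auto simp: image_iff) metis
 moreover have "J (f u) = f' (J u)" if "u:C.orb x" for u
 proof -
  obtain i where "u = (f ^^ i) x" using \<open>u:C.orb x\<close> by (auto simp: C.orb_def)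
  thus ?thesis using J[of i] J[of "Suc i"] by simp
 qed
 moreover have "C.orb x \<union> ?W = V" "C'.orb x' \<union> ?W' = V'" using C.orb(1)[OF x] C'.orb(1)[OF x'(1)] by auto
 moreover have fo: "f u:C.orb x <-> u:C.orb x" if "u:V" for u
  using cyc[OF less.prems(1) x] that C.bij C.orb(1)[OF x] C.orb_def[of x]
 proof -
  interpret W: finite_cycles ?W f by (rule cyc[OF less.prems(1) x])
  have "f u \<notin> C.orb x" if "u \<notin> C.orb x" using W.pow_closed[of u 1] that \<open>u:V\<close> by auto
  moreover have "f u:C.orb x" if u: "u:C.orb x"
  proof -
   obtain i where "u = (f ^^ i) x" using u by (auto simp: C.orb_def)
   hence "f u = (f ^^ Suc i) x" by simp
   thus ?thesis unfolding C.orb_def by blast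
  qed
  ultimately show ?thesis by blast
 qed
 ultimately show ?thesis using bij_betw_disjoint_Un[of J "C.orb x" "C'.orb x'" I ?W ?W'] I
  by (intro exI[of _ "%u. if u:C.orb x then J u else I u"]) auto
qed
qed

text \<open>An iterate fixes a pair exactly if both periods divide its exponent, so the period of a
  pair is the lcm.\<close>

lemma finite_cycles_product:
 assumes "finite_cycles U f" "finite_cycles V g"
 shows "finite_cycles (U \<times> V) (map_prod f g)"
  "real (card (finite_cycles.orb (map_prod f g) ` (U \<times> V)))
   = (\<Sum>z\<in>U. \<Sum>x\<in>V. 1 / real (lcm (finite_cycles.period f z) (finite_cycles.period g x)))"
proof -
interpret U: finite_cycles U f by fact
interpret V: finite_cycles V g by fact
show c: "finite_cycles (U \<times> V) (map_prod f g)"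
 using U.finite_V V.finite_V bij_betw_map_prod[OF U.bij V.bij] by (simp add: finite_cycles_def)
interpret P: finite_cycles "U \<times> V" "map_prod f g" by (rule c)
have pow: "(map_prod f g ^^ i) (z, x) = ((f ^^ i) z, (g ^^ i) x)" for i z x by (induction i) auto
have "P.period (z, x) = lcm (U.period z) (V.period x)" if "z:U" "x:V" for z x
proof -
 have "P.period (z, x) dvd i <-> lcm (U.period z) (V.period x) dvd i" for i
  using P.pow_fixed_iff[of "(z, x)" i] U.pow_fixed_iff[of z i] V.pow_fixed_iff[of x i] that by (auto simp: pow)
 thus ?thesis by (metis dvd_antisym dvd_refl)
qed
thus "real (card (P.orb ` (U \<times> V))) = (\<Sum>z\<in>U. \<Sum>x\<in>V. 1 / real (lcm (U.period z) (V.period x)))"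
 unfolding P.card_orbits sum.cartesian_product by (intro sum.cong) auto
qed

section \<open>Orbit counts and the equivariant bijection\<close>

context closure_over_finite
begin

lemma finite_cycles_subfield:
 assumes "subfield K F" "finite K"
 shows "finite_cycles (K - {\<zero>}) phi"
proof -
have phi1: "phi ^^ 1 = phi" by auto
have h: "phi:ring_hom F F" "inj_on phi <F>"
 using phi_pow_iso[of 1] unfolding phi1 by (auto simp: ring_iso_def bij_betw_def)
have c: "phi x:K - {\<zero>}" if x: "x:K - {\<zero>}" for x
proof -
 have xc: "x:<F>" using x subfieldE(3)[OF assms(1)] by blast
 have "x [^] j:K" for j :: nat by (induction j) (use x subringE[OF subfieldE(1)[OF assms(1)]] in auto)
 moreover have "phi x ~= phi \<zero>" using h(2) x xc by (auto simp: inj_on_eq_iff)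
 ultimately show ?thesis using ring_hom_zero[OF h(1) ring_axioms ring_axioms] by (simp add: phi_def)
qed
have "inj_on phi (K - {\<zero>})" using h(2) subfieldE(3)[OF assms(1)] by (auto intro: inj_on_subset)
thus ?thesis
 using assms(2) c endo_inj_surj[of "K - {\<zero>}" phi] by (auto simp: finite_cycles_def bij_betw_def image_subset_iff)
qed
end

context block_algebra
begin

abbreviation frob where "frob \<equiv> gal G phi"

lemma frob_pow: "c:irr ==> (frob ^^ i) c = gal G (phi ^^ i) c"
proof (induction i)
case 0
thus ?case using irr_values[of c] by (auto simp: galois_action_def)
next
case (Suc i)
thus ?case by (simp add: galois_action_comp)
qed

lemma finite_cycles_irr: "finite_cycles irr frob"
proof -
have c: "frob c:irr" if "c:irr" for c using galois_irr[OF galois_phi[of 1] that] by simp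
have "inj_on phi <F>" using phi_pow_iso[of 1] by (auto simp: ring_iso_def bij_betw_def)
hence "inj_on frob irr"
proof (intro inj_onI)
 fix c d assume cd: "c:irr" "d:irr" "frob c = frob d" and i: "inj_on phi <F>"
 show "c = d"
 proof (rule PiE_ext[OF irr_values[OF cd(1)] irr_values[OF cd(2)]])
  fix g assume g: "g:<G>"
  hence "phi (c g) = phi (d g)" using fun_cong[OF cd(3), of g] by (simp add: galois_action_def)
  thus "c g = d g" using i irr_values[OF cd(1)] irr_values[OF cd(2)] g by (meson PiE_mem inj_onD)
 qed
qed
thus ?thesis using finite_irr c endo_inj_surj[of irr frob] by (auto simp: finite_cycles_def bij_betw_def)
qed
end

lemma (in closure_group_algebra) subalgebra_mult:
 assumes xy: "x:carrier (group_ring (F(|carrier := k|)) G)" "y:carrier (group_ring (F(|carrier := k|)) G)"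
 shows "x\<otimes>.(group_ring (F(|carrier := k|)) G) y = x\<otimes>.KG y"
proof -
have v: "x g:k" "y g:k" if "g:<G>" for g using xy that by (auto simp: group_ring_def)
have "(%h. x h\<otimes> y (inv .G h\<otimes>.G g)):<G> -> k" if "g:<G>" for g
 using v that subringE(6)[OF subfieldE(1)[OF subfield_k]] by auto
note f = finsum_subfield[OF subfield_k this K.ring_axioms]
show ?thesis unfolding group_ring_def using f by auto
qed

context cyclic_block
begin

lemma block_product: "block_product (F(|carrier := k|)) (cyc m) G p b"
proof -
let ?kG = "group_ring (F(|carrier := k|)) G"
have bk: "b:<?kG>" using b_simps(1) b_in_k by (auto simp: group_ring_def)
have sub: "a:<KG>" if "a:<?kG>" for a using that subfieldE(3)[OF subfield_k] by (auto simp: group_ring_def)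
\<comment> \<open>p divides q^n = m + 1, so it cannot divide m.\<close>
have p_m: "~ p dvd m"
proof
 assume "p dvd m"
 moreover have "p dvd q ^ n" using p_dvd_q n_pos by (metis dvd_power dvd_trans)
 moreover have "q ^ n = Suc m" using q_pow_gt[OF n_pos] by (simp add: m_def)
 ultimately have "p dvd 1" using dvd_add_right_iff[of p m 1] by simp
 thus False using prime_p by simp
qed
have "b\<otimes>.(?kG) a = a\<otimes>.(?kG) b" if "a:<?kG>" for a
 using subalgebra_mult[OF bk that] subalgebra_mult[OF that bk] b_simps(3)[OF sub[OF that]] by simp
moreover have "b\<otimes>.(?kG) b = b" using subalgebra_mult[OF bk bk] b_simps(2) by simp
moreover have "product_algebra (F(|carrier := k|)) (cyc m) G"
 using K.subfield_iff(2)[OF subfield_k] group_L finite_k finite_G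
 unfolding product_algebra_def product_algebra_axioms_def by (intro conjI) (assumption | simp)+
moreover have "~ p dvd card (carrier (cyc m))" using p_m by simp
ultimately show ?thesis using prime_p bk unfolding block_product_def block_product_axioms_def by (intro conjI allI impI)
qed

text \<open>The dual basis is indexed by one primitive idempotent for each Frobenius orbit on the
  labels.\<close>

lemma RT_basis:
 assumes R: "cring R"
 shows "EX (I :: (nat \<times> 'g => 'f) set) u h. card I = card (finite_cycles.orb (map_prod phi frob) ` (mu \<times> irr)) &
  left_module R (RT_fun_obj R p (F(|carrier := k|)) G b (cyc m)) & dual_basis R (RT_fun_obj R p (F(|carrier := k|)) G b (cyc m)) I u h"
proof -
interpret B: block_product "F(|carrier := k|)" "cyc m" G p b by (rule block_product)
have eb: "B.eb = eA" unfolding B.eb_def B.emb_right_def eA_def by (intro ext) auto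
interpret C: finite_cycles "mu \<times> irr" "map_prod phi frob"
 using finite_cycles_product(1)[OF finite_cycles_subfield[OF subfield_E finite_E] finite_cycles_irr] by (simp add: mu_def)
have pow: "(map_prod phi frob ^^ i) \<pi> = Phi i \<pi>" if "\<pi>:mu \<times> irr" for i \<pi>
proof -
 have "(map_prod phi frob ^^ i) (z, x) = ((phi ^^ i) z, (frob ^^ i) x)" for z x by (induction i) auto
 thus ?thesis using that frob_pow by (auto simp: Phi_def)
qed
have orb: "C.orb \<pi> = {Phi i \<pi> | i. True}" if "\<pi>:mu \<times> irr" for \<pi> unfolding C.orb_def using pow[OF that] by simp
define S where "S = {a. A.KG.prim a & eA\<otimes>.A a = a}"
have "Omega ` S = C.orb ` (mu \<times> irr)"
proof (intro equalityI subsetI)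
 fix W assume "W:Omega ` S"
 then obtain a \<pi> where a: "a:S" "W = Omega a" "\<pi>:Omega a" using Omega_nonempty unfolding S_def by blast
 hence "\<pi>:mu \<times> irr" by (auto simp: Omega_def Pi_def)
 thus "W:C.orb ` (mu \<times> irr)" using Omega_orbit[of a \<pi>] a orb unfolding S_def by auto
next
 fix W assume "W:C.orb ` (mu \<times> irr)"
 then obtain \<pi> where p: "\<pi>:mu \<times> irr" "W = C.orb \<pi>" by blast
 then obtain a where a: "A.KG.prim a" "eA\<otimes>.A a = a" "\<pi>:Omega a" using Omega_covers[of \<pi>] by (auto simp: Pi_def)
 thus "W:Omega ` S" using Omega_orbit[OF a(1,3)] orb[OF p(1)] p(2) unfolding S_def by auto
qed
\<comment> \<open>A section of \<open>Omega\<close>: it picks one primitive idempotent per orbit,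
  and \<open>Omega_equiv\<close> makes these a system of representatives.\<close>
define r where "r = inv_into S Omega"
define I where "I = r ` (C.orb ` (mu \<times> irr))"
have r: "r W:S" "Omega (r W) = W" if "W:C.orb ` (mu \<times> irr)" for W
 using that unfolding r_def \<open>Omega ` S = _\<close>[symmetric] by (auto simp: inv_into_into f_inv_into_f)
have "card I = card (C.orb ` (mu \<times> irr))" unfolding I_def
 by (rule card_image) (rule inj_on_inverseI[of _ Omega], rule r(2))
moreover have "finite I" unfolding I_def using C.finite_V by simp
moreover have SI: "a:S" if "a:I" for a using that r(1) unfolding I_def by blast
moreover have "~ A.KG.idem_equiv a d" if "a:I" "d:I" "a ~= d" for a d
proof
 assume "A.KG.idem_equiv a d"
 hence "Omega a = Omega d" using Omega_equiv(2) SI that unfolding S_def by blast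
 thus False using that r(2) unfolding I_def by auto
qed
moreover have "EX d:I. A.KG.idem_equiv a d" if a: "a:S" for a
proof -
 have o: "Omega a:C.orb ` (mu \<times> irr)" using a unfolding \<open>Omega ` S = _\<close>[symmetric] by blast
 have "Omega a \<inter> Omega (r (Omega a)) ~= {}" using r(2)[OF o] Omega_nonempty a unfolding S_def by simp
 hence "A.KG.idem_equiv a (r (Omega a))" using Omega_equiv(1) a r(1)[OF o] unfolding S_def by blast
 thus ?thesis using o unfolding I_def by blast
qed
ultimately have d: "card I = card (C.orb ` (mu \<times> irr))" "left_module R (RT_fun_obj R p (F(|carrier := k|)) G b (cyc m))"
 "EX u h. dual_basis R (RT_fun_obj R p (F(|carrier := k|)) G b (cyc m)) I u h"
 using B.RT_dual_basis[OF _ _ _ _ R, of I] unfolding S_def RT_fun_obj_def eb by auto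
from d(3) obtain u h where "dual_basis R (RT_fun_obj R p (F(|carrier := k|)) G b (cyc m)) I u h" by (elim exE)
thus ?thesis using d(1,2) by (intro exI[of _ I] exI[of _ u] exI[of _ h] conjI)
qed
end

text \<open>The equivalence at the cyclic group is an R-linear isomorphism between modules with dual
  bases, so the two counts agree in R, hence as integers.\<close>

lemma functorially_equivalent_orbit_count:
 fixes F :: "'f ring" and G :: "('g, 'v) monoid_scheme" and H :: "('h, 'w) monoid_scheme"
 assumes G: "cyclic_block F Fp p k G b n E" and H: "cyclic_block F Fp p k H c n E"
  and R: "cring R" "inj (%n :: int. [n] \<cdot>.R \<one>.R)"
  and e: "functorially_equivalent R p (F(|carrier := k|)) G b H c"
 shows "card (finite_cycles.orb (map_prod (closure_over_finite.phi F k) (gal G (closure_over_finite.phi F k))) ` ((E - {\<zero>.F}) \<times> IBr F G b))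
  = card (finite_cycles.orb (map_prod (closure_over_finite.phi F k) (gal H (closure_over_finite.phi F k))) ` ((E - {\<zero>.F}) \<times> IBr F H c))"
proof -
interpret R: cring R by fact
interpret G: cyclic_block F Fp p k G b n E by fact
interpret H: cyclic_block F Fp p k H c n E by fact
let ?L = "cyc G.m"
have "fin_group_obj ?L" using G.group_L by (simp add: fin_group_obj_def)
then obtain t where t: "t:lmod_iso R (RT_fun_obj R p (F(|carrier := k|)) G b ?L) (RT_fun_obj R p (F(|carrier := k|)) H c ?L)"
 using e unfolding functorially_equivalent_def by blast
obtain I :: "(nat \<times> 'g => 'f) set" and u h where I: "card I = card (finite_cycles.orb (map_prod G.phi G.frob) ` (G.mu \<times> G.irr))"
 "left_module R (RT_fun_obj R p (F(|carrier := k|)) G b ?L)" "dual_basis R (RT_fun_obj R p (F(|carrier := k|)) G b ?L) I u h"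
 using G.RT_basis[OF R(1)] by (elim exE conjE)
obtain J :: "(nat \<times> 'h => 'f) set" and v w where J: "card J = card (finite_cycles.orb (map_prod G.phi H.frob) ` (G.mu \<times> H.irr))"
 "left_module R (RT_fun_obj R p (F(|carrier := k|)) H c ?L)" "dual_basis R (RT_fun_obj R p (F(|carrier := k|)) H c ?L) J v w"
 using H.RT_basis[OF R(1)] by (elim exE conjE)
have "[card I] \<cdot>.R \<one>.R = [card J] \<cdot>.R \<one>.R" by (rule R.dual_basis_card[OF I(2,3) J(2,3) t])
hence "[int (card I)] \<cdot>.R \<one>.R = [int (card J)] \<cdot>.R \<one>.R" by (simp add: add_pow_def int_pow_int)
hence "int (card I) = int (card J)" using R(2) by (rule injD[rotated])
thus ?thesis using I(1) J(1) by (simp add: G.mu_def G.irr_def H.irr_def)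
qed

lemma finite_minimal_field:
 fixes F :: "'f ring"
 assumes "Factorial_Ring.prime p" "algebraic_closure F Fp" "card Fp = p" "b ` S <= <F>" "finite S"
 shows "subfield (generate_field F (b ` S)) F" "finite (generate_field F (b ` S))"
proof -
interpret algebraic_closure F Fp by fact
have "finite Fp" using assms(1,3) prime_gt_0_nat card_ge_0_finite by metis
\<comment> \<open>Taking \<open>Fp\<close> for k makes \<open>finite_subfield\<close> available
  before k is known to be finite.\<close>
then interpret P: closure_over_finite F Fp p Fp
 using assms subfield_axioms by (simp add: closure_over_finite_def closure_over_finite_axioms_def)
show "subfield (generate_field F (b ` S)) F" by (rule generate_field_is_subfield[OF assms(4)])
obtain K where K: "subfield K F" "finite K" "b ` S <= K"
 using P.finite_subfield[OF finite_imageI[OF assms(5)] assms(4)] by metis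
thus "finite (generate_field F (b ` S))" using generate_field_min_subfield1[OF assms(4) K(1,3)] K(2) finite_subset by blast
qed

text \<open>E is described by K and n alone, so both blocks are evaluated on the same field and the
  same cyclic group.\<close>

lemma (in block_algebra) cyclic_block_of_divisor:
 assumes "subfield K F" "finite K" "k <= K" "card K = q ^ N" "N > 0" "n dvd N"
 defines "E \<equiv> {x:K. (phi ^^ n) x = x}"
 shows "cyclic_block F Fp p k G b n E"
proof -
obtain E' where E': "subfield E' F" "finite E'" "k <= E'" "card E' = q ^ n"
 using subfield_of_divisor[OF assms(1-6)] by metis
have n: "n > 0" using assms(5,6) by auto
have fx: "(phi ^^ n) x = x <-> x:E'" if "x:<F>" for x using subfield_fixed[OF E'(1,2,4) that n] .
have "E' <= K"
proof
 fix x assume x: "x:E'"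
 hence xc: "x:<F>" using subfieldE(3)[OF E'(1)] by blast
 obtain r where r: "N = n * r" using assms(6) by blast
 have "(phi ^^ (n * s)) x = x" for s by (induction s) (use fx[OF xc] x in \<open>auto simp: funpow_add\<close>)
 thus "x:K" using subfield_fixed[OF assms(1,2,4) xc assms(5)] r by simp
qed
hence "E = E'" using fx subfieldE(3)[OF assms(1)] by (auto simp: E_def)
thus ?thesis using E' n block_algebra_axioms by (simp add: cyclic_block_def cyclic_block_axioms_def)
qed

text \<open>The sum of 1/lcm over all pairs, grouped by the period a of the field element; these
  periods are divisors of n.\<close>

lemma (in block_algebra) orbit_count:
 assumes K: "subfield K F" "finite K" "k <= K" "card K = q ^ N" "N > 0" "n dvd N"
 shows "real (card (finite_cycles.orb (map_prod phi frob) ` (({x:K. (phi ^^ n) x = x} - {\<zero>}) \<times> irr)))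
  = (\<Sum>a | a dvd n. real (card {z:K - {\<zero>}. finite_cycles.period phi z = a}) * (\<Sum>x\<in>irr. 1 / real (lcm a (finite_cycles.period frob x))))"
proof -
let ?E = "{x:K. (phi ^^ n) x = x}"
interpret C: cyclic_block F Fp p k G b n ?E by (rule cyclic_block_of_divisor[OF K])
interpret U: finite_cycles "K - {\<zero>}" phi by (rule finite_cycles_subfield[OF K(1,2)])
have E: "?E - {\<zero>} = {z:K - {\<zero>}. U.period z dvd n}" using U.pow_fixed_iff by auto
have n: "n > 0" using K(5,6) by auto
let ?g = "%a. \<Sum>x\<in>irr. 1 / real (lcm a (finite_cycles.period frob x))"
have "real (card (finite_cycles.orb (map_prod phi frob) ` ((?E - {\<zero>}) \<times> irr))) = (\<Sum>z\<in>?E - {\<zero>}. ?g (U.period z))"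
 by (rule finite_cycles_product(2)[OF finite_cycles_subfield[OF C.subfield_E C.finite_E] finite_cycles_irr])
also have "... = (\<Sum>a | a dvd n. \<Sum>z\<in>{z:?E - {\<zero>}. U.period z = a}. ?g (U.period z))"
 unfolding E using K(2) n by (intro sum.group[symmetric]) auto
also have "... = (\<Sum>a | a dvd n. real (card {z:K - {\<zero>}. U.period z = a}) * ?g a)"
proof (rule sum.cong)
 fix a assume "a:{a. a dvd n}"
 hence "{z:?E - {\<zero>}. U.period z = a} = {z:K - {\<zero>}. U.period z = a}" unfolding E by auto
 thus "(\<Sum>z\<in>{z:?E - {\<zero>}. U.period z = a}. ?g (U.period z)) = real (card {z:K - {\<zero>}. U.period z = a}) * ?g a" by simp
qed simp
finally show ?thesis .
qed

text \<open>A generator of the field with q^n elements has period n. This makes the weights in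
  \<open>periods_determined\<close> nonzero.\<close>

lemma (in block_algebra) period_exists:
 assumes K: "subfield K F" "finite K" "k <= K" "card K = q ^ N" "N > 0" "n dvd N"
 shows "card {z:K - {\<zero>}. finite_cycles.period phi z = n} ~= 0"
proof -
let ?E = "{x:K. (phi ^^ n) x = x}"
interpret C: cyclic_block F Fp p k G b n ?E by (rule cyclic_block_of_divisor[OF K])
interpret U: finite_cycles "K - {\<zero>}" phi by (rule finite_cycles_subfield[OF K(1,2)])
obtain z where z: "z:?E" "z ~= \<zero>" "!!j::nat. z [^] j = \<one> <-> (q ^ n - 1) dvd j"
 by (rule subfield_generator[OF C.subfield_E C.finite_E C.card_E C.n_pos], blast)
have zc: "z:<F>" using z(1) subfieldE(3)[OF K(1)] by blast
have "U.period z dvd i <-> n dvd i" for i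
 using U.pow_fixed_iff[of z i] generator_period(2)[OF zc z(2,3) C.n_pos, of i] z(1,2) by simp
hence "U.period z = n" by (metis dvd_antisym dvd_refl)
hence "z:{z:K - {\<zero>}. U.period z = n}" using z(1,2) by simp
thus ?thesis using K(2) by auto
qed

theorem theorem1p7:
  fixes p :: nat and R :: "'r ring" and F :: "'f ring" and Fp :: "'f set"
    and G :: "'g monoid" and H :: "'h monoid"
    and b :: "'g \<Rightarrow> 'f" and c :: "'h \<Rightarrow> 'f" and k :: "'f set"
  assumes "Factorial_Ring.prime p"
    and "cring R" and "inj (\<lambda>n :: int. [n] \<cdot>\<^bsub>R\<^esub> \<one>\<^bsub>R\<^esub>)"
    and "algebraic_closure F Fp" and "card Fp = p"
    and "group G" and "finite (carrier G)"
    and "group H" and "finite (carrier H)"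
    and "central_idempotent (group_ring F G) b"
    and "central_idempotent (group_ring F H) c"
    and "minimal_field F G b = k" and "minimal_field F H c = k"
    and "functorially_equivalent R p (F\<lparr>carrier := k\<rparr>) G b H c"
  shows "\<exists>I. bij_betw I (IBr F G b) (IBr F H c) \<and>
    (\<forall>\<phi>\<in>IBr F G b. \<forall>\<sigma>\<in>galois_group F k.
       galois_action H \<sigma> (I \<phi>) = I (galois_action G \<sigma> \<phi>))"
proof -
interpret F: algebraic_closure F Fp by fact
have bc: "b:<G> \<rightarrow>\<^sub>E <F>" "c:<H> \<rightarrow>\<^sub>E <F>"
 using assms(10,11) by (simp_all add: central_idempotent_def ring_center_def group_ring_def)
hence "b ` <G> <= <F>" by auto
hence k: "subfield k F" "finite k"
 using finite_minimal_field[OF assms(1,4,5) _ assms(7)] assms(12) by (auto simp: minimal_field_def)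
interpret k: closure_over_finite F Fp p k
 using assms(1,4,5) k by (simp add: closure_over_finite_def closure_over_finite_axioms_def)
interpret G: block_algebra F Fp p k G b using assms(6,7,10,12) F.field_axioms k.closure_over_finite_axioms
 by (auto simp: block_algebra_def block_algebra_axioms_def closure_group_algebra_def group_algebra_def group_algebra_axioms_def
  minimal_field_def intro: generate_field.incl)
interpret H: block_algebra F Fp p k H c using assms(8,9,11,13) F.field_axioms k.closure_over_finite_axioms
 by (auto simp: block_algebra_def block_algebra_axioms_def closure_group_algebra_def group_algebra_def group_algebra_axioms_def
  minimal_field_def intro: generate_field.incl)
\<comment> \<open>All values of all characters on both sides: one finite field K containing them has
  a degree N that is a multiple of every character period.\<close>
let ?S = "(\<Union>x\<in>G.irr. x ` <G>) \<union> (\<Union>x\<in>H.irr. x ` <H>)"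
have S: "finite ?S" "?S <= <F>"
proof -
 show "finite ?S" using G.finite_irr H.finite_irr assms(7,9) by simp
 have "x g:<F>" if "x:G.irr" "g:<G>" for x g using G.irr_values[OF that(1)] that(2) by (rule PiE_mem)
 moreover have "x g:<F>" if "x:H.irr" "g:<H>" for x g using H.irr_values[OF that(1)] that(2) by (rule PiE_mem)
 ultimately show "?S <= <F>" by blast
qed
obtain K where K: "subfield K F" "finite K" "?S <= K" "k <= K" using S by (rule k.finite_subfield)
obtain N where N: "N > 0" "card K = k.q ^ N" using k.card_subfield[OF K(1,2,4)] by blast
note KN = K(1,2,4) N(2,1)
have fx: "(k.phi ^^ N) x = x" if "x:?S" for x
 using k.subfield_fixed[OF K(1,2) N(2) _ N(1), of x] that K(3) S(2) by blast
interpret CG: finite_cycles G.irr G.frob by (rule G.finite_cycles_irr)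
interpret CH: finite_cycles H.irr H.frob by (rule H.finite_cycles_irr)
have PG: "CG.period x dvd N" if x: "x:G.irr" for x
proof -
 have "gal G (k.phi ^^ N) x = x"
 proof (rule PiE_ext[OF _ G.irr_values[OF x]])
  show "gal G (k.phi ^^ N) x:<G> \<rightarrow>\<^sub>E <F>"
   using PiE_mem[OF G.irr_values[OF x]] by (auto simp: galois_action_def)
  fix g assume "g:<G>"
  thus "gal G (k.phi ^^ N) x g = x g" using fx[of "x g"] x by (auto simp: galois_action_def)
 qed
 thus ?thesis using CG.pow_fixed_iff[OF x] G.frob_pow[OF x] by simp
qed
have PH: "CH.period x dvd N" if x: "x:H.irr" for x
proof -
 have "gal H (k.phi ^^ N) x = x"
 proof (rule PiE_ext[OF _ H.irr_values[OF x]])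
  show "gal H (k.phi ^^ N) x:<H> \<rightarrow>\<^sub>E <F>"
   using PiE_mem[OF H.irr_values[OF x]] by (auto simp: galois_action_def)
  fix g assume "g:<H>"
  thus "gal H (k.phi ^^ N) x g = x g" using fx[of "x g"] x by (auto simp: galois_action_def)
 qed
 thus ?thesis using CH.pow_fixed_iff[OF x] H.frob_pow[OF x] by simp
qed
\<comment> \<open>The weights come from K alone and are therefore common to both sides.\<close>
let ?w = "%a. real (card {z:K - {\<zero>.F}. finite_cycles.period k.phi z = a})"
have "card {x:G.irr. CG.period x = t} = card {x:H.irr. CH.period x = t}" for t
proof (rule periods_determined[OF G.finite_irr H.finite_irr N(1), where w = ?w])
 show "?w n ~= 0" if "n dvd N" for n using G.period_exists[OF KN that] by simp
 fix n assume n: "n dvd N"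
 show "(\<Sum>a | a dvd n. ?w a * (\<Sum>x\<in>G.irr. 1 / real (lcm a (CG.period x)))) = (\<Sum>a | a dvd n. ?w a * (\<Sum>x\<in>H.irr. 1 / real (lcm a (CH.period x))))"
  unfolding G.orbit_count[OF KN n, symmetric] H.orbit_count[OF KN n, symmetric]
  using functorially_equivalent_orbit_count[OF G.cyclic_block_of_divisor[OF KN n] H.cyclic_block_of_divisor[OF KN n] assms(2,3,14)]
  by (simp add: G.irr_def H.irr_def)
qed (use PG PH in auto)
then obtain I where I: "bij_betw I G.irr H.irr" "ALL x:G.irr. I (G.frob x) = H.frob (I x)"
 using equivariant_bijection[OF G.finite_cycles_irr H.finite_cycles_irr] by blast
\<comment> \<open>On the values in \<open>?S\<close> the automorphism s is some power of Frobenius,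
  with which I commutes.\<close>
have "gal H s (I x) = I (gal G s x)" if x: "x:G.irr" and s: "s:galois_group F k" for x s
proof -
 obtain j where j: "!!y. y:?S ==> s y = (k.phi ^^ j) y" using k.galois_eq_phi[OF s S] by blast
 have Ix: "I x:H.irr" using I(1) x by (auto simp: bij_betw_def)
 have "I ((G.frob ^^ i) x) = (H.frob ^^ i) (I x)" for i by (induction i) (use I(2) CG.pow_closed[OF x] in auto)
 moreover have "gal H s (I x) = gal H (k.phi ^^ j) (I x)"
  unfolding galois_action_def using j Ix by (intro restrict_ext) blast
 moreover have "gal G s x = gal G (k.phi ^^ j) x"
  unfolding galois_action_def using j x by (intro restrict_ext) blast
 ultimately show ?thesis using G.frob_pow[OF x] H.frob_pow[OF Ix] by metis
qed
thus ?thesis using I(1) unfolding G.irr_def H.irr_def by blast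
qed

end
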